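(* Let $\Lambda$ be a primitive rank $1$ sublattice of $\mathbb{Z}^2$ and let $\mu_\Lambda(t)$ be an element of $\mathcal{M}_\Lambda(\tau,\epsilon)$, with part at infinity $\tilde\mu^\Lambda(t)$. Suppose that $\tau_\hbar\epsilon_\hbar\ge1$. Then, for every $k\in\Lambda\setminus\{0\}$, for every $a\in\mathcal{C}^\infty_c(\mathbb{R}^2\times\widehat{\mathbb{R}})$ and for a.e. $t\in\mathbb{R}$, $$\langle\tilde\mu^\Lambda(t),a(\xi,\eta)e^{-2i\pi k\cdot x}\rangle=0.$$ In particular, the measure $\tilde\mu^\Lambda(t)\rceil_{\mathbb{T}^2\times\Lambda^\perp\times\widehat{\mathbb{R}}}$ is constant in $x$.
   Context: Setting. $\mathbb{T}^2=\mathbb{R}^2/\mathbb{Z}^2$, $T^*\mathbb{T}^2=\mathbb{T}^2\times\mathbb{R}^2$, $V\in\mathcal{C}^\infty(\mathbb{T}^2;\mathbb{R})$, and $\epsilon_\hbar\ge0$ satisfies $\epsilon_\hbar\to0$ and $\hbar\epsilon_\hbar^{-1}\to0$ as $\hbar\to0^+$. For normalized initial data $u_\hbar\in L^2(\mathbb{T}^2)$, $v_\hbar(t)$ is the solution of $$i\hbar\partial_tv_\hbar=\Big(-\frac{\hbar^2\Delta}{2}+\epsilon_\hbar^2V\Big)v_\hbar,\qquad v_\hbar|_{t=0}=u_\hbar,\quad\|u_\hbar\|_{L^2}=1.$$ The initial data are always assumed to satisfy $$\limsup_{\hbar\to0}\|\mathbf{1}_{[R,\infty)}(-\hbar^2\Delta)u_\hbar\|_{L^2}\xrightarrow[R\to\infty]{}0,\qquad\limsup_{\hbar\to0}\|\mathbf{1}_{[0,\delta]}(-\hbar^2\Delta)u_\hbar\|_{L^2}\xrightarrow[\delta\to0^+]{}0.$$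 $(\tau_\hbar)$ is a sequence of time scales with $\tau_\hbar\to+\infty$ as $\hbar\to0^+$. Lattices. A primitive rank $1$ sublattice $\Lambda\subset\mathbb{Z}^2$ is one with $\dim\langle\Lambda\rangle=1$ and $\langle\Lambda\rangle\cap\mathbb{Z}^2=\Lambda$, where $\langle\Lambda\rangle$ is the linear span of $\Lambda$ in $\mathbb{R}^2$. Let $\mathfrak{e}_\Lambda$ be such that $\mathbb{Z}\mathfrak{e}_\Lambda=\Lambda$, $L_\Lambda=\|\mathfrak{e}_\Lambda\|$, $\Lambda^\perp=\{\xi\in\mathbb{R}^2:\langle\xi,\mathfrak{e}_\Lambda\rangle=0\}$, and $H_\Lambda(x,\xi)=\frac1{L_\Lambda}\langle\xi,\mathfrak{e}_\Lambda\rangle$. Two-microlocal distributions. $\widehat{\mathbb{R}}=\mathbb{R}\cup\{\pm\infty\}$ is the two-point compactification, with smooth structure near $\pm\infty$ given by the coordinate $1/\eta$. $\mathrm{Op}^w_\hbar(a)$ is the $\hbar$-Weyl quantization, acting on $\mathbb{T}^2$ by $\mathrm{Op}_\hbar^w(a)e_k=\sum_{q\in\mathbb{Z}^2}\hat a_{q-k}(\pi\hbar(q+k))\,e_q$, with $e_k(x)=e^{2i\pi k\cdot x}$ and $\hat a_p(\xi)=\int_{\mathbb{T}^2}a(x,\xi)e^{-2i\pi p\cdot x}dx$. For $a\in\mathcal{C}^\infty_c(T^*\mathbb{T}^2\times\widehat{\mathbb{R}})$, $$\langle w_{\Lambda,\hbar}(t),a\rangle:=\Big\langle v_\hbar(t),\mathrm{Op}^w_\hbar\Big(a\Big(x,\xi,\frac{H_\Lambda(x,\xi)}{\epsilon_\hbar}\Big)\Big)v_\hbar(t)\Big\rangle_{L^2(\mathbb{T}^2)}.$$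 Let $\mathcal{B}=\mathcal{C}^0_0(\mathbb{R}^2\times\widehat{\mathbb{R}},\mathcal{C}^3(\mathbb{T}^2))$ (continuous functions of $(\xi,\eta)$ with values in $\mathcal{C}^3(\mathbb{T}^2)$ tending to $0$ at infinity). There are subsequences $\hbar_n\to0^+$ and $\mu_\Lambda(t)\in\mathcal{B}'$ (for a.e. $t$) such that for all $\theta\in L^1(\mathbb{R})$ and $a\in\mathcal{C}^\infty_c(T^*\mathbb{T}^2\times\widehat{\mathbb{R}})$, $$\lim_{n\to\infty}\int_{\mathbb{R}}\theta(t)\langle w_{\Lambda,\hbar_n}(t\tau_{\hbar_n}),a\rangle dt=\int_{\mathbb{R}}\theta(t)\langle\mu_\Lambda(t),a\rangle dt.$$ $\mathcal{M}_\Lambda(\tau,\epsilon)$ is the set of all such limits as the initial data vary among sequences satisfying the two frequency conditions above. For a.e. $t$, $\mu_\Lambda(t)$ is a positive finite Radon measure on $T^*\mathbb{T}^2\times\widehat{\mathbb{R}}$, and its part at infinity is $\tilde\mu^\Lambda(t):=\mu_\Lambda(t)\rceil_{T^*\mathbb{T}^2\times\{\pm\infty\}}$. "Constant in $x$" means that integrating $a\in\mathcal{C}^0_c(T^*\mathbb{T}^2\times\widehat{\mathbb{R}})$ against the measure gives the same result as integrating $\int_{\mathbb{T}^2}a(y,\cdot)\,dy$ (for a.e. $t$). *)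

theory Defs
  imports "HOL-Analysis.Analysis"
begin

(* Functions on T^2 = R^2/Z^2 are Z^2-periodic functions on R^2.  Integrals over T^2 are integrals
   over the fundamental domain [0,1)^2, and a Borel measure on T^2 x R^2 x [-oo,oo] is a Borel
   measure on R^2 x R^2 x ereal concentrated on [0,1)^2 x R^2 x ereal. *)

definition ivec :: "int ^ 2 \<Rightarrow> real ^ 2" where
  "ivec k = (\<chi> i. of_int (k $ i))"

definition cell :: "(real ^ 2) set" where
  "cell = {x. \<forall>i. 0 \<le> x $ i \<and> x $ i < 1}"

definition periodic :: "(real ^ 2 \<Rightarrow> 'b) \<Rightarrow> bool" where
  "periodic f \<longleftrightarrow> (\<forall>x k. f (x + ivec k) = f x)"

section \<open>Differentiability classes\<close>

fun iter_deriv :: "'a::euclidean_space list \<Rightarrow> ('a \<Rightarrow> 'b::real_normed_vector) \<Rightarrow> 'a \<Rightarrow> 'b" where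
  "iter_deriv [] f = f"
| "iter_deriv (b # bs) f = (\<lambda>x. frechet_derivative (iter_deriv bs f) (at x) b)"

definition Ck :: "nat \<Rightarrow> ('a::euclidean_space \<Rightarrow> 'b::real_normed_vector) \<Rightarrow> bool" where
  "Ck n f \<longleftrightarrow> (\<forall>bs. set bs \<subseteq> Basis \<longrightarrow>
     (length bs < n \<longrightarrow> (\<forall>x. iter_deriv bs f differentiable (at x))) \<and>
     (length bs \<le> n \<longrightarrow> continuous_on UNIV (iter_deriv bs f)))"

definition smooth :: "('a::euclidean_space \<Rightarrow> 'b::real_normed_vector) \<Rightarrow> bool" where
  "smooth f \<longleftrightarrow> (\<forall>n. Ck n f)"

definition C3_norm :: "(real ^ 2 \<Rightarrow> complex) \<Rightarrow> real" where
  "C3_norm f = Sup {norm (iter_deriv bs f x) | bs x. set bs \<subseteq> Basis \<and> length bs \<le> 3}"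

section \<open>L2 functions and Fourier series on the torus\<close>

definition L2_torus :: "(real ^ 2 \<Rightarrow> complex) set" where
  "L2_torus = {f. f \<in> borel_measurable borel \<and> periodic f \<and>
                  set_integrable lborel cell (\<lambda>x. (norm (f x))\<^sup>2)}"

definition L2_inner :: "(real ^ 2 \<Rightarrow> complex) \<Rightarrow> (real ^ 2 \<Rightarrow> complex) \<Rightarrow> complex" where
  "L2_inner f g = (LINT x:cell|lborel. cnj (f x) * g x)"

definition L2_nrm :: "(real ^ 2 \<Rightarrow> complex) \<Rightarrow> real" where
  "L2_nrm f = sqrt (LINT x:cell|lborel. (norm (f x))\<^sup>2)"

definition wave :: "int ^ 2 \<Rightarrow> real ^ 2 \<Rightarrow> complex" where
  "wave k x = exp (2 * \<i> * of_real pi * of_real (ivec k \<bullet> x))"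

definition fourier :: "(real ^ 2 \<Rightarrow> complex) \<Rightarrow> int ^ 2 \<Rightarrow> complex" where
  "fourier f p = (LINT x:cell|lborel. f x * wave (- p) x)"

(* The L2 norm of 1_I(-h^2 Laplacian) u: the plane wave of index k is an eigenfunction of
   -h^2 Laplacian with eigenvalue (2 pi h |k|)^2, and the norm is computed by Parseval. *)
definition freq_norm :: "real set \<Rightarrow> real \<Rightarrow> (real ^ 2 \<Rightarrow> complex) \<Rightarrow> real" where
  "freq_norm I h u =
     sqrt (\<Sum>\<^sub>\<infinity>k\<in>{k. (2 * pi * h * norm (ivec k))\<^sup>2 \<in> I}. (norm (fourier u k))\<^sup>2)"

definition frequency_localized :: "(real \<Rightarrow> real ^ 2 \<Rightarrow> complex) \<Rightarrow> bool" where
  "frequency_localized u \<longleftrightarrow>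
     ((\<lambda>R. Limsup (at_right 0) (\<lambda>h. ereal (freq_norm {R..} h (u h)))) \<longlongrightarrow> 0) at_top \<and>
     ((\<lambda>\<delta>. Limsup (at_right 0) (\<lambda>h. ereal (freq_norm {0..\<delta>} h (u h)))) \<longlongrightarrow> 0) (at_right 0)"

section \<open>The Schroedinger equation\<close>

definition laplacian :: "(real ^ 2 \<Rightarrow> complex) \<Rightarrow> real ^ 2 \<Rightarrow> complex" where
  "laplacian f x = (\<Sum>b\<in>Basis. iter_deriv [b, b] f x)"

definition hamiltonian ::
  "real \<Rightarrow> real \<Rightarrow> (real ^ 2 \<Rightarrow> real) \<Rightarrow> (real ^ 2 \<Rightarrow> complex) \<Rightarrow> real ^ 2 \<Rightarrow> complex" where
  "hamiltonian h e V f x = - of_real (h\<^sup>2 / 2) * laplacian f x + of_real (e\<^sup>2 * V x) * f x"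

(* For initial data that are merely in L2 the equation is understood in the sense of
   distributions: v is continuous in time with values in L2, and for smooth phi on T^2,
   i h d/dt <phi, v(t)> = <P phi, v(t)>, where P is the (formally self-adjoint) Hamiltonian. *)
definition schroedinger_solution ::
  "real \<Rightarrow> real \<Rightarrow> (real ^ 2 \<Rightarrow> real) \<Rightarrow> (real ^ 2 \<Rightarrow> complex) \<Rightarrow> (real \<Rightarrow> real ^ 2 \<Rightarrow> complex) \<Rightarrow> bool"
  where
  "schroedinger_solution h e V u v \<longleftrightarrow>
     (\<forall>t. v t \<in> L2_torus) \<and>
     (\<forall>s. ((\<lambda>t. L2_nrm (\<lambda>x. v t x - v s x)) \<longlongrightarrow> 0) (at s)) \<and>
     (AE x in lborel. v 0 x = u x) \<and>
     (\<forall>\<phi>. smooth \<phi> \<and> periodic \<phi> \<longrightarrow>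
        (\<forall>t. ((\<lambda>s. L2_inner \<phi> (v s)) has_vector_derivative
               L2_inner (hamiltonian h e V \<phi>) (v t) / (\<i> * of_real h)) (at t)))"

section \<open>Rank one sublattices\<close>

(* A subset of this form is the intersection of Z^2 with a linear subspace; in particular it is
   automatically a subgroup. *)
definition primitive_rank1 :: "(int ^ 2) set \<Rightarrow> bool" where
  "primitive_rank1 \<Lambda> \<longleftrightarrow>
     dim (span (ivec ` \<Lambda>)) = 1 \<and> {k. ivec k \<in> span (ivec ` \<Lambda>)} = \<Lambda>"

(* H and perp are attached to a generator e of the lattice; H changes sign with e. *)
definition generator :: "(int ^ 2) set \<Rightarrow> int ^ 2 \<Rightarrow> bool" where
  "generator \<Lambda> e \<longleftrightarrow> range (\<lambda>n::int. n *s e) = \<Lambda>"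

definition H :: "int ^ 2 \<Rightarrow> real ^ 2 \<Rightarrow> real" where
  "H e \<xi> = (\<xi> \<bullet> ivec e) / norm (ivec e)"

definition perp :: "int ^ 2 \<Rightarrow> (real ^ 2) set" where
  "perp e = {\<xi>. \<xi> \<bullet> ivec e = 0}"

section \<open>Two-microlocal symbols\<close>

type_synonym symbol = "real ^ 2 \<Rightarrow> real ^ 2 \<Rightarrow> ereal \<Rightarrow> complex"

(* The extended line is compact with boundary points +oo and -oo, where 1/\<eta> is a coordinate taking
   values in [0,oo) respectively (-oo,0]; smoothness up to the boundary means that there is a smooth
   extension across it.  As T^2 and the extended line are compact, compact support is a condition
   on \<xi> only. *)
definition smooth_symbol :: "symbol \<Rightarrow> bool" where
  "smooth_symbol a \<longleftrightarrow>
     smooth (\<lambda>(x, \<xi>, \<eta>). a x \<xi> (ereal \<eta>)) \<and>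
     (\<exists>b :: (real ^ 2) \<times> (real ^ 2) \<times> real \<Rightarrow> complex. smooth b \<and>
        (\<forall>x \<xi>. b (x, \<xi>, 0) = a x \<xi> \<infinity> \<and> (\<forall>s>0. b (x, \<xi>, s) = a x \<xi> (ereal (1 / s))))) \<and>
     (\<exists>b :: (real ^ 2) \<times> (real ^ 2) \<times> real \<Rightarrow> complex. smooth b \<and>
        (\<forall>x \<xi>. b (x, \<xi>, 0) = a x \<xi> (- \<infinity>) \<and> (\<forall>s<0. b (x, \<xi>, s) = a x \<xi> (ereal (1 / s)))))"

definition x_periodic :: "symbol \<Rightarrow> bool" where
  "x_periodic a \<longleftrightarrow> (\<forall>\<xi> \<eta>. periodic (\<lambda>x. a x \<xi> \<eta>))"

definition compact_support :: "symbol \<Rightarrow> bool" where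
  "compact_support a \<longleftrightarrow> (\<exists>R. \<forall>x \<xi> \<eta>. norm \<xi> > R \<longrightarrow> a x \<xi> \<eta> = 0)"

definition Cinf_c :: "symbol set" where
  "Cinf_c = {a. smooth_symbol a \<and> x_periodic a \<and> compact_support a}"

definition C0_c :: "symbol set" where
  "C0_c = {a. continuous_on UNIV (\<lambda>(x, \<xi>, \<eta>). a x \<xi> \<eta>) \<and> x_periodic a \<and> compact_support a}"

definition B_space :: "symbol set" where
  "B_space = {a. x_periodic a \<and> (\<forall>\<xi> \<eta>. Ck 3 (\<lambda>x. a x \<xi> \<eta>)) \<and>
     (\<forall>\<xi>\<^sub>0 \<eta>\<^sub>0. ((\<lambda>(\<xi>, \<eta>). C3_norm (\<lambda>x. a x \<xi> \<eta> - a x \<xi>\<^sub>0 \<eta>\<^sub>0)) \<longlongrightarrow> 0) (at (\<xi>\<^sub>0, \<eta>\<^sub>0))) \<and>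
     (\<forall>r>0. \<exists>R. \<forall>\<xi> \<eta>. norm \<xi> > R \<longrightarrow> C3_norm (\<lambda>x. a x \<xi> \<eta>) < r)}"

definition B_norm :: "symbol \<Rightarrow> real" where
  "B_norm a = (SUP (\<xi>, \<eta>)\<in>UNIV. C3_norm (\<lambda>x. a x \<xi> \<eta>))"

definition B_dual :: "(symbol \<Rightarrow> complex) set" where
  "B_dual = {\<phi>.
     (\<forall>a\<in>B_space. \<forall>b\<in>B_space. \<phi> (\<lambda>x \<xi> \<eta>. a x \<xi> \<eta> + b x \<xi> \<eta>) = \<phi> a + \<phi> b) \<and>
     (\<forall>a\<in>B_space. \<forall>c. \<phi> (\<lambda>x \<xi> \<eta>. c * a x \<xi> \<eta>) = c * \<phi> a) \<and>
     (\<exists>C. \<forall>a\<in>B_space. norm (\<phi> a) \<le> C * B_norm a)}"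

section \<open>Two-microlocal distributions and their limits\<close>

(* The operator sending the plane wave of index k to
   the sum over q of a^_{q-k}(pi h (q+k)) times the plane wave of index q. *)
definition weyl_op ::
  "real \<Rightarrow> (real ^ 2 \<Rightarrow> real ^ 2 \<Rightarrow> complex) \<Rightarrow> (real ^ 2 \<Rightarrow> complex) \<Rightarrow> real ^ 2 \<Rightarrow> complex" where
  "weyl_op h a f x =
     (\<Sum>\<^sub>\<infinity>q. (\<Sum>\<^sub>\<infinity>k. fourier (\<lambda>y. a y ((pi * h) *\<^sub>R ivec (q + k))) (q - k) * fourier f k) * wave q x)"

definition two_micro_dist ::
  "real \<Rightarrow> real \<Rightarrow> int ^ 2 \<Rightarrow> (real ^ 2 \<Rightarrow> complex) \<Rightarrow> symbol \<Rightarrow> complex" where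
  "two_micro_dist h eh e f a = L2_inner f (weyl_op h (\<lambda>x \<xi>. a x \<xi> (ereal (H e \<xi> / eh))) f)"

(* The set M_Lambda(tau, epsilon), where e generates Lambda. *)
definition two_micro_limits ::
  "(real ^ 2 \<Rightarrow> real) \<Rightarrow> (real \<Rightarrow> real) \<Rightarrow> (real \<Rightarrow> real) \<Rightarrow> int ^ 2 \<Rightarrow>
   (real \<Rightarrow> symbol \<Rightarrow> complex) set" where
  "two_micro_limits V \<epsilon> \<tau> e = {\<mu>. \<exists>u v hs.
     (\<forall>h>0. u h \<in> L2_torus \<and> L2_nrm (u h) = 1 \<and> schroedinger_solution h (\<epsilon> h) V (u h) (v h)) \<and>
     frequency_localized u \<and>
     (\<forall>n::nat. hs n > 0) \<and> hs \<longlonglongrightarrow> 0 \<and>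
     (AE t in lborel. \<mu> t \<in> B_dual) \<and>
     (\<forall>\<theta> :: real \<Rightarrow> complex. \<forall>a\<in>Cinf_c. integrable lborel \<theta> \<longrightarrow>
        integrable lborel (\<lambda>t. \<theta> t * \<mu> t a) \<and>
        (\<lambda>n. LINT t|lborel. \<theta> t * two_micro_dist (hs n) (\<epsilon> (hs n)) e (v (hs n) (t * \<tau> (hs n))) a)
          \<longlonglongrightarrow> (LINT t|lborel. \<theta> t * \<mu> t a))}"

section \<open>Measures on the two-microlocal phase space\<close>

type_synonym phase_measure = "((real ^ 2) \<times> (real ^ 2) \<times> ereal) measure"

(* Finite Borel measures on this Polish space are automatically Radon. *)
definition finite_phase_measure :: "phase_measure \<Rightarrow> bool" where
  "finite_phase_measure m \<longleftrightarrow>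
     sets m = sets borel \<and> finite_measure m \<and> (AE p in m. fst p \<in> cell)"

definition pairing :: "phase_measure \<Rightarrow> symbol \<Rightarrow> complex" where
  "pairing m a = (LINT (x, \<xi>, \<eta>)|m. a x \<xi> \<eta>)"

(* The functional \<phi> in B' is the positive finite Radon measure m. *)
definition is_the_measure :: "(symbol \<Rightarrow> complex) \<Rightarrow> phase_measure \<Rightarrow> bool" where
  "is_the_measure \<phi> m \<longleftrightarrow> finite_phase_measure m \<and> (\<forall>a\<in>B_space. \<phi> a = pairing m a)"

definition measure_restr :: "'a measure \<Rightarrow> 'a set \<Rightarrow> 'a measure" where
  "measure_restr m A = density m (indicator A)"

definition part_at_infinity :: "phase_measure \<Rightarrow> phase_measure" where
  "part_at_infinity m = measure_restr m (UNIV \<times> UNIV \<times> {\<infinity>, -\<infinity>})"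

definition constant_in_x :: "phase_measure \<Rightarrow> bool" where
  "constant_in_x m \<longleftrightarrow>
     (\<forall>a\<in>C0_c. pairing m a = pairing m (\<lambda>x \<xi> \<eta>. LINT y:cell|lborel. a y \<xi> \<eta>))"

end

theory Submission
  imports Defs "HOL-Real_Asymp.Real_Asymp"
begin

text \<open>
  A symbol that is a single harmonic in \<open>x\<close> and compactly supported in \<open>\<xi>\<close> is paired with the solution by
  a finite sum of products of two Fourier coefficients.  Under the free flow the product belonging to
  the harmonic \<open>k\<close> oscillates with frequency proportional to \<open>\<xi> \<bullet> k\<close>; the potential contributes a
  commutator, which is bounded by the Lipschitz constant of the symbol.  Integrating in time, a symbol
  \<open>(\<xi> \<bullet> k) g\<close> therefore pairs to an endpoint term of size \<open>sup |g| / \<tau>\<close> plus an error of size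
  \<open>\<epsilon>\<^sup>2 Lip g\<close>.  If \<open>k\<close> lies in the lattice, then \<open>\<xi> \<bullet> k\<close> is a multiple of \<open>\<epsilon> \<eta>\<close>, and taking for \<open>g\<close> a cut-off to
  \<open>|\<eta>| > R\<close> divided by \<open>\<epsilon> \<eta>\<close> makes both terms \<open>O(1 / R)\<close>, because \<open>\<tau> \<epsilon> \<ge> 1\<close>; so the \<open>k\<close>-th Fourier
  mode of the part at infinity vanishes.  If \<open>k\<close> is arbitrary, both terms vanish in the limit, so that
  the \<open>k\<close>-th mode lives on \<open>\<xi> \<bullet> k = 0\<close>; for \<open>k\<close> outside the lattice this meets the orthogonal of
  the lattice only in \<open>\<xi> = 0\<close>, which carries no mass as no energy is transferred to low frequencies.
\<close>

text \<open>Testing one harmonic at a time keeps the calculus exact: since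
  \<open>|q + k|^2 - |q|^2 = (2 q + k) \<bullet> k\<close> and the Weyl symbol is evaluated at the
  midpoint \<open>pi h (2 q + k)\<close>, the free commutator has no remainder, and the potential
  enters only through increments \<open>g q - g (q - p)\<close> weighted by summable coefficients.
  Such a step moves \<xi> by \<open>2 pi h p\<close>, which cancels the \<open>1/h\<close> of the
  equation. Two obstacles shape the rest. A vanishing statement holds for almost every
  \<open>t\<close> with an exceptional set that depends on the symbol, so the symbols are reduced to
  countably many: bumps on boxes with rational corners. And the smallness of the initial data near
  \<xi> = 0 must be carried to all times without a functional calculus of the Hamiltonian. Averages
  of \<open>v(s)\<close> and \<open>v(s + h \<alpha>)\<close> replace it; \<open>n\<close> of them
  applied in a row act, up to an error of order \<open>n \<epsilon>^2\<close>, as a power of a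
  cosine in the energy, and this power separates low energies from the range that carries the
  initial data.\<close>

abbreviation torus :: "(real ^ 2) measure" where
  "torus \<equiv> restrict_space lborel cell"

lemma cell_alt: "cell = {x. 0 \<le> x $ 1 \<and> x $ 1 < 1 \<and> 0 \<le> x $ 2 \<and> x $ 2 < 1}"
  by (auto simp: cell_def forall_2)

lemma cell_borel [measurable]: "cell \<in> sets borel"
  unfolding cell_alt by measurable

lemma emeasure_cell: "emeasure lborel cell = 1"
proof (rule antisym)
  have b: "(1::real^2) \<bullet> b = 1" if "b \<in> Basis" for b
    using that by (auto simp: Basis_vec_def inner_axis)
  have "cell \<subseteq> cbox 0 (1::real^2)"
    by (auto simp: cell_def mem_box_cart less_imp_le)
  then have "emeasure lborel cell \<le> emeasure lborel (cbox 0 (1::real^2))"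
    by (intro emeasure_mono) auto
  also have "\<dots> = 1"
    by (subst emeasure_lborel_cbox) (simp_all add: b prod.neutral)
  finally show "emeasure lborel cell \<le> 1" .
  have "1 = emeasure lborel (box 0 (1::real^2))"
    by (subst emeasure_lborel_box) (simp_all add: b prod.neutral)
  also have "box 0 (1::real^2) \<subseteq> cell"
    by (auto simp: cell_def mem_box_cart less_imp_le)
  then have "emeasure lborel (box 0 (1::real^2)) \<le> emeasure lborel cell"
    by (intro emeasure_mono) auto
  finally show "1 \<le> emeasure lborel cell" .
qed

lemma finite_measure_torus: "finite_measure torus"
  by (rule finite_measureI) (simp add: space_restrict_space emeasure_restrict_space emeasure_cell)

interpretation torus: finite_measure torus
  by (rule finite_measure_torus)

lemma measure_torus_space [simp]: "measure torus (space torus) = 1" "measure torus cell = 1"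
  by (simp_all add: space_restrict_space measure_restrict_space measure_def emeasure_restrict_space emeasure_cell)

lemma space_torus [simp]: "space torus = cell"
  by (simp add: space_restrict_space)

lemma cell_integral: "(LINT x:cell|lborel. f x) = (LINT x|torus. f x)"
  for f :: "real ^ 2 \<Rightarrow> 'b::{banach, second_countable_topology}"
  by (simp add: set_lebesgue_integral_def integral_restrict_space)

lemma cell_integrable: "set_integrable lborel cell f \<longleftrightarrow> integrable torus f"
  for f :: "real ^ 2 \<Rightarrow> 'b::{banach, second_countable_topology}"
  by (simp add: set_integrable_def integrable_restrict_space)

lemma measurable_torus:
  "f \<in> borel_measurable borel \<Longrightarrow> f \<in> borel_measurable torus"
  for f :: "real ^ 2 \<Rightarrow> 'b::topological_space"
  by (intro measurable_restrict_space1) simp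

lemma measurable_cnj [measurable (raw)]:
  "f \<in> borel_measurable M \<Longrightarrow> (\<lambda>x. cnj (f x)) \<in> borel_measurable M"
  by (rule measurable_compose[OF _ borel_measurable_continuous_onI]) (auto intro: continuous_intros)

lemma integrable_torus_bounded:
  fixes f :: "real ^ 2 \<Rightarrow> 'b::{banach, second_countable_topology}"
  assumes "f \<in> borel_measurable borel" "\<And>x. norm (f x) \<le> B"
  shows "integrable torus f"
  by (rule torus.integrable_const_bound[where B=B])
     (use assms in \<open>auto intro: measurable_torus\<close>)

subsection \<open>Plane waves\<close>

lemma ivec_add: "ivec (p + q) = ivec p + ivec q"
  and ivec_minus: "ivec (- p) = - ivec p"
  and ivec_diff: "ivec (p - q) = ivec p - ivec q"
  and ivec_zero [simp]: "ivec 0 = 0"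
  by (simp_all add: ivec_def vec_eq_iff)

lemma ivec_nth [simp]: "ivec k $ i = of_int (k $ i)"
  by (simp add: ivec_def)

lemma wave_cis: "wave k x = cis (2 * pi * (ivec k \<bullet> x))"
  by (simp add: wave_def cis_conv_exp mult_ac)

lemma wave_add: "wave (p + q) x = wave p x * wave q x"
  by (simp add: wave_cis cis_mult ivec_add inner_add_left ring_distribs)

lemma wave_0 [simp]: "wave 0 x = 1"
  by (simp add: wave_cis)

lemma cnj_wave: "cnj (wave k x) = wave (- k) x"
  by (simp add: wave_cis cis_cnj ivec_minus)

lemma norm_wave [simp]: "norm (wave k x) = 1"
  by (simp add: wave_cis)

lemma wave_shift: "wave k (x + y) = wave k x * wave k y"
  by (simp add: wave_cis cis_mult inner_add_right ring_distribs)

lemma wave_neg_arg: "wave k (- x) = wave (- k) x"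
  by (simp add: wave_cis ivec_minus)

lemma wave_ivec [simp]: "wave k (ivec l) = 1"
proof -
  have "2 * pi * (ivec k \<bullet> ivec l) = 2 * pi * of_int (k $ 1 * l $ 1 + k $ 2 * l $ 2)"
    by (simp add: inner_vec_def sum_2)
  then show ?thesis
    unfolding wave_cis by (metis Ints_of_int cis_multiple_2pi)
qed

lemma periodic_wave: "periodic (wave k)"
  by (simp add: periodic_def wave_shift)

lemma continuous_wave: "continuous_on S (wave k)"
  unfolding wave_def by (intro continuous_intros)

lemma measurable_wave [measurable]: "wave k \<in> borel_measurable borel"
  by (intro borel_measurable_continuous_onI continuous_wave)

lemma integrable_wave: "integrable torus (wave k)"
  by (rule integrable_torus_bounded[where B=1]) auto

subsection \<open>Translation invariance\<close>

lemma ivec_axis: "ivec (axis i 1) = axis i 1"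
  by (simp add: vec_eq_iff axis_def)

lemma lborel_integral_shift:
  fixes f :: "'a::euclidean_space \<Rightarrow> 'b::{banach, second_countable_topology}"
  assumes [measurable]: "f \<in> borel_measurable borel"
  shows "(LINT x|lborel. f (x + c)) = (LINT x|lborel. f x)"
proof -
  have "(LINT x|lborel. f x) = (LINT x|distr lborel borel ((+) c). f x)"
    by (simp add: lborel_distr_plus)
  also have "\<dots> = (LINT x|lborel. f (x + c))"
    by (subst integral_distr) (simp_all add: add.commute)
  finally show ?thesis by simp
qed

text \<open>The part of the shifted cell that leaves through the face \<open>x $ i = 1\<close> is
  carried back by the lattice vector \<open>axis i 1\<close>, which does not change
  \<open>f\<close>.\<close>

lemma periodic_shift_integral:
  fixes f :: "real ^ 2 \<Rightarrow> complex"
  assumes f [measurable]: "f \<in> borel_measurable borel" and per: "periodic f"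
    and bd: "\<And>x. norm (f x) \<le> B" and s: "0 \<le> s" "s < 1"
  shows "(LINT x|torus. f (x + s *\<^sub>R axis i 1)) = (LINT x|torus. f x)"
proof -
  define b :: "real ^ 2" where "b = axis i 1"
  define lo where "lo = {x \<in> cell. x $ i < s}"
  define hi where "hi = {x \<in> cell. s \<le> x $ i}"
  have lo_m [measurable]: "lo \<in> sets borel" and hi_m [measurable]: "hi \<in> sets borel"
    unfolding lo_def hi_def by measurable
  have int: "integrable lborel (\<lambda>x. indicator A x *\<^sub>R f x)" if "A \<in> sets borel" "A \<subseteq> cell" for A
  proof -
    have "integrable lborel (\<lambda>x. indicator cell x *\<^sub>R (indicator A x *\<^sub>R f x))"
    proof (subst integrable_restrict_space[symmetric])
      have "0 \<le> B" using bd[of 0] norm_ge_zero[of "f 0"] by linarith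
      then show "integrable torus (\<lambda>x. indicator A x *\<^sub>R f x)"
        using that bd by (intro integrable_torus_bounded[where B=B]) (auto simp: indicator_def)
    qed simp
    also have "(\<lambda>x. indicator cell x *\<^sub>R (indicator A x *\<^sub>R f x)) = (\<lambda>x. indicator A x *\<^sub>R f x)"
      using that by (auto simp: indicator_def fun_eq_iff)
    finally show ?thesis .
  qed
  have int': "integrable lborel (\<lambda>x. indicator lo (x - b) *\<^sub>R f x)"
  proof -
    have "integrable (distr lborel borel ((+) (- b))) (\<lambda>x. indicator lo x *\<^sub>R f x)"
      using int[of lo] by (simp add: lborel_distr_plus lo_def)
    then have "integrable lborel (\<lambda>x. indicator lo (- b + x) *\<^sub>R f (- b + x))"
      by (subst (asm) integrable_distr_eq) auto
    moreover have "f (- b + x) = f x" for x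
      using per[unfolded periodic_def, rule_format, of "x - b" "axis i 1"]
      by (simp add: b_def ivec_axis)
    ultimately show ?thesis by simp
  qed
  have split: "indicator cell (x - s *\<^sub>R b) = (indicator hi x + indicator lo (x - b) :: real)" for x
  proof -
    have "x - s *\<^sub>R b \<in> cell \<longleftrightarrow> x \<in> hi \<or> x - b \<in> lo"
      using s exhaust_2[of i] unfolding lo_def hi_def cell_alt b_def
      by (auto simp: axis_def)
    moreover have "\<not> (x \<in> hi \<and> x - b \<in> lo)"
      using s exhaust_2[of i] unfolding lo_def hi_def cell_alt b_def
      by (auto simp: axis_def)
    ultimately show ?thesis by (auto simp: indicator_def)
  qed
  have "(LINT x|torus. f (x + s *\<^sub>R b)) = (LINT x|lborel. indicator cell x *\<^sub>R f (x + s *\<^sub>R b))"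
    by (simp add: integral_restrict_space)
  also have "\<dots> = (LINT x|lborel. indicator cell (x - s *\<^sub>R b) *\<^sub>R f x)"
    using lborel_integral_shift[of "\<lambda>x. indicator cell (x - s *\<^sub>R b) *\<^sub>R f x" "s *\<^sub>R b"] by simp
  also have "\<dots> = (LINT x|lborel. indicator hi x *\<^sub>R f x + indicator lo (x - b) *\<^sub>R f x)"
    by (simp add: split scaleR_add_left)
  also have "\<dots> = (LINT x|lborel. indicator hi x *\<^sub>R f x) + (LINT x|lborel. indicator lo (x - b) *\<^sub>R f x)"
    by (intro Bochner_Integration.integral_add int int') (auto simp: hi_def)
  also have "(LINT x|lborel. indicator lo (x - b) *\<^sub>R f x) = (LINT x|lborel. indicator lo x *\<^sub>R f x)"
  proof -
    have "f (x + b) = f x" for x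
      using per[unfolded periodic_def, rule_format, of x "axis i 1"] by (simp add: b_def ivec_axis)
    then show ?thesis
      using lborel_integral_shift[of "\<lambda>x. indicator lo (x - b) *\<^sub>R f x" b] by simp
  qed
  also have "(LINT x|lborel. indicator hi x *\<^sub>R f x) + (LINT x|lborel. indicator lo x *\<^sub>R f x)
      = (LINT x|lborel. indicator hi x *\<^sub>R f x + indicator lo x *\<^sub>R f x)"
    by (intro Bochner_Integration.integral_add[symmetric] int) (auto simp: hi_def lo_def)
  also have "\<dots> = (LINT x|lborel. indicator cell x *\<^sub>R f x)"
    by (intro Bochner_Integration.integral_cong) (auto simp: hi_def lo_def indicator_def)
  also have "\<dots> = (LINT x|torus. f x)"
    by (simp add: integral_restrict_space)
  finally show ?thesis by (simp add: b_def)
qed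

lemma inner_ivec_axis: "ivec k \<bullet> axis i 1 = of_int (k $ i)"
  by (simp add: inner_axis)

text \<open>In a direction with \<open>k $ i \<noteq> 0\<close>, a shift by half a period of the
  wave changes its sign, so for \<open>k \<noteq> 0\<close> the integral is its own
  negative.\<close>

lemma wave_integral: "(LINT x|torus. wave k x) = (if k = 0 then 1 else 0)"
proof (cases "k = 0")
  case True
  have "wave 0 = (\<lambda>x. 1)" by (auto simp: fun_eq_iff)
  then show ?thesis using True by simp
next
  case False
  then obtain i where i: "k $ i \<noteq> 0" by (auto simp: vec_eq_iff)
  define s where "s = 1 / (2 * \<bar>real_of_int (k $ i)\<bar>)"
  have s: "0 \<le> s" "s < 1" using i by (auto simp: s_def divide_simps)
  have "2 * pi * (ivec k \<bullet> (s *\<^sub>R axis i 1)) = (if k $ i > 0 then pi else - pi)"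
    using i by (auto simp: inner_ivec_axis s_def field_simps)
  then have w: "wave k (s *\<^sub>R axis i 1) = - 1"
    unfolding wave_cis by (auto simp: complex_eq_iff)
  have "(LINT x|torus. wave k x) = (LINT x|torus. wave k (x + s *\<^sub>R axis i 1))"
    by (rule periodic_shift_integral[symmetric, where B=1]) (use s in \<open>auto intro: periodic_wave\<close>)
  also have "\<dots> = - (LINT x|torus. wave k x)"
    by (simp add: wave_shift w)
  finally show ?thesis using False by (simp add: eq_neg_iff_add_eq_0)
qed

lemma periodic_reduce:
  assumes "periodic f"
  obtains y where "y \<in> cell" "f y = f x" 
proof
  let ?k = "\<chi> i. \<lfloor>x $ i\<rfloor>"
  show "x - ivec ?k \<in> cell" by (auto simp: cell_def) linarith+
  show "f (x - ivec ?k) = f x"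
    using assms unfolding periodic_def by (metis diff_add_cancel)
qed

lemma cell_subset: "cell \<subseteq> cbox 0 1"
  by (auto simp: cell_def mem_box_cart less_imp_le)

lemma periodic_bounded:
  fixes f :: "real ^ 2 \<Rightarrow> 'b::real_normed_vector"
  assumes "periodic f" "continuous_on UNIV f"
  obtains B where "B > 0" "\<And>x. norm (f x) \<le> B"
proof -
  have "compact (f ` cbox 0 1)"
    by (intro compact_continuous_image) (use assms in \<open>auto intro: continuous_on_subset\<close>)
  then obtain B where B: "B > 0" "\<And>y. y \<in> f ` cbox 0 1 \<Longrightarrow> norm y \<le> B"
    by (meson bounded_pos compact_imp_bounded)
  show thesis
  proof (rule that[of B])
    fix x
    obtain y where "y \<in> cell" "f y = f x" by (rule periodic_reduce[OF assms(1)])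
    then show "norm (f x) \<le> B" using B(2) cell_subset by (metis imageI subsetD)
  qed (fact B)
qed

subsection \<open>Integration by parts\<close>

text \<open>Difference quotients of a periodic function have integral zero by shift invariance. They
  are bounded by the supremum of the derivative, so dominated convergence passes to the
  derivative.\<close>

lemma periodic_derivative_integral:
  fixes G G' :: "real ^ 2 \<Rightarrow> complex"
  assumes per: "periodic G" "periodic G'" and c: "continuous_on UNIV G" "continuous_on UNIV G'"
    and der: "\<And>x s. ((\<lambda>s. G (x + s *\<^sub>R axis i 1)) has_vector_derivative G' (x + s *\<^sub>R axis i 1)) (at s)"
  shows "(LINT x|torus. G' x) = 0"
proof -
  define b :: "real ^ 2" where "b = axis i 1"
  obtain B where B: "B > 0" "\<And>x. norm (G x) \<le> B" using periodic_bounded[OF per(1) c(1)] by blast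
  obtain M where M: "M > 0" "\<And>x. norm (G' x) \<le> M" using periodic_bounded[OF per(2) c(2)] by blast
  have m [measurable]: "G \<in> borel_measurable borel" "G' \<in> borel_measurable borel"
    using c by (auto intro: borel_measurable_continuous_onI)
  \<comment> \<open>The offset 2 keeps every step strictly below one period, as
    \<open>periodic_shift_integral\<close> demands.\<close>
  define r where "r n = 1 / (real n + 2)" for n
  have r: "0 < r n" "r n < 1" for n by (auto simp: r_def)
  have r0: "r \<longlonglongrightarrow> 0" unfolding r_def by real_asymp
  define d where "d n x = (G (x + r n *\<^sub>R b) - G x) /\<^sub>R r n" for n x
  have "(LINT x|torus. d n x) = 0" for n
  proof -
    have "(LINT x|torus. d n x) = ((LINT x|torus. G (x + r n *\<^sub>R b)) - (LINT x|torus. G x)) /\<^sub>R r n"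
      unfolding d_def
      by (subst integral_scaleR_right, rule arg_cong[where f="\<lambda>z. z /\<^sub>R r n"],
          rule Bochner_Integration.integral_diff)
         (use B in \<open>auto intro!: integrable_torus_bounded[where B=B]\<close>)
    also have "(LINT x|torus. G (x + r n *\<^sub>R b)) = (LINT x|torus. G x)"
      unfolding b_def by (rule periodic_shift_integral[OF m(1) per(1) B(2)]) (use r[of n] in auto)
    finally show ?thesis by simp
  qed
  moreover have "(\<lambda>n. LINT x|torus. d n x) \<longlonglongrightarrow> (LINT x|torus. G' x)"
  proof (rule integral_dominated_convergence[where w="\<lambda>_. M"])
    show "AE x in torus. (\<lambda>n. d n x) \<longlonglongrightarrow> G' x"
    proof (intro AE_I2)
      fix x
      have "((\<lambda>s. (G (x + s *\<^sub>R b) - G x) /\<^sub>R s) \<longlongrightarrow> G' x) (at 0)"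
      proof (rule LIM_zero_cancel, rule tendsto_norm_zero_cancel)
        have "((\<lambda>h. norm (G (x + h *\<^sub>R b) - G x - h *\<^sub>R G' x) / norm h) \<longlongrightarrow> 0) (at 0)"
          using der[of x 0] by (simp add: has_vector_derivative_def has_derivative_at b_def)
        moreover have "norm (G (x + h *\<^sub>R b) - G x - h *\<^sub>R G' x) / norm h
            = norm ((G (x + h *\<^sub>R b) - G x) /\<^sub>R h - G' x)" if "h \<noteq> 0" for h
        proof -
          have "(G (x + h *\<^sub>R b) - G x) /\<^sub>R h - G' x = (G (x + h *\<^sub>R b) - G x - h *\<^sub>R G' x) /\<^sub>R h"
            using that by (simp add: scaleR_diff_right)
          then show ?thesis by (simp add: divide_inverse mult.commute)
        qed
        ultimately show "((\<lambda>s. norm ((G (x + s *\<^sub>R b) - G x) /\<^sub>R s - G' x)) \<longlongrightarrow> 0) (at 0)"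
          by (subst filterlim_cong[OF refl refl, symmetric]) (auto simp: eventually_at_filter)
      qed
      then show "(\<lambda>n. d n x) \<longlonglongrightarrow> G' x"
        unfolding d_def
        by (rule filterlim_compose) (use r0 r in \<open>auto simp: filterlim_at less_imp_neq[symmetric]\<close>)
    qed
    show "AE x in torus. norm (d n x) \<le> M" for n
    proof (intro AE_I2)
      fix x
      have "norm (G (x + r n *\<^sub>R b) - G (x + 0 *\<^sub>R b)) \<le> M * norm (r n - 0)"
      proof (rule differentiable_bound[where f'="\<lambda>s t. t *\<^sub>R G' (x + s *\<^sub>R b)" and S="UNIV"])
        show "((\<lambda>s. G (x + s *\<^sub>R b)) has_derivative (\<lambda>t. t *\<^sub>R G' (x + s *\<^sub>R b))) (at s within UNIV)" for s
          using der[of x s] by (simp add: has_vector_derivative_def b_def)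
        show "onorm (\<lambda>t. t *\<^sub>R G' (x + s *\<^sub>R b)) \<le> M" for s
          by (rule onorm_le) (use M(2) in \<open>auto simp: mult.commute[of M] intro: mult_left_mono\<close>)
      qed auto
      then show "norm (d n x) \<le> M" using r[of n] by (simp add: d_def inverse_eq_divide pos_divide_le_eq)
    qed
  qed (use m in \<open>auto simp: d_def intro!: measurable_torus\<close>)
  ultimately show ?thesis by (simp add: LIMSEQ_const_iff)
qed

lemma wave_has_vector_derivative:
  "((\<lambda>s. wave k (x + s *\<^sub>R y)) has_vector_derivative
     (2 * \<i> * of_real pi * of_real (ivec k \<bullet> y)) * wave k (x + s *\<^sub>R y)) (at s)"
proof -
  let ?f = "\<lambda>z. exp (2 * \<i> * of_real pi * (of_real (ivec k \<bullet> x) + z * of_real (ivec k \<bullet> y)))"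
  have "(?f has_field_derivative (2 * \<i> * of_real pi * of_real (ivec k \<bullet> y)) * ?f (of_real s)) (at (of_real s))"
    by (auto intro!: derivative_eq_intros)
  from has_vector_derivative_real_field[OF this] show ?thesis
    by (simp add: wave_def inner_add_right)
qed

lemma fourier_torus: "fourier f p = (LINT x|torus. f x * wave (- p) x)"
  by (simp add: fourier_def cell_integral)

text \<open>Integration by parts: the derivative of the periodic product of \<open>g\<close> and
  \<open>wave (- p)\<close> has integral zero. Periodicity of the derivative is included so that the
  statement can be iterated.\<close>

lemma fourier_derivative:
  fixes g :: "real ^ 2 \<Rightarrow> real"
  assumes per: "periodic g" and dg: "\<And>x. g differentiable (at x)"
    and c: "continuous_on UNIV (\<lambda>x. frechet_derivative g (at x) (axis i 1))"
    (is "continuous_on UNIV ?g'")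
  shows "fourier (\<lambda>x. of_real (?g' x)) p = 2 * \<i> * pi * (p $ i) * fourier (\<lambda>x. of_real (g x)) p"
    and "periodic ?g'"
proof -
  show per': "periodic ?g'"
    unfolding periodic_def
  proof (intro allI)
    fix x k
    have "((\<lambda>y. g (y + ivec k)) has_derivative frechet_derivative g (at (x + ivec k))) (at x)"
      using dg[of "x + ivec k"]
      by (auto intro!: derivative_eq_intros has_derivative_compose[of "\<lambda>y. y + ivec k" "\<lambda>y. y" x UNIV g] simp: frechet_derivative_works)
    moreover have "(\<lambda>y. g (y + ivec k)) = g" using per by (auto simp: periodic_def)
    ultimately show "?g' (x + ivec k) = ?g' x"
      by (metis frechet_derivative_at)
  qed
  have cg: "continuous_on UNIV g"
    using dg by (simp add: continuous_on_eq_continuous_at differentiable_imp_continuous_within)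
  let ?c = "2 * \<i> * of_real pi * of_real (ivec (- p) \<bullet> axis i 1)"
  let ?G' = "\<lambda>x. of_real (?g' x) * wave (- p) x + ?c * (of_real (g x) * wave (- p) x)"
  have z: "(LINT x|torus. ?G' x) = 0"
  proof (rule periodic_derivative_integral[where i=i and G="\<lambda>x. of_real (g x) * wave (- p) x"])
    show "periodic (\<lambda>x. of_real (g x) * wave (- p) x)" "periodic ?G'"
      using per per' periodic_wave[of "- p"] by (auto simp: periodic_def)
    fix x :: "real ^ 2" and s :: real
    have "((\<lambda>s. g (x + s *\<^sub>R axis i 1)) has_vector_derivative ?g' (x + s *\<^sub>R axis i 1)) (at s)"
    proof -
      have "(g has_derivative frechet_derivative g (at (x + s *\<^sub>R axis i 1))) (at (x + s *\<^sub>R axis i 1))"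
        using dg by (simp add: frechet_derivative_works)
      then have "((\<lambda>s. g (x + s *\<^sub>R axis i 1)) has_derivative (\<lambda>t. frechet_derivative g (at (x + s *\<^sub>R axis i 1)) (t *\<^sub>R axis i 1))) (at s)"
        by (rule has_derivative_compose[rotated]) (auto intro!: derivative_eq_intros)
      moreover have "linear (frechet_derivative g (at (x + s *\<^sub>R axis i 1)))"
        using dg by (intro linear_frechet_derivative)
      ultimately show ?thesis
        by (simp add: has_vector_derivative_def linear_scale)
    qed
    from has_vector_derivative_mult[OF this[THEN bounded_linear.has_vector_derivative[OF bounded_linear_of_real]] wave_has_vector_derivative[of "-p" x "axis i 1" s]]
    show "((\<lambda>s. of_real (g (x + s *\<^sub>R axis i 1)) * wave (- p) (x + s *\<^sub>R axis i 1)) has_vector_derivative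
         ?G' (x + s *\<^sub>R axis i 1)) (at s)"
      by (simp add: algebra_simps)
  qed (intro continuous_intros continuous_wave c cg)+
  obtain B where B: "\<And>x. norm (g x) \<le> B" using periodic_bounded[OF per cg] by blast
  obtain M where M: "\<And>x. norm (?g' x) \<le> M" using periodic_bounded[OF per' c] by blast
  have [measurable]: "g \<in> borel_measurable borel" "?g' \<in> borel_measurable borel"
    using c cg by (auto intro: borel_measurable_continuous_onI)
  have "(LINT x|torus. ?G' x) = fourier (\<lambda>x. of_real (?g' x)) p + ?c * fourier (\<lambda>x. of_real (g x)) p"
    unfolding fourier_torus
    apply (subst Bochner_Integration.integral_add)
      apply (rule integrable_torus_bounded[where B=M]; use M in \<open>simp add: norm_mult\<close>)
     apply (intro integrable_mult_right)
     apply (rule integrable_torus_bounded[where B=B]; use B in \<open>simp add: norm_mult\<close>)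
    apply (simp only: integral_mult_right_zero)
    done
  then show "fourier (\<lambda>x. of_real (?g' x)) p = 2 * \<i> * pi * (p $ i) * fourier (\<lambda>x. of_real (g x)) p"
    unfolding z by (simp add: inner_ivec_axis ivec_minus algebra_simps add_eq_0_iff)
qed

subsection \<open>Square-integrable functions\<close>

lemma L2_torus_iff:
  "f \<in> L2_torus \<longleftrightarrow> f \<in> borel_measurable borel \<and> periodic f \<and> integrable torus (\<lambda>x. (norm (f x))\<^sup>2)"
  by (auto simp: L2_torus_def cell_integrable)

lemma L2_nrm_sq: "(L2_nrm f)\<^sup>2 = (LINT x|torus. (norm (f x))\<^sup>2)"
  by (simp add: L2_nrm_def cell_integral)

lemma L2_nrm_nonneg: "0 \<le> L2_nrm f"
  by (simp add: L2_nrm_def cell_integral)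

lemma L2_integrable:
  assumes "f \<in> L2_torus"
  shows "integrable torus f"
proof (rule Bochner_Integration.integrable_bound)
  show "integrable torus (\<lambda>x. 1 + (norm (f x))\<^sup>2)"
    using assms by (intro Bochner_Integration.integrable_add) (auto simp: L2_torus_iff)
  have "t \<le> 1 + t\<^sup>2" for t :: real
    using zero_le_power2[of "t - 1/2"] by (simp add: power2_eq_square algebra_simps)
  then show "AE x in torus. norm (f x) \<le> norm (1 + (norm (f x))\<^sup>2)"
    by (auto intro!: AE_I2)
qed (use assms in \<open>auto simp: L2_torus_iff intro: measurable_torus\<close>)

lemma L2_integrable_mult:
  assumes f: "f \<in> L2_torus" and g: "g \<in> borel_measurable borel" "\<And>x. norm (g x) \<le> B"
  shows "integrable torus (\<lambda>x. g x * f x)" "integrable torus (\<lambda>x. f x * g x)"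
    "integrable torus (\<lambda>x. g x * cnj (f x))" "integrable torus (\<lambda>x. cnj (f x) * g x)"
proof -
  have f' [measurable]: "f \<in> borel_measurable borel" "g \<in> borel_measurable borel"
    using f g by (auto simp: L2_torus_iff)
  have i: "integrable torus (\<lambda>x. B *\<^sub>R norm (f x))"
    using L2_integrable[OF f] by auto
  show *: "integrable torus (\<lambda>x. g x * f x)"
    by (rule Bochner_Integration.integrable_bound[OF i])
       (auto intro!: AE_I2 measurable_torus mult_right_mono intro: order_trans[OF _ abs_ge_self] g simp: norm_mult)
  show **: "integrable torus (\<lambda>x. g x * cnj (f x))"
    by (rule Bochner_Integration.integrable_bound[OF i])
       (auto intro!: AE_I2 measurable_torus mult_right_mono intro: order_trans[OF _ abs_ge_self] g simp: norm_mult)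
  show "integrable torus (\<lambda>x. f x * g x)" "integrable torus (\<lambda>x. cnj (f x) * g x)"
    using * ** by (simp_all add: mult.commute)
qed

section \<open>Trigonometric polynomials and Bessel's inequality\<close>

definition trig :: "(int ^ 2) set \<Rightarrow> (int ^ 2 \<Rightarrow> complex) \<Rightarrow> real ^ 2 \<Rightarrow> complex" where
  "trig A c x = (\<Sum>p\<in>A. c p * wave p x)"

lemma norm_trig_le: "norm (trig A c x) \<le> (\<Sum>p\<in>A. norm (c p))"
  unfolding trig_def by (rule norm_sum[THEN order_trans]) (simp add: norm_mult)

lemma measurable_trig [measurable]: "trig A c \<in> borel_measurable borel"
  unfolding trig_def[abs_def] by measurable

lemma L2_trig: "trig A c \<in> L2_torus"
  unfolding L2_torus_iff
proof (intro conjI)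
  show "periodic (trig A c)"
    using periodic_wave by (auto simp: periodic_def trig_def)
  show "integrable torus (\<lambda>x. (norm (trig A c x))\<^sup>2)"
    by (rule integrable_torus_bounded[where B="(\<Sum>p\<in>A. norm (c p))\<^sup>2"])
       (use norm_trig_le in \<open>auto intro!: power_mono\<close>)
qed measurable

lemma fourier_trig:
  assumes "finite A"
  shows "fourier (trig A c) q = (if q \<in> A then c q else 0)"
proof -
  have "fourier (trig A c) q = (LINT x|torus. (\<Sum>p\<in>A. c p * wave (p - q) x))"
    by (simp add: fourier_torus trig_def sum_distrib_right wave_add[symmetric] mult.assoc)
  also have "\<dots> = (\<Sum>p\<in>A. c p * (LINT x|torus. wave (p - q) x))"
    by (subst Bochner_Integration.integral_sum) (auto intro: integrable_wave)
  also have "\<dots> = (\<Sum>p\<in>A. if p = q then c q else 0)"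
    by (intro sum.cong) (auto simp: wave_integral)
  finally show ?thesis using assms by simp
qed

lemma inner_trig:
  assumes "f \<in> L2_torus"
  shows "(LINT x|torus. f x * cnj (trig A c x)) = (\<Sum>p\<in>A. cnj (c p) * fourier f p)"
proof -
  have "(LINT x|torus. f x * cnj (trig A c x)) = (LINT x|torus. (\<Sum>p\<in>A. cnj (c p) * (f x * wave (- p) x)))"
    by (simp add: trig_def cnj_wave sum_distrib_left mult_ac)
  also have "\<dots> = (\<Sum>p\<in>A. cnj (c p) * fourier f p)"
    by (subst Bochner_Integration.integral_sum)
       (auto simp: fourier_torus intro!: integrable_mult_right L2_integrable_mult[OF assms, where B=1])
  finally show ?thesis .
qed

text \<open>The difference of the two sides is the squared distance from \<open>f\<close> to its
  Fourier sum over \<open>A\<close>.\<close>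

lemma bessel:
  assumes f: "f \<in> L2_torus" and A: "finite A"
  shows "(\<Sum>p\<in>A. (norm (fourier f p))\<^sup>2) \<le> (L2_nrm f)\<^sup>2"
proof -
  let ?c = "fourier f" and ?S = "\<Sum>p\<in>A. (norm (fourier f p))\<^sup>2"
  define g where "g = trig A ?c"
  have g: "g \<in> L2_torus" by (simp add: g_def L2_trig)
  have [measurable]: "f \<in> borel_measurable borel" "g \<in> borel_measurable borel"
    using f g by (auto simp: L2_torus_iff)
  have gb: "norm (cnj (g x)) \<le> (\<Sum>p\<in>A. norm (?c p))" for x
    unfolding g_def using norm_trig_le by simp
  have fg: "integrable torus (\<lambda>x. f x * cnj (g x))" "integrable torus (\<lambda>x. g x * cnj (g x))"
    using L2_integrable_mult(2)[OF f _ gb] L2_integrable_mult(2)[OF g _ gb] by simp_all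
  have c1: "(LINT x|torus. f x * cnj (g x)) = of_real ?S"
    unfolding g_def inner_trig[OF f] of_real_sum
    by (intro sum.cong) (auto simp: complex_norm_square[symmetric] mult.commute)
  have c2: "(LINT x|torus. g x * cnj (g x)) = of_real ?S"
    using inner_trig[OF g, of A ?c] unfolding g_def of_real_sum fourier_trig[OF A]
    by (auto intro!: sum.cong simp: complex_norm_square[symmetric] mult.commute)
  define P Q where "P x = Re (f x * cnj (g x))" and "Q x = Re (g x * cnj (g x))" for x
  have PQ: "integrable torus P" "integrable torus Q"
    "(LINT x|torus. P x) = ?S" "(LINT x|torus. Q x) = ?S"
    unfolding P_def Q_def using fg c1 c2 by (simp_all only: integral_Re integrable_Re Re_complex_of_real)
  have "(norm (f x - g x))\<^sup>2 = (norm (f x))\<^sup>2 - 2 * P x + Q x" for x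
    unfolding cmod_power2 P_def Q_def by (simp add: power2_eq_square algebra_simps)
  then have "(LINT x|torus. (norm (f x - g x))\<^sup>2) = (LINT x|torus. (norm (f x))\<^sup>2 - 2 * P x + Q x)"
    by simp
  also have "\<dots> = (LINT x|torus. (norm (f x))\<^sup>2) - 2 * (LINT x|torus. P x) + (LINT x|torus. Q x)"
    using f PQ by (simp add: L2_torus_iff)
  also have "\<dots> = (L2_nrm f)\<^sup>2 - ?S"
    unfolding PQ L2_nrm_sq by simp
  finally have "(L2_nrm f)\<^sup>2 - ?S = (LINT x|torus. (norm (f x - g x))\<^sup>2)" ..
  also have "\<dots> \<ge> 0" by simp
  finally show ?thesis by simp
qed

subsection \<open>Approximation by trigonometric polynomials\<close>

definition is_trig :: "(real ^ 2 \<Rightarrow> complex) \<Rightarrow> bool" where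
  "is_trig f \<longleftrightarrow> (\<exists>A c. finite A \<and> f = trig A c)"

lemma is_trig_wave: "is_trig (wave k)"
  unfolding is_trig_def by (rule exI[of _ "{k}"], rule exI[of _ "\<lambda>_. 1"]) (auto simp: trig_def fun_eq_iff)

lemma is_trig_cmult: "is_trig f \<Longrightarrow> is_trig (\<lambda>x. c * f x)"
  unfolding is_trig_def
proof (elim exE conjE)
  fix A a assume "finite A" "f = trig A a"
  then show "\<exists>A a. finite A \<and> (\<lambda>x. c * f x) = trig A a"
    by (intro exI[of _ A] exI[of _ "\<lambda>p. c * a p"]) (auto simp: trig_def fun_eq_iff sum_distrib_left mult.assoc)
qed

lemma is_trig_const: "is_trig (\<lambda>x. c)"
  using is_trig_cmult[OF is_trig_wave[of 0], of c] by simp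

lemma is_trig_add:
  assumes "is_trig f" "is_trig g"
  shows "is_trig (\<lambda>x. f x + g x)"
proof -
  obtain A a B b where *: "finite A" "finite B" "f = trig A a" "g = trig B b"
    using assms by (auto simp: is_trig_def)
  define c where "c p = (if p \<in> A then a p else 0) + (if p \<in> B then b p else 0)" for p
  have "trig (A \<union> B) c x = trig A a x + trig B b x" for x
  proof -
    have "trig A a x = (\<Sum>p\<in>A \<union> B. (if p \<in> A then a p else 0) * wave p x)"
      unfolding trig_def using * by (intro sum.mono_neutral_cong_left) auto
    moreover have "trig B b x = (\<Sum>p\<in>A \<union> B. (if p \<in> B then b p else 0) * wave p x)"
      unfolding trig_def using * by (intro sum.mono_neutral_cong_left) auto
    ultimately show ?thesis
      by (simp add: trig_def c_def sum.distrib[symmetric] distrib_right)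
  qed
  then show ?thesis
    unfolding is_trig_def using * by (intro exI[of _ "A \<union> B"] exI[of _ c]) auto
qed

lemma is_trig_sum: "finite I \<Longrightarrow> (\<And>i. i \<in> I \<Longrightarrow> is_trig (f i)) \<Longrightarrow> is_trig (\<lambda>x. \<Sum>i\<in>I. f i x)"
  by (induction I rule: finite_induct) (auto intro: is_trig_const is_trig_add)

lemma is_trig_mult:
  assumes "is_trig f" "is_trig g"
  shows "is_trig (\<lambda>x. f x * g x)"
proof -
  obtain A a B b where *: "finite A" "finite B" "f = trig A a" "g = trig B b"
    using assms by (auto simp: is_trig_def)
  have "(\<lambda>x. f x * g x) = (\<lambda>x. \<Sum>p\<in>A. \<Sum>q\<in>B. (a p * b q) * wave (p + q) x)"
    by (simp add: * trig_def fun_eq_iff sum_product wave_add mult_ac)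
  then show ?thesis
    using * by (auto intro!: is_trig_sum is_trig_cmult is_trig_wave)
qed

lemma is_trig_power: "is_trig f \<Longrightarrow> is_trig (\<lambda>x. f x ^ n)"
  by (induction n) (auto intro: is_trig_const is_trig_mult)

text \<open>The function \<open>cos(pi z1)^2 cos(pi z2)^2\<close>, written so that it is visibly a
  trigonometric polynomial. It takes values in [0, 1] and equals 1 exactly on the integer lattice;
  its normalized powers are an approximate identity on the torus.\<close>

definition kern :: "real ^ 2 \<Rightarrow> real" where
  "kern z = (1 + cos (2 * pi * z $ 1)) / 2 * ((1 + cos (2 * pi * z $ 2)) / 2)"

lemma one_plus_cos_nonneg: "0 \<le> 1 + cos t" for t :: real
  using cos_ge_minus_one[of t] by linarith

lemma kern_nonneg: "0 \<le> kern z"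
  unfolding kern_def by (intro mult_nonneg_nonneg divide_nonneg_nonneg one_plus_cos_nonneg) auto

lemma kern_le_1: "kern z \<le> 1"
  unfolding kern_def by (intro mult_le_one divide_nonneg_nonneg one_plus_cos_nonneg) auto

lemma kern_0: "kern 0 = 1"
  by (simp add: kern_def)

lemma continuous_kern: "continuous_on S kern"
  unfolding kern_def by (intro continuous_intros) auto

lemma measurable_kern [measurable]: "kern \<in> borel_measurable borel"
  by (intro borel_measurable_continuous_onI continuous_kern)

lemma kern_eq_1:
  assumes "kern z = 1"
  obtains k where "z = ivec k"
proof -
  define a b where "a = (1 + cos (2 * pi * z $ 1)) / 2" and "b = (1 + cos (2 * pi * z $ 2)) / 2"
  have ab: "0 \<le> a" "a \<le> 1" "0 \<le> b" "b \<le> 1" "a * b = 1"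
    using assms one_plus_cos_nonneg[of "2 * pi * z $ 1"] one_plus_cos_nonneg[of "2 * pi * z $ 2"]
    unfolding a_def b_def kern_def by auto
  have "a * b \<le> a" "a * b \<le> b"
    using ab mult_left_mono[of b 1 a] mult_right_mono[of a 1 b] by auto
  then have "a = 1" "b = 1" using ab by linarith+
  then have "cos (2 * pi * z $ 1) = 1" "cos (2 * pi * z $ 2) = 1" by (auto simp: a_def b_def)
  then obtain m n :: int where "2 * pi * z $ 1 = of_int m * 2 * pi" "2 * pi * z $ 2 = of_int n * 2 * pi"
    unfolding cos_one_2pi_int by blast
  then have "z $ 1 = of_int m" "z $ 2 = of_int n" by auto
  then have "z = ivec (\<chi> i. if i = 1 then m else n)"
    by (auto simp: vec_eq_iff forall_2)
  then show thesis by (rule that)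
qed

lemma is_trig_kern: "is_trig (\<lambda>z. of_real (kern z))"
proof -
  let ?w = "\<lambda>i. wave (axis i 1)" and ?w' = "\<lambda>i. wave (- axis i 1)"
  have c: "of_real ((1 + cos (2 * pi * z $ i)) / 2) = 1/2 + ((1/4) * ?w i z + (1/4) * ?w' i z)" for i z
    by (simp add: wave_cis ivec_axis ivec_minus inner_axis' complex_eq_iff)
  have "is_trig (\<lambda>z. (1/2 + ((1/4) * ?w i z + (1/4) * ?w' i z)))" for i
    by (intro is_trig_add is_trig_cmult is_trig_const is_trig_wave)
  then have "is_trig (\<lambda>z. of_real ((1 + cos (2 * pi * z $ i)) / 2))" for i
    unfolding c .
  from is_trig_mult[OF this[of 1] this[of 2]] show ?thesis
    by (simp add: kern_def)
qed

text \<open>Near 0 the kernel exceeds \<open>1 - \<kappa>\<close> on a set of positive measure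
  \<open>m\<close>. The normalizing integrals thus decay at most geometrically, at a rate as close
  to 1 as desired.\<close>

lemma kern_lower_bound:
  assumes "\<kappa> > 0" "\<kappa> < 1"
  obtains m where "m > 0" "\<And>n. (1 - \<kappa>) ^ n * m \<le> (LINT y|torus. kern y ^ n)"
proof -
  have "isCont kern 0"
    using continuous_kern[of UNIV] by (simp add: continuous_on_eq_continuous_at)
  then have "(kern \<longlongrightarrow> 1) (nhds 0)"
    using tendsto_at_iff_tendsto_nhds[of kern 0] by (simp add: isCont_def kern_0)
  then have "eventually (\<lambda>y. kern y > 1 - \<kappa>) (nhds 0)"
    using assms by (intro order_tendstoD(1)) auto
  then obtain d where d: "d > 0" "\<And>y. dist y 0 < d \<Longrightarrow> kern y > 1 - \<kappa>"
    unfolding eventually_nhds_metric by blast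
  define U where "U = ball (0::real^2) d \<inter> box 0 1"
  have U: "open U" "U \<subseteq> cell"
    by (auto simp: U_def cell_def mem_box_cart less_imp_le)
  \<comment> \<open>The origin is only a corner of the cell, so \<open>U\<close> is shown to be
    nonempty by a point inside the open box; its coordinates are at most \<open>d / 4\<close>, which
    keeps the norm below \<open>d\<close>.\<close>
  define y :: "real ^ 2" where "y = (\<chi> i. min (1/2) (d / 4))"
  have "norm y \<le> \<bar>y $ 1\<bar> + \<bar>y $ 2\<bar>"
    using norm_le_l1_cart[of y] by (simp add: sum_2)
  also have "\<dots> < d" using d(1) by (auto simp: y_def)
  finally have "y \<in> U"
    using d(1) by (auto simp: U_def mem_box_cart y_def min_def)
  then have "U \<noteq> {}" by auto
  have [measurable]: "U \<in> sets borel" using U by auto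
  have "emeasure lborel U \<noteq> 0"
    using open_not_negligible[OF U(1) \<open>U \<noteq> {}\<close>] U(1)
    by (simp add: negligible_iff_null_sets null_sets_completion_iff null_sets_def)
  moreover have "emeasure lborel U \<le> emeasure lborel cell"
    using U by (intro emeasure_mono) auto
  then have "emeasure lborel U \<noteq> \<infinity>"
    by (auto simp: emeasure_cell top_unique)
  ultimately have "measure lborel U \<noteq> 0"
    by (auto simp: measure_def enn2real_eq_0_iff)
  then have m: "measure lborel U > 0"
    using measure_nonneg[of lborel U] by linarith
  show thesis
  proof (rule that[OF m])
    fix n
    have "(1 - \<kappa>) ^ n * measure lborel U = (LINT y|torus. indicator U y * (1 - \<kappa>) ^ n)"
      using U(2) by (simp add: measure_restrict_space Int_absorb2)
    also have "\<dots> \<le> (LINT y|torus. kern y ^ n)"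
    proof (rule integral_mono)
      show "indicator U y * (1 - \<kappa>) ^ n \<le> kern y ^ n" for y
        using d(2)[of y] assms kern_nonneg[of y]
        by (auto simp: indicator_def U_def dist_commute intro!: power_mono)
    qed (use assms in \<open>auto intro!: integrable_torus_bounded[where B=1] power_le_one mult_le_one
           simp: kern_nonneg kern_le_1 indicator_def\<close>)
    finally show "(1 - \<kappa>) ^ n * measure lborel U \<le> (LINT y|torus. kern y ^ n)" .
  qed
qed

text \<open>Convolution with the normalized power \<open>kern ^ n\<close> (a de la Vallee Poussin
  kernel) multiplies the Fourier coefficients by \<open>\<gamma> n p\<close>. Positivity and total
  mass 1 give the bounds on the multipliers and on the supremum, and concentration at the lattice
  gives pointwise convergence.\<close>

lemma fejer_approximation:
  obtains A :: "nat \<Rightarrow> (int ^ 2) set" and \<gamma> :: "nat \<Rightarrow> int ^ 2 \<Rightarrow> complex"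
  where "\<And>n. finite (A n)" "\<And>n. 0 \<in> A n" "\<And>n. \<gamma> n 0 = 1" "\<And>n p. p \<in> A n \<Longrightarrow> norm (\<gamma> n p) \<le> 1"
    "\<And>n x f B. periodic f \<Longrightarrow> continuous_on UNIV f \<Longrightarrow> (\<And>x. norm (f x) \<le> B) \<Longrightarrow>
        norm (trig (A n) (\<lambda>p. \<gamma> n p * fourier f p) x) \<le> B"
    "\<And>x f. periodic f \<Longrightarrow> continuous_on UNIV f \<Longrightarrow>
        (\<lambda>n. trig (A n) (\<lambda>p. \<gamma> n p * fourier f p) x) \<longlonglongrightarrow> f x"
proof -
  have "\<forall>n. \<exists>A c. finite A \<and> (\<lambda>z. of_real (kern z) ^ n) = trig A c"
    using is_trig_power[OF is_trig_kern] by (auto simp: is_trig_def)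
  then obtain A c where A: "\<And>n. finite (A n)"
    and Ac: "\<And>n z. of_real (kern z) ^ n = trig (A n) (c n) z"
    by (metis (no_types, lifting))
  define Z where "Z n = (LINT y|torus. kern y ^ n)" for n
  have Zpos: "Z n > 0" for n
  proof -
    obtain m where m: "m > 0" "\<And>n. (1 - 1/2) ^ n * m \<le> (LINT y|torus. kern y ^ n)"
      by (rule kern_lower_bound[of "1/2"]) auto
    have "0 < (1 - 1/2) ^ n * m" using m(1) by simp
    also have "\<dots> \<le> Z n" using m(2) by (simp only: Z_def)
    finally show ?thesis .
  qed
  have ck: "c n p = (LINT y|torus. of_real (kern y ^ n) * wave (- p) y)" if "p \<in> A n" for n p
    using fourier_trig[OF A, of n "c n" p] that by (simp add: fourier_torus Ac[symmetric])
  have kint: "integrable torus (\<lambda>y. kern y ^ n)" for n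
    by (rule integrable_torus_bounded[where B=1])
       (auto intro!: power_le_one simp: kern_nonneg kern_le_1)
  have cn: "norm (c n p) \<le> Z n" if "p \<in> A n" for n p
  proof -
    have "norm (c n p) \<le> (LINT y|torus. norm (of_real (kern y ^ n) * wave (- p) y))"
      unfolding ck[OF that] by (rule integral_norm_bound)
    then show ?thesis by (simp add: norm_mult norm_power kern_nonneg Z_def)
  qed
  have "fourier (trig (A n) (c n)) 0 = of_real (Z n)" for n
    using kint unfolding fourier_torus Ac[symmetric] Z_def
    by (simp flip: of_real_power)
  \<comment> \<open>The coefficient at 0 is the positive number \<open>Z n\<close>, whereas
    \<open>fourier_trig\<close> yields 0 outside \<open>A n\<close>; hence 0 belongs to
    \<open>A n\<close>.\<close>
  then have Z0: "0 \<in> A n \<and> c n 0 = of_real (Z n)" for n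
    using Zpos[of n] fourier_trig[OF A, of n "c n" 0] by (auto split: if_splits)
  have conv: "trig (A n) (\<lambda>p. c n p * fourier f p) x = (LINT y|torus. f y * of_real (kern (x - y) ^ n))"
    if f: "integrable torus f" and f': "\<And>g. (g \<in> borel_measurable borel \<Longrightarrow> (\<And>y. norm (g y) \<le> 1) \<Longrightarrow> integrable torus (\<lambda>y. f y * g y))" for f n x
  proof -
    have "f y * of_real (kern (x - y) ^ n) = (\<Sum>p\<in>A n. c n p * wave p x * (f y * wave (- p) y))" for y
      using wave_shift[of _ x "- y"]
      by (simp add: Ac trig_def sum_distrib_left wave_neg_arg mult_ac)
    then have "(LINT y|torus. f y * of_real (kern (x - y) ^ n)) = (\<Sum>p\<in>A n. c n p * wave p x * fourier f p)"
      unfolding fourier_torus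
      by (simp add: Bochner_Integration.integral_sum f')
    then show ?thesis by (simp add: trig_def mult_ac)
  qed
  have bint: "integrable torus (\<lambda>y. f y * g y)" 
    if "f \<in> borel_measurable borel" "\<And>x. norm (f x) \<le> B" "g \<in> borel_measurable borel" "\<And>y. norm (g y) \<le> 1"
    for f g :: "real ^ 2 \<Rightarrow> complex" and B
  proof (rule integrable_torus_bounded[where B="B * 1"])
    show "norm (f x * g x) \<le> B * 1" for x
      unfolding norm_mult using that order_trans[OF norm_ge_zero that(2)] by (intro mult_mono) auto
  qed (use that in auto)
  have convZ: "(LINT y|torus. kern (x - y) ^ n) = Z n" for x n
  proof -
    have "of_real (LINT y|torus. kern (x - y) ^ n) = (LINT y|torus. (1::complex) * of_real (kern (x - y) ^ n))"
      by (subst integral_of_real[symmetric]) (auto intro!: integrable_torus_bounded[where B=1] power_le_one simp: kern_nonneg kern_le_1)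
    also have "\<dots> = trig (A n) (\<lambda>p. c n p * fourier (\<lambda>_. 1) p) x"
      by (rule conv[symmetric]) (auto intro!: integrable_torus_bounded[where B=1])
    also have "\<dots> = trig (A n) (\<lambda>p. c n p * (if p = 0 then 1 else 0)) x"
      using wave_integral by (auto simp: fourier_torus intro!: arg_cong[where f="\<lambda>c. trig (A n) c x"])
    also have "\<dots> = (\<Sum>p\<in>A n. if p = 0 then c n 0 else 0)"
      unfolding trig_def by (intro sum.cong) auto
    also have "\<dots> = of_real (Z n)" using Z0[of n] A[of n] by simp
    finally show ?thesis by (simp only: of_real_eq_iff)
  qed
  define \<gamma> where "\<gamma> n p = c n p / of_real (Z n)" for n p
  have scale: "trig (A n) (\<lambda>p. \<gamma> n p * fourier f p) x = trig (A n) (\<lambda>p. c n p * fourier f p) x / of_real (Z n)" for f n x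
    by (simp add: trig_def \<gamma>_def sum_divide_distrib)
  show thesis
  proof (rule that)
    show "finite (A n)" "0 \<in> A n" "\<gamma> n 0 = 1" for n
      using A Z0[of n] Zpos[of n] by (auto simp: \<gamma>_def)
    show "norm (\<gamma> n p) \<le> 1" if "p \<in> A n" for n p
      using cn[OF that] Zpos[of n] by (auto simp: \<gamma>_def norm_divide)
    fix f :: "real ^ 2 \<Rightarrow> complex" and x assume f: "periodic f" "continuous_on UNIV f"
    have fm [measurable]: "f \<in> borel_measurable borel" using f by (intro borel_measurable_continuous_onI)
    show bound: "norm (trig (A n) (\<lambda>p. \<gamma> n p * fourier f p) x) \<le> B" if B: "\<And>x. norm (f x) \<le> B" for n B
    proof -
      have "norm (trig (A n) (\<lambda>p. c n p * fourier f p) x) = norm (LINT y|torus. f y * of_real (kern (x - y) ^ n))"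
        by (subst conv[OF integrable_torus_bounded[OF fm B] bint[OF fm B]]) auto
      also have "\<dots> \<le> (LINT y|torus. norm (f y * of_real (kern (x - y) ^ n)))"
        by (rule integral_norm_bound)
      also have "\<dots> \<le> (LINT y|torus. B * kern (x - y) ^ n)"
      proof (rule integral_mono)
        show "norm (f y * of_real (kern (x - y) ^ n)) \<le> B * kern (x - y) ^ n" for y
          using B[of y] by (auto simp: norm_mult norm_power kern_nonneg intro!: mult_right_mono)
        have i: "integrable torus (\<lambda>y. kern (x - y) ^ n)"
          by (rule integrable_torus_bounded[where B=1])
             (auto intro!: power_le_one simp: kern_nonneg kern_le_1)
        then show "integrable torus (\<lambda>y. B * kern (x - y) ^ n)" by simp
        have "integrable torus (\<lambda>y. f y * of_real (kern (x - y) ^ n))"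
          by (rule bint[OF fm B]) (auto intro!: power_le_one simp: norm_power kern_nonneg kern_le_1)
        then show "integrable torus (\<lambda>y. norm (f y * of_real (kern (x - y) ^ n)))" by (rule integrable_norm)
      qed
      also have "\<dots> = B * Z n" by (simp add: convZ)
      finally show ?thesis unfolding scale using Zpos[of n] by (simp add: norm_divide divide_le_eq)
    qed
    obtain B where B: "B > 0" "\<And>x. norm (f x) \<le> B" using periodic_bounded[OF f] by blast
    show "(\<lambda>n. trig (A n) (\<lambda>p. \<gamma> n p * fourier f p) x) \<longlonglongrightarrow> f x"
    proof (rule LIMSEQ_I)
      fix r0 :: real assume "r0 > 0"
      define r where "r = r0 / 2"
      have r: "r > 0" using \<open>r0 > 0\<close> by (simp add: r_def)
      define S where "S = {y \<in> cbox 0 1. r \<le> norm (f y - f x)}"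
      have "closed {y. r \<le> norm (f y - f x)}"
        by (intro closed_Collect_le continuous_intros f)
      then have "compact S"
        unfolding S_def Collect_conj_eq Collect_mem_eq by (intro compact_Int_closed) auto
      \<comment> \<open>Where the kernel equals 1, \<open>y\<close> and \<open>x\<close> differ by a
        lattice vector, and then \<open>f y = f x\<close>, which is excluded on \<open>S\<close>.
        Compactness of \<open>S\<close> turns the strict inequality into a uniform gap.\<close>
      have lt: "kern (x - y) < 1" if "y \<in> S" for y
      proof (rule ccontr)
        assume "\<not> kern (x - y) < 1"
        then have "kern (x - y) = 1" using kern_le_1[of "x - y"] by linarith
        then obtain k where "x - y = ivec k" by (rule kern_eq_1)
        then have "x = y + ivec k" by (simp add: algebra_simps)
        then have "f x = f y" using f(1) by (simp add: periodic_def)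
        then show False using that r by (simp add: S_def)
      qed
      obtain \<kappa> where \<kappa>: "0 < \<kappa>" "\<kappa> < 1/2" "\<And>y. y \<in> S \<Longrightarrow> kern (x - y) \<le> 1 - 2 * \<kappa>"
      proof (cases "S = {}")
        case True
        then show thesis using that[of "1/4"] by auto
      next
        case False
        have "continuous_on S (\<lambda>y. kern (x - y))"
          by (rule continuous_on_compose2[OF continuous_kern[of UNIV]]) (auto intro: continuous_intros)
        from continuous_attains_sup[OF \<open>compact S\<close> False this] obtain y0 where
          y0: "y0 \<in> S" "\<And>y. y \<in> S \<Longrightarrow> kern (x - y) \<le> kern (x - y0)" by auto
        \<comment> \<open>A third of the gap: the kernel is then at most
          \<open>1 - 3 \<kappa>\<close> on \<open>S\<close>, and \<open>\<kappa> \<le> 1/3\<close>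
          stays below 1/2.\<close>
        define \<kappa> where "\<kappa> = (1 - kern (x - y0)) / 3"
        have "0 < \<kappa>" "\<kappa> < 1/2" using lt[OF y0(1)] kern_nonneg[of "x - y0"] by (auto simp: \<kappa>_def)
        moreover have "kern (x - y) \<le> 1 - 2 * \<kappa>" if "y \<in> S" for y
          using y0(2)[OF that] lt[OF y0(1)] by (simp add: \<kappa>_def field_simps)
        ultimately show thesis by (rule that)
      qed
      obtain m where m: "m > 0" "\<And>n. (1 - \<kappa>) ^ n * m \<le> Z n"
        unfolding Z_def by (rule kern_lower_bound[of \<kappa>]) (use \<kappa> in auto)
      \<comment> \<open>The contribution of \<open>S\<close> is of order
        \<open>(1 - 2 \<kappa>) ^ n\<close>, while the normalizing integral is at least of order
        \<open>(1 - \<kappa>) ^ n\<close>; their ratio decays.\<close>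
      define q where "q = (1 - 2 * \<kappa>) / (1 - \<kappa>)"
      have q: "0 \<le> q" "q < 1" using \<kappa> by (auto simp: q_def field_simps)
      have est: "norm (trig (A n) (\<lambda>p. \<gamma> n p * fourier f p) x - f x) \<le> r + 2 * B / m * q ^ n" for n
      proof -
        have i1: "integrable torus (\<lambda>y. f y * of_real (kern (x - y) ^ n))"
          by (rule bint[where B=B]) (auto intro!: power_le_one simp: norm_power kern_nonneg kern_le_1 B)
        have i2: "integrable torus (\<lambda>y. f x * of_real (kern (x - y) ^ n))"
          by (rule bint[where B=B]) (auto intro!: power_le_one simp: norm_power kern_nonneg kern_le_1 B)
        have i3: "integrable torus (\<lambda>y. kern (x - y) ^ n)"
          by (rule integrable_torus_bounded[where B=1]) (auto intro!: power_le_one simp: kern_nonneg kern_le_1)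
        have "trig (A n) (\<lambda>p. c n p * fourier f p) x - f x * of_real (Z n)
          = (LINT y|torus. f y * of_real (kern (x - y) ^ n)) - (LINT y|torus. f x * of_real (kern (x - y) ^ n))"
          by (subst conv[OF integrable_torus_bounded[OF fm B(2)] bint[OF fm B(2)]]) (auto simp flip: of_real_power simp: convZ)
        also have "\<dots> = (LINT y|torus. (f y - f x) * of_real (kern (x - y) ^ n))"
          by (subst Bochner_Integration.integral_diff[OF i1 i2, symmetric]) (simp add: left_diff_distrib)
        finally have eq: "trig (A n) (\<lambda>p. c n p * fourier f p) x - f x * of_real (Z n)
          = (LINT y|torus. (f y - f x) * of_real (kern (x - y) ^ n))" .
        have "norm \<dots> \<le> (LINT y|torus. norm ((f y - f x) * of_real (kern (x - y) ^ n)))"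
          by (rule integral_norm_bound)
        also have "\<dots> \<le> (LINT y|torus. r * kern (x - y) ^ n + 2 * B * (1 - 2 * \<kappa>) ^ n)"
        proof (rule integral_mono)
          show "integrable torus (\<lambda>y. norm ((f y - f x) * of_real (kern (x - y) ^ n)))"
            using Bochner_Integration.integrable_diff[OF i1 i2] by (simp only: left_diff_distrib integrable_norm)
          show "integrable torus (\<lambda>y. r * kern (x - y) ^ n + 2 * B * (1 - 2 * \<kappa>) ^ n)"
            using i3 by auto
          fix y assume "y \<in> space torus"
          then have yc: "y \<in> cbox 0 1" using cell_subset by auto
          have nn: "norm (f y - f x) \<le> 2 * B"
            using norm_triangle_ineq4[of "f y" "f x"] B(2)[of x] B(2)[of y] by linarith
          show "norm ((f y - f x) * of_real (kern (x - y) ^ n)) \<le> r * kern (x - y) ^ n + 2 * B * (1 - 2 * \<kappa>) ^ n"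
          proof (cases "y \<in> S")
            case True
            then have "norm (f y - f x) * kern (x - y) ^ n \<le> 2 * B * (1 - 2 * \<kappa>) ^ n"
              using nn \<kappa>(3)[OF True] B(1) by (intro mult_mono power_mono) (auto simp: kern_nonneg)
            moreover have "0 \<le> r * kern (x - y) ^ n" using r by (simp add: kern_nonneg)
            ultimately show ?thesis by (simp add: norm_mult norm_power kern_nonneg)
          next
            case False
            then have "norm (f y - f x) \<le> r" using yc by (simp add: S_def)
            then have "norm (f y - f x) * kern (x - y) ^ n \<le> r * kern (x - y) ^ n"
              by (intro mult_right_mono) (auto simp: kern_nonneg)
            moreover have "0 \<le> 2 * B * (1 - 2 * \<kappa>) ^ n" using B(1) \<kappa> by simp
            ultimately show ?thesis by (simp add: norm_mult norm_power kern_nonneg)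
          qed
        qed
        also have "\<dots> = r * Z n + 2 * B * (1 - 2 * \<kappa>) ^ n"
          using i3 by (subst Bochner_Integration.integral_add) (auto simp: convZ)
        finally have *: "norm (trig (A n) (\<lambda>p. c n p * fourier f p) x - f x * of_real (Z n))
           \<le> r * Z n + 2 * B * (1 - 2 * \<kappa>) ^ n" unfolding eq .
        have "trig (A n) (\<lambda>p. \<gamma> n p * fourier f p) x - f x = (trig (A n) (\<lambda>p. c n p * fourier f p) x - f x * of_real (Z n)) / of_real (Z n)"
          unfolding scale using Zpos[of n] by (simp add: field_simps)
        then have "norm (trig (A n) (\<lambda>p. \<gamma> n p * fourier f p) x - f x) \<le> (r * Z n + 2 * B * (1 - 2 * \<kappa>) ^ n) / Z n"
          using * Zpos[of n] by (simp add: norm_divide divide_right_mono)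
        also have "\<dots> = r + 2 * B * (1 - 2 * \<kappa>) ^ n / Z n"
          using Zpos[of n] by (simp add: field_simps)
        also have "2 * B * (1 - 2 * \<kappa>) ^ n / Z n \<le> 2 * B * (1 - 2 * \<kappa>) ^ n / ((1 - \<kappa>) ^ n * m)"
          using m \<kappa> B(1) by (intro divide_left_mono mult_pos_pos Zpos) auto
        also have "\<dots> = 2 * B / m * q ^ n"
          by (simp add: q_def power_divide)
        finally show ?thesis by simp
      qed
      have "(\<lambda>n. r + 2 * B / m * q ^ n) \<longlonglongrightarrow> r + 2 * B / m * 0"
        using q by (intro tendsto_intros LIMSEQ_realpow_zero) auto
      then have "eventually (\<lambda>n. r + 2 * B / m * q ^ n < r0) sequentially"
        by (rule order_tendstoD) (use \<open>r0 > 0\<close> in \<open>simp add: r_def\<close>)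
      then obtain n0 where "\<And>n. n \<ge> n0 \<Longrightarrow> r + 2 * B / m * q ^ n < r0"
        unfolding eventually_sequentially by blast
      then show "\<exists>no. \<forall>n\<ge>no. norm (trig (A n) (\<lambda>p. \<gamma> n p * fourier f p) x - f x) < r0"
        using est by (meson le_less_trans)
    qed
  qed
qed

subsection \<open>Decay of the Fourier coefficients of a smooth function\<close>

lemma fourier_iter_deriv:
  fixes V :: "real ^ 2 \<Rightarrow> real"
  assumes V: "smooth V" "periodic V"
  shows "fourier (\<lambda>x. of_real (iter_deriv (replicate m (axis i 1)) V x)) p
      = (2 * \<i> * pi * (p $ i)) ^ m * fourier (\<lambda>x. of_real (V x)) p"
    and "periodic (iter_deriv (replicate m (axis i 1)) V)"
proof (induction m)
  case (Suc m)
  let ?bs = "replicate m (axis i 1) :: (real ^ 2) list"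
  have s: "set ?bs \<subseteq> Basis" "set (axis i 1 # ?bs) \<subseteq> (Basis :: (real^2) set)"
    by (auto simp: axis_in_Basis_iff)
  have C: "Ck (Suc (Suc m)) V" using V(1) by (simp add: smooth_def)
  have d: "iter_deriv ?bs V differentiable (at x)" for x
    using C s(1) unfolding Ck_def by simp
  have c: "continuous_on UNIV (iter_deriv (axis i 1 # ?bs) V)"
    using C s(2) unfolding Ck_def by (metis length_Cons length_replicate le_SucI order_refl)
  have "fourier (\<lambda>x. of_real (iter_deriv (replicate (Suc m) (axis i 1)) V x)) p =
      2 * \<i> * pi * (p $ i) * fourier (\<lambda>x. of_real (iter_deriv ?bs V x)) p"
    "periodic (iter_deriv (replicate (Suc m) (axis i 1)) V)"
    using fourier_derivative[OF Suc.IH(2) d c[unfolded iter_deriv.simps]] by simp_all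
  then show "fourier (\<lambda>x. of_real (iter_deriv (replicate (Suc m) (axis i 1)) V x)) p
      = (2 * \<i> * pi * (p $ i)) ^ (Suc m) * fourier (\<lambda>x. of_real (V x)) p"
    "periodic (iter_deriv (replicate (Suc m) (axis i 1)) V)"
    using Suc.IH(1) by (simp_all add: mult_ac)
qed (use V in auto)

lemma fourier_bounded_le:
  assumes "f \<in> borel_measurable borel" "\<And>x. norm (f x) \<le> B"
  shows "norm (fourier f p) \<le> B"
proof -
  have [measurable]: "f \<in> borel_measurable borel" by fact
  have "norm (fourier f p) \<le> (LINT x|torus. norm (f x * wave (- p) x))"
    unfolding fourier_torus by (rule integral_norm_bound)
  also have "\<dots> \<le> (LINT x|torus. B)"
    by (rule integral_mono)
       (use assms in \<open>auto simp: norm_mult intro!: integrable_torus_bounded[where B=B]\<close>)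
  finally show ?thesis by simp
qed

lemma fourier_decay_axis:
  fixes V :: "real ^ 2 \<Rightarrow> real"
  assumes V: "smooth V" "periodic V"
  obtains M where "M > 0" "\<And>p. \<bar>p $ i\<bar> ^ m * norm (fourier (\<lambda>x. of_real (V x)) p) \<le> M"
proof -
  let ?W = "iter_deriv (replicate m (axis i 1)) V"
  have s: "set (replicate m (axis i 1)) \<subseteq> (Basis :: (real^2) set)"
    by (auto simp: axis_in_Basis_iff)
  have c: "continuous_on UNIV ?W"
    using V(1) s unfolding smooth_def Ck_def by (metis length_replicate order_refl)
  obtain M where M: "M > 0" "\<And>x. norm (?W x) \<le> M"
    using periodic_bounded[OF fourier_iter_deriv(2)[OF V] c] by blast
  have [measurable]: "?W \<in> borel_measurable borel" using c by (rule borel_measurable_continuous_onI)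
  show thesis
  proof (rule that[OF M(1)])
    fix p :: "int ^ 2"
    have "norm (fourier (\<lambda>x. of_real (?W x)) p) \<le> M"
      by (rule fourier_bounded_le) (use M in auto)
    then have "(2 * pi) ^ m * (\<bar>p $ i\<bar> ^ m * norm (fourier (\<lambda>x. of_real (V x)) p)) \<le> M"
      unfolding fourier_iter_deriv(1)[OF V]
      by (simp add: norm_mult norm_power power_mult_distrib mult.assoc)
    moreover have "1 * (\<bar>p $ i\<bar> ^ m * norm (fourier (\<lambda>x. of_real (V x)) p)) \<le>
       (2 * pi) ^ m * (\<bar>p $ i\<bar> ^ m * norm (fourier (\<lambda>x. of_real (V x)) p))"
      using pi_gt3 by (intro mult_right_mono one_le_power) auto
    ultimately show "\<bar>p $ i\<bar> ^ m * norm (fourier (\<lambda>x. of_real (V x)) p) \<le> M" by linarith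
  qed
qed

text \<open>The absolute value folds the integers onto the naturals, and it is injective on the
  nonnegative and on the negative integers, so two copies of the sum of inverse squares suffice. The
  added 1 gives strict positivity.\<close>

lemma sum_int_inverse_squares_bounded:
  obtains T :: real where "T > 0" "\<And>G. finite G \<Longrightarrow> (\<Sum>n\<in>G. 1 / (1 + \<bar>real_of_int n\<bar>)\<^sup>2) \<le> T"
proof -
  define g :: "nat \<Rightarrow> real" where "g k = 1 / (1 + real k)\<^sup>2" for k
  have sg: "summable g"
    using inverse_squares_sums unfolding g_def[abs_def] sums_iff by (simp add: add.commute)
  have g0: "0 \<le> g k" for k by (simp add: g_def)
  have bd: "(\<Sum>n\<in>G. g (nat \<bar>n\<bar>)) \<le> suminf g" if "finite G" "inj_on (\<lambda>n. nat \<bar>n\<bar>) G" for G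
  proof -
    have "(\<Sum>n\<in>G. g (nat \<bar>n\<bar>)) = sum g ((\<lambda>n. nat \<bar>n\<bar>) ` G)"
      using that by (simp add: sum.reindex)
    also have "\<dots> \<le> suminf g" using that by (intro sum_le_suminf sg) (auto simp: g0)
    finally show ?thesis .
  qed
  show thesis
  proof (rule that[of "2 * suminf g + 1"])
    show "0 < 2 * suminf g + 1" using suminf_nonneg[OF sg g0] by simp
    fix G :: "int set" assume "finite G"
    have "(\<Sum>n\<in>G. 1 / (1 + \<bar>real_of_int n\<bar>)\<^sup>2) = (\<Sum>n\<in>G. g (nat \<bar>n\<bar>))"
      by (intro sum.cong) (auto simp: g_def)
    also have "\<dots> = (\<Sum>n\<in>{n\<in>G. 0 \<le> n} \<union> {n\<in>G. n < 0}. g (nat \<bar>n\<bar>))"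
      by (rule sum.cong) auto
    also have "\<dots> = (\<Sum>n\<in>{n\<in>G. 0 \<le> n}. g (nat \<bar>n\<bar>)) + (\<Sum>n\<in>{n\<in>G. n < 0}. g (nat \<bar>n\<bar>))"
      using \<open>finite G\<close> by (intro sum.union_disjoint) auto
    also have "\<dots> \<le> suminf g + suminf g"
      using \<open>finite G\<close> by (intro add_mono bd) (auto simp: inj_on_def)
    finally show "(\<Sum>n\<in>G. 1 / (1 + \<bar>real_of_int n\<bar>)\<^sup>2) \<le> 2 * suminf g + 1" by simp
  qed
qed

lemma norm_ivec_le: "norm (ivec p) \<le> \<bar>real_of_int (p $ 1)\<bar> + \<bar>real_of_int (p $ 2)\<bar>"
  using norm_le_l1_cart[of "ivec p"] by (simp add: sum_2)

text \<open>Five derivatives are used: with \<open>N\<close> the larger coordinate in modulus, the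
  weight \<open>1 + norm (ivec p)\<close> costs one power of \<open>1 + N\<close>, and the two
  inverse squares that make the double sum converge cost four. The constant 64 is
  \<open>2 * 2 ^ 5\<close>, from \<open>(1 + N) ^ 5 \<le> 32 * (1 + N ^ 5)\<close> and
  \<open>1 + norm (ivec p) \<le> 2 * (1 + N)\<close>.\<close>

lemma fourier_coefficients_summable:
  fixes V :: "real ^ 2 \<Rightarrow> real"
  assumes V: "smooth V" "periodic V"
  obtains S where "S > 0"
    "\<And>F. finite F \<Longrightarrow> (\<Sum>p\<in>F. (1 + norm (ivec p)) * norm (fourier (\<lambda>x. of_real (V x)) p)) \<le> S"
proof -
  let ?v = "\<lambda>p. norm (fourier (\<lambda>x. complex_of_real (V x)) p)"
  obtain M0 where M0: "M0 > 0" "\<And>p::int^2. \<bar>p $ 1\<bar> ^ 0 * ?v p \<le> M0" using fourier_decay_axis[OF V] by blast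
  obtain M1 where M1: "M1 > 0" "\<And>p::int^2. \<bar>p $ 1\<bar> ^ 5 * ?v p \<le> M1" using fourier_decay_axis[OF V] by blast
  obtain M2 where M2: "M2 > 0" "\<And>p::int^2. \<bar>p $ 2\<bar> ^ 5 * ?v p \<le> M2" using fourier_decay_axis[OF V] by blast
  define M where "M = M0 + M1 + M2"
  obtain T where T: "T > 0" "\<And>G. finite G \<Longrightarrow> (\<Sum>n\<in>G. 1 / (1 + \<bar>real_of_int n\<bar>)\<^sup>2) \<le> T"
    using sum_int_inverse_squares_bounded by blast
  let ?g = "\<lambda>n::int. 1 / (1 + \<bar>real_of_int n\<bar>)\<^sup>2"
  have pt: "(1 + norm (ivec p)) * ?v p \<le> 64 * M * (?g (p $ 1) * ?g (p $ 2))" for p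
  proof -
    define a b where "a = \<bar>real_of_int (p $ 1)\<bar>" and "b = \<bar>real_of_int (p $ 2)\<bar>"
    define N where "N = max a b"
    have ab: "0 \<le> a" "0 \<le> b" "a \<le> N" "b \<le> N" by (auto simp: a_def b_def N_def)
    have NM: "N ^ 5 * ?v p \<le> M1 + M2"
    proof (cases "a \<le> b")
      case True
      then show ?thesis using M2(2)[of p] M1(1) by (simp add: N_def b_def max_def)
    next
      case False
      then show ?thesis using M1(2)[of p] M2(1) by (simp add: N_def a_def max_def)
    qed
    have "(1 + N) ^ 5 \<le> 32 * (1 + N ^ 5)"
    proof (cases "N \<le> 1")
      case True
      then have "(1 + N) ^ 5 \<le> 2 ^ 5" using ab by (intro power_mono) auto
      also have "\<dots> \<le> 32 * (1 + N ^ 5)" using ab by simp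
      finally show ?thesis .
    next
      case False
      then have "(1 + N) ^ 5 \<le> (2 * N) ^ 5" using ab by (intro power_mono) auto
      also have "\<dots> \<le> 32 * (1 + N ^ 5)" by (simp add: power_mult_distrib)
      finally show ?thesis .
    qed
    then have "(1 + N) ^ 5 * ?v p \<le> 32 * (1 + N ^ 5) * ?v p"
      by (intro mult_right_mono) auto
    also have "\<dots> = 32 * (?v p + N ^ 5 * ?v p)" by (simp add: algebra_simps)
    also have "\<dots> \<le> 32 * M" using NM M0(2)[of p] by (simp add: M_def)
    finally have *: "2 * (1 + N) ^ 5 * ?v p \<le> 64 * M" by linarith
    have "(1 + norm (ivec p)) * ((1 + a)\<^sup>2 * (1 + b)\<^sup>2) \<le> (2 * (1 + N)) * ((1 + N)\<^sup>2 * (1 + N)\<^sup>2)"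
      using norm_ivec_le[of p] ab by (intro mult_mono power_mono) (auto simp: a_def b_def)
    also have "\<dots> = 2 * (1 + N) ^ 5" by (simp add: eval_nat_numeral)
    finally have "(1 + norm (ivec p)) * ((1 + a)\<^sup>2 * (1 + b)\<^sup>2) * ?v p \<le> 2 * (1 + N) ^ 5 * ?v p"
      by (intro mult_right_mono) auto
    also note *
    finally have "(1 + norm (ivec p)) * ?v p * ((1 + a)\<^sup>2 * (1 + b)\<^sup>2) \<le> 64 * M" by (simp add: mult_ac)
    then have "(1 + norm (ivec p)) * ?v p \<le> 64 * M / ((1 + a)\<^sup>2 * (1 + b)\<^sup>2)"
      using ab by (subst pos_le_divide_eq) (auto intro!: mult_pos_pos)
    then show ?thesis by (simp add: a_def b_def)
  qed
  have Mpos: "M > 0" using M0 M1 M2 by (simp add: M_def)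
  show thesis
  proof (rule that[of "64 * M * (T * T)"])
    show "0 < 64 * M * (T * T)" using Mpos T by simp
    fix F :: "(int ^ 2) set" assume F: "finite F"
    \<comment> \<open>The sum over \<open>F\<close> is enlarged to the rectangle spanned by its two
      projections, where it factors.\<close>
    let ?A = "(\<lambda>p. p $ 1) ` F" and ?B = "(\<lambda>p. p $ 2) ` F"
    have "(\<Sum>p\<in>F. (1 + norm (ivec p)) * ?v p) \<le> (\<Sum>p\<in>F. 64 * M * (?g (p $ 1) * ?g (p $ 2)))"
      by (intro sum_mono pt)
    also have "\<dots> = 64 * M * (\<Sum>p\<in>F. (?g (p $ 1) * ?g (p $ 2)))"
      by (simp add: sum_distrib_left)
    also have "(\<Sum>p\<in>F. (?g (p $ 1) * ?g (p $ 2))) = (\<Sum>(x, y)\<in>(\<lambda>p. (p $ 1, p $ 2)) ` F. ?g x * ?g y)"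
      by (subst sum.reindex) (auto simp: inj_on_def vec_eq_iff forall_2)
    also have "\<dots> \<le> (\<Sum>(x, y)\<in>?A \<times> ?B. ?g x * ?g y)"
      using F by (intro sum_mono2) auto
    also have "\<dots> = (\<Sum>x\<in>?A. ?g x) * (\<Sum>y\<in>?B. ?g y)"
      by (simp add: sum_product sum.cartesian_product)
    also have "\<dots> \<le> T * T"
      using F T by (intro mult_mono T) (auto intro!: sum_nonneg)
    finally show "(\<Sum>p\<in>F. (1 + norm (ivec p)) * ?v p) \<le> 64 * M * (T * T)" using Mpos by simp
  qed
qed

subsection \<open>Square-summable sequences\<close>

text \<open>The bound \<open>B\<close> on the l2 norm of \<open>c\<close>, expressed by finite
  partial sums so that no summability has to be carried along.\<close>

definition ell2_le :: "('a \<Rightarrow> complex) \<Rightarrow> real \<Rightarrow> bool" where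
  "ell2_le c B \<longleftrightarrow> (\<forall>F. finite F \<longrightarrow> L2_set (\<lambda>j. norm (c j)) F \<le> B)"

lemma ell2_leD: "ell2_le c B \<Longrightarrow> finite F \<Longrightarrow> L2_set (\<lambda>j. norm (c j)) F \<le> B"
  by (simp add: ell2_le_def)

lemma ell2_le_nonneg: "ell2_le c B \<Longrightarrow> 0 \<le> B"
  using ell2_leD[of c B "{}"] by simp

lemma ell2_le_mono: "ell2_le c B \<Longrightarrow> B \<le> B' \<Longrightarrow> ell2_le c B'"
  by (force simp: ell2_le_def)

lemma ell2_le_iff_sum:
  assumes "0 \<le> B"
  shows "ell2_le c B \<longleftrightarrow> (\<forall>F. finite F \<longrightarrow> (\<Sum>j\<in>F. (norm (c j))\<^sup>2) \<le> B\<^sup>2)"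
  unfolding ell2_le_def L2_set_def using assms
  by (auto simp: real_sqrt_le_iff' intro!: real_le_lsqrt sum_nonneg dest!: sqrt_le_D)

lemma ell2_le_norm_mono:
  "ell2_le c B \<Longrightarrow> (\<And>j. norm (d j) \<le> norm (c j)) \<Longrightarrow> ell2_le d B"
  unfolding ell2_le_def by (meson L2_set_mono norm_ge_zero order_trans)

lemma ell2_le_add:
  assumes "ell2_le c A" "ell2_le d B"
  shows "ell2_le (\<lambda>j. c j + d j) (A + B)"
  unfolding ell2_le_def
proof (intro allI impI)
  fix F :: "'a set" assume F: "finite F"
  have "L2_set (\<lambda>j. norm (c j + d j)) F \<le> L2_set (\<lambda>j. norm (c j) + norm (d j)) F"
    by (intro L2_set_mono norm_triangle_ineq norm_ge_zero)
  also have "\<dots> \<le> L2_set (\<lambda>j. norm (c j)) F + L2_set (\<lambda>j. norm (d j)) F"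
    by (rule L2_set_triangle_ineq)
  also have "\<dots> \<le> A + B" using assms F by (intro add_mono ell2_leD)
  finally show "L2_set (\<lambda>j. norm (c j + d j)) F \<le> A + B" .
qed

lemma ell2_le_cmult:
  assumes "ell2_le c B" shows "ell2_le (\<lambda>j. a * c j) (norm a * B)"
  unfolding ell2_le_def
proof (intro allI impI)
  fix F :: "'a set" assume F: "finite F"
  have "L2_set (\<lambda>j. norm (a * c j)) F = norm a * L2_set (\<lambda>j. norm (c j)) F"
    by (simp add: norm_mult L2_set_right_distrib)
  then show "L2_set (\<lambda>j. norm (a * c j)) F \<le> norm a * B"
    using ell2_leD[OF assms F] by (simp add: mult_left_mono)
qed

lemma ell2_le_reindex:
  assumes "ell2_le c B" "finite F" "inj_on f F"
  shows "L2_set (\<lambda>j. norm (c (f j))) F \<le> B"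
proof -
  have "L2_set (\<lambda>j. norm (c (f j))) F = L2_set (\<lambda>j. norm (c j)) (f ` F)"
    using assms(3) by (simp add: L2_set_def sum.reindex)
  then show ?thesis using ell2_leD[OF assms(1)] assms(2) by simp
qed

lemma ell2_le_product:
  assumes "ell2_le c A" "ell2_le d B" "finite F" "inj_on f F" "inj_on g F"
  shows "(\<Sum>q\<in>F. norm (c (f q)) * norm (d (g q))) \<le> A * B"
proof -
  have "(\<Sum>q\<in>F. norm (c (f q)) * norm (d (g q))) \<le>
      L2_set (\<lambda>q. norm (c (f q))) F * L2_set (\<lambda>q. norm (d (g q))) F"
    using L2_set_mult_ineq[of "\<lambda>q. norm (c (f q))" "\<lambda>q. norm (d (g q))" F] by simp
  also have "\<dots> \<le> A * B"
    using ell2_le_reindex[OF assms(1,3,4)] ell2_le_reindex[OF assms(2,3,5)] ell2_le_nonneg[OF assms(1)]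
    by (intro mult_mono) (auto simp: L2_set_nonneg)
  finally show ?thesis .
qed

lemma ell2_le_fourier: "f \<in> L2_torus \<Longrightarrow> ell2_le (fourier f) (L2_nrm f)"
  by (subst ell2_le_iff_sum) (auto simp: L2_nrm_nonneg intro: bessel)

subsection \<open>Multiplication by the potential\<close>

text \<open>The Fejer approximants of a smooth potential converge boundedly, with weighted absolute
  coefficient sums bounded by \<open>S\<close>.\<close>

definition tame_potential :: "(real ^ 2 \<Rightarrow> real) \<Rightarrow> real \<Rightarrow> bool" where
  "tame_potential V S \<longleftrightarrow> 0 < S \<and> V \<in> borel_measurable borel \<and> (\<exists>B. \<forall>x. \<bar>V x\<bar> \<le> B) \<and>
     (\<exists>A u. (\<forall>n::nat. finite (A n)) \<and>
       (\<forall>n. (\<Sum>p\<in>A n. (1 + norm (ivec p)) * norm (u n p :: complex)) \<le> S) \<and>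
       (\<forall>F. integrable torus F \<longrightarrow>
          (\<lambda>n. \<Sum>p\<in>A n. u n p * (LINT x|torus. wave p x * F x)) \<longlonglongrightarrow> (LINT x|torus. of_real (V x) * F x)))"

lemma tame_potentialE:
  assumes "tame_potential V S"
  obtains A u where "\<And>n::nat. finite (A n)"
    and "\<And>n. (\<Sum>p\<in>A n. (1 + norm (ivec p)) * norm (u n p :: complex)) \<le> S"
    and "\<And>F. integrable torus F \<Longrightarrow>
          (\<lambda>n. \<Sum>p\<in>A n. u n p * (LINT x|torus. wave p x * F x)) \<longlonglongrightarrow> (LINT x|torus. of_real (V x) * F x)"
proof -
  obtain A u where *: "\<forall>n::nat. finite (A n)"
    "\<forall>n. (\<Sum>p\<in>A n. (1 + norm (ivec p)) * norm (u n p :: complex)) \<le> S"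
    "\<forall>F. integrable torus F \<longrightarrow>
          (\<lambda>n. \<Sum>p\<in>A n. u n p * (LINT x|torus. wave p x * F x)) \<longlonglongrightarrow> (LINT x|torus. of_real (V x) * F x)"
    using assms unfolding tame_potential_def by (elim conjE exE)
  show thesis by (rule that[of A u, OF *[rule_format]])
qed

lemma smooth_continuous: "smooth f \<Longrightarrow> continuous_on UNIV f"
proof -
  assume "smooth f"
  then have "Ck 0 f" by (simp add: smooth_def)
  then show ?thesis unfolding Ck_def by (metis empty_subsetI iter_deriv.simps(1) le0 list.set(1) list.size(3))
qed

text \<open>The multipliers have modulus at most 1, so the weighted coefficient sums of the
  approximants stay below those of \<open>V\<close>; the uniform bound on the approximants gives
  dominated convergence against every integrable function. In this way no sum of the Fourier series
  of \<open>V\<close> itself is needed.\<close>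

lemma smooth_imp_tame:
  fixes V :: "real ^ 2 \<Rightarrow> real"
  assumes V: "smooth V" "periodic V"
  obtains S where "tame_potential V S"
proof -
  let ?V = "\<lambda>x. complex_of_real (V x)"
  obtain S where S: "S > 0" "\<And>F. finite F \<Longrightarrow> (\<Sum>p\<in>F. (1 + norm (ivec p)) * norm (fourier ?V p)) \<le> S"
    using fourier_coefficients_summable[OF V] by blast
  have cV: "continuous_on UNIV V" by (rule smooth_continuous[OF V(1)])
  have pV: "periodic ?V" "continuous_on UNIV ?V"
    using V(2) by (auto simp: periodic_def intro!: continuous_intros cV)
  obtain B where B: "B > 0" "\<And>x. norm (V x) \<le> B" using periodic_bounded[OF V(2) cV] by blast
  obtain A \<gamma> where A: "\<And>n::nat. finite (A n)" and g: "\<And>n p. p \<in> A n \<Longrightarrow> norm (\<gamma> n p) \<le> 1"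
    and bd: "\<And>n x f B. periodic f \<Longrightarrow> continuous_on UNIV f \<Longrightarrow> (\<And>x. norm (f x) \<le> B) \<Longrightarrow>
        norm (trig (A n) (\<lambda>p. \<gamma> n p * fourier f p) x) \<le> B"
    and lim: "\<And>x f. periodic f \<Longrightarrow> continuous_on UNIV f \<Longrightarrow>
        (\<lambda>n. trig (A n) (\<lambda>p. \<gamma> n p * fourier f p) x) \<longlonglongrightarrow> f x"
    by (rule fejer_approximation) blast
  define u where "u n p = \<gamma> n p * fourier ?V p" for n p
  have "(\<lambda>n. \<Sum>p\<in>A n. u n p * (LINT x|torus. wave p x * F x)) \<longlonglongrightarrow> (LINT x|torus. ?V x * F x)"
    if F: "integrable torus F" for F
  proof -
    have Fm [measurable]: "F \<in> borel_measurable torus" using F by auto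
    have Vm [measurable]: "V \<in> borel_measurable torus"
      using cV by (intro measurable_torus borel_measurable_continuous_onI)
    have [measurable]: "wave p \<in> borel_measurable torus" "trig C c \<in> borel_measurable torus" for p C c
      by (auto intro: measurable_torus)
    have iw: "integrable torus (\<lambda>x. wave p x * F x)" for p
      by (rule Bochner_Integration.integrable_bound[OF F]) (auto simp: norm_mult)
    have "(\<Sum>p\<in>A n. u n p * (LINT x|torus. wave p x * F x)) = (LINT x|torus. trig (A n) (u n) x * F x)" for n
    proof -
      have "(LINT x|torus. trig (A n) (u n) x * F x) = (LINT x|torus. (\<Sum>p\<in>A n. u n p * (wave p x * F x)))"
        by (simp add: trig_def sum_distrib_right mult.assoc)
      also have "\<dots> = (\<Sum>p\<in>A n. u n p * (LINT x|torus. wave p x * F x))"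
        using iw by (subst Bochner_Integration.integral_sum) auto
      finally show ?thesis by simp
    qed
    moreover have "(\<lambda>n. LINT x|torus. trig (A n) (u n) x * F x) \<longlonglongrightarrow> (LINT x|torus. ?V x * F x)"
    proof (rule integral_dominated_convergence[where w="\<lambda>x. B * norm (F x)"])
      show "AE x in torus. (\<lambda>n. trig (A n) (u n) x * F x) \<longlonglongrightarrow> ?V x * F x"
        unfolding u_def by (intro AE_I2 tendsto_intros lim pV)
      show "AE x in torus. norm (trig (A n) (u n) x * F x) \<le> B * norm (F x)" for n
        unfolding u_def norm_mult by (intro AE_I2 mult_right_mono bd pV) (use B in auto)
      show "integrable torus (\<lambda>x. B * norm (F x))" using F by auto
    qed measurable
    ultimately show ?thesis by simp
  qed
  moreover have "(\<Sum>p\<in>A n. (1 + norm (ivec p)) * norm (u n p)) \<le> S" for n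
  proof -
    have "(\<Sum>p\<in>A n. (1 + norm (ivec p)) * norm (u n p)) \<le> (\<Sum>p\<in>A n. (1 + norm (ivec p)) * norm (fourier ?V p))"
      unfolding u_def norm_mult by (intro sum_mono mult_left_mono mult_left_le_one_le g) auto
    also have "\<dots> \<le> S" by (intro S A)
    finally show ?thesis .
  qed
  ultimately have "tame_potential V S"
    unfolding tame_potential_def using S(1) A B(2) cV
    by (auto intro!: exI[of _ A] exI[of _ u] borel_measurable_continuous_onI)
  then show thesis by (rule that)
qed

lemma fourier_wave_shift: "(LINT x|torus. wave p x * (f x * wave (- q) x)) = fourier f (q - p)"
proof -
  have "wave p x * (f x * wave (- q) x) = f x * wave (- (q - p)) x" for x
    using wave_add[of p "- q" x] by simp
  then show ?thesis unfolding fourier_torus by (rule Bochner_Integration.integral_cong[OF refl])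
qed

lemma potential_cnj:
  "cnj (fourier (\<lambda>x. of_real (V x) * f x) q) = (LINT x|torus. of_real (V x) * (cnj (f x) * wave q x))"
  unfolding fourier_torus
  by (rule trans[OF Bochner_Integration.integral_cnj[symmetric] Bochner_Integration.integral_cong]) (simp_all add: cnj_wave mult_ac)

text \<open>Multiplication by \<open>V\<close> is bounded on l2 by \<open>S\<close>: each harmonic
  merely shifts the coefficient sequence, which keeps its l2 bound, and the harmonics are absolutely
  summable. The estimate is made for the approximants and passes to the limit.\<close>

lemma potential_pairing_bound:
  assumes V: "tame_potential V S" and f: "f \<in> L2_torus" and B: "ell2_le (fourier f) B" and F: "finite F"
  shows "norm (\<Sum>j\<in>F. y j * fourier (\<lambda>x. of_real (V x) * f x) j) \<le> L2_set (\<lambda>j. norm (y j)) F * B * S"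
proof -
  let ?L = "L2_set (\<lambda>j. norm (y j)) F"
  obtain A u where A: "\<And>n::nat. finite (A n)"
    and u: "\<And>n. (\<Sum>p\<in>A n. (1 + norm (ivec p)) * norm (u n p :: complex)) \<le> S"
    and lim: "\<And>F. integrable torus F \<Longrightarrow>
          (\<lambda>n. \<Sum>p\<in>A n. u n p * (LINT x|torus. wave p x * F x)) \<longlonglongrightarrow> (LINT x|torus. of_real (V x) * F x)"
    by (rule tame_potentialE[OF V]) blast
  have i: "integrable torus (\<lambda>x. f x * wave (- j) x)" for j
    by (rule L2_integrable_mult(2)[OF f, where B=1]) auto
  have "(\<lambda>n. \<Sum>p\<in>A n. u n p * fourier f (j - p)) \<longlonglongrightarrow> fourier (\<lambda>x. of_real (V x) * f x) j" for j
    using lim[OF i[of j]] unfolding fourier_wave_shift by (simp add: fourier_torus mult.assoc)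
  then have l: "(\<lambda>n. \<Sum>j\<in>F. y j * (\<Sum>p\<in>A n. u n p * fourier f (j - p))) \<longlonglongrightarrow>
     (\<Sum>j\<in>F. y j * fourier (\<lambda>x. of_real (V x) * f x) j)"
    by (intro tendsto_intros)
  have bd: "norm (\<Sum>j\<in>F. y j * (\<Sum>p\<in>A n. u n p * fourier f (j - p))) \<le> ?L * B * S" for n
  proof -
    have "(\<Sum>j\<in>F. y j * (\<Sum>p\<in>A n. u n p * fourier f (j - p)))
        = (\<Sum>p\<in>A n. u n p * (\<Sum>j\<in>F. y j * fourier f (j - p)))"
      unfolding sum_distrib_left by (subst sum.swap) (simp add: mult_ac)
    also have "norm \<dots> \<le> (\<Sum>p\<in>A n. norm (u n p) * (?L * B))"
    proof (rule sum_norm_le)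
      fix p
      have "norm (\<Sum>j\<in>F. y j * fourier f (j - p)) \<le> (\<Sum>j\<in>F. norm (y j) * norm (fourier f (j - p)))"
        by (rule sum_norm_le) (simp add: norm_mult)
      also have "\<dots> \<le> ?L * L2_set (\<lambda>j. norm (fourier f (j - p))) F"
        using L2_set_mult_ineq[of "\<lambda>j. norm (y j)" "\<lambda>j. norm (fourier f (j - p))" F] by simp
      also have "\<dots> \<le> ?L * B"
        by (intro mult_left_mono ell2_le_reindex[OF B F] L2_set_nonneg) (auto simp: inj_on_def)
      finally show "norm (u n p * (\<Sum>j\<in>F. y j * fourier f (j - p))) \<le> norm (u n p) * (?L * B)"
        by (simp add: norm_mult mult_left_mono)
    qed
    also have "\<dots> = (\<Sum>p\<in>A n. norm (u n p)) * (?L * B)" by (simp add: sum_distrib_right)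
    also have "\<dots> \<le> S * (?L * B)"
    proof (rule mult_right_mono)
      have "(\<Sum>p\<in>A n. norm (u n p)) \<le> (\<Sum>p\<in>A n. (1 + norm (ivec p)) * norm (u n p))"
        by (intro sum_mono) (simp add: distrib_right)
      then show "(\<Sum>p\<in>A n. norm (u n p)) \<le> S" using u[of n] by linarith
    qed (use ell2_le_nonneg[OF B] in \<open>simp add: L2_set_nonneg\<close>)
    finally show ?thesis by (simp add: mult_ac)
  qed
  show ?thesis
    by (rule tendsto_upperbound[OF tendsto_norm[OF l]]) (use bd in auto)
qed

text \<open>For a single harmonic of index \<open>p\<close>, moving the summation index by
  \<open>p\<close> in one of the two terms leaves the increment \<open>g q - g (q - p)\<close>, of
  size at most \<open>K * norm (ivec p)\<close>. The factor \<open>norm (ivec p)\<close> is absorbed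
  by the weight in the coefficient sums.\<close>

lemma commutator_bound:
  assumes V: "tame_potential V S" and f: "f \<in> L2_torus" and B: "ell2_le (fourier f) B"
    and Q: "finite Q" "\<And>q. q \<notin> Q \<Longrightarrow> g q = 0"
    and K: "0 \<le> K" "\<And>q p. norm (g q - g (q - p)) \<le> K * norm (ivec p)"
  defines "d \<equiv> fourier (\<lambda>x. of_real (V x) * f x)"
  shows "norm (\<Sum>q\<in>Q. g q * (cnj (fourier f q) * d (q + k) - cnj (d q) * fourier f (q + k))) \<le> K * S * B\<^sup>2"
proof -
  let ?c = "fourier f"
  obtain A u where A: "\<And>n::nat. finite (A n)"
    and u: "\<And>n. (\<Sum>p\<in>A n. (1 + norm (ivec p)) * norm (u n p :: complex)) \<le> S"
    and lim: "\<And>F. integrable torus F \<Longrightarrow>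
          (\<lambda>n. \<Sum>p\<in>A n. u n p * (LINT x|torus. wave p x * F x)) \<longlonglongrightarrow> (LINT x|torus. of_real (V x) * F x)"
    by (rule tame_potentialE[OF V]) blast
  have i: "integrable torus (\<lambda>x. f x * wave (- j) x)" "integrable torus (\<lambda>x. cnj (f x) * wave j x)" for j
    by (rule L2_integrable_mult[OF f, where B=1]; simp)+
  have l1: "(\<lambda>n. \<Sum>p\<in>A n. u n p * ?c (j - p)) \<longlonglongrightarrow> d j" for j
    using lim[OF i(1)[of j]] unfolding fourier_wave_shift d_def by (simp add: fourier_torus mult.assoc)
  have "(LINT x|torus. wave p x * (cnj (f x) * wave j x)) = cnj (?c (j + p))" for p j
    unfolding fourier_torus
    by (rule trans[OF Bochner_Integration.integral_cong Bochner_Integration.integral_cnj]) (simp_all add: cnj_wave wave_add[symmetric] mult_ac add.commute)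
  \<comment> \<open>Since \<open>V\<close> is real, \<open>cnj (d j)\<close> is the integral of
    \<open>V\<close> against a conjugated function, and it is approximated with the same
    coefficients \<open>u n p\<close> as \<open>d j\<close>. This is what makes the two terms
    comparable harmonic by harmonic.\<close>
  then have l2: "(\<lambda>n. \<Sum>p\<in>A n. u n p * cnj (?c (j + p))) \<longlonglongrightarrow> cnj (d j)" for j
    using lim[OF i(2)[of j]] unfolding d_def potential_cnj by simp
  define R where "R p = (\<Sum>q\<in>Q. g q * (cnj (?c q) * ?c (q + k - p) - cnj (?c (q + p)) * ?c (q + k)))" for p
  have "(\<lambda>n. \<Sum>q\<in>Q. g q * (cnj (?c q) * (\<Sum>p\<in>A n. u n p * ?c (q + k - p)) - (\<Sum>p\<in>A n. u n p * cnj (?c (q + p))) * ?c (q + k)))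
     \<longlonglongrightarrow> (\<Sum>q\<in>Q. g q * (cnj (?c q) * d (q + k) - cnj (d q) * ?c (q + k)))"
    by (intro tendsto_intros l1 l2)
  moreover have "(\<Sum>q\<in>Q. g q * (cnj (?c q) * (\<Sum>p\<in>A n. u n p * ?c (q + k - p)) - (\<Sum>p\<in>A n. u n p * cnj (?c (q + p))) * ?c (q + k)))
     = (\<Sum>p\<in>A n. u n p * R p)" for n
    unfolding R_def sum_distrib_left sum_distrib_right sum_subtractf[symmetric]
    by (subst sum.swap) (simp add: algebra_simps)
  ultimately have l: "(\<lambda>n. \<Sum>p\<in>A n. u n p * R p) \<longlonglongrightarrow> (\<Sum>q\<in>Q. g q * (cnj (?c q) * d (q + k) - cnj (d q) * ?c (q + k)))"
    by simp
  have R: "norm (R p) \<le> K * norm (ivec p) * B\<^sup>2" for p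
  proof -
    \<comment> \<open>Large enough to contain the supports of both \<open>g q\<close> and
      \<open>g (q - p)\<close>.\<close>
    define Q' where "Q' = Q \<union> (\<lambda>q. q + p) ` Q"
    have Q': "finite Q'" using Q by (simp add: Q'_def)
    have "R p = (\<Sum>q\<in>Q. g q * (cnj (?c q) * ?c (q + k - p))) - (\<Sum>q\<in>Q. g q * (cnj (?c (q + p)) * ?c (q + k)))"
      by (simp add: R_def right_diff_distrib sum_subtractf)
    also have "(\<Sum>q\<in>Q. g q * (cnj (?c q) * ?c (q + k - p))) = (\<Sum>q\<in>Q'. g q * (cnj (?c q) * ?c (q + k - p)))"
      using Q Q' by (intro sum.mono_neutral_left) (auto simp: Q'_def)
    also have "(\<Sum>q\<in>Q. g q * (cnj (?c (q + p)) * ?c (q + k)))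
        = (\<Sum>q\<in>(\<lambda>q. q + p) ` Q. g (q - p) * (cnj (?c q) * ?c (q + k - p)))"
      by (subst sum.reindex) (auto simp: inj_on_def algebra_simps)
    also have "\<dots> = (\<Sum>q\<in>Q'. g (q - p) * (cnj (?c q) * ?c (q + k - p)))"
    proof (intro sum.mono_neutral_left)
      show "\<forall>q\<in>Q' - (\<lambda>q. q + p) ` Q. g (q - p) * (cnj (?c q) * ?c (q + k - p)) = 0"
      proof
        fix q assume "q \<in> Q' - (\<lambda>q. q + p) ` Q"
        then have "q - p \<notin> Q" by (metis DiffD2 diff_add_cancel imageI)
        then show "g (q - p) * (cnj (?c q) * ?c (q + k - p)) = 0" using Q by simp
      qed
    qed (use Q' in \<open>auto simp: Q'_def\<close>)
    finally have "R p = (\<Sum>q\<in>Q'. (g q - g (q - p)) * (cnj (?c q) * ?c (q + k - p)))"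
      by (simp add: left_diff_distrib sum_subtractf)
    then have "norm (R p) \<le> (\<Sum>q\<in>Q'. (K * norm (ivec p)) * (norm (?c q) * norm (?c (q + k - p))))"
      by (auto simp: norm_mult intro!: sum_norm_le mult_mono K mult_nonneg_nonneg)
    also have "\<dots> = K * norm (ivec p) * (\<Sum>q\<in>Q'. norm (?c (id q)) * norm (?c (q + k - p)))"
      by (simp add: sum_distrib_left)
    also have "\<dots> \<le> K * norm (ivec p) * (B * B)"
      using K(1) by (intro mult_left_mono ell2_le_product[OF B B Q']) (auto simp: inj_on_def)
    finally show ?thesis by (simp add: power2_eq_square)
  qed
  have "norm (\<Sum>p\<in>A n. u n p * R p) \<le> K * S * B\<^sup>2" for n
  proof -
    have "norm (\<Sum>p\<in>A n. u n p * R p) \<le> (\<Sum>p\<in>A n. ((1 + norm (ivec p)) * norm (u n p)) * (K * B\<^sup>2))"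
    proof (rule sum_norm_le)
      fix p
      have "norm (u n p * R p) \<le> norm (u n p) * (K * norm (ivec p) * B\<^sup>2)"
        unfolding norm_mult by (intro mult_left_mono R) auto
      also have "\<dots> = (norm (ivec p) * norm (u n p)) * (K * B\<^sup>2)" by simp
      also have "\<dots> \<le> ((1 + norm (ivec p)) * norm (u n p)) * (K * B\<^sup>2)"
        using K(1) by (intro mult_right_mono) auto
      finally show "norm (u n p * R p) \<le> ((1 + norm (ivec p)) * norm (u n p)) * (K * B\<^sup>2)" .
    qed
    also have "\<dots> = (\<Sum>p\<in>A n. (1 + norm (ivec p)) * norm (u n p)) * (K * B\<^sup>2)"
      by (simp add: sum_distrib_right)
    also have "\<dots> \<le> S * (K * B\<^sup>2)" using K(1) by (intro mult_right_mono u) auto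
    finally show ?thesis by (simp add: mult_ac)
  qed
  then show ?thesis by (intro tendsto_upperbound[OF tendsto_norm[OF l]]) auto
qed

subsection \<open>The Schroedinger equation in Fourier coefficients\<close>

text \<open>The eigenvalue of \<open>- h^2/2\<close> times the Laplacian on the plane wave of index
  \<open>j\<close>.\<close>

definition energy :: "real \<Rightarrow> int ^ 2 \<Rightarrow> real" where
  "energy h j = 2 * pi\<^sup>2 * h\<^sup>2 * (norm (ivec j))\<^sup>2"

text \<open>The Schroedinger equation tested on plane waves, with continuity in L2 weakened to local
  boundedness of the coefficients. This class is easily seen to be stable under averaging with a
  time translate.\<close>

definition coefficient_solution :: "real \<Rightarrow> real \<Rightarrow> (real ^ 2 \<Rightarrow> real) \<Rightarrow> (real \<Rightarrow> real ^ 2 \<Rightarrow> complex) \<Rightarrow> bool" where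
  "coefficient_solution h e V v \<longleftrightarrow>
     (\<forall>t. v t \<in> L2_torus) \<and>
     (\<forall>t. \<exists>d>0. \<exists>B. \<forall>s. \<bar>s - t\<bar> < d \<longrightarrow> ell2_le (fourier (v s)) B) \<and>
     (\<forall>j t. ((\<lambda>s. fourier (v s) j) has_vector_derivative
         (of_real (energy h j) * fourier (v t) j + of_real (e\<^sup>2) * fourier (\<lambda>x. of_real (V x) * v t x) j)
           / (\<i> * of_real h)) (at t))"

lemma wave_has_derivative:
  "((\<lambda>x. c * wave k x) has_derivative (\<lambda>y. c * (2 * \<i> * of_real pi * of_real (ivec k \<bullet> y)) * wave k x)) (at x)"
proof -
  let ?g = "\<lambda>x. 2 * \<i> * of_real pi * of_real (ivec k \<bullet> x)"
  have g: "(?g has_derivative ?g) (at x)"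
    by (intro bounded_linear_imp_has_derivative bounded_linear_const_mult
        bounded_linear_compose[OF bounded_linear_of_real bounded_linear_inner_right])
  have "(exp has_derivative (*) (exp (?g x))) (at (?g x))"
    using DERIV_exp[of "?g x"] by (simp add: has_field_derivative_def)
  from has_derivative_mult_right[OF has_derivative_compose[OF g this], of c] show ?thesis
    by (simp add: wave_def mult_ac)
qed

lemma iter_deriv_wave:
  "iter_deriv bs (\<lambda>x. c * wave k x) = (\<lambda>x. (c * (\<Prod>b\<leftarrow>bs. 2 * \<i> * of_real pi * of_real (ivec k \<bullet> b))) * wave k x)"
proof (induction bs)
  case (Cons b bs)
  show ?case
    unfolding iter_deriv.simps Cons.IH frechet_derivative_at[OF wave_has_derivative, symmetric]
    by (simp add: mult_ac)
qed simp

lemma smooth_wave: "smooth (\<lambda>x. c * wave k x)"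
  unfolding smooth_def Ck_def iter_deriv_wave
  using wave_has_derivative by (auto simp: differentiable_def intro!: continuous_intros continuous_wave)

lemma laplacian_wave: "laplacian (wave k) x = - of_real (4 * pi\<^sup>2 * (norm (ivec k))\<^sup>2) * wave k x"
proof -
  have "laplacian (wave k) x = (\<Sum>b\<in>Basis. ((2 * \<i> * of_real pi * of_real (ivec k \<bullet> b)) * (2 * \<i> * of_real pi * of_real (ivec k \<bullet> b))) * wave k x)"
    using iter_deriv_wave[of _ 1 k] unfolding laplacian_def by (simp del: iter_deriv.simps)
  also have "\<dots> = - of_real (4 * pi\<^sup>2 * (\<Sum>b\<in>Basis. (ivec k \<bullet> b)\<^sup>2)) * wave k x"
    by (simp add: sum_distrib_left sum_distrib_right sum_negf[symmetric] power2_eq_square mult_ac)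
  also have "(\<Sum>b\<in>Basis. (ivec k \<bullet> b)\<^sup>2) = (norm (ivec k))\<^sup>2"
    unfolding power2_norm_eq_inner by (subst euclidean_inner) (simp add: power2_eq_square)
  finally show ?thesis .
qed

lemma L2_diff_bound:
  assumes "f \<in> L2_torus" "g \<in> L2_torus"
  shows "(L2_nrm f)\<^sup>2 \<le> 2 * (L2_nrm (\<lambda>x. f x - g x))\<^sup>2 + 2 * (L2_nrm g)\<^sup>2"
proof -
  have ge: "(norm z)\<^sup>2 \<le> 2 * (norm (z - w))\<^sup>2 + 2 * (norm w)\<^sup>2" for z w :: complex
  proof -
    have "norm z \<le> norm (z - w) + norm w" by (metis diff_add_cancel norm_triangle_ineq)
    then have "(norm z)\<^sup>2 \<le> (norm (z - w) + norm w)\<^sup>2" by (intro power_mono) auto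
    also have "\<dots> \<le> 2 * (norm (z - w))\<^sup>2 + 2 * (norm w)\<^sup>2"
      using zero_le_power2[of "norm (z - w) - norm w"] by (simp add: power2_eq_square algebra_simps)
    finally show ?thesis .
  qed
  have m: "f \<in> borel_measurable torus" "g \<in> borel_measurable torus"
    using assms by (auto simp: L2_torus_iff intro: measurable_torus)
  have i: "integrable torus (\<lambda>x. (norm (f x - g x))\<^sup>2)"
  proof (rule Bochner_Integration.integrable_bound)
    show "integrable torus (\<lambda>x. 2 * (norm (f x))\<^sup>2 + 2 * (norm (g x))\<^sup>2)"
      using assms by (auto simp: L2_torus_iff)
    show "AE x in torus. norm ((norm (f x - g x))\<^sup>2) \<le> norm (2 * (norm (f x))\<^sup>2 + 2 * (norm (g x))\<^sup>2)"
      using ge[of "f x - g x" "- g x" for x] by auto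
  qed (use m in measurable)
  have "(L2_nrm f)\<^sup>2 \<le> (LINT x|torus. 2 * (norm (f x - g x))\<^sup>2 + 2 * (norm (g x))\<^sup>2)"
    unfolding L2_nrm_sq using assms i by (intro integral_mono ge) (auto simp: L2_torus_iff)
  also have "\<dots> = 2 * (L2_nrm (\<lambda>x. f x - g x))\<^sup>2 + 2 * (L2_nrm g)\<^sup>2"
    unfolding L2_nrm_sq using assms i by (simp add: L2_torus_iff)
  finally show ?thesis .
qed

text \<open>Plane waves are admissible test functions and eigenfunctions of the Laplacian.
  Continuity in L2 at \<open>t\<close> provides a bound on the norm near \<open>t\<close>, hence by
  Bessel's inequality a bound on the coefficients.\<close>

lemma schroedinger_coefficients:
  assumes sol: "schroedinger_solution h e V u v" and V: "tame_potential V S"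
  shows "coefficient_solution h e V v" and "u \<in> L2_torus \<Longrightarrow> fourier (v 0) = fourier u"
proof -
  have L: "v t \<in> L2_torus" for t using sol by (simp add: schroedinger_solution_def)
  have "\<exists>d>0. \<exists>B. \<forall>s. \<bar>s - t\<bar> < d \<longrightarrow> ell2_le (fourier (v s)) B" for t
  proof -
    have "((\<lambda>s. L2_nrm (\<lambda>x. v s x - v t x)) \<longlongrightarrow> 0) (at t)"
      using sol by (simp add: schroedinger_solution_def)
    then have "eventually (\<lambda>s. L2_nrm (\<lambda>x. v s x - v t x) < 1) (at t)"
      by (rule order_tendstoD) simp
    then obtain d where d: "d > 0" "\<And>s. s \<noteq> t \<Longrightarrow> dist s t < d \<Longrightarrow> L2_nrm (\<lambda>x. v s x - v t x) < 1"
      unfolding eventually_at by auto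
    have "L2_nrm (v s) \<le> sqrt (2 + 2 * (L2_nrm (v t))\<^sup>2)" if "\<bar>s - t\<bar> < d" for s
    proof (rule real_le_rsqrt)
      have "(L2_nrm (\<lambda>x. v s x - v t x))\<^sup>2 \<le> 1"
      proof (cases "s = t")
        case True then show ?thesis by (simp add: L2_nrm_def)
      next
        case False then show ?thesis
          using d(2)[of s] that L2_nrm_nonneg by (intro power_le_one) (auto simp: dist_real_def intro: less_imp_le)
      qed
      then show "(L2_nrm (v s))\<^sup>2 \<le> 2 + 2 * (L2_nrm (v t))\<^sup>2"
        using L2_diff_bound[OF L L, of s t] by linarith
    qed
    then show ?thesis using d(1) ell2_le_mono[OF ell2_le_fourier[OF L]] by blast
  qed
  moreover have "((\<lambda>s. fourier (v s) j) has_vector_derivative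
         (of_real (energy h j) * fourier (v t) j + of_real (e\<^sup>2) * fourier (\<lambda>x. of_real (V x) * v t x) j)
           / (\<i> * of_real h)) (at t)" for j t
  proof -
    obtain B where B: "\<And>x. \<bar>V x\<bar> \<le> B" and Vm [measurable]: "V \<in> borel_measurable borel"
      using V by (auto simp: tame_potential_def)
    have inner: "L2_inner (wave j) f = fourier f j" for f
      by (simp add: L2_inner_def cell_integral fourier_torus cnj_wave mult.commute)
    have i1: "integrable torus (\<lambda>x. v t x * wave (- j) x)"
      by (rule L2_integrable_mult(2)[OF L, where B=1]) auto
    have i2: "integrable torus (\<lambda>x. of_real (V x) * wave (- j) x * v t x)"
      by (rule L2_integrable_mult(1)[OF L, where B=B]) (auto simp: norm_mult B)
    have ham: "cnj (hamiltonian h e V (wave j) x) = of_real (energy h j) * wave (- j) x + of_real (e\<^sup>2) * (of_real (V x) * wave (- j) x)" for x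
      by (simp add: hamiltonian_def laplacian_wave energy_def cnj_wave algebra_simps)
    have "L2_inner (hamiltonian h e V (wave j)) (v t)
      = (LINT x|torus. of_real (energy h j) * (v t x * wave (- j) x) + of_real (e\<^sup>2) * (of_real (V x) * wave (- j) x * v t x))"
      unfolding L2_inner_def cell_integral ham by (simp add: algebra_simps)
    also have "\<dots> = of_real (energy h j) * (LINT x|torus. v t x * wave (- j) x)
        + of_real (e\<^sup>2) * (LINT x|torus. of_real (V x) * wave (- j) x * v t x)"
      using i1 i2 by simp
    also have "\<dots> = of_real (energy h j) * fourier (v t) j + of_real (e\<^sup>2) * fourier (\<lambda>x. of_real (V x) * v t x) j"
      unfolding fourier_torus by (simp add: mult_ac)
    finally have eq: "L2_inner (hamiltonian h e V (wave j)) (v t) =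
       of_real (energy h j) * fourier (v t) j + of_real (e\<^sup>2) * fourier (\<lambda>x. of_real (V x) * v t x) j" .
    have "smooth (wave j)" using smooth_wave[of 1 j] by simp
    then have "((\<lambda>s. L2_inner (wave j) (v s)) has_vector_derivative
               L2_inner (hamiltonian h e V (wave j)) (v t) / (\<i> * of_real h)) (at t)"
      using sol periodic_wave unfolding schroedinger_solution_def by blast
    then show ?thesis unfolding inner eq .
  qed
  ultimately show "coefficient_solution h e V v"
    using L by (simp add: coefficient_solution_def)
  assume u: "u \<in> L2_torus"
  have "AE x in torus. v 0 x = u x"
    using sol by (subst AE_restrict_space_iff) (auto simp: schroedinger_solution_def)
  then show "fourier (v 0) = fourier u"
    unfolding fourier_torus using L[of 0] u
    by (intro ext integral_cong_AE) (auto simp: L2_torus_iff intro!: borel_measurable_times measurable_torus)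
qed

text \<open>Stated on \<open>closed_segment\<close> so that \<open>b < a\<close> is allowed:
  solutions are followed in both time directions.\<close>

lemma vector_mean_value_bound:
  fixes f :: "real \<Rightarrow> 'a::real_normed_vector"
  assumes "\<And>t. t \<in> closed_segment a b \<Longrightarrow> (f has_vector_derivative f' t) (at t within closed_segment a b)"
    and "\<And>t. t \<in> closed_segment a b \<Longrightarrow> norm (f' t) \<le> B"
  shows "norm (f b - f a) \<le> B * \<bar>b - a\<bar>"
proof -
  have "norm (f b - f a) \<le> B * norm (b - a)"
  proof (rule differentiable_bound[where S="closed_segment a b" and f'="\<lambda>t s. s *\<^sub>R f' t"])
    show "(f has_derivative (\<lambda>s. s *\<^sub>R f' t)) (at t within closed_segment a b)" if "t \<in> closed_segment a b" for t
      using assms(1)[OF that] by (simp add: has_vector_derivative_def)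
    show "onorm (\<lambda>s. s *\<^sub>R f' t) \<le> B" if "t \<in> closed_segment a b" for t
      by (rule onorm_le) (use assms(2)[OF that] in \<open>auto simp: mult.commute[of B] intro: mult_left_mono\<close>)
  qed auto
  then show ?thesis by simp
qed

lemma finite_ivec_bounded: "finite {q. norm (ivec q) \<le> r}"
proof (rule inj_on_finite[where f="\<lambda>q. (q $ 1, q $ 2)"])
  show "inj_on (\<lambda>q. (q $ 1, q $ 2)) {q. norm (ivec q) \<le> r}"
    by (auto simp: inj_on_def vec_eq_iff forall_2)
  have "- \<lceil>r\<rceil> \<le> q $ i \<and> q $ i \<le> \<lceil>r\<rceil>" if "norm (ivec q) \<le> r" for q i
    using component_le_norm_cart[of "ivec q" i] that by simp linarith
  then show "(\<lambda>q. (q $ 1, q $ 2)) ` {q. norm (ivec q) \<le> r} \<subseteq> {-\<lceil>r\<rceil>..\<lceil>r\<rceil>} \<times> {-\<lceil>r\<rceil>..\<lceil>r\<rceil>}"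
    by auto
qed auto

text \<open>Applied with \<open>w = 1 / (\<i> h)\<close>, which is purely imaginary: in the
  derivative of \<open>cnj a * b\<close> the energies then combine to their difference and the
  potential terms to a commutator.\<close>

lemma product_rule_identity:
  fixes w :: complex
  assumes "cnj w = - w"
  shows "cnj a * (w * (of_real E' * b + of_real r * y)) + cnj (w * (of_real E * a + of_real r * x)) * b
    = w * of_real (E' - E) * (cnj a * b) + of_real r * w * (cnj a * y - cnj x * b)"
  by (simp add: assms algebra_simps)

lemma distrib_identity: "g * (A * B + C * D) = A * (g * B) + C * (g * D)" for g :: complex
  by (simp add: algebra_simps)

text \<open>The energies of \<open>q + k\<close> and \<open>q\<close> differ by
  \<open>2 pi h\<close> times the inner product of \<open>k\<close> with the frequency
  \<open>pi h (q + (q + k))\<close> at which the Weyl quantization evaluates its symbol. The first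
  sum is therefore again a quantized symbol, multiplied by
  \<open>- 2 pi i (\<xi> \<bullet> k)\<close>.\<close>

lemma form_derivative:
  assumes sol: "coefficient_solution h e V v" and h: "h > 0"
  defines "d \<equiv> \<lambda>t. fourier (\<lambda>x. of_real (V x) * v t x)"
  shows "((\<lambda>s. \<Sum>q\<in>Q. g q * (cnj (fourier (v s) q) * fourier (v s) (q + k))) has_vector_derivative
     ((\<Sum>q\<in>Q. - 2 * \<i> * of_real pi * of_real (((pi * h) *\<^sub>R ivec (q + (q + k))) \<bullet> ivec k) * (g q * (cnj (fourier (v t) q) * fourier (v t) (q + k))))
      + of_real (e\<^sup>2) / (\<i> * of_real h) *
        (\<Sum>q\<in>Q. g q * (cnj (fourier (v t) q) * d t (q + k) - cnj (d t q) * fourier (v t) (q + k))))) (at t)"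
proof -
  let ?c = "fourier (v t)"
  let ?c' = "\<lambda>j. (of_real (energy h j) * ?c j + of_real (e\<^sup>2) * d t j) / (\<i> * of_real h)"
  have dc: "((\<lambda>s. fourier (v s) j) has_vector_derivative ?c' j) (at t)" for j
    using sol by (simp add: coefficient_solution_def d_def)
  have dcn: "((\<lambda>s. cnj (fourier (v s) j)) has_vector_derivative cnj (?c' j)) (at t)" for j
    by (intro has_vector_derivative_cnj dc)
  have D: "((\<lambda>s. \<Sum>q\<in>Q. g q * (cnj (fourier (v s) q) * fourier (v s) (q + k))) has_vector_derivative
    (\<Sum>q\<in>Q. g q * (cnj (?c q) * ?c' (q + k) + cnj (?c' q) * ?c (q + k)))) (at t)"
    by (intro has_vector_derivative_sum has_vector_derivative_mult_right has_vector_derivative_mult dc dcn)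
  have en: "energy h (q + k) - energy h q = 2 * pi * h * (((pi * h) *\<^sub>R ivec (q + (q + k))) \<bullet> ivec k)" for q
  proof -
    have "(norm (ivec (q + k)))\<^sup>2 - (norm (ivec q))\<^sup>2 = ivec (q + (q + k)) \<bullet> ivec k"
      unfolding power2_norm_eq_inner ivec_add inner_add_left inner_add_right by (simp add: inner_commute)
    then show ?thesis
      unfolding energy_def right_diff_distrib[symmetric] by (simp add: power2_eq_square)
  qed
  have T: "cnj (?c q) * ?c' (q + k) + cnj (?c' q) * ?c (q + k)
    = - 2 * \<i> * of_real pi * of_real (((pi * h) *\<^sub>R ivec (q + (q + k))) \<bullet> ivec k) * (cnj (?c q) * ?c (q + k))
      + of_real (e\<^sup>2) / (\<i> * of_real h) * (cnj (?c q) * d t (q + k) - cnj (d t q) * ?c (q + k))" for q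
  proof -
    define w where "w = 1 / (\<i> * complex_of_real h)"
    have w: "cnj w = - w" by (simp add: w_def)
    have "w * of_real (energy h (q + k) - energy h q) = - 2 * \<i> * of_real pi * of_real (((pi * h) *\<^sub>R ivec (q + (q + k))) \<bullet> ivec k)"
      unfolding en w_def using h by (simp add: divide_simps)
    then show ?thesis
      using product_rule_identity[OF w, of "?c q" "energy h (q + k)" "?c (q + k)" "e\<^sup>2" "d t (q + k)" "energy h q" "d t q"]
      by (simp only: w_def times_divide_eq_left times_divide_eq_right mult_1_left mult_1_right)
  qed
  have "(\<Sum>q\<in>Q. g q * (cnj (?c q) * ?c' (q + k) + cnj (?c' q) * ?c (q + k))) =
     (\<Sum>q\<in>Q. - 2 * \<i> * of_real pi * of_real (((pi * h) *\<^sub>R ivec (q + (q + k))) \<bullet> ivec k) * (g q * (cnj (?c q) * ?c (q + k))))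
      + of_real (e\<^sup>2) / (\<i> * of_real h) *
        (\<Sum>q\<in>Q. g q * (cnj (?c q) * d t (q + k) - cnj (d t q) * ?c (q + k)))"
    unfolding T sum_distrib_left sum.distrib[symmetric]
    by (intro sum.cong refl) (rule distrib_identity)
  then show ?thesis using D by simp
qed

lemma coefficient_solution_locally_bounded:
  assumes "coefficient_solution h e V v"
  obtains d B where "d > 0" "\<And>s. \<bar>s - t\<bar> < d \<Longrightarrow> ell2_le (fourier (v s)) B"
proof -
  have "\<exists>d>0. \<exists>B. \<forall>s. \<bar>s - t\<bar> < d \<longrightarrow> ell2_le (fourier (v s)) B"
    using assms unfolding coefficient_solution_def by (elim conjE) (erule allE)
  then show thesis using that by blast
qed

lemma coefficient_solution_bounded:
  assumes "coefficient_solution h e V v"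
  obtains M where "0 \<le> M" "\<And>s. s \<in> closed_segment a b \<Longrightarrow> ell2_le (fourier (v s)) M"
proof -
  have "\<forall>t. \<exists>dC. fst dC > 0 \<and> (\<forall>s. \<bar>s - t\<bar> < fst dC \<longrightarrow> ell2_le (fourier (v s)) (snd dC))"
  proof
    fix t
    obtain d B where "d > 0" "\<And>s. \<bar>s - t\<bar> < d \<Longrightarrow> ell2_le (fourier (v s)) B"
      by (rule coefficient_solution_locally_bounded[OF assms]) blast
    then show "\<exists>dC. fst dC > 0 \<and> (\<forall>s. \<bar>s - t\<bar> < fst dC \<longrightarrow> ell2_le (fourier (v s)) (snd dC))"
      by (intro exI[of _ "(d, B)"]) auto
  qed
  then obtain dC where dC: "\<forall>t. fst (dC t) > 0 \<and> (\<forall>s. \<bar>s - t\<bar> < fst (dC t) \<longrightarrow> ell2_le (fourier (v s)) (snd (dC t)))"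
    by (rule choice[THEN exE])
  define d C where "d t = fst (dC t)" and "C t = snd (dC t)" for t
  have d: "\<And>t. d t > 0" and C: "\<And>t s. \<bar>s - t\<bar> < d t \<Longrightarrow> ell2_le (fourier (v s)) (C t)"
    using dC by (simp_all add: d_def C_def)
  let ?S = "closed_segment a b"
  have "?S \<subseteq> (\<Union>t\<in>?S. ball t (d t))" using d by auto
  then obtain T where T: "T \<subseteq> ?S" "finite T" "?S \<subseteq> (\<Union>t\<in>T. ball t (d t))"
    by (rule compactE_image[OF compact_segment, of ?S "\<lambda>t. ball t (d t)", rotated]) auto
  show thesis
  proof (rule that[of "\<Sum>t\<in>T. \<bar>C t\<bar>"])
    fix s assume "s \<in> ?S"
    then obtain t where t: "t \<in> T" "\<bar>s - t\<bar> < d t"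
      using T(3) by (auto simp: dist_real_def abs_minus_commute)
    have "\<bar>C t\<bar> \<le> (\<Sum>t\<in>T. \<bar>C t\<bar>)" using t(1) T(2) by (intro member_le_sum) auto
    then show "ell2_le (fourier (v s)) (\<Sum>t\<in>T. \<bar>C t\<bar>)"
      by (intro ell2_le_mono[OF C[OF t(2)]]) linarith
  qed (auto intro: sum_nonneg)
qed

text \<open>The full sum of squares need not be differentiable term by term, so it is truncated by a
  slowly varying cut-off. For \<open>k = 0\<close> the free part of \<open>form_derivative\<close>
  vanishes, and the commutator with the potential is controlled by the Lipschitz constant of the
  cut-off, which tends to 0. The crude bound \<open>M\<close> on the time segment disappears in the
  limit.\<close>

lemma norm_conservation:
  assumes sol: "coefficient_solution h e V v" and V: "tame_potential V S" and h: "h > 0"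
    and B: "ell2_le (fourier (v a)) B"
  shows "ell2_le (fourier (v b)) B"
proof -
  obtain M where M: "0 \<le> M" "\<And>s. s \<in> closed_segment a b \<Longrightarrow> ell2_le (fourier (v s)) M"
    by (rule coefficient_solution_bounded[OF sol]) blast
  have L: "v t \<in> L2_torus" for t using sol by (simp add: coefficient_solution_def)
  \<comment> \<open>A tent of radius \<open>n + 1\<close>, hence with Lipschitz constant
    \<open>1 / (n + 1)\<close>.\<close>
  define g where "g n q = max 0 (1 - norm (ivec q) / (real n + 1))" for n and q :: "int ^ 2"
  define Q where "Q n = {q::int^2. norm (ivec q) \<le> real n + 1}" for n
  define C where "C = e\<^sup>2 / h * (S * M\<^sup>2) * \<bar>b - a\<bar>"
  define E where "E n s = (\<Sum>q\<in>Q n. g n q * (norm (fourier (v s) q))\<^sup>2)" for n s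
  have Q: "finite (Q n)" for n unfolding Q_def by (rule finite_ivec_bounded)
  have g: "0 \<le> g n q" "g n q \<le> 1" for n q by (auto simp: g_def)
  have g0: "g n q = 0" if "q \<notin> Q n" for n q
    using that by (auto simp: g_def Q_def max_def field_simps)
  have nr: "norm (complex_of_real x - of_real y) = \<bar>x - y\<bar>" for x y
    by (simp flip: of_real_diff)
  have czz: "cnj z * z = (complex_of_real (norm z))\<^sup>2" for z
    using complex_norm_square[of z] by (simp add: mult.commute)
  have gl: "norm (complex_of_real (g n q) - of_real (g n (q - p))) \<le> 1 / (real n + 1) * norm (ivec p)" for n q p
  proof -
    have eq: "norm (complex_of_real (g n q) - of_real (g n (q - p))) = \<bar>g n q - g n (q - p)\<bar>"
      by (rule nr)
    have "\<bar>max 0 (1 - x) - max 0 (1 - y)\<bar> \<le> \<bar>x - y\<bar>" for x y :: real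
      by (auto simp: max_def)
    then have "\<bar>g n q - g n (q - p)\<bar> \<le> \<bar>norm (ivec q) / (real n + 1) - norm (ivec (q - p)) / (real n + 1)\<bar>"
      unfolding g_def .
    also have "\<dots> = \<bar>norm (ivec q) - norm (ivec (q - p))\<bar> / (real n + 1)"
      by (simp add: diff_divide_distrib[symmetric])
    also have "\<dots> \<le> norm (ivec q - ivec (q - p)) / (real n + 1)"
      by (intro divide_right_mono norm_triangle_ineq3) auto
    finally show ?thesis unfolding eq by (simp add: ivec_diff)
  qed
  have Ediff: "E n b \<le> E n a + C / (real n + 1)" for n
  proof -
    let ?F = "\<lambda>s. \<Sum>q\<in>Q n. complex_of_real (g n q) * (cnj (fourier (v s) q) * fourier (v s) (q + 0))"
    have F: "?F s = of_real (E n s)" for s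
      unfolding E_def of_real_sum by (intro sum.cong) (simp_all add: czz)
    let ?d = "\<lambda>t. fourier (\<lambda>x. of_real (V x) * v t x)"
    let ?F' = "\<lambda>t. of_real (e\<^sup>2) / (\<i> * of_real h) *
        (\<Sum>q\<in>Q n. complex_of_real (g n q) * (cnj (fourier (v t) q) * ?d t (q + 0) - cnj (?d t q) * fourier (v t) (q + 0)))"
    have "norm (?F b - ?F a) \<le> (e\<^sup>2 / h * (1 / (real n + 1) * S * M\<^sup>2)) * \<bar>b - a\<bar>"
    proof (rule vector_mean_value_bound[where f'="?F'"])
      show "(?F has_vector_derivative ?F' t) (at t within closed_segment a b)" for t
        using has_vector_derivative_at_within[OF form_derivative[OF sol h, where Q="Q n" and g="\<lambda>q. of_real (g n q)" and k=0 and t=t]]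
        by simp
      show "norm (?F' t) \<le> e\<^sup>2 / h * (1 / (real n + 1) * S * M\<^sup>2)" if "t \<in> closed_segment a b" for t
      proof -
        have "norm (of_real (e\<^sup>2) / (\<i> * complex_of_real h)) = e\<^sup>2 / h"
          using h by (simp add: norm_divide norm_mult norm_power)
        then show ?thesis
          unfolding norm_mult
          using h commutator_bound[OF V L[of t] M(2)[OF that] Q, where g="\<lambda>q. of_real (g n q)" and k=0, OF _ _ gl]
          by (intro mult_mono) (auto simp: g0)
      qed
    qed
    then have "\<bar>E n b - E n a\<bar> \<le> C / (real n + 1)"
      unfolding F nr by (simp add: C_def)
    then show ?thesis by linarith
  qed
  have Ea: "E n a \<le> B\<^sup>2" for n
  proof -
    have "E n a \<le> (\<Sum>q\<in>Q n. (norm (fourier (v a) q))\<^sup>2)"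
      unfolding E_def by (intro sum_mono mult_left_le_one_le g) auto
    also have "\<dots> \<le> B\<^sup>2" using B ell2_le_nonneg[OF B] Q by (simp add: ell2_le_iff_sum)
    finally show ?thesis .
  qed
  have "(\<Sum>q\<in>G. (norm (fourier (v b) q))\<^sup>2) \<le> B\<^sup>2" if G: "finite G" for G
  proof (rule LIMSEQ_le)
    have z: "(\<lambda>n. 1 / (real n + 1)) \<longlonglongrightarrow> 0" by real_asymp
    have zr: "(\<lambda>n. r / (real n + 1)) \<longlonglongrightarrow> 0" for r :: real
      using tendsto_mult_right_zero[OF z, of r] by simp
    have "(\<lambda>n. g n q) \<longlonglongrightarrow> max 0 (1 - 0)" for q
      unfolding g_def by (rule tendsto_max[OF tendsto_const tendsto_diff[OF tendsto_const zr]])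
    then have "(\<lambda>n. \<Sum>q\<in>G. g n q * (norm (fourier (v b) q))\<^sup>2) \<longlonglongrightarrow> (\<Sum>q\<in>G. 1 * (norm (fourier (v b) q))\<^sup>2)"
      by (intro tendsto_intros) simp
    then show "(\<lambda>n. \<Sum>q\<in>G. g n q * (norm (fourier (v b) q))\<^sup>2) \<longlonglongrightarrow> (\<Sum>q\<in>G. (norm (fourier (v b) q))\<^sup>2)"
      by simp
    show "(\<lambda>n. B\<^sup>2 + C / (real n + 1)) \<longlonglongrightarrow> B\<^sup>2"
      using tendsto_add[OF tendsto_const zr[of C], of "B\<^sup>2"] by simp
    have "(\<Sum>q\<in>G. g n q * (norm (fourier (v b) q))\<^sup>2) \<le> B\<^sup>2 + C / (real n + 1)" for n
    proof -
      have "(\<Sum>q\<in>G. g n q * (norm (fourier (v b) q))\<^sup>2) = (\<Sum>q\<in>G \<inter> Q n. g n q * (norm (fourier (v b) q))\<^sup>2)"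
        using G by (intro sum.mono_neutral_right) (auto simp: g0)
      also have "\<dots> \<le> E n b" unfolding E_def
        by (intro sum_mono2) (auto simp: Q g)
      finally show ?thesis using Ediff[of n] Ea[of n] by linarith
    qed
    then show "\<exists>N. \<forall>n\<ge>N. (\<Sum>q\<in>G. g n q * (norm (fourier (v b) q))\<^sup>2) \<le> B\<^sup>2 + C / (real n + 1)" by blast
  qed
  then show ?thesis using ell2_le_nonneg[OF B] by (simp add: ell2_le_iff_sum)
qed

text \<open>In rescaled time the oscillating sum is the derivative of the form divided by
  \<open>T\<close>, up to the commutator: the form is bounded by \<open>G\<close> at both endpoints,
  and the commutator is integrated over the interval.\<close>

lemma interval_estimate:
  assumes sol: "coefficient_solution h e V v" and V: "tame_potential V S" and h: "h > 0" and T: "T > 0"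
    and c1: "\<And>s. ell2_le (fourier (v s)) 1"
    and Q: "finite Q" "\<And>q. q \<notin> Q \<Longrightarrow> g q = 0"
    and G: "\<And>q. norm (g q) \<le> G"
    and K: "0 \<le> K" "\<And>q p. norm (g q - g (q - p)) \<le> K * norm (ivec p)"
    and ab: "a \<le> b"
  shows "norm (LINT t:{a..b}|lborel. (\<Sum>q\<in>Q. - 2 * \<i> * of_real pi * of_real (((pi * h) *\<^sub>R ivec (q + (q + k))) \<bullet> ivec k)
       * (g q * (cnj (fourier (v (t * T)) q) * fourier (v (t * T)) (q + k)))))
    \<le> 2 * G / T + (b - a) * (e\<^sup>2 / h * (K * S))"
proof -
  have L: "v t \<in> L2_torus" for t using sol by (simp add: coefficient_solution_def)
  define F where "F s = (\<Sum>q\<in>Q. g q * (cnj (fourier (v s) q) * fourier (v s) (q + k)))" for s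
  define X where "X s = (\<Sum>q\<in>Q. - 2 * \<i> * of_real pi * of_real (((pi * h) *\<^sub>R ivec (q + (q + k))) \<bullet> ivec k)
       * (g q * (cnj (fourier (v s) q) * fourier (v s) (q + k))))" for s
  define d where "d t = fourier (\<lambda>x. of_real (V x) * v t x)" for t
  define Y where "Y t = of_real (e\<^sup>2) / (\<i> * of_real h) *
        (\<Sum>q\<in>Q. g q * (cnj (fourier (v t) q) * d t (q + k) - cnj (d t q) * fourier (v t) (q + k)))" for t
  have F: "(F has_vector_derivative (X t + Y t)) (at t)" for t
    using form_derivative[OF sol h, where Q=Q and g=g and k=k and t=t] unfolding F_def X_def Y_def d_def .
  have Y: "norm (Y t) \<le> e\<^sup>2 / h * (K * S)" for t
  proof -
    have "norm (of_real (e\<^sup>2) / (\<i> * complex_of_real h)) = e\<^sup>2 / h"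
      using h by (simp add: norm_divide norm_mult norm_power)
    then show ?thesis
      unfolding norm_mult Y_def d_def
      using h commutator_bound[OF V L[of t] c1[of t] Q K, where k=k] by (intro mult_mono) auto
  qed
  have FG: "norm (F s) \<le> G" for s
  proof -
    have "norm (F s) \<le> (\<Sum>q\<in>Q. G * (norm (fourier (v s) (id q)) * norm (fourier (v s) (q + k))))"
      unfolding F_def by (auto intro!: sum_norm_le mult_right_mono G simp: norm_mult)
    also have "\<dots> = G * (\<Sum>q\<in>Q. norm (fourier (v s) (id q)) * norm (fourier (v s) (q + k)))"
      by (simp add: sum_distrib_left)
    also have "\<dots> \<le> G * (1 * 1)"
      using order_trans[OF norm_ge_zero G]
      by (intro mult_left_mono ell2_le_product[OF c1 c1 Q(1)]) (auto simp: inj_on_def)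
    finally show ?thesis by simp
  qed
  have cc: "continuous_on UNIV (\<lambda>s. fourier (v s) j)" for j
    using sol unfolding coefficient_solution_def continuous_on_eq_continuous_at[OF open_UNIV]
    by (blast intro: has_vector_derivative_continuous)
  have cX: "continuous_on A (\<lambda>t. X (t * T))" for A
    unfolding X_def
    by (intro continuous_intros continuous_on_compose2[OF cc]) auto
  define I where "I t = integral {a..t} (\<lambda>t. X (t * T))" for t
  \<comment> \<open>Subtracting the primitive of the oscillating part leaves a function whose
    derivative is the commutator term alone. The mean value bound then applies to it without any
    regularity of that term in time.\<close>
  define \<Phi> where "\<Phi> t = (1 / T) *\<^sub>R F (t * T) - I t" for t
  have seg: "closed_segment a b = {a..b}" using ab by (simp add: closed_segment_eq_real_ivl)
  have "norm (\<Phi> b - \<Phi> a) \<le> (e\<^sup>2 / h * (K * S)) * \<bar>b - a\<bar>"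
  proof (rule vector_mean_value_bound[where f'="\<lambda>t. Y (t * T)"])
    fix t assume t: "t \<in> closed_segment a b"
    have "((\<lambda>t. t * T) has_vector_derivative T) (at t within {a..b})"
      by (auto intro!: derivative_eq_intros simp: has_real_derivative_iff_has_vector_derivative[symmetric])
    from vector_diff_chain_within[OF this has_vector_derivative_at_within[OF F]]
    have "((\<lambda>t. F (t * T)) has_vector_derivative (T *\<^sub>R (X (t * T) + Y (t * T)))) (at t within {a..b})"
      by (simp add: o_def)
    then have "((\<lambda>t. (1 / T) *\<^sub>R F (t * T)) has_vector_derivative (1 / T) *\<^sub>R (T *\<^sub>R (X (t * T) + Y (t * T)))) (at t within {a..b})"
      by (rule bounded_linear.has_vector_derivative[OF bounded_linear_scaleR_right])
    moreover have "(I has_vector_derivative X (t * T)) (at t within {a..b})"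
      unfolding I_def by (rule integral_has_vector_derivative[OF cX]) (use t seg in simp)
    ultimately have "(\<Phi> has_vector_derivative ((1 / T) *\<^sub>R (T *\<^sub>R (X (t * T) + Y (t * T))) - X (t * T))) (at t within {a..b})"
      unfolding \<Phi>_def by (rule has_vector_derivative_diff)
    then show "(\<Phi> has_vector_derivative Y (t * T)) (at t within closed_segment a b)"
      using T seg by simp
    show "norm (Y (t * T)) \<le> e\<^sup>2 / h * (K * S)" by (rule Y)
  qed
  then have \<Phi>: "norm (\<Phi> b - \<Phi> a) \<le> (b - a) * (e\<^sup>2 / h * (K * S))"
    using ab by (simp add: mult.commute)
  have "I a = 0" by (simp add: I_def)
  then have "I b = (1 / T) *\<^sub>R (F (b * T) - F (a * T)) - (\<Phi> b - \<Phi> a)"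
    by (simp add: \<Phi>_def scaleR_diff_right)
  then have "norm (I b) \<le> norm ((1 / T) *\<^sub>R (F (b * T) - F (a * T))) + norm (\<Phi> b - \<Phi> a)"
    by (simp only: norm_triangle_ineq4)
  also have "norm ((1 / T) *\<^sub>R (F (b * T) - F (a * T))) \<le> (1 / T) * (G + G)"
    using T norm_triangle_ineq4[of "F (b * T)" "F (a * T)"] FG[of "b * T"] FG[of "a * T"]
    by (auto simp: divide_right_mono)
  finally have "norm (I b) \<le> 2 * G / T + (b - a) * (e\<^sup>2 / h * (K * S))" using \<Phi> by simp
  moreover have "(LINT t:{a..b}|lborel. X (t * T)) = I b"
    unfolding I_def by (rule set_borel_integral_eq_integral(2)[OF borel_integrable_atLeastAtMost'[OF cX]])
  ultimately show ?thesis unfolding X_def by simp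
qed

subsection \<open>Propagation of low energies\<close>

text \<open>In the interaction picture, with the coefficient multiplied by \<open>ph j\<close>, only
  the potential drives the evolution; over a time \<open>h \<alpha>\<close> it contributes at most
  \<open>h \<alpha> * (e^2 / h) * S\<close>, in which \<open>h\<close> cancels.\<close>

lemma shift_error:
  assumes sol: "coefficient_solution h e V v" and V: "tame_potential V S" and h: "h > 0" and \<alpha>: "\<alpha> \<ge> 0"
    and c1: "\<And>s. ell2_le (fourier (v s)) 1"
  shows "ell2_le (\<lambda>j. fourier (v (s + h * \<alpha>)) j - cis (- (\<alpha> * energy h j)) * fourier (v s) j) (\<alpha> * e\<^sup>2 * S)"
  unfolding ell2_le_def
proof (intro allI impI)
  fix F :: "(int ^ 2) set" assume F: "finite F"
  have L: "v t \<in> L2_torus" for t using sol by (simp add: coefficient_solution_def)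
  have S: "S > 0" using V by (simp add: tame_potential_def)
  define d where "d t = fourier (\<lambda>x. of_real (V x) * v t x)" for t
  define ph where "ph j r = exp (\<i> * of_real (energy h j / h) * of_real r)" for j r
  define b where "b j r = ph j r * fourier (v (s + r)) j" for j r
  have nph: "norm (ph j r) = 1" for j r by (simp add: ph_def)
  have db: "(b j has_vector_derivative ph j r * (of_real (e\<^sup>2) / (\<i> * of_real h) * d (s + r) j)) (at r within A)" for j r A
  proof -
    have "((\<lambda>z. exp (a * z)) has_field_derivative exp (a * w) * a) (at w)" for a w :: complex
      by (auto intro!: derivative_eq_intros)
    from this[of "\<i> * of_real (energy h j / h)" "of_real r"] have 1: "(ph j has_vector_derivative ph j r * (\<i> * of_real (energy h j / h))) (at r)"
      unfolding ph_def[abs_def] by (rule has_vector_derivative_real_field)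
    have "((\<lambda>t. s + t) has_vector_derivative 1) (at r)"
      by (auto intro!: derivative_eq_intros simp: has_real_derivative_iff_has_vector_derivative[symmetric])
    moreover have "((\<lambda>s. fourier (v s) j) has_vector_derivative
         (of_real (energy h j) * fourier (v (s + r)) j + of_real (e\<^sup>2) * d (s + r) j) / (\<i> * of_real h)) (at (s + r))"
      using sol by (simp add: coefficient_solution_def d_def)
    ultimately have 2: "((\<lambda>r. fourier (v (s + r)) j) has_vector_derivative
         (of_real (energy h j) * fourier (v (s + r)) j + of_real (e\<^sup>2) * d (s + r) j) / (\<i> * of_real h)) (at r)"
      using vector_diff_chain_at[of "\<lambda>t. s + t" 1 r "\<lambda>s. fourier (v s) j"] by (simp add: o_def)
    have eq: "ph j r * ((of_real (energy h j) * fourier (v (s + r)) j + of_real (e\<^sup>2) * d (s + r) j) / (\<i> * of_real h))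
        + ph j r * (\<i> * of_real (energy h j / h)) * fourier (v (s + r)) j
       = ph j r * (of_real (e\<^sup>2) / (\<i> * of_real h) * d (s + r) j)"
    proof -
      have h0: "h \<noteq> 0" using h by simp
      have "of_real (energy h j) * fourier (v (s + r)) j / (\<i> * of_real h) = - (\<i> * of_real (energy h j / h) * fourier (v (s + r)) j)"
        by (auto simp: divide_simps h0)
      then show ?thesis
        unfolding add_divide_distrib by (simp add: algebra_simps)
    qed
    show ?thesis
      using has_vector_derivative_mult[OF 1 2] unfolding b_def[abs_def] eq
      by (rule has_vector_derivative_at_within)
  qed
  \<comment> \<open>Pairing with the increment \<open>z\<close> itself turns the pairing bound into
    an inequality of the form \<open>?L^2 \<le> (\<alpha> * e^2 * S) * ?L\<close>.\<close>
  define z where "z j = b j (h * \<alpha>) - b j 0" for j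
  let ?L = "L2_set (\<lambda>j. norm (z j)) F"
  have "norm ((\<Sum>j\<in>F. cnj (z j) * b j (h * \<alpha>)) - (\<Sum>j\<in>F. cnj (z j) * b j 0)) \<le> (e\<^sup>2 / h * (?L * 1 * S)) * \<bar>h * \<alpha> - 0\<bar>"
  proof (rule vector_mean_value_bound)
    fix r
    show "((\<lambda>r. \<Sum>j\<in>F. cnj (z j) * b j r) has_vector_derivative
       (\<Sum>j\<in>F. cnj (z j) * (ph j r * (of_real (e\<^sup>2) / (\<i> * of_real h) * d (s + r) j)))) (at r within closed_segment 0 (h * \<alpha>))"
      by (intro has_vector_derivative_sum has_vector_derivative_mult_right db)
    have "(\<Sum>j\<in>F. cnj (z j) * (ph j r * (of_real (e\<^sup>2) / (\<i> * of_real h) * d (s + r) j)))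
       = of_real (e\<^sup>2) / (\<i> * of_real h) * (\<Sum>j\<in>F. (cnj (z j) * ph j r) * d (s + r) j)"
      by (simp add: sum_distrib_left mult_ac)
    also have "norm \<dots> = e\<^sup>2 / h * norm (\<Sum>j\<in>F. (cnj (z j) * ph j r) * d (s + r) j)"
      using h by (simp add: norm_mult norm_divide norm_power)
    also have "\<dots> \<le> e\<^sup>2 / h * (L2_set (\<lambda>j. norm (cnj (z j) * ph j r)) F * 1 * S)"
      unfolding d_def using h by (intro mult_left_mono potential_pairing_bound[OF V L c1 F]) auto
    also have "L2_set (\<lambda>j. norm (cnj (z j) * ph j r)) F = ?L" by (simp add: norm_mult nph)
    finally show "norm (\<Sum>j\<in>F. cnj (z j) * (ph j r * (of_real (e\<^sup>2) / (\<i> * of_real h) * d (s + r) j))) \<le> e\<^sup>2 / h * (?L * 1 * S)" .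
  qed
  moreover have "(\<Sum>j\<in>F. cnj (z j) * b j (h * \<alpha>)) - (\<Sum>j\<in>F. cnj (z j) * b j 0) = of_real (?L\<^sup>2)"
  proof -
    have "(\<Sum>j\<in>F. cnj (z j) * b j (h * \<alpha>)) - (\<Sum>j\<in>F. cnj (z j) * b j 0) = (\<Sum>j\<in>F. cnj (z j) * z j)"
      by (simp add: z_def sum_subtractf right_diff_distrib)
    also have "\<dots> = of_real (\<Sum>j\<in>F. (norm (z j))\<^sup>2)"
      unfolding of_real_sum complex_norm_square by (simp add: mult.commute)
    also have "(\<Sum>j\<in>F. (norm (z j))\<^sup>2) = ?L\<^sup>2"
      unfolding L2_set_def by (simp add: sum_nonneg)
    finally show ?thesis .
  qed
  ultimately have "?L\<^sup>2 \<le> (e\<^sup>2 / h * (?L * 1 * S)) * \<bar>h * \<alpha>\<bar>"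
    by (simp add: norm_power)
  also have "\<dots> = (\<alpha> * e\<^sup>2 * S) * ?L" using h \<alpha> by (simp add: abs_mult)
  finally have *: "?L * ?L \<le> (\<alpha> * e\<^sup>2 * S) * ?L" by (simp add: power2_eq_square)
  have "?L \<le> \<alpha> * e\<^sup>2 * S"
  proof (cases "?L = 0")
    case True then show ?thesis using \<alpha> S by simp
  next
    case False
    then have "?L > 0" using L2_set_nonneg[of "\<lambda>j. norm (z j)" F] by linarith
    then show ?thesis using * by (metis mult_le_cancel_right_pos)
  qed
  moreover have "norm (z j) = norm (fourier (v (s + h * \<alpha>)) j - cis (- (\<alpha> * energy h j)) * fourier (v s) j)" for j
  proof -
    have p: "ph j (h * \<alpha>) = cis (\<alpha> * energy h j)"
      using h by (simp add: ph_def cis_conv_exp mult_ac)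
    have "z j = cis (\<alpha> * energy h j) * (fourier (v (s + h * \<alpha>)) j - cis (- (\<alpha> * energy h j)) * fourier (v s) j)"
      by (simp add: z_def b_def p right_diff_distrib mult.assoc[symmetric] cis_mult) (simp add: ph_def)
    then show ?thesis by (simp add: norm_mult)
  qed
  ultimately show "L2_set (\<lambda>j. norm (fourier (v (s + h * \<alpha>)) j - cis (- (\<alpha> * energy h j)) * fourier (v s) j)) F \<le> \<alpha> * e\<^sup>2 * S"
    by simp
qed

fun shift_average :: "real \<Rightarrow> nat \<Rightarrow> (real \<Rightarrow> real ^ 2 \<Rightarrow> complex) \<Rightarrow> real \<Rightarrow> real ^ 2 \<Rightarrow> complex" where
  "shift_average \<sigma> 0 v = v"
| "shift_average \<sigma> (Suc n) v = (\<lambda>s x. (shift_average \<sigma> n v s x + shift_average \<sigma> n v (s + \<sigma>) x) / 2)"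

lemma L2_average:
  assumes "f \<in> L2_torus" "g \<in> L2_torus"
  shows "(\<lambda>x. (f x + g x) / 2) \<in> L2_torus"
  unfolding L2_torus_iff
proof (intro conjI)
  have m: "f \<in> borel_measurable borel" "g \<in> borel_measurable borel"
    using assms by (auto simp: L2_torus_iff)
  then have mt: "f \<in> borel_measurable torus" "g \<in> borel_measurable torus"
    by (auto intro: measurable_torus)
  show "(\<lambda>x. (f x + g x) / 2) \<in> borel_measurable borel" using m by measurable
  show "periodic (\<lambda>x. (f x + g x) / 2)" using assms by (auto simp: L2_torus_iff periodic_def)
  show "integrable torus (\<lambda>x. (norm ((f x + g x) / 2))\<^sup>2)"
  proof (rule Bochner_Integration.integrable_bound)
    show "integrable torus (\<lambda>x. (norm (f x))\<^sup>2 + (norm (g x))\<^sup>2)"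
      using assms by (auto simp: L2_torus_iff)
    have "(norm ((z + w) / 2))\<^sup>2 \<le> (norm z)\<^sup>2 + (norm w)\<^sup>2" for z w :: complex
    proof -
      have "(norm ((z + w) / 2))\<^sup>2 \<le> ((norm z + norm w) / 2)\<^sup>2"
        using norm_triangle_ineq[of z w] by (intro power_mono) (auto simp: norm_divide)
      also have "\<dots> \<le> (norm z)\<^sup>2 + (norm w)\<^sup>2"
      proof -
        have "((norm z + norm w) / 2)\<^sup>2 = ((norm z)\<^sup>2 + (norm w)\<^sup>2) / 2 - ((norm z - norm w) / 2)\<^sup>2"
          by (simp add: power2_eq_square field_simps)
        moreover have "(A + B) / 2 - C \<le> A + B" if "0 \<le> A" "0 \<le> B" "0 \<le> C" for A B C :: real
        proof -
          have "(A + B) / 2 \<le> A + B" using that by (simp add: field_simps)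
          then show ?thesis using that(3) by (simp add: algebra_simps add_increasing2)
        qed
        ultimately show ?thesis by simp
      qed
      finally show ?thesis .
    qed
    then show "AE x in torus. norm ((norm ((f x + g x) / 2))\<^sup>2) \<le> norm ((norm (f x))\<^sup>2 + (norm (g x))\<^sup>2)"
      by auto
  qed (use mt in measurable)
qed

lemma fourier_average:
  assumes "f \<in> L2_torus" "g \<in> L2_torus" "V \<in> borel_measurable borel" "\<And>x. \<bar>V x\<bar> \<le> B"
  shows "fourier (\<lambda>x. of_real (V x) * ((f x + g x) / 2)) j
     = (fourier (\<lambda>x. of_real (V x) * f x) j + fourier (\<lambda>x. of_real (V x) * g x) j) / 2"
proof -
  have [measurable]: "V \<in> borel_measurable borel" by fact
  have i: "integrable torus (\<lambda>x. of_real (V x) * wave (- j) x * f x)" if "f \<in> L2_torus" for f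
    by (rule L2_integrable_mult(1)[OF that, where B=B]) (use assms in \<open>auto simp: norm_mult\<close>)
  have "fourier (\<lambda>x. of_real (V x) * ((f x + g x) / 2)) j
    = (LINT x|torus. (of_real (V x) * wave (- j) x * f x + of_real (V x) * wave (- j) x * g x) / 2)"
    unfolding fourier_torus by (simp add: field_simps)
  also have "\<dots> = ((LINT x|torus. of_real (V x) * wave (- j) x * f x) + (LINT x|torus. of_real (V x) * wave (- j) x * g x)) / 2"
    using i assms(1,2) by simp
  finally show ?thesis unfolding fourier_torus by (simp add: mult_ac)
qed

lemma coefficient_solution_average:
  assumes sol: "coefficient_solution h e V v" and V: "tame_potential V S" and h: "h > 0"
  shows "coefficient_solution h e V (\<lambda>s x. (v s x + v (s + \<sigma>) x) / 2)"
    and "fourier (\<lambda>x. (v s x + v (s + \<sigma>) x) / 2) j = (fourier (v s) j + fourier (v (s + \<sigma>)) j) / 2"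
proof -
  have L: "v t \<in> L2_torus" for t using sol by (simp add: coefficient_solution_def)
  obtain B where B: "V \<in> borel_measurable borel" "\<And>x. \<bar>V x\<bar> \<le> B"
    using V by (auto simp: tame_potential_def)
  show f: "fourier (\<lambda>x. (v s x + v (s + \<sigma>) x) / 2) j = (fourier (v s) j + fourier (v (s + \<sigma>)) j) / 2" for s j
    using fourier_average[OF L L, of "\<lambda>_. 1" 1 s "s + \<sigma>" j] by simp
  have fV: "fourier (\<lambda>x. of_real (V x) * ((v s x + v (s + \<sigma>) x) / 2)) j
     = (fourier (\<lambda>x. of_real (V x) * v s x) j + fourier (\<lambda>x. of_real (V x) * v (s + \<sigma>) x) j) / 2" for s j
    by (rule fourier_average[OF L L B])
  show "coefficient_solution h e V (\<lambda>s x. (v s x + v (s + \<sigma>) x) / 2)"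
    unfolding coefficient_solution_def
  proof (intro conjI allI)
    show "(\<lambda>x. (v t x + v (t + \<sigma>) x) / 2) \<in> L2_torus" for t by (rule L2_average[OF L L])
    fix t
    obtain d1 B1 where 1: "d1 > 0" "\<And>s. \<bar>s - t\<bar> < d1 \<Longrightarrow> ell2_le (fourier (v s)) B1"
      by (rule coefficient_solution_locally_bounded[OF sol]) blast
    obtain d2 B2 where 2: "d2 > 0" "\<And>s. \<bar>s - (t + \<sigma>)\<bar> < d2 \<Longrightarrow> ell2_le (fourier (v s)) B2"
      by (rule coefficient_solution_locally_bounded[OF sol]) blast
    show "\<exists>d>0. \<exists>B. \<forall>s. \<bar>s - t\<bar> < d \<longrightarrow> ell2_le (fourier (\<lambda>x. (v s x + v (s + \<sigma>) x) / 2)) B"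
    proof (intro exI conjI allI impI)
      show "min d1 d2 > 0" using 1 2 by simp
      fix s assume "\<bar>s - t\<bar> < min d1 d2"
      then have "ell2_le (\<lambda>j. (1/2) * (fourier (v s) j + fourier (v (s + \<sigma>)) j)) (norm (1/2::complex) * (B1 + B2))"
        by (intro ell2_le_cmult ell2_le_add 1 2) auto
      then show "ell2_le (fourier (\<lambda>x. (v s x + v (s + \<sigma>) x) / 2)) (norm (1/2::complex) * (B1 + B2))"
        unfolding f by simp
    qed
  next
    fix j t
    let ?d = "\<lambda>t. (of_real (energy h j) * fourier (v t) j + of_real (e\<^sup>2) * fourier (\<lambda>x. of_real (V x) * v t x) j)
           / (\<i> * of_real h)"
    have d: "((\<lambda>s. fourier (v s) j) has_vector_derivative ?d t) (at t)" for t
      using sol by (simp add: coefficient_solution_def)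
    have "((\<lambda>s. s + \<sigma>) has_vector_derivative 1) (at t)"
      by (auto intro!: derivative_eq_intros simp: has_real_derivative_iff_has_vector_derivative[symmetric])
    from vector_diff_chain_at[OF this d]
    have d': "((\<lambda>s. fourier (v (s + \<sigma>)) j) has_vector_derivative ?d (t + \<sigma>)) (at t)"
      by (simp add: o_def)
    have "((\<lambda>s. (1/2) * (fourier (v s) j + fourier (v (s + \<sigma>)) j)) has_vector_derivative (1/2) * (?d t + ?d (t + \<sigma>))) (at t)"
      by (intro has_vector_derivative_mult_right has_vector_derivative_add d d')
    moreover have "(\<lambda>s. (1/2) * (fourier (v s) j + fourier (v (s + \<sigma>)) j)) = (\<lambda>s. (fourier (v s) j + fourier (v (s + \<sigma>)) j) / 2)"
      by simp
    ultimately have D: "((\<lambda>s. (fourier (v s) j + fourier (v (s + \<sigma>)) j) / 2) has_vector_derivative (1/2) * (?d t + ?d (t + \<sigma>))) (at t)"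
      by (simp only:)
    have "(1/2) * (?d t + ?d (t + \<sigma>)) = (of_real (energy h j) * ((fourier (v t) j + fourier (v (t + \<sigma>)) j) / 2)
       + of_real (e\<^sup>2) * ((fourier (\<lambda>x. of_real (V x) * v t x) j + fourier (\<lambda>x. of_real (V x) * v (t + \<sigma>) x) j) / 2)) / (\<i> * of_real h)"
      using h by (simp add: field_simps)
    from has_vector_derivative_eq_rhs[OF D this]
    show "((\<lambda>s. fourier (\<lambda>x. (v s x + v (s + \<sigma>) x) / 2) j) has_vector_derivative
        (of_real (energy h j) * fourier (\<lambda>x. (v t x + v (t + \<sigma>) x) / 2) j
          + of_real (e\<^sup>2) * fourier (\<lambda>x. of_real (V x) * ((v t x + v (t + \<sigma>) x) / 2)) j) / (\<i> * of_real h)) (at t)"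
      unfolding f fV .
  qed
qed

text \<open>Averages of time translates of a solution are solutions, so their norms are conserved; up to
  an error controlled by the potential they are Fourier multipliers of the solution itself.\<close>

lemma low_energy_propagation:
  assumes sol: "coefficient_solution h e V v" and V: "tame_potential V S" and h: "h > 0" and \<alpha>: "\<alpha> \<ge> 0"
    and c0: "ell2_le (fourier (v 0)) 1"
  defines "\<mu> \<equiv> \<lambda>j. (1 + cis (- (\<alpha> * energy h j))) / 2"
  assumes low: "ell2_le (\<lambda>j. \<mu> j ^ n * fourier (v 0) j) \<rho>"
  shows "ell2_le (\<lambda>j. \<mu> j ^ n * fourier (v s) j) (\<rho> + 2 * (real n * (\<alpha> * e\<^sup>2 * S)))"
proof -
  define \<delta> where "\<delta> = \<alpha> * e\<^sup>2 * S"
  have \<delta>: "\<delta> \<ge> 0" using \<alpha> V by (simp add: \<delta>_def tame_potential_def)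
  define w where "w m = shift_average (h * \<alpha>) m v" for m
  have w: "coefficient_solution h e V (w m) \<and> (\<forall>s. ell2_le (fourier (w m s)) 1) \<and>
     (\<forall>s. ell2_le (\<lambda>j. fourier (w m s) j - \<mu> j ^ m * fourier (v s) j) (real m * \<delta>))" for m
  proof (induction m)
    case 0
    have "ell2_le (\<lambda>j. 0::complex) 0" by (simp add: ell2_le_def L2_set_def)
    then show ?case
      using sol norm_conservation[OF sol V h c0] by (auto simp: w_def)
  next
    case (Suc m)
    then have s: "coefficient_solution h e V (w m)" and c1: "\<And>s. ell2_le (fourier (w m s)) 1"
      and er: "\<And>s. ell2_le (\<lambda>j. fourier (w m s) j - \<mu> j ^ m * fourier (v s) j) (real m * \<delta>)" by auto
    have ws: "w (Suc m) = (\<lambda>s x. (w m s x + w m (s + h * \<alpha>) x) / 2)" by (simp add: w_def)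
    note avg = coefficient_solution_average[OF s V h, where \<sigma>="h * \<alpha>"]
    have f: "fourier (w (Suc m) s) j = (1/2) * (fourier (w m s) j + fourier (w m (s + h * \<alpha>)) j)" for s j
      unfolding ws avg(2) by simp
    have "ell2_le (fourier (w (Suc m) s)) 1" for s
    proof -
      have "ell2_le (\<lambda>j. (1/2) * (fourier (w m s) j + fourier (w m (s + h * \<alpha>)) j)) (norm (1/2::complex) * (1 + 1))"
        by (intro ell2_le_cmult ell2_le_add c1)
      then show ?thesis by (simp add: f[abs_def])
    qed
    moreover have "ell2_le (\<lambda>j. fourier (w (Suc m) s) j - \<mu> j ^ Suc m * fourier (v s) j) (real (Suc m) * \<delta>)" for s
    proof -
      let ?r = "\<lambda>j. fourier (w m s) j - \<mu> j ^ m * fourier (v s) j"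
      let ?z = "\<lambda>j. cis (- (\<alpha> * energy h j))"
      have z: "ell2_le (\<lambda>j. ?z j * ?r j) (real m * \<delta>)"
        by (rule ell2_le_norm_mono[OF er[of s]]) (simp add: norm_mult)
      \<comment> \<open>The new error is half of the old error, plus half of the error of one time
        shift, plus half of the old error times a phase of modulus 1. One averaging step thus adds
        at most \<delta>.\<close>
      have "ell2_le (\<lambda>j. (1/2) * (?r j + ((fourier (w m (s + h * \<alpha>)) j - ?z j * fourier (w m s) j) + ?z j * ?r j)))
         (norm (1/2::complex) * (real m * \<delta> + (\<delta> + real m * \<delta>)))"
        unfolding \<delta>_def by (intro ell2_le_cmult ell2_le_add er[unfolded \<delta>_def] z[unfolded \<delta>_def] shift_error[OF s V h \<alpha> c1])
      moreover have "(1/2) * (?r j + ((fourier (w m (s + h * \<alpha>)) j - ?z j * fourier (w m s) j) + ?z j * ?r j))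
         = fourier (w (Suc m) s) j - \<mu> j ^ Suc m * fourier (v s) j" for j
        unfolding f by (simp add: \<mu>_def field_simps)
      moreover have "norm (1/2::complex) * (real m * \<delta> + (\<delta> + real m * \<delta>)) \<le> real (Suc m) * \<delta>"
        using \<delta> by (simp add: field_simps)
      ultimately show ?thesis by (simp only: ell2_le_mono)
    qed
    ultimately show ?case using avg(1) by (simp add: ws)
  qed
  \<comment> \<open>The path is: multiplier at time 0, averaged solution at time 0, averaged
    solution at time \<open>s\<close>, multiplier at time \<open>s\<close>. The middle passage is
    norm conservation; each of the two comparisons costs \<open>real n * \<delta>\<close>, which
    explains the factor 2.\<close>
  have "ell2_le (\<lambda>j. \<mu> j ^ n * fourier (v 0) j + (fourier (w n 0) j - \<mu> j ^ n * fourier (v 0) j)) (\<rho> + real n * \<delta>)"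
    using w by (intro ell2_le_add low) auto
  then have "ell2_le (fourier (w n 0)) (\<rho> + real n * \<delta>)" by simp
  then have 1: "ell2_le (fourier (w n s)) (\<rho> + real n * \<delta>)"
    using norm_conservation[OF _ V h] w by blast
  have "ell2_le (\<lambda>j. \<mu> j ^ n * fourier (v s) j - fourier (w n s) j) (real n * \<delta>)"
    by (rule ell2_le_norm_mono[OF w[of n, THEN conjunct2, THEN conjunct2, rule_format, of s]]) (simp add: norm_minus_commute)
  from ell2_le_add[OF 1 this] show ?thesis by (simp add: \<delta>_def algebra_simps)
qed

subsection \<open>The flat function\<close>

text \<open>For \<open>n = 0\<close> this is the classical function \<open>exp (- 1/x)\<close>, flat
  at 0. With the additional powers the span of the family is closed under differentiation and under
  division by \<open>x\<close>; the latter is how a cut-off in \<eta> is divided by \<eta> while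
  remaining bounded and Lipschitz.\<close>

definition flat :: "nat \<Rightarrow> real \<Rightarrow> real" where
  "flat n x = (if x > 0 then (1 / x) ^ n * exp (- (1 / x)) else 0)"

lemma flat_nonneg: "0 \<le> flat n x"
  by (simp add: flat_def)

lemma flat_nonpos_arg: "x \<le> 0 \<Longrightarrow> flat n x = 0"
  by (simp add: flat_def)

lemma flat_step: "flat n x = x * flat (Suc n) x"
  by (simp add: flat_def)

lemma power_le_fact_exp: "y ^ n \<le> fact n * exp y" if "y \<ge> 0" for y :: real
proof -
  have "(\<Sum>k\<in>{n}. inverse (fact k) * y ^ k) \<le> (\<Sum>k. inverse (fact k) * y ^ k)"
    using summable_exp[of y] that by (intro sum_le_suminf) (auto)
  then have "y ^ n / fact n \<le> exp y"
    by (simp add: exp_def divide_inverse mult.commute scaleR_conv_of_real)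
  then show ?thesis by (simp add: pos_divide_le_eq mult.commute)
qed

lemma flat_le: "flat n x \<le> fact n"
proof (cases "x > 0")
  case True
  then have "(1 / x) ^ n * exp (- (1 / x)) \<le> (fact n * exp (1 / x)) * exp (- (1 / x))"
    by (intro mult_right_mono power_le_fact_exp) auto
  also have "\<dots> = fact n" by (simp add: exp_minus)
  finally show ?thesis using True by (simp add: flat_def)
qed (simp add: flat_nonpos_arg)

lemma flat_has_real_derivative:
  "(flat n has_real_derivative (flat (n + 2) x - real n * flat (n + 1) x)) (at x)"
proof -
  consider "x > 0" | "x < 0" | "x = 0" by linarith
  then show ?thesis
  proof cases
    case 1
    have d: "((\<lambda>x. (1 / x) ^ n * exp (- (1 / x))) has_real_derivative (flat (n + 2) x - real n * flat (n + 1) x)) (at x)"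
      using 1 by (auto intro!: derivative_eq_intros simp: flat_def)
        (cases n; simp add: field_simps power2_eq_square)
    show ?thesis
      by (rule has_field_derivative_transform_within_open[OF d, of "{0<..}"]) (use 1 in \<open>auto simp: flat_def\<close>)
  next
    case 2
    have d: "((\<lambda>x. 0) has_real_derivative 0) (at x)" by simp
    have "(flat n has_real_derivative 0) (at x)"
      by (rule has_field_derivative_transform_within_open[OF d, of "{..<0}"]) (use 2 in \<open>auto simp: flat_def\<close>)
    then show ?thesis using 2 by (simp add: flat_nonpos_arg)
  next
    case 3
    \<comment> \<open>Two applications of \<open>flat_step\<close> show that the difference quotient
      at 0 is \<open>h\<close> times a bounded function.\<close>
    have b: "norm ((flat n (0 + h) - flat n 0) / h) \<le> \<bar>h\<bar> * fact (Suc (Suc n))" for h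
    proof -
      have "flat n h / h = (if h = 0 then 0 else h * flat (Suc (Suc n)) h)"
        using flat_step[of n h] flat_step[of "Suc n" h] by simp
      moreover have "\<bar>h * flat (Suc (Suc n)) h\<bar> \<le> \<bar>h\<bar> * fact (Suc (Suc n))"
        unfolding abs_mult using flat_le[of "Suc (Suc n)" h] flat_nonneg[of "Suc (Suc n)" h]
        by (intro mult_left_mono) auto
      ultimately show ?thesis by (simp add: flat_nonpos_arg)
    qed
    have "((\<lambda>h. (flat n (0 + h) - flat n 0) / h) \<longlongrightarrow> 0) (at 0)"
    proof (rule Lim_null_comparison)
      show "((\<lambda>h. \<bar>h\<bar> * fact (Suc (Suc n))) \<longlongrightarrow> 0) (at (0::real))"
        by (auto intro!: tendsto_eq_intros)
    qed (use b in \<open>intro always_eventually allI\<close>)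
    then have "(flat n has_real_derivative 0) (at 0)" by (simp add: DERIV_def)
    then show ?thesis using 3 by (simp add: flat_nonpos_arg)
  qed
qed

lemma flat_lipschitz: "\<bar>flat n x - flat n y\<bar> \<le> (fact (n + 2) + real n * fact (n + 1)) * \<bar>x - y\<bar>"
proof -
  have "norm (flat n x - flat n y) \<le> (fact (n + 2) + real n * fact (n + 1)) * norm (x - y)"
  proof (rule field_differentiable_bound[where S=UNIV])
    show "(flat n has_field_derivative (flat (n + 2) z - real n * flat (n + 1) z)) (at z within UNIV)" for z
      using flat_has_real_derivative by simp
    fix z
    have "\<bar>flat (n + 2) z - real n * flat (n + 1) z\<bar> \<le> \<bar>flat (n + 2) z\<bar> + \<bar>real n * flat (n + 1) z\<bar>"
      by (rule abs_triangle_ineq4)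
    also have "\<dots> \<le> fact (n + 2) + real n * fact (n + 1)"
      using flat_le[of "n + 2" z] flat_le[of "n + 1" z] flat_nonneg[of "n + 2" z] flat_nonneg[of "n + 1" z]
      by (intro add_mono) (auto simp only: abs_mult abs_of_nonneg of_nat_0_le_iff intro: mult_left_mono)
    finally show "norm (flat (n + 2) z - real n * flat (n + 1) z) \<le> fact (n + 2) + real n * fact (n + 1)"
      by simp
  qed auto
  then show ?thesis by simp
qed

lemma continuous_flat: "continuous_on S (flat n)"
  by (meson DERIV_isCont continuous_at_imp_continuous_on flat_has_real_derivative)

text \<open>Because \<open>flat 0\<close> tends to 1 at infinity, dilating its argument recovers the
  indicator of the open half line.\<close>

lemma flat_scale_limit:
  "((\<lambda>m. flat 0 (real m * x)) \<longlongrightarrow> (if x > 0 then 1 else 0)) sequentially"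
proof (cases "x > 0")
  case True
  have "((\<lambda>m. exp (- (1 / (real m * x)))) \<longlongrightarrow> 1) sequentially"
    using True by real_asymp
  moreover have "eventually (\<lambda>m. exp (- (1 / (real m * x))) = flat 0 (real m * x)) sequentially"
    using eventually_gt_at_top[of 0] by eventually_elim (use True in \<open>simp add: flat_def\<close>)
  ultimately show ?thesis using True by (simp add: filterlim_cong)
next
  case False
  then have "flat 0 (real m * x) = 0" for m by (intro flat_nonpos_arg) (simp add: mult_le_0_iff)
  then show ?thesis using False by simp
qed

subsection \<open>A class of smooth functions\<close>

text \<open>Being closed under directional derivatives, every function in this class is smooth.\<close>

inductive_set SM :: "('a::euclidean_space \<Rightarrow> complex) set" where
  SM_const: "(\<lambda>_. c) \<in> SM"
| SM_lin: "bounded_linear l \<Longrightarrow> (\<lambda>x. of_real (l x)) \<in> SM"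
| SM_add: "f \<in> SM \<Longrightarrow> g \<in> SM \<Longrightarrow> (\<lambda>x. f x + g x) \<in> SM"
| SM_mult: "f \<in> SM \<Longrightarrow> g \<in> SM \<Longrightarrow> (\<lambda>x. f x * g x) \<in> SM"
| SM_exp: "bounded_linear l \<Longrightarrow> (\<lambda>x. exp (c * of_real (l x))) \<in> SM"
| SM_flat: "bounded_linear l \<Longrightarrow> (\<lambda>x. of_real (flat n (l x + d))) \<in> SM"

lemma SM_derivative:
  "f \<in> SM \<Longrightarrow> \<exists>f'. (\<forall>x. (f has_derivative f' x) (at x)) \<and> (\<forall>b. (\<lambda>x. f' x b) \<in> SM)"
proof (induction rule: SM.induct)
  case (SM_const c)
  show ?case by (rule exI[of _ "\<lambda>x y. 0"]) (auto intro: SM.intros)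
next
  case (SM_lin l)
  then show ?case
    by (intro exI[of _ "\<lambda>x y. of_real (l y)"] conjI allI)
       (auto intro: SM.intros bounded_linear_imp_has_derivative bounded_linear_compose[OF bounded_linear_of_real])
next
  case (SM_add f g)
  then obtain f' g' where *: "\<And>x. (f has_derivative f' x) (at x)" "\<And>b. (\<lambda>x. f' x b) \<in> SM"
    "\<And>x. (g has_derivative g' x) (at x)" "\<And>b. (\<lambda>x. g' x b) \<in> SM" by blast
  show ?case
    by (rule exI[of _ "\<lambda>x y. f' x y + g' x y"]) (auto intro!: has_derivative_add * SM.intros)
next
  case (SM_mult f g)
  then obtain f' g' where *: "\<And>x. (f has_derivative f' x) (at x)" "\<And>b. (\<lambda>x. f' x b) \<in> SM"
    "\<And>x. (g has_derivative g' x) (at x)" "\<And>b. (\<lambda>x. g' x b) \<in> SM" by blast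
  show ?case
    by (rule exI[of _ "\<lambda>x y. f x * g' x y + f' x y * g x"])
       (auto intro!: has_derivative_mult * SM.intros SM_mult)
next
  case (SM_exp l c)
  have d: "((\<lambda>x. exp (c * of_real (l x))) has_derivative (\<lambda>y. exp (c * of_real (l x)) * (c * of_real (l y)))) (at x)" for x
  proof -
    have g: "((\<lambda>x. c * of_real (l x)) has_derivative (\<lambda>y. c * of_real (l y))) (at x)"
      by (intro bounded_linear_imp_has_derivative bounded_linear_const_mult
          bounded_linear_compose[OF bounded_linear_of_real SM_exp])
    have "(exp has_derivative (*) (exp (c * of_real (l x)))) (at (c * of_real (l x)))"
      using DERIV_exp[of "c * of_real (l x)"] by (simp add: has_field_derivative_def)
    from has_derivative_compose[OF g this] show ?thesis .
  qed
  show ?case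
    by (rule exI[of _ "\<lambda>x y. exp (c * of_real (l x)) * (c * of_real (l y))"])
       (auto intro!: d SM.intros SM_exp)
next
  case (SM_flat l n d)
  let ?D = "\<lambda>x. flat (n + 2) (l x + d) - real n * flat (n + 1) (l x + d)"
  have dd: "((\<lambda>x. complex_of_real (flat n (l x + d))) has_derivative (\<lambda>y. of_real (?D x * l y))) (at x)" for x
  proof -
    have g: "((\<lambda>x. l x + d) has_derivative l) (at x)"
      using bounded_linear_imp_has_derivative[OF SM_flat] by (auto intro!: derivative_eq_intros)
    have "(flat n has_derivative (*) (?D x)) (at (l x + d))"
      using flat_has_real_derivative[of n "l x + d"] by (simp add: has_field_derivative_def)
    from has_derivative_of_real[OF has_derivative_compose[OF g this]] show ?thesis .
  qed
  have "(\<lambda>x. (of_real (flat (n + 2) (l x + d)) + (- of_nat n) * of_real (flat (n + 1) (l x + d))) * of_real (l b)) \<in> SM" for b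
    by (intro SM.intros SM_flat)
  then have "(\<lambda>x. complex_of_real (?D x * l b)) \<in> SM" for b by simp
  then show ?case using dd by (intro exI[of _ "\<lambda>x y. of_real (?D x * l y)"]) blast
qed

lemma SM_frechet_derivative:
  assumes "f \<in> SM"
  shows "f differentiable (at x)" "(\<lambda>x. frechet_derivative f (at x) b) \<in> SM"
proof -
  obtain f' where *: "\<And>x. (f has_derivative f' x) (at x)" "\<And>b. (\<lambda>x. f' x b) \<in> SM"
    using SM_derivative[OF assms] by blast
  show "f differentiable (at x)" using *(1) by (auto simp: differentiable_def)
  have "frechet_derivative f (at x) = f' x" for x
    using *(1) by (rule frechet_derivative_at[symmetric])
  then show "(\<lambda>x. frechet_derivative f (at x) b) \<in> SM" using *(2) by simp
qed

lemma SM_continuous: "f \<in> SM \<Longrightarrow> continuous_on S f"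
  using SM_frechet_derivative(1) by (meson continuous_at_imp_continuous_on differentiable_imp_continuous_within)

lemma SM_smooth: "f \<in> SM \<Longrightarrow> smooth f"
proof -
  assume f: "f \<in> SM"
  have "iter_deriv bs f \<in> SM" for bs
    by (induction bs) (use f SM_frechet_derivative(2) in auto)
  then show "smooth f"
    unfolding smooth_def Ck_def using SM_frechet_derivative(1) SM_continuous by blast
qed

lemma SM_compose_linear:
  assumes "f \<in> SM" "bounded_linear l"
  shows "(\<lambda>x. f (l x)) \<in> SM"
  using assms(1)
proof (induction rule: SM.induct)
  case (SM_lin k)
  show ?case by (rule SM.SM_lin[OF bounded_linear_compose[OF SM_lin assms(2)]])
next
  case (SM_exp k c)
  show ?case by (rule SM.SM_exp[OF bounded_linear_compose[OF SM_exp assms(2)]])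
next
  case (SM_flat k n d)
  show ?case by (rule SM.SM_flat[OF bounded_linear_compose[OF SM_flat assms(2)]])
qed (auto intro: SM.intros)

lemma SM_wave: "wave k \<in> SM"
  using SM_exp[OF bounded_linear_inner_right[of "ivec k"], of "2 * \<i> * of_real pi"]
  by (simp add: wave_def[abs_def])

subsection \<open>Test symbols\<close>

text \<open>A smooth cut-off to large \<eta> near one end, selected by \<sigma> = 1 or \<sigma> =
  -1. On the side of that end it is \<open>exp (- R / \<bar>\<eta>\<bar>)\<close>, so in the
  coordinate \<open>s = 1/\<eta>\<close> it is \<open>exp (- R * \<sigma> * s)\<close>, which is
  smooth up to and across infinity.\<close>

definition end_cutoff :: "real \<Rightarrow> real \<Rightarrow> ereal \<Rightarrow> real" where
  "end_cutoff \<sigma> R \<eta> = (case \<eta> of ereal r \<Rightarrow> flat 0 (\<sigma> * r / R)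
     | PInfty \<Rightarrow> (if \<sigma> > 0 then 1 else 0) | MInfty \<Rightarrow> (if \<sigma> < 0 then 1 else 0))"

lemma end_cutoff_simps [simp]:
  "end_cutoff \<sigma> R (ereal r) = flat 0 (\<sigma> * r / R)"
  "end_cutoff \<sigma> R \<infinity> = (if \<sigma> > 0 then 1 else 0)"
  "end_cutoff \<sigma> R (- \<infinity>) = (if \<sigma> < 0 then 1 else 0)"
  by (simp_all add: end_cutoff_def)

text \<open>What is asked of a factor in \<eta> so that its products with smooth functions of
  \<open>x\<close> and \<xi> are smooth symbols. The two functions \<open>b\<close> are the
  extensions across the ends in the coordinate \<open>s = 1/\<eta>\<close>.\<close>

definition smooth_end :: "(ereal \<Rightarrow> real) \<Rightarrow> bool" where
  "smooth_end W \<longleftrightarrow> continuous_on UNIV W \<and> (\<forall>\<eta>. 0 \<le> W \<eta> \<and> W \<eta> \<le> 1) \<and>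
     (\<lambda>r. complex_of_real (W (ereal r))) \<in> SM \<and>
     (\<exists>b\<in>SM. b 0 = complex_of_real (W \<infinity>) \<and> (\<forall>s>0. b s = of_real (W (ereal (1 / s))))) \<and>
     (\<exists>b\<in>SM. b 0 = complex_of_real (W (- \<infinity>)) \<and> (\<forall>s<0. b s = of_real (W (ereal (1 / s)))))"

lemma smooth_end_1: "smooth_end (\<lambda>_. 1)"
  unfolding smooth_end_def by (auto intro!: bexI[of _ "\<lambda>_. 1"] SM.intros)

lemma at_minus_infty_ereal: "at (- \<infinity> :: ereal) = filtermap ereal at_bot"
proof -
  have "at (- \<infinity> :: ereal) = at_right (- \<infinity>)"
    by (rule filter_eqI) (auto simp: eventually_at_filter elim!: eventually_mono)
  then show ?thesis by (simp add: at_right_MInf)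
qed

lemma smooth_end_cutoff:
  assumes "\<sigma> = 1 \<or> \<sigma> = -1" "R > 0"
  shows "smooth_end (end_cutoff \<sigma> R)"
proof -
  have c: "isCont (end_cutoff \<sigma> R) \<eta>" for \<eta>
  proof (cases \<eta>)
    case (real r)
    have "((\<lambda>r. flat 0 (\<sigma> * r / R)) \<longlongrightarrow> flat 0 (\<sigma> * r / R)) (at r)"
      by (rule isCont_tendsto_compose[where g="flat 0"])
         (auto intro!: tendsto_eq_intros DERIV_isCont flat_has_real_derivative simp: assms(2)[THEN less_imp_neq, symmetric])
    then show ?thesis unfolding real isCont_def unfolding at_ereal filterlim_filtermap by simp
  next
    case PInf
    show ?thesis
    proof (cases "\<sigma> = 1")
      case True
      have "((\<lambda>r. exp (- (1 / (r / R)))) \<longlongrightarrow> 1) at_top" using assms(2) by real_asymp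
      moreover have "eventually (\<lambda>r. exp (- (1 / (r / R))) = flat 0 (r / R)) at_top"
        using eventually_gt_at_top[of 0] by eventually_elim (use assms(2) in \<open>simp add: flat_def\<close>)
      ultimately have "((\<lambda>r. flat 0 (r / R)) \<longlongrightarrow> 1) at_top" by (simp add: filterlim_cong)
      then show ?thesis unfolding PInf isCont_def unfolding at_infty_ereal_eq_at_top filterlim_filtermap by (simp add: True)
    next
      case False
      have "eventually (\<lambda>r. flat 0 (\<sigma> * r / R) = 0) at_top"
        using eventually_gt_at_top[of 0] by eventually_elim (use assms False in \<open>auto simp: flat_def divide_less_0_iff\<close>)
      then have "((\<lambda>r. flat 0 (\<sigma> * r / R)) \<longlongrightarrow> 0) at_top" by (rule tendsto_eventually)
      then show ?thesis unfolding PInf isCont_def unfolding at_infty_ereal_eq_at_top filterlim_filtermap using False assms(1) by auto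
    qed
  next
    case MInf
    have MInf': "\<eta> = - \<infinity>" using MInf by simp
    show ?thesis
    proof (cases "\<sigma> = 1")
      case False
      have "((\<lambda>r. exp (- (1 / (- r / R)))) \<longlongrightarrow> 1) at_bot" using assms(2) by real_asymp
      moreover have "eventually (\<lambda>r. exp (- (1 / (- r / R))) = flat 0 (- r / R)) at_bot"
        using eventually_gt_at_bot[of 0] by eventually_elim (use assms(2) in \<open>simp add: flat_def divide_less_0_iff\<close>)
      ultimately have "((\<lambda>r. flat 0 (- r / R)) \<longlongrightarrow> 1) at_bot" by (simp add: filterlim_cong)
      then show ?thesis unfolding MInf' isCont_def unfolding at_minus_infty_ereal filterlim_filtermap using False assms(1) by auto
    next
      case True
      have "eventually (\<lambda>r. flat 0 (\<sigma> * r / R) = 0) at_bot"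
        using eventually_gt_at_bot[of 0] by eventually_elim (use assms True in \<open>auto simp: flat_def zero_less_divide_iff\<close>)
      then have "((\<lambda>r. flat 0 (\<sigma> * r / R)) \<longlongrightarrow> 0) at_bot" by (rule tendsto_eventually)
      then show ?thesis unfolding MInf' isCont_def unfolding at_minus_infty_ereal filterlim_filtermap by (simp add: True)
    qed
  qed
  have b: "0 \<le> end_cutoff \<sigma> R \<eta> \<and> end_cutoff \<sigma> R \<eta> \<le> 1" for \<eta>
    using flat_le[of 0] flat_nonneg[of 0] by (cases \<eta>) (auto simp: end_cutoff_def)
  have s: "(\<lambda>r. complex_of_real (end_cutoff \<sigma> R (ereal r))) \<in> SM"
    using SM_flat[OF bounded_linear_mult_right[of "\<sigma> / R"], of 0 0] by simp
  \<comment> \<open>The extension across the selected end; across the other end the cut-off is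
    extended by zero.\<close>
  have e: "(\<lambda>s::real. complex_of_real (exp (- (R * \<sigma>) * s))) \<in> SM"
    using SM_exp[OF bounded_linear_mult_right[of "- (R * \<sigma>)"], of 1] by (simp add: exp_of_real[symmetric])
  have z: "(\<lambda>s::real. 0::complex) \<in> SM" by (rule SM_const)
  have p: "\<exists>b\<in>SM. b 0 = complex_of_real (end_cutoff \<sigma> R \<infinity>) \<and> (\<forall>s>0. b s = of_real (end_cutoff \<sigma> R (ereal (1 / s))))"
  proof (cases "\<sigma> = 1")
    case True
    then show ?thesis using assms by (intro bexI[OF _ e]) (auto simp: flat_def mult.commute)
  next
    case False
    then show ?thesis using assms by (intro bexI[OF _ z]) (auto simp: flat_def mult_less_0_iff divide_less_0_iff)
  qed
  have m: "\<exists>b\<in>SM. b 0 = complex_of_real (end_cutoff \<sigma> R (- \<infinity>)) \<and> (\<forall>s<0. b s = of_real (end_cutoff \<sigma> R (ereal (1 / s))))"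
  proof (cases "\<sigma> = 1")
    case False
    then show ?thesis using assms
      by (intro bexI[OF _ e]) (auto simp: flat_def mult.commute divide_less_0_iff zero_less_mult_iff mult_less_0_iff)
  next
    case True
    then show ?thesis using assms by (intro bexI[OF _ z]) (auto simp: flat_def zero_less_mult_iff zero_less_divide_iff)
  qed
  show ?thesis
    unfolding smooth_end_def using b c s p m
    by (intro conjI) (auto simp: continuous_on_eq_continuous_at)
qed

definition test_symbol :: "(real ^ 2 \<Rightarrow> real) \<Rightarrow> (ereal \<Rightarrow> real) \<Rightarrow> int ^ 2 \<Rightarrow> symbol" where
  "test_symbol \<beta> W k = (\<lambda>x \<xi> \<eta>. of_real (\<beta> \<xi>) * of_real (W \<eta>) * wave (- k) x)"

lemma periodic_cmult_wave: "periodic (\<lambda>x. c * wave k x)"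
  using periodic_wave[of k] by (simp add: periodic_def)

lemma sym_Cinf_c:
  assumes \<beta>: "(\<lambda>\<xi>. of_real (\<beta> \<xi>)) \<in> SM" and supp: "\<And>\<xi>. norm \<xi> > R \<Longrightarrow> \<beta> \<xi> = 0" and W: "smooth_end W"
  shows "test_symbol \<beta> W k \<in> Cinf_c"
proof -
  have prod: "(\<lambda>p :: (real^2) \<times> (real^2) \<times> real. of_real (\<beta> (fst (snd p))) * b (snd (snd p)) * wave (- k) (fst p)) \<in> SM"
    if "b \<in> SM" for b
    by (intro SM_mult SM_compose_linear[OF \<beta>] SM_compose_linear[OF that] SM_compose_linear[OF SM_wave]
        bounded_linear_compose[OF bounded_linear_fst bounded_linear_snd]
        bounded_linear_compose[OF bounded_linear_snd bounded_linear_snd] bounded_linear_fst)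
  have "smooth_symbol (test_symbol \<beta> W k)"
    unfolding smooth_symbol_def
  proof (intro conjI)
    have "(\<lambda>r. complex_of_real (W (ereal r))) \<in> SM" using W by (simp add: smooth_end_def)
    from SM_smooth[OF prod[OF this]]
    show "smooth (\<lambda>(x, \<xi>, \<eta>). test_symbol \<beta> W k x \<xi> (ereal \<eta>))"
      by (simp add: test_symbol_def case_prod_unfold)
    obtain b where b: "b \<in> SM" "b 0 = complex_of_real (W \<infinity>)" "\<forall>s>0. b s = of_real (W (ereal (1 / s)))"
      using W by (auto simp: smooth_end_def)
    show "\<exists>b :: (real ^ 2) \<times> (real ^ 2) \<times> real \<Rightarrow> complex. smooth b \<and>
        (\<forall>x \<xi>. b (x, \<xi>, 0) = test_symbol \<beta> W k x \<xi> \<infinity> \<and> (\<forall>s>0. b (x, \<xi>, s) = test_symbol \<beta> W k x \<xi> (ereal (1 / s))))"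
      by (rule exI, rule conjI, rule SM_smooth[OF prod[OF b(1)]]) (use b in \<open>simp add: test_symbol_def\<close>)
    obtain b where b: "b \<in> SM" "b 0 = complex_of_real (W (- \<infinity>))" "\<forall>s<0. b s = of_real (W (ereal (1 / s)))"
      using W by (auto simp: smooth_end_def)
    show "\<exists>b :: (real ^ 2) \<times> (real ^ 2) \<times> real \<Rightarrow> complex. smooth b \<and>
        (\<forall>x \<xi>. b (x, \<xi>, 0) = test_symbol \<beta> W k x \<xi> (- \<infinity>) \<and> (\<forall>s<0. b (x, \<xi>, s) = test_symbol \<beta> W k x \<xi> (ereal (1 / s))))"
      by (rule exI, rule conjI, rule SM_smooth[OF prod[OF b(1)]]) (use b in \<open>simp add: test_symbol_def\<close>)
  qed
  moreover have "x_periodic (test_symbol \<beta> W k)"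
    unfolding x_periodic_def test_symbol_def by (intro allI periodic_cmult_wave)
  moreover have "compact_support (test_symbol \<beta> W k)"
    unfolding compact_support_def test_symbol_def using supp by (intro exI[of _ R]) auto
  ultimately show ?thesis by (simp add: Cinf_c_def)
qed

text \<open>Every derivative brings down a factor \<open>2 pi i (ivec k \<bullet> b)\<close>. The
  added 1 lets the cube dominate the lower orders, and both bounds use that the supremum is over a
  nonempty set bounded above.\<close>

lemma C3_norm_wave:
  "0 \<le> C3_norm (\<lambda>x. c * wave k x)" "C3_norm (\<lambda>x. c * wave k x) \<le> norm c * (1 + 2 * pi * norm (ivec k)) ^ 3"
proof -
  let ?A = "{norm (iter_deriv bs (\<lambda>x. c * wave k x) x) | bs x. set bs \<subseteq> (Basis :: (real^2) set) \<and> length bs \<le> 3}"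
  have le: "norm (iter_deriv bs (\<lambda>x. c * wave k x) x) \<le> norm c * (1 + 2 * pi * norm (ivec k)) ^ 3"
    if "set bs \<subseteq> Basis" "length bs \<le> 3" for bs x
  proof -
    have "norm (\<Prod>b\<leftarrow>bs. 2 * \<i> * of_real pi * complex_of_real (ivec k \<bullet> b)) \<le> (1 + 2 * pi * norm (ivec k)) ^ length bs"
      using that(1)
    proof (induction bs)
      case (Cons b bs)
      have "\<bar>ivec k \<bullet> b\<bar> \<le> norm (ivec k)" using Cons.prems Basis_le_norm by auto
      then have "norm (2 * \<i> * of_real pi * complex_of_real (ivec k \<bullet> b)) \<le> 1 + 2 * pi * norm (ivec k)"
        by (simp add: norm_mult add_increasing)
      then show ?case using Cons by (auto simp: norm_mult intro!: mult_mono)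
    qed simp
    also have "\<dots> \<le> (1 + 2 * pi * norm (ivec k)) ^ 3"
      using that(2) by (intro power_increasing) auto
    finally show ?thesis
      unfolding iter_deriv_wave by (simp add: norm_mult mult_left_mono)
  qed
  have ne: "norm (iter_deriv [] (\<lambda>x. c * wave k x) 0) \<in> ?A"
    by (intro CollectI exI[of _ "[]"] exI[of _ "0 :: real^2"]) simp
  have bdd: "bdd_above ?A" using le by (auto intro!: bdd_aboveI)
  show "0 \<le> C3_norm (\<lambda>x. c * wave k x)"
    unfolding C3_norm_def by (rule cSup_upper2[OF ne _ bdd]) simp
  show "C3_norm (\<lambda>x. c * wave k x) \<le> norm c * (1 + 2 * pi * norm (ivec k)) ^ 3"
    unfolding C3_norm_def by (rule cSup_least) (use ne le in auto)
qed

text \<open>The C3 norm of a harmonic is at most its amplitude times a constant depending on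
  \<open>k\<close>, so continuity with values in C3 reduces to continuity of the amplitude in \<xi>
  and \<eta>.\<close>

lemma sym_B_space:
  assumes \<beta>: "continuous_on UNIV \<beta>" and supp: "\<And>\<xi>. norm \<xi> > R \<Longrightarrow> \<beta> \<xi> = 0" and W: "continuous_on UNIV W"
  shows "test_symbol \<beta> W k \<in> B_space"
proof -
  define C where "C \<xi> \<eta> = complex_of_real (\<beta> \<xi>) * of_real (W \<eta>)" for \<xi> \<eta>
  define M where "M = (1 + 2 * pi * norm (ivec (- k))) ^ 3"
  have s: "test_symbol \<beta> W k x \<xi> \<eta> = C \<xi> \<eta> * wave (- k) x" for x \<xi> \<eta> by (simp add: test_symbol_def C_def)
  have d: "(\<lambda>x. test_symbol \<beta> W k x \<xi> \<eta> - test_symbol \<beta> W k x \<xi>0 \<eta>0) = (\<lambda>x. (C \<xi> \<eta> - C \<xi>0 \<eta>0) * wave (- k) x)" for \<xi> \<eta> \<xi>0 \<eta>0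
    by (simp add: s left_diff_distrib)
  have cont: "continuous_on UNIV (\<lambda>(\<xi>, \<eta>). C \<xi> \<eta>)"
    unfolding C_def case_prod_unfold
    by (intro continuous_intros continuous_on_compose2[OF \<beta>] continuous_on_compose2[OF W]) auto
  have lim: "((\<lambda>(\<xi>, \<eta>). C3_norm (\<lambda>x. test_symbol \<beta> W k x \<xi> \<eta> - test_symbol \<beta> W k x \<xi>0 \<eta>0)) \<longlongrightarrow> 0) (at (\<xi>0, \<eta>0))" for \<xi>0 \<eta>0
  proof (rule Lim_null_comparison)
    have "((\<lambda>(\<xi>, \<eta>). C \<xi> \<eta>) \<longlongrightarrow> C \<xi>0 \<eta>0) (at (\<xi>0, \<eta>0))"
      using cont by (auto simp: continuous_on_def)
    then have "((\<lambda>p. norm ((\<lambda>(\<xi>, \<eta>). C \<xi> \<eta>) p - C \<xi>0 \<eta>0) * M) \<longlongrightarrow> 0) (at (\<xi>0, \<eta>0))"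
      by (intro tendsto_mult_left_zero tendsto_norm_zero LIM_zero)
    then show "((\<lambda>(\<xi>, \<eta>). norm (C \<xi> \<eta> - C \<xi>0 \<eta>0) * M) \<longlongrightarrow> 0) (at (\<xi>0, \<eta>0))"
      by (simp add: case_prod_unfold)
    show "eventually (\<lambda>p. norm ((\<lambda>(\<xi>, \<eta>). C3_norm (\<lambda>x. test_symbol \<beta> W k x \<xi> \<eta> - test_symbol \<beta> W k x \<xi>0 \<eta>0)) p)
       \<le> (\<lambda>(\<xi>, \<eta>). norm (C \<xi> \<eta> - C \<xi>0 \<eta>0) * M) p) (at (\<xi>0, \<eta>0))"
      unfolding d M_def using C3_norm_wave by (auto intro!: always_eventually)
  qed
  have decay: "\<exists>R. \<forall>\<xi> \<eta>. norm \<xi> > R \<longrightarrow> C3_norm (\<lambda>x. test_symbol \<beta> W k x \<xi> \<eta>) < r" if "r > 0" for r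
  proof (intro exI[of _ R] allI impI)
    fix \<xi> :: "real^2" and \<eta> assume "norm \<xi> > R"
    then have "C \<xi> \<eta> = 0" using supp by (simp add: C_def)
    then show "C3_norm (\<lambda>x. test_symbol \<beta> W k x \<xi> \<eta>) < r"
      unfolding s using C3_norm_wave(2)[of 0 "- k"] that by simp
  qed
  have per: "x_periodic (test_symbol \<beta> W k)"
    unfolding x_periodic_def s by (intro allI periodic_cmult_wave)
  have "Ck 3 (\<lambda>x. test_symbol \<beta> W k x \<xi> \<eta>)" for \<xi> \<eta>
    using smooth_wave[of "C \<xi> \<eta>" "- k"] unfolding s smooth_def by blast
  then show ?thesis
    unfolding B_space_def using per lim decay by simp
qed

text \<open>The Fourier transform of the symbol in \<open>x\<close> is concentrated at
  \<open>- k\<close>, so in the Weyl formula only the input index \<open>q + k\<close> contributes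
  to the output index \<open>q\<close>, and only finitely many \<open>q\<close> see the support in
  \<xi>. The infinite sums of \<open>weyl_op\<close> thereby become finite.\<close>

lemma two_micro_dist_sym:
  assumes f: "f \<in> L2_torus" and Q: "finite Q"
    and Q0: "\<And>q. q \<notin> Q \<Longrightarrow> \<beta> ((pi * h) *\<^sub>R ivec (q + (q + k))) = 0"
  shows "two_micro_dist h eh e f (test_symbol \<beta> W k) =
    (\<Sum>q\<in>Q. of_real (\<beta> ((pi * h) *\<^sub>R ivec (q + (q + k))) * W (ereal (H e ((pi * h) *\<^sub>R ivec (q + (q + k))) / eh)))
        * (cnj (fourier f q) * fourier f (q + k)))"
proof -
  define g where "g \<xi> = \<beta> \<xi> * W (ereal (H e \<xi> / eh))" for \<xi>
  define G where "G q = of_real (g ((pi * h) *\<^sub>R ivec (q + (q + k)))) * fourier f (q + k)" for q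
  have fs: "fourier (\<lambda>y. test_symbol \<beta> W k y \<xi> (ereal (H e \<xi> / eh))) p = (if p = - k then of_real (g \<xi>) else 0)" for \<xi> p
  proof -
    have "test_symbol \<beta> W k y \<xi> (ereal (H e \<xi> / eh)) * wave (- p) y = of_real (g \<xi>) * wave (- k - p) y" for y
      using wave_add[of "- k" "- p" y] by (simp add: test_symbol_def g_def mult.assoc)
    then have "fourier (\<lambda>y. test_symbol \<beta> W k y \<xi> (ereal (H e \<xi> / eh))) p = of_real (g \<xi>) * (LINT y|torus. wave (- k - p) y)"
      unfolding fourier_torus by simp
    also have "\<dots> = (if p = - k then of_real (g \<xi>) else 0)"
      unfolding wave_integral right_minus_eq by auto
    finally show ?thesis .
  qed
  have inner: "(\<Sum>\<^sub>\<infinity>k'. fourier (\<lambda>y. test_symbol \<beta> W k y ((pi * h) *\<^sub>R ivec (q + k')) (ereal (H e ((pi * h) *\<^sub>R ivec (q + k')) / eh))) (q - k') * fourier f k') = G q" for q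
  proof -
    have "(\<Sum>\<^sub>\<infinity>k'. fourier (\<lambda>y. test_symbol \<beta> W k y ((pi * h) *\<^sub>R ivec (q + k')) (ereal (H e ((pi * h) *\<^sub>R ivec (q + k')) / eh))) (q - k') * fourier f k')
      = (\<Sum>\<^sub>\<infinity>k'\<in>{q + k}. of_real (g ((pi * h) *\<^sub>R ivec (q + k'))) * fourier f k')"
      unfolding fs by (rule infsum_cong_neutral) (auto simp: algebra_simps)
    then show ?thesis by (simp add: G_def)
  qed
  have G0: "G q = 0" if "q \<notin> Q" for q using Q0[OF that] by (simp add: G_def g_def)
  have "weyl_op h (\<lambda>x \<xi>. test_symbol \<beta> W k x \<xi> (ereal (H e \<xi> / eh))) f x = trig Q G x" for x
  proof -
    have "weyl_op h (\<lambda>x \<xi>. test_symbol \<beta> W k x \<xi> (ereal (H e \<xi> / eh))) f x = (\<Sum>\<^sub>\<infinity>q. G q * wave q x)"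
      unfolding weyl_op_def inner ..
    also have "\<dots> = (\<Sum>\<^sub>\<infinity>q\<in>Q. G q * wave q x)"
      by (rule infsum_cong_neutral) (auto simp: G0)
    finally show ?thesis using Q by (simp add: trig_def)
  qed
  then have "two_micro_dist h eh e f (test_symbol \<beta> W k) = (LINT x|torus. cnj (f x * cnj (trig Q G x)))"
    unfolding two_micro_dist_def L2_inner_def cell_integral by simp
  also have "\<dots> = cnj (\<Sum>p\<in>Q. cnj (G p) * fourier f p)"
    by (simp only: Bochner_Integration.integral_cnj inner_trig[OF f])
  also have "\<dots> = (\<Sum>q\<in>Q. of_real (g ((pi * h) *\<^sub>R ivec (q + (q + k)))) * (cnj (fourier f q) * fourier f (q + k)))"
    by (simp add: G_def mult_ac)
  finally show ?thesis by (simp only: g_def)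
qed

section \<open>Smooth bumps approximating the indicators of open boxes\<close>

definition box_bump :: "real ^ 2 \<Rightarrow> real ^ 2 \<Rightarrow> nat \<Rightarrow> real ^ 2 \<Rightarrow> real" where
  "box_bump a b N \<xi> = (\<Prod>i\<in>UNIV. flat 0 (real N * (\<xi> $ i - a $ i)) * flat 0 (real N * (b $ i - \<xi> $ i)))"

lemma box_bump_range: "0 \<le> box_bump a b N \<xi>" "box_bump a b N \<xi> \<le> 1"
  unfolding box_bump_def using flat_le[of 0] flat_nonneg[of 0]
  by (auto intro!: prod_nonneg prod_le_1 mult_le_one)

lemma box_bump_outside:
  assumes "\<xi> \<notin> box a b" shows "box_bump a b N \<xi> = 0"
proof -
  obtain i where "\<xi> $ i \<le> a $ i \<or> b $ i \<le> \<xi> $ i"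
    using assms by (auto simp: mem_box_cart not_less)
  then have "flat 0 (real N * (\<xi> $ i - a $ i)) * flat 0 (real N * (b $ i - \<xi> $ i)) = 0"
    by (auto intro!: flat_nonpos_arg mult_nonneg_nonpos)
  then show ?thesis unfolding box_bump_def by (auto intro!: prod_zero)
qed

lemma box_bump_limit: "(\<lambda>N. box_bump a b N \<xi>) \<longlonglongrightarrow> indicator (box a b) \<xi>"
proof -
  have "(\<lambda>N. box_bump a b N \<xi>) \<longlonglongrightarrow> (\<Prod>i\<in>UNIV. (if \<xi> $ i - a $ i > 0 then 1 else 0) * (if b $ i - \<xi> $ i > 0 then 1 else 0))"
    unfolding box_bump_def by (intro tendsto_prod tendsto_mult flat_scale_limit)
  also have "(\<Prod>i\<in>UNIV. (if \<xi> $ i - a $ i > 0 then 1 else 0) * (if b $ i - \<xi> $ i > 0 then 1 else 0)) = (indicator (box a b) \<xi> :: real)"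
    by (auto simp: indicator_def mem_box_cart UNIV_2 forall_2)
  finally show ?thesis .
qed

lemma box_bump_SM: "(\<lambda>\<xi>. complex_of_real (box_bump a b N \<xi>)) \<in> SM"
proof -
  have l: "bounded_linear (\<lambda>\<xi> :: real^2. c * \<xi> $ i)" for c i
    by (intro bounded_linear_const_mult bounded_linear_vec_nth)
  have 1: "(\<lambda>\<xi> :: real^2. complex_of_real (flat 0 (real N * (\<xi> $ i - a $ i)))) \<in> SM" for i
    using SM_flat[OF l[of "real N" i], of 0 "- real N * a $ i"] by (simp add: algebra_simps)
  have 2: "(\<lambda>\<xi> :: real^2. complex_of_real (flat 0 (real N * (b $ i - \<xi> $ i)))) \<in> SM" for i
    using SM_flat[OF l[of "- real N" i], of 0 "real N * b $ i"] by (simp add: algebra_simps)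
  show ?thesis
    unfolding box_bump_def UNIV_2
    using SM_mult[OF SM_mult[OF 1[of 1] 2[of 1]] SM_mult[OF 1[of 2] 2[of 2]]] by simp
qed

lemma continuous_box_bump: "continuous_on S (box_bump a b N)"
  unfolding box_bump_def
  by (intro continuous_intros continuous_on_compose2[OF continuous_flat[of UNIV]]) auto

lemma box_norm_bound:
  fixes a b :: "real ^ 2"
  obtains R where "R > 0" "\<And>\<xi>. \<xi> \<in> box a b \<Longrightarrow> norm \<xi> \<le> R"
  using bounded_box[of a b] unfolding bounded_pos by blast

lemma prod2_diff_le:
  fixes x y x' y' :: real
  assumes "\<bar>x\<bar> \<le> 1" "\<bar>y'\<bar> \<le> 1"
  shows "\<bar>x * y - x' * y'\<bar> \<le> \<bar>x - x'\<bar> + \<bar>y - y'\<bar>"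
proof -
  have "x * y - x' * y' = x * (y - y') + (x - x') * y'" by (simp add: algebra_simps)
  also have "\<bar>\<dots>\<bar> \<le> \<bar>x * (y - y')\<bar> + \<bar>(x - x') * y'\<bar>" by (rule abs_triangle_ineq)
  also have "\<dots> \<le> 1 * \<bar>y - y'\<bar> + \<bar>x - x'\<bar> * 1"
    unfolding abs_mult using assms by (intro add_mono mult_mono) auto
  finally show ?thesis by simp
qed

text \<open>Four factors with values in [0, 1], each with Lipschitz constant
  \<open>2 * real N\<close>, since \<open>flat 0\<close> has Lipschitz constant
  \<open>fact 2\<close>.\<close>

lemma box_bump_lipschitz: "\<bar>box_bump a b N \<xi> - box_bump a b N \<xi>'\<bar> \<le> 8 * real N * norm (\<xi> - \<xi>')"
proof -
  let ?A = "\<lambda>i \<xi>. flat 0 (real N * (\<xi> $ i - a $ i))" and ?B = "\<lambda>i \<xi>. flat 0 (real N * (b $ i - \<xi> $ i))"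
  have r: "\<bar>flat 0 x\<bar> \<le> 1" for x using flat_le[of 0 x] flat_nonneg[of 0 x] by simp
  have c: "\<bar>\<xi> $ i - \<xi>' $ i\<bar> \<le> norm (\<xi> - \<xi>')" for i
    using component_le_norm_cart[of "\<xi> - \<xi>'" i] by simp
  have A: "\<bar>?A i \<xi> - ?A i \<xi>'\<bar> \<le> 2 * real N * norm (\<xi> - \<xi>')" for i
  proof -
    have "\<bar>?A i \<xi> - ?A i \<xi>'\<bar> \<le> 2 * \<bar>real N * (\<xi> $ i - a $ i) - real N * (\<xi>' $ i - a $ i)\<bar>"
      using flat_lipschitz[of 0] by (simp add: numeral_2_eq_2)
    also have "\<dots> = 2 * real N * \<bar>\<xi> $ i - \<xi>' $ i\<bar>" by (simp add: abs_mult flip: right_diff_distrib)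
    also have "\<dots> \<le> 2 * real N * norm (\<xi> - \<xi>')" by (intro mult_left_mono c) auto
    finally show ?thesis .
  qed
  have B: "\<bar>?B i \<xi> - ?B i \<xi>'\<bar> \<le> 2 * real N * norm (\<xi> - \<xi>')" for i
  proof -
    have "\<bar>?B i \<xi> - ?B i \<xi>'\<bar> \<le> 2 * \<bar>real N * (b $ i - \<xi> $ i) - real N * (b $ i - \<xi>' $ i)\<bar>"
      using flat_lipschitz[of 0] by (simp add: numeral_2_eq_2)
    also have "\<dots> = 2 * real N * \<bar>\<xi> $ i - \<xi>' $ i\<bar>" by (simp add: abs_mult abs_minus_commute flip: right_diff_distrib)
    also have "\<dots> \<le> 2 * real N * norm (\<xi> - \<xi>')" by (intro mult_left_mono c) auto
    finally show ?thesis .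
  qed
  have P: "\<bar>?A i \<xi> * ?B i \<xi> - ?A i \<xi>' * ?B i \<xi>'\<bar> \<le> 4 * real N * norm (\<xi> - \<xi>')" for i
    using prod2_diff_le[where x="?A i \<xi>" and y="?B i \<xi>" and x'="?A i \<xi>'" and y'="?B i \<xi>'", OF r r] A[of i] B[of i] by linarith
  have "\<bar>?A 1 \<xi> * ?B 1 \<xi>\<bar> \<le> 1" "\<bar>?A 2 \<xi>' * ?B 2 \<xi>'\<bar> \<le> 1"
    unfolding abs_mult by (intro mult_le_one r abs_ge_zero)+
  from prod2_diff_le[OF this, of "?A 2 \<xi> * ?B 2 \<xi>" "?A 1 \<xi>' * ?B 1 \<xi>'"] P[of 1] P[of 2]
  show ?thesis unfolding box_bump_def UNIV_2 by simp
qed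

lemma integrable_indicator_Icc: "integrable lborel (\<lambda>t. indicator {a..b} t :: complex)" for a b :: real
proof -
  have "integrable lborel (\<lambda>t. complex_of_real (indicator {a..b} t))"
    by (intro integrable_of_real) (simp add: integrable_indicator_iff emeasure_lborel_Icc_eq)
  also have "(\<lambda>t. complex_of_real (indicator {a..b} t)) = (\<lambda>t. indicator {a..b} t)"
    by (auto simp: indicator_def)
  finally show ?thesis .
qed

subsection \<open>Vanishing of functions with vanishing integrals\<close>

text \<open>A pi-lambda argument for complex integrals, pulled back along \<open>X\<close>: the sets
  over which \<open>f\<close> integrates to zero form a Dynkin system, with \<open>total\<close>
  serving the complements.\<close>

lemma integral_zero_sigma_sets:
  fixes f :: "'a \<Rightarrow> complex"
  assumes f: "integrable M f" and X: "\<And>A. A \<in> sigma_sets UNIV G \<Longrightarrow> X -` A \<inter> space M \<in> sets M"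
    and G: "Int_stable G" and zero: "\<And>A. A \<in> G \<Longrightarrow> (LINT z:X -` A \<inter> space M|M. f z) = 0"
    and total: "(LINT z|M. f z) = 0" and A: "A \<in> sigma_sets UNIV G"
  shows "(LINT z:X -` A \<inter> space M|M. f z) = 0"
proof -
  have si: "set_integrable M (X -` A \<inter> space M) f" if "A \<in> sigma_sets UNIV G" for A
    unfolding set_integrable_def using X[OF that] f by (intro integrable_mult_indicator)
  have tot: "(LINT z:X -` UNIV \<inter> space M|M. f z) = 0"
    using total by (simp add: set_lebesgue_integral_def cong: Bochner_Integration.integral_cong)
  have "G \<subseteq> Pow UNIV" by simp
  from G this A show ?thesis
  proof (induction rule: sigma_sets_induct_disjoint)
    case (basic A)
    then show ?case by (rule zero)
  next
    case empty
    show ?case by (simp add: set_lebesgue_integral_def)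
  next
    case (compl A)
    have U: "UNIV \<in> sigma_sets UNIV G" by (rule sigma_sets_top)
    have C: "UNIV - A \<in> sigma_sets UNIV G" using compl.hyps by (rule sigma_sets.Compl)
    have "(LINT z:X -` UNIV \<inter> space M|M. f z) = (LINT z:(X -` A \<inter> space M) \<union> (X -` (UNIV - A) \<inter> space M)|M. f z)"
      by (rule arg_cong[where f="\<lambda>S. set_lebesgue_integral M S f"]) auto
    also have "\<dots> = (LINT z:X -` A \<inter> space M|M. f z) + (LINT z:X -` (UNIV - A) \<inter> space M|M. f z)"
      by (rule set_integral_Un) (auto intro!: si compl C)
    finally show ?case using compl.IH tot by simp
  next
    case (union A)
    have U: "(\<Union>i. A i) \<in> sigma_sets UNIV G" using union.hyps by (intro sigma_sets.Union) auto
    have "(LINT z:X -` (\<Union>i. A i) \<inter> space M|M. f z) = (LINT z:(\<Union>i. X -` A i \<inter> space M)|M. f z)"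
      by (rule arg_cong[where f="\<lambda>S. set_lebesgue_integral M S f"]) auto
    also have "\<dots> = (\<Sum>i. LINT z:X -` A i \<inter> space M|M. f z)"
    proof (rule lebesgue_integral_countable_add)
      show "X -` A i \<inter> space M \<in> sets M" for i using union.hyps by (intro X) auto
      show "(X -` A i \<inter> space M) \<inter> (X -` A j \<inter> space M) = {}" if "i \<noteq> j" for i j
        using union.hyps(1) that unfolding disjoint_family_on_def by blast
      show "set_integrable M (\<Union>i. X -` A i \<inter> space M) f"
        using si[OF U] by (rule back_subst) auto
    qed
    also have "\<dots> = 0" using union.IH by simp
    finally show ?case .
  qed
qed

text \<open>Restriction to \<open>[-N, N]\<close> makes \<open>f\<close> integrable. Its integrals
  over all Borel sets then vanish, since the closed intervals are a generator stable under
  intersection, and uniqueness of densities applies to the real and imaginary parts.\<close>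

lemma AE_zero_of_intervals:
  fixes f :: "real \<Rightarrow> complex"
  assumes f: "\<And>a b. set_integrable lborel {a..b} f"
    and z: "\<And>a b. a \<le> b \<Longrightarrow> (LINT t:{a..b}|lborel. f t) = 0"
  shows "AE t in lborel. f t = 0"
proof -
  have "AE t in lborel. t \<in> {- real N..real N} \<longrightarrow> f t = 0" for N :: nat
  proof -
    let ?I = "{- real N..real N}"
    define h where "h t = indicator ?I t *\<^sub>R f t" for t
    have h: "integrable lborel h" using f[of "- real N" "real N"] by (simp add: h_def[abs_def] set_integrable_def)
    have zero: "(LINT t:(\<lambda>t. t) -` A \<inter> space lborel|lborel. h t) = 0" if "A \<in> sigma_sets UNIV (range (\<lambda>(a, b). {a..b::real}))" for A
    proof (rule integral_zero_sigma_sets[OF h _ _ _ _ that])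
      fix B :: "real set" assume "B \<in> sigma_sets UNIV (range (\<lambda>(a, b). {a..b}))"
      then show "(\<lambda>t. t) -` B \<inter> space lborel \<in> sets lborel"
        by (simp add: borel_eq_atLeastAtMost sets_measure_of)
    next
      show "Int_stable (range (\<lambda>(a, b). {a..b::real}))"
        by (auto simp: Int_stable_def)
    next
      fix B :: "real set" assume "B \<in> range (\<lambda>(a, b). {a..b})"
      then obtain a b where B: "B = {a..b}" by auto
      have "(LINT t:(\<lambda>t. t) -` B \<inter> space lborel|lborel. h t) = (LINT t:{max a (- real N)..min b (real N)}|lborel. f t)"
        unfolding set_lebesgue_integral_def B h_def
        by (intro Bochner_Integration.integral_cong) (auto simp: indicator_def)
      also have "\<dots> = 0"
        using z[of "max a (- real N)" "min b (real N)"]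
        by (cases "max a (- real N) \<le> min b (real N)") (auto simp: set_lebesgue_integral_def)
      finally show "(LINT t:(\<lambda>t. t) -` B \<inter> space lborel|lborel. h t) = 0" .
    next
      show "(LINT t|lborel. h t) = 0"
        using z[of "- real N" "real N"] by (simp add: h_def set_lebesgue_integral_def)
    qed
    have zero': "(LINT t:A|lborel. h t) = 0" if "A \<in> sets lborel" for A
      using zero[of A] that by (simp add: borel_eq_atLeastAtMost sets_measure_of)
    have "AE t in lborel. Re (h t) = 0"
    proof (rule density_unique_real)
      show "(LINT t:A|lborel. Re (h t)) = (LINT t:A|lborel. 0)" if "A \<in> sets lborel" for A
      proof -
        have "integrable lborel (\<lambda>t. indicator A t *\<^sub>R h t)" using h that by (intro integrable_mult_indicator)
        then have "(LINT t:A|lborel. Re (h t)) = Re (LINT t:A|lborel. h t)"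
          unfolding set_lebesgue_integral_def by (simp flip: integral_Re)
        then show ?thesis using zero'[OF that] by (simp add: set_lebesgue_integral_def)
      qed
    qed (use h in \<open>auto intro: integrable_Re\<close>)
    moreover have "AE t in lborel. Im (h t) = 0"
    proof (rule density_unique_real)
      show "(LINT t:A|lborel. Im (h t)) = (LINT t:A|lborel. 0)" if "A \<in> sets lborel" for A
      proof -
        have "integrable lborel (\<lambda>t. indicator A t *\<^sub>R h t)" using h that by (intro integrable_mult_indicator)
        then have "(LINT t:A|lborel. Im (h t)) = Im (LINT t:A|lborel. h t)"
          unfolding set_lebesgue_integral_def by (simp flip: integral_Im)
        then show ?thesis using zero'[OF that] by (simp add: set_lebesgue_integral_def)
      qed
    qed (use h in \<open>auto intro: integrable_Im\<close>)
    ultimately show ?thesis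
      by eventually_elim (auto simp: h_def complex_eq_iff)
  qed
  then have "AE t in lborel. \<forall>N::nat. t \<in> {- real N..real N} \<longrightarrow> f t = 0"
    by (subst AE_all_countable) blast
  then show ?thesis
  proof eventually_elim
    case (elim t)
    obtain N :: nat where "\<bar>t\<bar> \<le> real N" using real_arch_simple by blast
    then have "t \<in> {- real N..real N}" by auto
    then show ?case using elim by blast
  qed
qed

text \<open>Small time integrals alone do not make the functions small at a given time. Here
  pointwise convergence is known beforehand, and dominated convergence shows that the limit has
  integral zero over every interval.\<close>

lemma AE_limit_zero:
  fixes F :: "nat \<Rightarrow> real \<Rightarrow> complex"
  assumes F: "\<And>R a b. set_integrable lborel {a..b} (F R)"
    and M: "\<And>R. AE t in lborel. norm (F R t) \<le> M"
    and small: "\<And>a b. a \<le> b \<Longrightarrow> (\<lambda>R. LINT t:{a..b}|lborel. F R t) \<longlonglongrightarrow> 0"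
    and conv: "AE t in lborel. convergent (\<lambda>R. F R t)"
  shows "AE t in lborel. (\<lambda>R. F R t) \<longlonglongrightarrow> 0"
proof -
  define f where "f t = lim (\<lambda>R. F R t)" for t
  have fl: "AE t in lborel. (\<lambda>R. F R t) \<longlonglongrightarrow> f t"
    using conv by eventually_elim (simp add: f_def convergent_LIMSEQ_iff)
  have meas: "(\<lambda>t. indicator {a..b} t *\<^sub>R f t) \<in> borel_measurable lborel" for a b
  proof -
    have [measurable]: "(\<lambda>t. indicator {a..b} t *\<^sub>R F R t) \<in> borel_measurable lborel" for R
      using F[of a b R] by (auto simp: set_integrable_def)
    have "(\<lambda>t. lim (\<lambda>R. indicator {a..b} t *\<^sub>R F R t)) \<in> borel_measurable lborel" by measurable
    also have "(\<lambda>t. lim (\<lambda>R. indicator {a..b} t *\<^sub>R F R t)) = (\<lambda>t. indicator {a..b} t *\<^sub>R f t)"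
      by (auto simp: fun_eq_iff f_def indicator_def)
    finally show ?thesis .
  qed
  have dom: "integrable lborel (\<lambda>t. indicator {a..b} t *\<^sub>R M)" for a b :: real
    by (intro integrable_mult_indicator borel_integrable_atLeastAtMost'[unfolded set_integrable_def]) auto
  have AEl: "AE t in lborel. (\<lambda>R. indicator {a..b} t *\<^sub>R F R t) \<longlonglongrightarrow> indicator {a..b} t *\<^sub>R f t" for a b
    using fl by eventually_elim (intro tendsto_intros)
  have AEb: "AE t in lborel. norm (indicator {a..b} t *\<^sub>R F R t) \<le> indicator {a..b} t *\<^sub>R M" for a b R
    using M[of R] by eventually_elim (auto simp: indicator_def)
  have measF: "(\<lambda>t. indicator {a..b} t *\<^sub>R F R t) \<in> borel_measurable lborel" for a b R
    using F[of a b R] by (auto simp: set_integrable_def)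
  have "AE t in lborel. f t = 0"
  proof (rule AE_zero_of_intervals)
    show "set_integrable lborel {a..b} f" for a b
      unfolding set_integrable_def
      by (rule integrable_dominated_convergence[OF meas measF dom AEl AEb])
    show "(LINT t:{a..b}|lborel. f t) = 0" if "a \<le> b" for a b
    proof -
      have "(\<lambda>R. LINT t:{a..b}|lborel. F R t) \<longlonglongrightarrow> (LINT t:{a..b}|lborel. f t)"
        unfolding set_lebesgue_integral_def
        by (rule integral_dominated_convergence[OF meas measF dom AEl AEb])
      then show ?thesis using small[OF that] LIMSEQ_unique by blast
    qed
  qed
  with fl show ?thesis by eventually_elim simp
qed

subsection \<open>Limits of the two-microlocal distributions\<close>

lemma symbol_sum_finite:
  assumes "h > 0"
  shows "finite {q. norm ((pi * h) *\<^sub>R ivec (q + (q + k))) \<le> R}"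
proof -
  have "inj (\<lambda>q :: int^2. q + (q + k))" by (auto simp: inj_on_def vec_eq_iff)
  moreover have "finite {q. norm (ivec q) \<le> R / (pi * h)}" by (rule finite_ivec_bounded)
  ultimately have "finite ((\<lambda>q :: int^2. q + (q + k)) -` {q. norm (ivec q) \<le> R / (pi * h)})"
    by (intro finite_vimageI)
  also have "(\<lambda>q :: int^2. q + (q + k)) -` {q. norm (ivec q) \<le> R / (pi * h)} = {q. norm ((pi * h) *\<^sub>R ivec (q + (q + k))) \<le> R}"
    using assms by (auto simp: pos_le_divide_eq mult.commute)
  finally show ?thesis .
qed

lemma form_bound:
  assumes c: "ell2_le c 1" and Q: "finite Q" and M: "0 \<le> M" "\<And>q. norm (G q) \<le> M"
  shows "norm (\<Sum>q\<in>Q. G q * (cnj (c q) * c (q + k :: 'a :: ab_group_add))) \<le> M"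
proof -
  have "norm (\<Sum>q\<in>Q. G q * (cnj (c q) * c (q + k))) \<le> (\<Sum>q\<in>Q. M * (norm (c (id q)) * norm (c (q + k))))"
    using M by (auto intro!: sum_norm_le mult_right_mono simp: norm_mult)
  also have "\<dots> = M * (\<Sum>q\<in>Q. norm (c (id q)) * norm (c (q + k)))" by (simp add: sum_distrib_left)
  also have "\<dots> \<le> M * (1 * 1)"
    using M by (intro mult_left_mono ell2_le_product[OF c c Q]) (auto simp: inj_on_def)
  finally show ?thesis by simp
qed

text \<open>One limit together with the sequence that produces it. The Schroedinger equation appears
  through its Fourier coefficients and the potential through \<open>tame_potential\<close>, the
  forms in which the estimates use them.\<close>

locale two_micro_limit =
  fixes V :: "real ^ 2 \<Rightarrow> real" and \<epsilon> \<tau> :: "real \<Rightarrow> real" and e :: "int ^ 2"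
    and \<mu> :: "real \<Rightarrow> symbol \<Rightarrow> complex" and m :: "real \<Rightarrow> phase_measure"
    and u :: "real \<Rightarrow> real ^ 2 \<Rightarrow> complex" and v :: "real \<Rightarrow> real \<Rightarrow> real ^ 2 \<Rightarrow> complex"
    and hs :: "nat \<Rightarrow> real" and S :: real
  assumes V: "tame_potential V S"
    and eps_pos: "\<And>h. h > 0 \<Longrightarrow> \<epsilon> h > 0"
    and eps_lim: "(\<epsilon> \<longlongrightarrow> 0) (at_right 0)"
    and tau_lim: "filterlim \<tau> at_top (at_right 0)"
    and tau_eps: "\<And>h. h > 0 \<Longrightarrow> \<tau> h * \<epsilon> h \<ge> 1"
    and e_nz: "e \<noteq> 0"
    and sol: "\<And>h. h > 0 \<Longrightarrow> coefficient_solution h (\<epsilon> h) V (v h)"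
    and v0: "\<And>h. h > 0 \<Longrightarrow> fourier (v h 0) = fourier (u h)"
    and u: "\<And>h. h > 0 \<Longrightarrow> u h \<in> L2_torus" "\<And>h. h > 0 \<Longrightarrow> L2_nrm (u h) = 1"
    and loc: "frequency_localized u"
    and hs: "\<And>n. hs n > 0" "hs \<longlonglongrightarrow> 0"
    and lim_int: "\<And>\<theta> a. a \<in> Cinf_c \<Longrightarrow> integrable lborel \<theta> \<Longrightarrow> integrable lborel (\<lambda>t. \<theta> t * \<mu> t a)"
    and lim: "\<And>\<theta> a. a \<in> Cinf_c \<Longrightarrow> integrable lborel \<theta> \<Longrightarrow>
        (\<lambda>n. LINT t|lborel. \<theta> t * two_micro_dist (hs n) (\<epsilon> (hs n)) e (v (hs n) (t * \<tau> (hs n))) a)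
          \<longlonglongrightarrow> (LINT t|lborel. \<theta> t * \<mu> t a)"
begin

abbreviation "dst n t a \<equiv> two_micro_dist (hs n) (\<epsilon> (hs n)) e (v (hs n) (t * \<tau> (hs n))) a"

lemma S_pos: "S > 0"
  using V by (simp add: tame_potential_def)

lemma v_L2: "h > 0 \<Longrightarrow> v h s \<in> L2_torus"
  using sol by (simp add: coefficient_solution_def)

lemma ell2_initial: "h > 0 \<Longrightarrow> ell2_le (fourier (v h 0)) 1"
  using ell2_le_fourier[OF u(1)] u(2) v0 by metis

lemma ell2_v: "h > 0 \<Longrightarrow> ell2_le (fourier (v h s)) 1"
  using norm_conservation[OF sol V _ ell2_initial] by blast

lemma hs_at_right: "filterlim hs (at_right 0) sequentially"
  using hs by (auto simp: filterlim_at intro!: always_eventually less_imp_neq[symmetric])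

lemma eventually_hs: "eventually P (at_right 0) \<Longrightarrow> eventually (\<lambda>n. P (hs n)) sequentially"
  by (rule eventually_compose_filterlim[OF _ hs_at_right])

lemma tau_pos: "h > 0 \<Longrightarrow> \<tau> h > 0"
  using tau_eps[of h] eps_pos[of h] by (smt (verit) mult_nonpos_nonneg)

lemma limit_set_integrable: "a \<in> Cinf_c \<Longrightarrow> set_integrable lborel {\<alpha>..\<beta>} (\<lambda>t. \<mu> t a)"
proof -
  assume a: "a \<in> Cinf_c"
  have "integrable lborel (\<lambda>t. indicator {\<alpha>..\<beta>} t :: complex)"
    by (rule integrable_indicator_Icc)
  then show ?thesis
  proof -
    have "(\<lambda>t. indicator {\<alpha>..\<beta>} t * \<mu> t a) = (\<lambda>t. indicator {\<alpha>..\<beta>} t *\<^sub>R \<mu> t a)"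
      by (auto simp: fun_eq_iff indicator_def)
    with lim_int[OF a \<open>integrable lborel (\<lambda>t. indicator {\<alpha>..\<beta>} t)\<close>] show ?thesis
      unfolding set_integrable_def by (simp only:)
  qed
qed

lemma limit_interval:
  assumes a: "a \<in> Cinf_c" and bd: "eventually (\<lambda>n. norm (LINT t:{\<alpha>..\<beta>}|lborel. dst n t a) \<le> C n) sequentially"
    and C: "C \<longlonglongrightarrow> C'"
  shows "norm (LINT t:{\<alpha>..\<beta>}|lborel. \<mu> t a) \<le> C'"
proof -
  have i: "integrable lborel (\<lambda>t. indicator {\<alpha>..\<beta>} t :: complex)"
    by (rule integrable_indicator_Icc)
  have eq: "(LINT t|lborel. indicator {\<alpha>..\<beta>} t * f t) = (LINT t:{\<alpha>..\<beta>}|lborel. f t)" for f :: "real \<Rightarrow> complex"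
    unfolding set_lebesgue_integral_def by (intro Bochner_Integration.integral_cong) (auto simp: indicator_def)
  have "(\<lambda>n. LINT t:{\<alpha>..\<beta>}|lborel. dst n t a) \<longlonglongrightarrow> (LINT t:{\<alpha>..\<beta>}|lborel. \<mu> t a)"
    using lim[OF a i] unfolding eq .
  then show ?thesis
    using bd C by (intro tendsto_le[OF sequentially_bot C tendsto_norm])
qed

text \<open>The limit is known only after integration in time, so a pointwise bound needs a suitable
  weight: the conjugate phase of \<open>\<mu> t a\<close> on the set \<open>A\<close> where its
  modulus exceeds \<open>M\<close>. The limit relation then bounds the integral of the modulus over
  \<open>A\<close> by \<open>M\<close> times the measure of \<open>A\<close>, so \<open>A\<close> is
  null. Restriction to \<open>[-N, N]\<close> makes \<open>A\<close> of finite measure.\<close>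

lemma limit_AE_bound:
  assumes a: "a \<in> Cinf_c" and M: "0 \<le> M" and bd: "eventually (\<lambda>n. \<forall>t. norm (dst n t a) \<le> M) sequentially"
  shows "AE t in lborel. norm (\<mu> t a) \<le> M"
proof -
  have "AE t in lborel. t \<in> {- real N..real N} \<longrightarrow> norm (\<mu> t a) \<le> M" for N :: nat
  proof -
    let ?I = "{- real N..real N}"
    define f where "f t = indicator ?I t *\<^sub>R \<mu> t a" for t
    have fi: "integrable lborel f"
      using limit_set_integrable[OF a, of "- real N" "real N"] by (simp add: f_def[abs_def] set_integrable_def)
    then have [measurable]: "f \<in> borel_measurable lborel" by auto
    define A where "A = {t. norm (f t) > M}"
    have A [measurable]: "A \<in> sets lborel"
    proof -
      have "{t \<in> space lborel. norm (f t) > M} \<in> sets lborel" by measurable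
      then show ?thesis by (simp add: A_def)
    qed
    have AI: "A \<subseteq> ?I" using M by (auto simp: A_def f_def indicator_def)
    have "emeasure lborel A \<le> emeasure lborel ?I" using AI by (intro emeasure_mono) auto
    then have Afin: "emeasure lborel A < \<infinity>"
      by (simp add: emeasure_lborel_Icc_eq) (meson ennreal_less_top le_less_trans)
    have indA: "integrable lborel (\<lambda>t. indicator A t :: real)"
      using Afin A by (simp add: integrable_indicator_iff)
    \<comment> \<open>Chosen such that \<open>\<theta> t * \<mu> t a\<close> is the modulus of
      \<open>\<mu> t a\<close> on \<open>A\<close> and 0 elsewhere.\<close>
    define \<theta> where "\<theta> t = indicator A t *\<^sub>R cnj (sgn (f t))" for t
    have \<theta>i: "integrable lborel \<theta>"
    proof (rule Bochner_Integration.integrable_bound[OF indA])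
      show "\<theta> \<in> borel_measurable lborel" unfolding \<theta>_def sgn_div_norm by measurable
      show "AE t in lborel. norm (\<theta> t) \<le> norm (indicator A t :: real)"
        by (auto simp: \<theta>_def norm_sgn indicator_def)
    qed
    have th\<mu>: "\<theta> t * \<mu> t a = of_real (indicator A t * norm (f t))" for t
    proof (cases "t \<in> A")
      case True
      then have "f t = \<mu> t a" using AI by (auto simp: f_def)
      have "cnj (sgn z) * z = of_real (norm z)" for z :: complex
      proof (cases "z = 0")
        case False
        have "cnj (sgn z) * z = (z * cnj z) /\<^sub>R norm z" by (simp add: sgn_div_norm mult.commute)
        also have "\<dots> = of_real (norm z)"
          using False unfolding complex_norm_square[symmetric] by (simp add: power2_eq_square scaleR_conv_of_real)
        finally show ?thesis .
      qed simp
      then show ?thesis using True \<open>f t = \<mu> t a\<close> by (simp add: \<theta>_def)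
    qed (simp add: \<theta>_def)
    have int: "integrable lborel (\<lambda>t. indicator A t * norm (f t))"
      using integrable_mult_indicator[OF A integrable_norm[OF fi]] by simp
    have le: "norm (LINT t|lborel. \<theta> t * \<mu> t a) \<le> M * measure lborel A"
    proof (rule tendsto_upperbound[OF tendsto_norm[OF lim[OF a \<theta>i]]])
      show "eventually (\<lambda>n. norm (LINT t|lborel. \<theta> t * dst n t a) \<le> M * measure lborel A) sequentially"
        using bd
      proof eventually_elim
        case (elim n)
        have "norm (LINT t|lborel. \<theta> t * dst n t a) \<le> (LINT t|lborel. norm (\<theta> t * dst n t a))"
          by (rule integral_norm_bound)
        also have "\<dots> \<le> (LINT t|lborel. M * indicator A t)"
        proof (rule integral_mono')
          show "integrable lborel (\<lambda>t. M * indicator A t)" using indA by simp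
          fix t
          have "norm (\<theta> t) \<le> indicator A t" by (auto simp: \<theta>_def norm_sgn indicator_def)
          then have "norm (\<theta> t) * norm (dst n t a) \<le> indicator A t * M"
            using elim by (intro mult_mono) auto
          then show "norm (\<theta> t * dst n t a) \<le> M * indicator A t" by (simp add: norm_mult mult.commute)
        qed (use M in auto)
        also have "\<dots> = M * measure lborel A" by simp
        finally show ?case .
      qed
    qed simp
    have "(LINT t|lborel. indicator A t * norm (f t)) = norm (LINT t|lborel. \<theta> t * \<mu> t a)"
      unfolding th\<mu> by (simp add: integral_of_real[symmetric] del: of_real_mult)
    then have "(LINT t|lborel. indicator A t * norm (f t) - M * indicator A t) \<le> 0"
      using le int indA by (simp add: Bochner_Integration.integral_diff)
    moreover have nn: "0 \<le> indicator A t * norm (f t) - M * indicator A t" for t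
      by (auto simp: indicator_def A_def)
    then have "0 \<le> (LINT t|lborel. indicator A t * norm (f t) - M * indicator A t)"
      by (intro integral_nonneg_AE) auto
    ultimately have "(LINT t|lborel. indicator A t * norm (f t) - M * indicator A t) = 0" by linarith
    then have "AE t in lborel. indicator A t * norm (f t) - M * indicator A t = 0"
      using int indA nn by (subst (asm) integral_nonneg_eq_0_iff_AE) auto
    then show ?thesis
      by eventually_elim (auto simp: A_def f_def indicator_def not_less split: if_splits)
  qed
  then have "AE t in lborel. \<forall>N::nat. t \<in> {- real N..real N} \<longrightarrow> norm (\<mu> t a) \<le> M"
    by (subst AE_all_countable) blast
  then show ?thesis
  proof eventually_elim
    case (elim t)
    obtain N :: nat where "\<bar>t\<bar> \<le> real N" using real_arch_simple by blast
    then have "t \<in> {- real N..real N}" by auto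
    then show ?case using elim by blast
  qed
qed

lemma sym_dist:
  assumes h: "h > 0" and supp: "\<And>\<xi>. norm \<xi> > R \<Longrightarrow> \<beta> \<xi> = 0"
  shows "two_micro_dist h (\<epsilon> h) e (v h s) (test_symbol \<beta> W k) =
    (\<Sum>q\<in>{q. norm ((pi * h) *\<^sub>R ivec (q + (q + k))) \<le> R}.
        of_real (\<beta> ((pi * h) *\<^sub>R ivec (q + (q + k))) * W (ereal (H e ((pi * h) *\<^sub>R ivec (q + (q + k))) / \<epsilon> h)))
        * (cnj (fourier (v h s) q) * fourier (v h s) (q + k)))"
  using h supp by (intro two_micro_dist_sym v_L2 symbol_sum_finite) (auto simp: not_le)

lemma sym_AE_bound:
  assumes \<beta>: "(\<lambda>\<xi>. of_real (\<beta> \<xi>)) \<in> SM" and supp: "\<And>\<xi>. norm \<xi> > R \<Longrightarrow> \<beta> \<xi> = 0" and W: "smooth_end W"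
    and M: "\<And>\<xi>. \<bar>\<beta> \<xi>\<bar> \<le> M"
  shows "AE t in lborel. norm (\<mu> t (test_symbol \<beta> W k)) \<le> M"
proof (rule limit_AE_bound[OF sym_Cinf_c[OF \<beta> supp W]])
  show "0 \<le> M" using M[of 0] by linarith
  show "eventually (\<lambda>n. \<forall>t. norm (dst n t (test_symbol \<beta> W k)) \<le> M) sequentially"
  proof (intro always_eventually allI)
    fix n t
    have "\<bar>\<beta> \<xi> * W \<eta>\<bar> \<le> M * 1" for \<xi> \<eta>
      unfolding abs_mult using W M \<open>0 \<le> M\<close> by (intro mult_mono) (auto simp: smooth_end_def)
    then have b: "norm (complex_of_real (\<beta> \<xi> * W \<eta>)) \<le> M" for \<xi> \<eta>
      by (simp only: norm_of_real mult_1_right)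
    show "norm (dst n t (test_symbol \<beta> W k)) \<le> M"
      by (subst sym_dist[where R=R, OF hs(1)], erule supp)
         (rule form_bound[OF ell2_v[OF hs(1)] symbol_sum_finite[OF hs(1)] \<open>0 \<le> M\<close> b])
  qed
qed

lemma norm_e: "norm (ivec e) \<ge> 1"
proof -
  obtain i where "e $ i \<noteq> 0" using e_nz by (auto simp: vec_eq_iff)
  then have "1 \<le> \<bar>real_of_int (e $ i)\<bar>" by linarith
  also have "\<dots> \<le> norm (ivec e)" using component_le_norm_cart[of "ivec e" i] by simp
  finally show ?thesis .
qed

lemma H_diff: "\<bar>H e \<xi> - H e \<xi>'\<bar> \<le> norm (\<xi> - \<xi>')"
proof -
  have "\<bar>H e \<xi> - H e \<xi>'\<bar> = \<bar>(\<xi> - \<xi>') \<bullet> ivec e\<bar> / norm (ivec e)"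
    by (simp add: H_def diff_divide_distrib[symmetric] inner_diff_left)
  also have "\<dots> \<le> norm (\<xi> - \<xi>') * norm (ivec e) / norm (ivec e)"
    by (intro divide_right_mono Cauchy_Schwarz_ineq2) auto
  moreover have "norm (\<xi> - \<xi>') * norm (ivec e) / norm (ivec e) = norm (\<xi> - \<xi>')"
    using norm_e by (intro nonzero_mult_div_cancel_right) linarith
  ultimately show ?thesis by linarith
qed

text \<open>Changing \<open>q\<close> by \<open>p\<close> moves \<xi> by \<open>2 pi h\<close> times
  \<open>ivec p\<close>. In \<xi>, the bump has Lipschitz constant \<open>8 N\<close> and the second
  factor \<open>8 / (\<epsilon> h * R)\<close>; here 8 is \<open>fact 3 + fact 2\<close>, the
  constant of \<open>flat 1\<close>, which also covers \<open>flat 0\<close>.\<close>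

lemma bump_flat_lipschitz:
  fixes k :: "int ^ 2" and a b :: "real ^ 2" and N :: nat
  assumes "\<sigma> = 1 \<or> \<sigma> = -1" "R > 0" "h > 0" "n \<le> 1"
  defines "\<xi> \<equiv> \<lambda>q. (pi * h) *\<^sub>R ivec (q + (q + k))"
  defines "G \<equiv> \<lambda>q. box_bump a b N (\<xi> q) * flat n (\<sigma> * (H e (\<xi> q) / \<epsilon> h) / R)"
  shows "\<bar>G q\<bar> \<le> 1" "\<bar>G q - G (q - p)\<bar> \<le> 16 * pi * h * (real N + 1 / (\<epsilon> h * R)) * norm (ivec p)"
proof -
  have fn: "fact n = (1::real)" "fact (n + 2) + real n * fact (n + 1) \<le> (8::real)"
    using assms(4) by (cases n; simp add: numeral_eq_Suc)+
  have r: "\<bar>flat n x\<bar> \<le> 1" for x using flat_le[of n x] flat_nonneg[of n x] fn by simp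
  have rb: "\<bar>box_bump a b N x\<bar> \<le> 1" for x using box_bump_range[of a b N x] by simp
  show "\<bar>G q\<bar> \<le> 1" unfolding G_def abs_mult by (intro mult_le_one r rb) auto
  define d where "d = norm (\<xi> q - \<xi> (q - p))"
  have "\<xi> q - \<xi> (q - p) = (2 * pi * h) *\<^sub>R ivec p"
  proof -
    have "ivec (q + (q + k)) - ivec (q - p + (q - p + k)) = 2 *\<^sub>R ivec p"
      unfolding ivec_add ivec_diff by (simp add: scaleR_2)
    then have "\<xi> q - \<xi> (q - p) = (pi * h) *\<^sub>R (2 *\<^sub>R ivec p)"
      by (simp only: \<xi>_def scaleR_diff_right[symmetric])
    then show ?thesis by (simp add: mult_ac)
  qed
  then have d: "d = 2 * pi * h * norm (ivec p)" using assms(3) by (simp add: d_def)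
  have E: "\<epsilon> h > 0" by (rule eps_pos[OF assms(3)])
  have "\<bar>flat n (\<sigma> * (H e (\<xi> q) / \<epsilon> h) / R) - flat n (\<sigma> * (H e (\<xi> (q - p)) / \<epsilon> h) / R)\<bar>
     \<le> 8 * \<bar>\<sigma> * (H e (\<xi> q) / \<epsilon> h) / R - \<sigma> * (H e (\<xi> (q - p)) / \<epsilon> h) / R\<bar>"
    by (rule order_trans[OF flat_lipschitz mult_right_mono[OF fn(2)]]) simp
  also have "\<sigma> * (H e (\<xi> q) / \<epsilon> h) / R - \<sigma> * (H e (\<xi> (q - p)) / \<epsilon> h) / R
     = \<sigma> * ((H e (\<xi> q) - H e (\<xi> (q - p))) / (\<epsilon> h * R))"
    using E assms(2) by (simp add: field_simps)
  also have "\<bar>\<dots>\<bar> = \<bar>H e (\<xi> q) - H e (\<xi> (q - p))\<bar> / (\<epsilon> h * R)"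
    using E assms(1,2) by (auto simp: abs_mult)
  also have "\<dots> \<le> d / (\<epsilon> h * R)"
    unfolding d_def using E assms(2) by (intro divide_right_mono H_diff) auto
  finally have 1: "\<bar>flat n (\<sigma> * (H e (\<xi> q) / \<epsilon> h) / R) - flat n (\<sigma> * (H e (\<xi> (q - p)) / \<epsilon> h) / R)\<bar> \<le> 8 * (d / (\<epsilon> h * R))"
    by simp
  have 2: "\<bar>box_bump a b N (\<xi> q) - box_bump a b N (\<xi> (q - p))\<bar> \<le> 8 * real N * d"
    unfolding d_def by (rule box_bump_lipschitz)
  have "\<bar>G q - G (q - p)\<bar> \<le> 8 * real N * d + 8 * (d / (\<epsilon> h * R))"
    unfolding G_def by (rule order_trans[OF prod2_diff_le[OF rb r] add_mono[OF 2 1]])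
  also have "\<dots> = 16 * pi * h * (real N + 1 / (\<epsilon> h * R)) * norm (ivec p)"
    by (simp add: d algebra_simps)
  finally show "\<bar>G q - G (q - p)\<bar> \<le> 16 * pi * h * (real N + 1 / (\<epsilon> h * R)) * norm (ivec p)" .
qed

end

subsection \<open>Resonant and non-resonant modes\<close>

definition endpt :: "real \<Rightarrow> ereal" where
  "endpt \<sigma> = (if \<sigma> > 0 then \<infinity> else - \<infinity>)"

lemma end_cutoff_limit:
  assumes "\<sigma> = 1 \<or> \<sigma> = -1"
  shows "(\<lambda>j. end_cutoff \<sigma> (real (Suc j)) \<eta>) \<longlonglongrightarrow> indicator {endpt \<sigma>} \<eta>"
proof (cases \<eta>)
  case (real r)
  have "(\<lambda>j. flat 0 (\<sigma> * r / real (Suc j))) \<longlonglongrightarrow> 0"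
  proof (cases "\<sigma> * r > 0")
    case True
    define x where "x = \<sigma> * r"
    have x: "x > 0" using True by (simp add: x_def)
    have "(\<lambda>j. exp (- (1 / (x / real (Suc j))))) \<longlonglongrightarrow> 0" using x by real_asymp
    then show ?thesis using x by (simp add: flat_def x_def[symmetric])
  next
    case False
    then have "flat 0 (\<sigma> * r / real (Suc j)) = 0" for j
      by (intro flat_nonpos_arg) (simp add: divide_le_0_iff not_less)
    then show ?thesis by simp
  qed
  then show ?thesis using real by (simp add: endpt_def)
qed (use assms in \<open>auto simp: endpt_def\<close>)

text \<open>The pairing with a test symbol, in a form that also makes sense when the factors in
  \<xi> and \<eta> are merely measurable, such as the indicator of an end.\<close>

definition phase_integral :: "phase_measure \<Rightarrow> (real ^ 2 \<Rightarrow> real) \<Rightarrow> (ereal \<Rightarrow> real) \<Rightarrow> int ^ 2 \<Rightarrow> complex" where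
  "phase_integral M \<beta> W k = (LINT z|M. of_real (\<beta> (fst (snd z))) * of_real (W (snd (snd z))) * wave (- k) (fst z))"

lemma pairing_test_symbol: "pairing M (test_symbol \<beta> W k) = phase_integral M \<beta> W k"
  by (simp add: pairing_def phase_integral_def test_symbol_def case_prod_unfold)

text \<open>Lets measurability be checked factor by factor, although a \<open>phase_measure\<close>
  lives on the Borel sets of the product.\<close>

lemma phase_borel: "finite_phase_measure M \<Longrightarrow> sets M = sets (borel \<Otimes>\<^sub>M (borel \<Otimes>\<^sub>M borel))"
proof -
  assume M: "finite_phase_measure M"
  have "borel \<Otimes>\<^sub>M (borel \<Otimes>\<^sub>M borel) = (borel \<Otimes>\<^sub>M borel :: phase_measure)"
    by (rule arg_cong2[where f=pair_measure, OF refl borel_prod])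
  also have "\<dots> = borel" by (rule borel_prod)
  finally have eq: "borel \<Otimes>\<^sub>M (borel \<Otimes>\<^sub>M borel) = (borel :: phase_measure)" .
  have "sets M = sets borel" using M unfolding finite_phase_measure_def by (rule conjunct1)
  then show "sets M = sets (borel \<Otimes>\<^sub>M (borel \<Otimes>\<^sub>M borel))"
    by (rule trans[OF _ arg_cong[where f=sets, OF eq[symmetric]]])
qed

lemma phase_integral_limit:
  assumes M: "finite_phase_measure M"
    and m: "\<And>j. \<beta> j \<in> borel_measurable borel" "\<And>j. W j \<in> borel_measurable borel"
      "\<beta>' \<in> borel_measurable borel" "W' \<in> borel_measurable borel"
    and l: "\<And>\<xi>. (\<lambda>j. \<beta> j \<xi>) \<longlonglongrightarrow> \<beta>' \<xi>" "\<And>\<eta>. (\<lambda>j. W j \<eta>) \<longlonglongrightarrow> W' \<eta>"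
    and b: "\<And>j \<xi>. \<bar>\<beta> j \<xi>\<bar> \<le> B" "\<And>j \<eta>. \<bar>W j \<eta>\<bar> \<le> 1"
  shows "(\<lambda>j. phase_integral M (\<beta> j) (W j) k) \<longlonglongrightarrow> phase_integral M \<beta>' W' k"
proof -
  interpret finite_measure M using M by (simp add: finite_phase_measure_def)
  note [measurable_cong] = phase_borel[OF M]
  note [measurable] = m
  show ?thesis
    unfolding phase_integral_def
  proof (rule integral_dominated_convergence[where w="\<lambda>_. B * 1"])
    show "AE z in M. (\<lambda>j. complex_of_real (\<beta> j (fst (snd z))) * complex_of_real (W j (snd (snd z))) * wave (- k) (fst z))
       \<longlonglongrightarrow> complex_of_real (\<beta>' (fst (snd z))) * complex_of_real (W' (snd (snd z))) * wave (- k) (fst z)"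
      by (intro AE_I2 tendsto_intros l)
    show "AE z in M. norm (complex_of_real (\<beta> j (fst (snd z))) * complex_of_real (W j (snd (snd z))) * wave (- k) (fst z)) \<le> B * 1" for j
    proof (intro AE_I2)
      fix z :: "(real ^ 2) \<times> (real ^ 2) \<times> ereal"
      have "\<bar>\<beta> j (fst (snd z))\<bar> * \<bar>W j (snd (snd z))\<bar> \<le> B * 1"
        using b order_trans[OF abs_ge_zero b(1)] by (intro mult_mono) auto
      then show "norm (complex_of_real (\<beta> j (fst (snd z))) * complex_of_real (W j (snd (snd z))) * wave (- k) (fst z)) \<le> B * 1"
        by (simp add: norm_mult)
    qed
    show "(\<lambda>z. complex_of_real (\<beta>' (fst (snd z))) * complex_of_real (W' (snd (snd z))) * wave (- k) (fst z)) \<in> borel_measurable M"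
      by measurable
    show "(\<lambda>z. complex_of_real (\<beta> j (fst (snd z))) * complex_of_real (W j (snd (snd z))) * wave (- k) (fst z)) \<in> borel_measurable M" for j
      by measurable
  qed simp
qed

lemma smooth_end_borel: "smooth_end W \<Longrightarrow> W \<in> borel_measurable borel"
  by (simp add: smooth_end_def borel_measurable_continuous_onI)

lemma smooth_end_le_1: "smooth_end W \<Longrightarrow> \<bar>W \<eta>\<bar> \<le> 1"
  by (auto simp: smooth_end_def)

lemma SM_of_real_continuous:
  assumes "(\<lambda>\<xi>. complex_of_real (\<beta> \<xi>)) \<in> SM" shows "continuous_on S \<beta>"
  using continuous_on_Re[OF SM_continuous[OF assms]] by simp

lemma inner_bump_bound:
  assumes "\<And>\<xi>. \<xi> \<in> box a b \<Longrightarrow> norm \<xi> \<le> \<rho>" "\<rho> > 0"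
  shows "\<bar>(\<xi> \<bullet> y) * box_bump a b N \<xi>\<bar> \<le> \<rho> * norm y"
proof (cases "\<xi> \<in> box a b")
  case True
  have "\<bar>\<xi> \<bullet> y\<bar> \<le> norm \<xi> * norm y" by (rule Cauchy_Schwarz_ineq2)
  also have "\<dots> \<le> \<rho> * norm y" using assms(1)[OF True] by (intro mult_right_mono) auto
  finally have "\<bar>\<xi> \<bullet> y\<bar> * \<bar>box_bump a b N \<xi>\<bar> \<le> \<rho> * norm y * 1"
    using box_bump_range[of a b N \<xi>] assms(2) by (intro mult_mono) auto
  then show ?thesis by (simp add: abs_mult)
next
  case False
  then show ?thesis using assms(2) by (simp add: box_bump_outside)
qed

locale two_micro_limit_measure = two_micro_limit +
  assumes meas: "AE t in lborel. is_the_measure (\<mu> t) (m t)"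
begin

lemma test_symbol_measure:
  assumes \<beta>: "(\<lambda>\<xi>. of_real (\<beta> \<xi>)) \<in> SM" and supp: "\<And>\<xi>. norm \<xi> > R \<Longrightarrow> \<beta> \<xi> = 0" and W: "smooth_end W"
    and t: "is_the_measure (\<mu> t) (m t)"
  shows "\<mu> t (test_symbol \<beta> W k) = phase_integral (m t) \<beta> W k"
proof -
  have "test_symbol \<beta> W k \<in> B_space"
    using W by (intro sym_B_space[OF SM_of_real_continuous[OF \<beta>] supp]) (auto simp: smooth_end_def)
  then show ?thesis using t by (simp add: is_the_measure_def pairing_test_symbol)
qed

text \<open>As \<open>R\<close> grows, the cut-offs converge to the indicator of an end. For a fixed
  time at which \<open>\<mu> t\<close> is a measure, the pairings then converge to the integral over
  that end; the time integrals tend to 0, so this limit is 0 for almost every time.\<close>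

lemma end_limit:
  assumes \<beta>: "(\<lambda>\<xi>. of_real (\<beta> \<xi>)) \<in> SM" and supp: "\<And>\<xi>. norm \<xi> > R \<Longrightarrow> \<beta> \<xi> = 0"
    and M: "\<And>\<xi>. \<bar>\<beta> \<xi>\<bar> \<le> M" and \<sigma>: "\<sigma> = 1 \<or> \<sigma> = -1"
    and small: "\<And>a b. a \<le> b \<Longrightarrow> (\<lambda>j. LINT t:{a..b}|lborel. \<mu> t (test_symbol \<beta> (end_cutoff \<sigma> (real (Suc j))) k)) \<longlonglongrightarrow> 0"
  shows "AE t in lborel. phase_integral (m t) \<beta> (indicator {endpt \<sigma>}) k = 0"
proof -
  define F where "F j t = \<mu> t (test_symbol \<beta> (end_cutoff \<sigma> (real (Suc j))) k)" for j t
  have W: "smooth_end (end_cutoff \<sigma> (real (Suc j)))" for j by (rule smooth_end_cutoff[OF \<sigma>]) simp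
  have L: "(\<lambda>j. F j t) \<longlonglongrightarrow> phase_integral (m t) \<beta> (indicator {endpt \<sigma>}) k" if t: "is_the_measure (\<mu> t) (m t)" for t
  proof -
    have fm: "finite_phase_measure (m t)" using t by (simp add: is_the_measure_def)
    have "(\<lambda>j. phase_integral (m t) \<beta> (end_cutoff \<sigma> (real (Suc j))) k) \<longlonglongrightarrow> phase_integral (m t) \<beta> (indicator {endpt \<sigma>}) k"
      by (rule phase_integral_limit[OF fm, where B=M])
         (auto simp del: of_nat_Suc intro: M smooth_end_borel[OF W] smooth_end_le_1[OF W] end_cutoff_limit[OF \<sigma>]
            borel_measurable_continuous_onI SM_of_real_continuous[OF \<beta>])
    moreover have "F j t = phase_integral (m t) \<beta> (end_cutoff \<sigma> (real (Suc j))) k" for j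
      unfolding F_def by (rule test_symbol_measure[OF \<beta> _ W t]) (erule supp)
    ultimately show ?thesis by (simp only:)
  qed
  have "AE t in lborel. (\<lambda>j. F j t) \<longlonglongrightarrow> 0"
  proof (rule AE_limit_zero)
    show "set_integrable lborel {a..b} (F j)" for j a b
      unfolding F_def by (rule limit_set_integrable[OF sym_Cinf_c[OF \<beta> supp W]])
    show "AE t in lborel. norm (F j t) \<le> M" for j
      unfolding F_def by (rule sym_AE_bound[OF \<beta> supp W M])
    show "(\<lambda>j. LINT t:{a..b}|lborel. F j t) \<longlonglongrightarrow> 0" if "a \<le> b" for a b
      unfolding F_def by (rule small[OF that])
    show "AE t in lborel. convergent (\<lambda>j. F j t)"
      using meas by eventually_elim (auto intro: L convergentI)
  qed
  with meas show ?thesis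
    by eventually_elim (use L LIMSEQ_unique in blast)
qed

text \<open>The estimate shared by the two kinds of modes. The symbol must be
  \<open>- 2 pi i (\<xi> \<bullet> k)\<close> times a bump in \<xi> times \<open>flat n\<close>,
  with a normalization \<open>c\<close>. The Lipschitz constant of the multiplier contains a factor
  \<open>h\<close>, which cancels the \<open>1/h\<close> in front of the commutator.\<close>

lemma oscillating_interval_estimate:
  assumes \<sigma>: "\<sigma> = 1 \<or> \<sigma> = -1" and \<alpha>\<beta>: "\<alpha> \<le> \<beta>" and R: "R > 0" and h: "h > 0" and n: "n \<le> 1"
    and c: "norm c \<le> C" and supp: "\<And>\<xi>. \<xi> \<notin> box a b \<Longrightarrow> B \<xi> = 0"
    and key: "\<And>\<xi>. - 2 * \<i> * of_real pi * of_real (\<xi> \<bullet> ivec k)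
        * (c * of_real (box_bump a b N \<xi> * flat n (\<sigma> * (H e \<xi> / \<epsilon> h) / R)))
      = of_real (B \<xi> * W (ereal (H e \<xi> / \<epsilon> h)))"
  shows "norm (LINT t:{\<alpha>..\<beta>}|lborel. two_micro_dist h (\<epsilon> h) e (v h (t * \<tau> h)) (test_symbol B W k))
     \<le> 2 * C / \<tau> h + (\<beta> - \<alpha>) * (16 * pi * S * (C * ((\<epsilon> h)\<^sup>2 * real N + \<epsilon> h / R)))"
proof -
  obtain \<rho> where \<rho>: "\<rho> > 0" "\<And>\<xi>. \<xi> \<in> box a b \<Longrightarrow> norm \<xi> \<le> \<rho>" by (rule box_norm_bound[of a b]) blast
  have outside: "\<xi> \<notin> box a b" if "norm \<xi> > \<rho>" for \<xi>
    using \<rho>(2)[of \<xi>] that by auto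
  have E: "0 < \<epsilon> h" by (rule eps_pos[OF h])
  have C0: "0 \<le> C" using order_trans[OF norm_ge_zero c] .
  define \<xi> where "\<xi> q = (pi * h) *\<^sub>R ivec (q + (q + k))" for q
  define Q where "Q = {q. norm (\<xi> q) \<le> \<rho>}"
  have Q: "finite Q" unfolding Q_def \<xi>_def by (rule symbol_sum_finite[OF h])
  define G where "G q = box_bump a b N (\<xi> q) * flat n (\<sigma> * (H e (\<xi> q) / \<epsilon> h) / R)" for q
  have G0: "c * of_real (G q) = 0" if "q \<notin> Q" for q
    using that outside[of "\<xi> q"] by (simp add: Q_def G_def box_bump_outside)
  have lip: "\<bar>G q\<bar> \<le> 1" "\<bar>G q - G (q - p)\<bar> \<le> 16 * pi * h * (real N + 1 / (\<epsilon> h * R)) * norm (ivec p)" for q p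
    unfolding G_def \<xi>_def by (intro bump_flat_lipschitz[OF \<sigma> R h n])+
  have gG: "norm (c * of_real (G q)) \<le> C" for q
    using mult_mono[OF c lip(1)[of q]] C0 by (simp add: norm_mult)
  have gK: "norm (c * of_real (G q) - c * of_real (G (q - p))) \<le> (C * (16 * pi * h * (real N + 1 / (\<epsilon> h * R)))) * norm (ivec p)" for q p
  proof -
    have "norm (c * of_real (G q) - c * of_real (G (q - p))) = norm c * \<bar>G q - G (q - p)\<bar>"
      by (simp add: norm_mult flip: right_diff_distrib of_real_diff)
    also have "\<dots> \<le> C * (16 * pi * h * (real N + 1 / (\<epsilon> h * R)) * norm (ivec p))"
      using C0 by (intro mult_mono c lip(2)) auto
    finally show ?thesis by (simp only: mult.assoc)
  qed
  have key': "- 2 * \<i> * of_real pi * of_real (\<xi> q \<bullet> ivec k) * (c * of_real (G q) * X)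
     = of_real (B (\<xi> q) * W (ereal (H e (\<xi> q) / \<epsilon> h))) * X" for q X
    using key[of "\<xi> q"] by (simp only: G_def mult.assoc[symmetric])
  have d: "two_micro_dist h (\<epsilon> h) e (v h (t * \<tau> h)) (test_symbol B W k) =
     (\<Sum>q\<in>Q. - 2 * \<i> * of_real pi * of_real (((pi * h) *\<^sub>R ivec (q + (q + k))) \<bullet> ivec k)
       * (c * of_real (G q) * (cnj (fourier (v h (t * \<tau> h)) q) * fourier (v h (t * \<tau> h)) (q + k))))" for t
    unfolding key'[unfolded \<xi>_def] Q_def \<xi>_def by (rule sym_dist[where R=\<rho>, OF h], rule supp, erule outside)
  have "norm (LINT t:{\<alpha>..\<beta>}|lborel. two_micro_dist h (\<epsilon> h) e (v h (t * \<tau> h)) (test_symbol B W k))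
     \<le> 2 * C / \<tau> h + (\<beta> - \<alpha>) * ((\<epsilon> h)\<^sup>2 / h * ((C * (16 * pi * h * (real N + 1 / (\<epsilon> h * R)))) * S))"
    unfolding d
    by (rule interval_estimate[OF sol[OF h] V h tau_pos[OF h] ell2_v[OF h] Q G0 gG _ gK \<alpha>\<beta>])
       (use h E R C0 in auto)
  also have "(\<epsilon> h)\<^sup>2 / h * ((C * (16 * pi * h * (real N + 1 / (\<epsilon> h * R)))) * S) = 16 * pi * S * (C * ((\<epsilon> h)\<^sup>2 * real N + \<epsilon> h / R))"
    using E R h by (simp add: power2_eq_square field_simps)
  finally show ?thesis .
qed

text \<open>For \<open>k = n *s e\<close> the factor \<open>\<xi> \<bullet> k\<close> is
  \<open>n * norm (ivec e) * \<epsilon> * \<eta>\<close>, and the cut-off is divisible by \<eta>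
  through \<open>flat 0 x = x * flat 1 x\<close>. The quotient has size
  \<open>1 / (\<epsilon> R)\<close>: the endpoint term is at most
  \<open>2 / (\<tau> \<epsilon> R) \<le> 2 / R\<close>, and the commutator term is of order
  \<open>(N \<epsilon> + 1/R) / R\<close>, in which \<epsilon> and \<open>1/R\<close> are then
  bounded by 1.\<close>

lemma resonant_interval_bound:
  assumes k: "k = n *s e" "n \<noteq> 0" and \<sigma>: "\<sigma> = 1 \<or> \<sigma> = -1" and \<alpha>\<beta>: "\<alpha> \<le> \<beta>" and R: "R \<ge> 1"
  shows "norm (LINT t:{\<alpha>..\<beta>}|lborel. \<mu> t (test_symbol (box_bump a b N) (end_cutoff \<sigma> R) k))
     \<le> (2 + (\<beta> - \<alpha>) * (16 * pi * S * (real N + 1))) / R"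
proof -
  obtain \<rho> where \<rho>: "\<rho> > 0" "\<And>\<xi>. \<xi> \<in> box a b \<Longrightarrow> norm \<xi> \<le> \<rho>" by (rule box_norm_bound[of a b]) blast
  have supp: "box_bump a b N \<xi> = 0" if "norm \<xi> > \<rho>" for \<xi>
    using \<rho>(2)[of \<xi>] that by (intro box_bump_outside) auto
  have W: "smooth_end (end_cutoff \<sigma> R)" using R by (intro smooth_end_cutoff[OF \<sigma>]) auto
  have n1: "1 \<le> \<bar>real_of_int n\<bar>" using k(2) by linarith
  have R0: "R > 0" using R by simp
  show ?thesis
  proof (rule limit_interval[OF sym_Cinf_c[OF box_bump_SM supp W] _ tendsto_const])
    have "eventually (\<lambda>h. \<epsilon> h < 1) (at_right 0)"
      using eps_lim by (rule order_tendstoD) simp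
    from eventually_hs[OF this]
    show "eventually (\<lambda>j. norm (LINT t:{\<alpha>..\<beta>}|lborel. dst j t (test_symbol (box_bump a b N) (end_cutoff \<sigma> R) k))
       \<le> (2 + (\<beta> - \<alpha>) * (16 * pi * S * (real N + 1))) / R) sequentially"
    proof eventually_elim
      case (elim j)
      define h where "h = hs j"
      have h: "h > 0" using hs(1) by (simp add: h_def)
      define E where "E = \<epsilon> h"
      have E: "0 < E" "E < 1" using eps_pos[OF h] elim by (simp_all add: E_def h_def)
      define T where "T = \<tau> h"
      have T: "T > 0" "T * E \<ge> 1" using tau_pos[OF h] tau_eps[OF h] by (simp_all add: T_def E_def)
      \<comment> \<open>With \<open>\<eta> = H e \<xi> / E\<close>, the constant \<open>y\<close>
        satisfies \<open>- 2 pi i (\<xi> \<bullet> k) = y * \<eta>\<close>. Dividing by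
        \<open>y\<close> and multiplying by \<open>\<sigma> / R\<close> in \<open>c0\<close>
        produces the argument \<open>\<sigma> * \<eta> / R\<close> of \<open>flat\<close>, ready for
        \<open>flat_step\<close>.\<close>
      define y where "y = - 2 * \<i> * of_real pi * complex_of_real (n * norm (ivec e) * E)"
      have y: "y \<noteq> 0" using k(2) norm_e E by (auto simp: y_def)
      define c0 where "c0 = of_real (\<sigma> / R) / y"
      have c0: "norm c0 \<le> 1 / (E * R)"
      proof -
        have "1 * 1 \<le> (2 * pi) * (\<bar>real_of_int n\<bar> * norm (ivec e))"
          using n1 norm_e pi_gt3 mult_mono[OF n1 norm_e] by (intro mult_mono) auto
        then have "E * R * 1 \<le> E * R * (2 * pi * (\<bar>real_of_int n\<bar> * norm (ivec e)))"
          using E R by (intro mult_left_mono) auto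
        then have "1 / (E * R * (2 * pi * (\<bar>real_of_int n\<bar> * norm (ivec e)))) \<le> 1 / (E * R)"
          using E R by (intro divide_left_mono mult_pos_pos) auto
        moreover have "norm c0 = 1 / (E * R * (2 * pi * (\<bar>real_of_int n\<bar> * norm (ivec e))))"
          using \<sigma> E R unfolding c0_def y_def by (auto simp: norm_divide norm_mult mult_ac)
        ultimately show ?thesis by simp
      qed
      have key: "- 2 * \<i> * of_real pi * of_real (\<xi> \<bullet> ivec k)
          * (c0 * of_real (box_bump a b N \<xi> * flat 1 (\<sigma> * (H e \<xi> / E) / R)))
        = of_real (box_bump a b N \<xi> * end_cutoff \<sigma> R (ereal (H e \<xi> / E)))" for \<xi>
      proof -
        have "ivec k = of_int n *\<^sub>R ivec e" by (simp add: k vec_eq_iff)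
        moreover have "\<xi> \<bullet> ivec e = norm (ivec e) * H e \<xi>" using norm_e by (auto simp: H_def)
        ultimately have ip: "\<xi> \<bullet> ivec k = n * norm (ivec e) * E * (H e \<xi> / E)" using E by simp
        have "- 2 * \<i> * of_real pi * of_real (\<xi> \<bullet> ivec k) = y * of_real (H e \<xi> / E)"
          unfolding ip y_def by (simp only: of_real_mult mult.assoc)
        then have "- 2 * \<i> * of_real pi * of_real (\<xi> \<bullet> ivec k)
            * (c0 * of_real (box_bump a b N \<xi> * flat 1 (\<sigma> * (H e \<xi> / E) / R)))
          = of_real (\<sigma> / R * (H e \<xi> / E) * (box_bump a b N \<xi> * flat 1 (\<sigma> * (H e \<xi> / E) / R)))"
          unfolding c0_def using y by (simp add: mult_ac)
        also have "\<sigma> / R * (H e \<xi> / E) * (box_bump a b N \<xi> * flat 1 (\<sigma> * (H e \<xi> / E) / R))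
          = box_bump a b N \<xi> * end_cutoff \<sigma> R (ereal (H e \<xi> / E))"
          using flat_step[of 0 "\<sigma> * (H e \<xi> / E) / R"] by (simp add: mult_ac)
        finally show ?thesis .
      qed
      have "norm (LINT t:{\<alpha>..\<beta>}|lborel. dst j t (test_symbol (box_bump a b N) (end_cutoff \<sigma> R) k))
         \<le> 2 * (1 / (E * R)) / T + (\<beta> - \<alpha>) * (16 * pi * S * (1 / (E * R) * (E\<^sup>2 * real N + E / R)))"
        unfolding E_def T_def h_def[symmetric]
        by (rule oscillating_interval_estimate[OF \<sigma> \<alpha>\<beta> R0 h _ c0[unfolded E_def] _ key[unfolded E_def]])
           (simp_all add: box_bump_outside)
      also have "2 * (1 / (E * R)) / T \<le> 2 / R"
      proof -
        have "1 / (T * E) \<le> 1" using T by simp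
        then have "2 / R * (1 / (T * E)) \<le> 2 / R * 1" using R by (intro mult_left_mono) auto
        then show ?thesis by (simp add: mult_ac)
      qed
      also have "16 * pi * S * (1 / (E * R) * (E\<^sup>2 * real N + E / R)) = 16 * pi * S * (real N * E + 1 / R) / R"
        using E R by (simp add: power2_eq_square field_simps)
      also have "(\<beta> - \<alpha>) * (16 * pi * S * (real N * E + 1 / R) / R) \<le> (\<beta> - \<alpha>) * (16 * pi * S * (real N + 1) / R)"
      proof -
        have "real N * E \<le> real N * 1" using E by (intro mult_left_mono) auto
        moreover have "1 / R \<le> 1" using R by simp
        ultimately have "real N * E + 1 / R \<le> real N + 1" by linarith
        then show ?thesis
          using \<alpha>\<beta> R S_pos by (intro mult_left_mono divide_right_mono) auto
      qed
      finally show ?case using R by (simp add: add_divide_distrib)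
    qed
  qed
qed

lemma resonant_end:
  assumes k: "k = n *s e" "n \<noteq> 0" and \<sigma>: "\<sigma> = 1 \<or> \<sigma> = -1"
  shows "AE t in lborel. phase_integral (m t) (box_bump a b N) (indicator {endpt \<sigma>}) k = 0"
proof -
  obtain \<rho> where \<rho>: "\<rho> > 0" "\<And>\<xi>. \<xi> \<in> box a b \<Longrightarrow> norm \<xi> \<le> \<rho>" by (rule box_norm_bound[of a b]) blast
  show ?thesis
  proof (rule end_limit[OF box_bump_SM _ _ \<sigma>])
    show "box_bump a b N \<xi> = 0" if "norm \<xi> > \<rho>" for \<xi>
      using \<rho>(2)[of \<xi>] that by (intro box_bump_outside) auto
    show "\<bar>box_bump a b N \<xi>\<bar> \<le> 1" for \<xi> using box_bump_range[of a b N \<xi>] by simp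
    fix \<alpha> \<beta> :: real assume \<alpha>\<beta>: "\<alpha> \<le> \<beta>"
    let ?C = "2 + (\<beta> - \<alpha>) * (16 * pi * S * (real N + 1))"
    show "(\<lambda>j. LINT t:{\<alpha>..\<beta>}|lborel. \<mu> t (test_symbol (box_bump a b N) (end_cutoff \<sigma> (real (Suc j))) k)) \<longlonglongrightarrow> 0"
    proof (rule Lim_null_comparison)
      show "eventually (\<lambda>j. norm (LINT t:{\<alpha>..\<beta>}|lborel. \<mu> t (test_symbol (box_bump a b N) (end_cutoff \<sigma> (real (Suc j))) k)) \<le> ?C / real (Suc j)) sequentially"
        by (intro always_eventually allI resonant_interval_bound[OF k \<sigma> \<alpha>\<beta>]) simp
      show "(\<lambda>j. ?C / real (Suc j)) \<longlonglongrightarrow> 0"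
        using LIMSEQ_Suc[OF lim_const_over_n[of ?C]] by simp
    qed
  qed
qed

text \<open>Here the symbol carries the factor \<open>\<xi> \<bullet> k\<close> itself, so nothing
  is divided and the multiplier stays bounded by 1. For fixed \<open>R\<close> both
  \<open>2 / \<tau>\<close> and \<open>\<epsilon>^2 * N + \<epsilon> / R\<close> tend to 0, so the
  integral vanishes exactly, for every \<open>k\<close>.\<close>

lemma transport_interval:
  assumes \<sigma>: "\<sigma> = 1 \<or> \<sigma> = -1" and \<alpha>\<beta>: "\<alpha> \<le> \<beta>" and R: "R > 0"
    and SM: "(\<lambda>\<xi>. of_real ((\<xi> \<bullet> ivec k) * box_bump a b N \<xi>)) \<in> SM"
  shows "(LINT t:{\<alpha>..\<beta>}|lborel. \<mu> t (test_symbol (\<lambda>\<xi>. (\<xi> \<bullet> ivec k) * box_bump a b N \<xi>) (end_cutoff \<sigma> R) k)) = 0"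
proof -
  let ?\<beta> = "\<lambda>\<xi>. (\<xi> \<bullet> ivec k) * box_bump a b N \<xi>"
  obtain \<rho> where \<rho>: "\<rho> > 0" "\<And>\<xi>. \<xi> \<in> box a b \<Longrightarrow> norm \<xi> \<le> \<rho>" by (rule box_norm_bound[of a b]) blast
  have supp': "box_bump a b N \<xi> = 0" if "norm \<xi> > \<rho>" for \<xi>
    using \<rho>(2)[of \<xi>] that by (intro box_bump_outside) auto
  then have supp: "?\<beta> \<xi> = 0" if "norm \<xi> > \<rho>" for \<xi> using that by simp
  have W: "smooth_end (end_cutoff \<sigma> R)" using R by (intro smooth_end_cutoff[OF \<sigma>]) auto
  define C where "C h = 2 / \<tau> h + (\<beta> - \<alpha>) * (16 * pi * S * ((\<epsilon> h)\<^sup>2 * real N + \<epsilon> h / R))" for h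
  have "(C \<longlongrightarrow> 0 + (\<beta> - \<alpha>) * (16 * pi * S * (0\<^sup>2 * real N + 0 / R))) (at_right 0)"
    unfolding C_def
    by (intro tendsto_intros eps_lim tendsto_divide_0[OF tendsto_const filterlim_at_top_imp_at_infinity[OF tau_lim]])
       (use R in auto)
  then have "(C \<longlongrightarrow> 0) (at_right 0)" by simp
  then have "(\<lambda>j. C (hs j)) \<longlonglongrightarrow> 0" using hs_at_right by (rule filterlim_compose)
  have cinf: "test_symbol ?\<beta> (end_cutoff \<sigma> R) k \<in> Cinf_c"
    by (rule sym_Cinf_c[where R=\<rho>, OF SM _ W], erule supp)
  have "norm (LINT t:{\<alpha>..\<beta>}|lborel. \<mu> t (test_symbol ?\<beta> (end_cutoff \<sigma> R) k)) \<le> 0"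
  proof -
    have "norm (LINT t:{\<alpha>..\<beta>}|lborel. dst j t (test_symbol ?\<beta> (end_cutoff \<sigma> R) k)) \<le> C (hs j)" for j
    proof -
      define c0 :: complex where "c0 = 1 / (- 2 * \<i> * of_real pi)"
      have "norm c0 = 1 / (2 * pi)" by (simp add: c0_def norm_divide norm_mult)
      also have "\<dots> \<le> 1" using pi_gt3 by simp
      finally have "norm c0 \<le> 1" .
      from oscillating_interval_estimate[OF \<sigma> \<alpha>\<beta> R hs(1)[of j] _ this,
          where n=0 and a=a and b=b and N=N and k=k and B="?\<beta>" and W="end_cutoff \<sigma> R"]
      show ?thesis by (simp add: C_def c0_def box_bump_outside)
    qed
    then show ?thesis
      by (intro limit_interval[OF cinf _ \<open>(\<lambda>j. C (hs j)) \<longlonglongrightarrow> 0\<close>] always_eventually allI)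
  qed
  then show ?thesis by simp
qed

lemma transport_end:
  assumes \<sigma>: "\<sigma> = 1 \<or> \<sigma> = -1"
  shows "AE t in lborel. phase_integral (m t) (\<lambda>\<xi>. (\<xi> \<bullet> ivec k) * box_bump a b N \<xi>) (indicator {endpt \<sigma>}) k = 0"
proof -
  obtain \<rho> where \<rho>: "\<rho> > 0" "\<And>\<xi>. \<xi> \<in> box a b \<Longrightarrow> norm \<xi> \<le> \<rho>" by (rule box_norm_bound[of a b]) blast
  have SM: "(\<lambda>\<xi>. complex_of_real ((\<xi> \<bullet> ivec k) * box_bump a b N \<xi>)) \<in> SM"
    using SM_mult[OF SM_lin[OF bounded_linear_inner_left[of "ivec k"]] box_bump_SM[of a b N]] by simp
  show ?thesis
  proof (rule end_limit[OF SM _ _ \<sigma>])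
    show "(\<xi> \<bullet> ivec k) * box_bump a b N \<xi> = 0" if "norm \<xi> > \<rho>" for \<xi>
      using \<rho>(2)[of \<xi>] that box_bump_outside[of \<xi> a b N] by auto
    show "\<bar>(\<xi> \<bullet> ivec k) * box_bump a b N \<xi>\<bar> \<le> \<rho> * norm (ivec k)" for \<xi>
      by (rule inner_bump_bound[OF \<rho>(2,1)])
    show "(\<lambda>j. LINT t:{c..d}|lborel. \<mu> t (test_symbol (\<lambda>\<xi>. (\<xi> \<bullet> ivec k) * box_bump a b N \<xi>) (end_cutoff \<sigma> (real (Suc j))) k)) \<longlonglongrightarrow> 0"
      if "c \<le> d" for c d
      by (subst transport_interval[OF \<sigma> that _ SM]) auto
  qed
qed

subsection \<open>Low energies\<close>

lemma freq_norm_ell2: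
  assumes f: "f \<in> L2_torus" and r: "freq_norm I h f \<le> r"
  shows "ell2_le (\<lambda>j. if (2 * pi * h * norm (ivec j))\<^sup>2 \<in> I then fourier f j else 0) r"
proof -
  let ?A = "{j. (2 * pi * h * norm (ivec j))\<^sup>2 \<in> I}"
  let ?c = "\<lambda>j. (norm (fourier f j))\<^sup>2"
  \<comment> \<open>An \<open>infsum\<close> without summability is 0 by default, and a bound on
    \<open>freq_norm\<close> would then say nothing about partial sums. Bessel's inequality supplies
    the summability.\<close>
  have s: "?c summable_on ?A"
    by (rule nonneg_bdd_above_summable_on) (auto intro!: bdd_aboveI[where M="(L2_nrm f)\<^sup>2"] bessel[OF f])
  have nn: "0 \<le> infsum ?c ?A" by (rule infsum_nonneg) auto
  have r0: "0 \<le> r" using r nn unfolding freq_norm_def by (meson order_trans real_sqrt_ge_zero)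
  have le: "infsum ?c ?A \<le> r\<^sup>2"
    using r unfolding freq_norm_def by (rule sqrt_le_D)
  show ?thesis
    unfolding ell2_le_iff_sum[OF r0]
  proof (intro allI impI)
    fix F :: "(int ^ 2) set" assume F: "finite F"
    have "(\<Sum>j\<in>F. (norm (if (2 * pi * h * norm (ivec j))\<^sup>2 \<in> I then fourier f j else 0))\<^sup>2) = (\<Sum>j\<in>F \<inter> ?A. ?c j)"
      using F by (intro sum.mono_neutral_cong_right) auto
    also have "\<dots> \<le> infsum ?c ?A"
      by (rule finite_sum_le_infsum[OF s]) (use F in auto)
    finally show "(\<Sum>j\<in>F. (norm (if (2 * pi * h * norm (ivec j))\<^sup>2 \<in> I then fourier f j else 0))\<^sup>2) \<le> r\<^sup>2"
      using le by linarith
  qed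
qed

lemma norm_half_cis: "norm ((1 + cis (- \<theta>)) / 2) = \<bar>cos (\<theta> / 2)\<bar>"
proof -
  have "1 + cis (- \<theta>) = cis (- \<theta> / 2) * (cis (\<theta> / 2) + cis (- \<theta> / 2))"
    by (simp add: distrib_left cis_mult)
  also have "cis (\<theta> / 2) + cis (- \<theta> / 2) = of_real (2 * cos (\<theta> / 2))"
    by (simp add: complex_eq_iff)
  finally show ?thesis by (simp add: norm_mult norm_divide)
qed

text \<open>A power of the multiplier \<open>\<mu>0\<close> acts as a low-energy filter: it is small
  on the energies between \<delta> and \<open>R\<close> that carry the initial data, and at least
  1/2 near energy 0. The filtered initial data have norm at most \<open>3 r\<close>, and at later
  times at most \<open>4 r\<close> once \<epsilon> is small. Undoing the filter near 0 bounds the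
  low-energy mass by \<open>4 * (4 r)^2 = 64 r^2\<close>.\<close>

lemma low_energy_bound:
  assumes r: "0 < r"
  obtains c where "c > 0"
    "\<And>N. AE t in lborel. norm (\<mu> t (test_symbol (box_bump (\<chi> i. - c) (\<chi> i. c) N) (\<lambda>_. 1) 0)) \<le> 64 * r\<^sup>2"
proof -
  have l1: "((\<lambda>R. Limsup (at_right 0) (\<lambda>h. ereal (freq_norm {R..} h (u h)))) \<longlongrightarrow> 0) at_top"
    and l2: "((\<lambda>\<delta>. Limsup (at_right 0) (\<lambda>h. ereal (freq_norm {0..\<delta>} h (u h)))) \<longlongrightarrow> 0) (at_right 0)"
    using loc by (auto simp: frequency_localized_def)
  have r': "0 < ereal r" using r by simp
  have "eventually (\<lambda>R. Limsup (at_right 0) (\<lambda>h. ereal (freq_norm {R..} h (u h))) < ereal r \<and> R > 0) at_top"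
    using order_tendstoD(2)[OF l1 r'] eventually_gt_at_top[of 0] by eventually_elim simp
  then obtain R where R: "Limsup (at_right 0) (\<lambda>h. ereal (freq_norm {R..} h (u h))) < ereal r" "R > 0"
    using eventually_happens' trivial_limit_at_top_linorder by blast
  have "eventually (\<lambda>\<delta>. Limsup (at_right 0) (\<lambda>h. ereal (freq_norm {0..\<delta>} h (u h))) < ereal r \<and> \<delta> > 0 \<and> \<delta> < R) (at_right 0)"
    using order_tendstoD(2)[OF l2 r'] eventually_at_right_less[of 0] eventually_at_right_real[OF R(2)]
    by eventually_elim simp
  then obtain \<delta> where \<delta>: "Limsup (at_right 0) (\<lambda>h. ereal (freq_norm {0..\<delta>} h (u h))) < ereal r" "\<delta> > 0" "\<delta> < R"
    using eventually_happens'[OF trivial_limit_at_right_real] by blast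
  \<comment> \<open>The energy of \<open>j\<close> is \<open>X h j / 2\<close>, so this choice makes
    the modulus of the multiplier \<open>\<bar>cos (pi X / (2 R))\<bar>\<close>, which decreases
    from 1 at \<open>X = 0\<close> to its first zero at \<open>X = R\<close>.\<close>
  define \<alpha> where "\<alpha> = 2 * pi / R"
  have \<alpha>: "\<alpha> > 0" using R by (simp add: \<alpha>_def)
  define X where "X h j = (2 * pi * h * norm (ivec j))\<^sup>2" for h and j :: "int ^ 2"
  define \<mu>0 where "\<mu>0 h j = (1 + cis (- (\<alpha> * energy h j))) / 2" for h j
  have n\<mu>: "norm (\<mu>0 h j) = \<bar>cos (pi * X h j / (2 * R))\<bar>" for h j
  proof -
    have "\<alpha> * energy h j / 2 = pi * X h j / (2 * R)"
      by (simp add: \<alpha>_def energy_def X_def power_mult_distrib)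
    then show ?thesis unfolding \<mu>0_def norm_half_cis by (simp only:)
  qed
  have \<mu>1: "norm (\<mu>0 h j ^ n) \<le> 1" for h j n
    unfolding norm_power n\<mu> by (intro power_le_one) auto
  \<comment> \<open>The largest modulus of the multiplier for \<open>X\<close> between \<delta> and
    \<open>R\<close>. As it is below 1, some power \<open>n\<close> pushes it below
    \<open>r\<close>; only then is the neighbourhood of 0 chosen on which the \<open>n\<close>-th
    power still exceeds 1/2.\<close>
  define q0 where "q0 = cos (pi * \<delta> / (2 * R))"
  have ang: "0 < pi * \<delta> / (2 * R)" "pi * \<delta> / (2 * R) < pi / 2"
    using R \<delta> by (auto simp: field_simps)
  have q0: "0 \<le> q0" "q0 < 1"
    unfolding q0_def using ang cos_monotone_0_pi[of 0 "pi * \<delta> / (2 * R)"] by (auto intro!: cos_ge_zero)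
  have "eventually (\<lambda>n. q0 ^ n < r) sequentially"
    using LIMSEQ_realpow_zero[OF q0] r by (rule order_tendstoD)
  then obtain n where n: "q0 ^ n < r" by (auto simp: eventually_sequentially)
  have "((\<lambda>x. \<bar>cos (pi * x / (2 * R))\<bar> ^ n) \<longlongrightarrow> \<bar>cos (pi * 0 / (2 * R))\<bar> ^ n) (at 0)"
    by (intro tendsto_intros) (use R in auto)
  then have "eventually (\<lambda>x. \<bar>cos (pi * x / (2 * R))\<bar> ^ n > 1/2) (at 0)"
    by (rule order_tendstoD) simp
  then obtain d where d: "d > 0" "\<And>x. x \<noteq> 0 \<Longrightarrow> dist x 0 < d \<Longrightarrow> \<bar>cos (pi * x / (2 * R))\<bar> ^ n > 1/2"
    unfolding eventually_at by auto
  have d': "\<bar>cos (pi * x / (2 * R))\<bar> ^ n > 1/2" if "0 \<le> x" "x < d" for x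
    using d(2)[of x] that by (cases "x = 0") auto
  have init: "ell2_le (\<lambda>j. \<mu>0 h j ^ n * fourier (v h 0) j) (3 * r)"
    if h: "h > 0" and f1: "freq_norm {R..} h (u h) < r" and f2: "freq_norm {0..\<delta>} h (u h) < r" for h
  proof -
    let ?c = "fourier (u h)"
    have 1: "ell2_le (\<lambda>j. if X h j \<in> {R..} then ?c j else 0) r"
      unfolding X_def by (rule freq_norm_ell2[OF u(1)[OF h]]) (use f1 in simp)
    have 2: "ell2_le (\<lambda>j. if X h j \<in> {0..\<delta>} then ?c j else 0) r"
      unfolding X_def by (rule freq_norm_ell2[OF u(1)[OF h]]) (use f2 in simp)
    have 3: "ell2_le (\<lambda>j. of_real r * ?c j) (norm (complex_of_real r) * 1)"
      using ell2_initial[OF h] unfolding v0[OF h] by (rule ell2_le_cmult)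
    \<comment> \<open>The outer two regions are small because the data are small there, the middle
      one because the multiplier is; each contributes \<open>r\<close>.\<close>
    let ?d1 = "\<lambda>j. if X h j \<in> {R..} then \<mu>0 h j ^ n * ?c j else 0"
    let ?d2 = "\<lambda>j. if X h j \<in> {0..\<delta>} then \<mu>0 h j ^ n * ?c j else 0"
    let ?d3 = "\<lambda>j. if X h j \<in> {\<delta><..<R} then \<mu>0 h j ^ n * ?c j else 0"
    have a1: "ell2_le ?d1 r"
      by (rule ell2_le_norm_mono[OF 1]) (use \<mu>1 in \<open>auto simp: norm_mult intro: mult_left_le_one_le\<close>)
    have a2: "ell2_le ?d2 r"
      by (rule ell2_le_norm_mono[OF 2]) (use \<mu>1 in \<open>auto simp: norm_mult intro: mult_left_le_one_le\<close>)
    have a3: "ell2_le ?d3 (norm (complex_of_real r) * 1)"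
    proof (rule ell2_le_norm_mono[OF 3])
      fix j
      show "norm (?d3 j) \<le> norm (of_real r * ?c j)"
      proof (cases "X h j \<in> {\<delta><..<R}")
        case True
        then have "pi * \<delta> / (2 * R) \<le> pi * X h j / (2 * R)" "pi * X h j / (2 * R) \<le> pi / 2"
          using R by (auto simp: divide_simps)
        then have "0 \<le> cos (pi * X h j / (2 * R))" "cos (pi * X h j / (2 * R)) \<le> q0"
          unfolding q0_def using ang by (auto intro!: cos_ge_zero cos_monotone_0_pi_le)
        then have "norm (\<mu>0 h j ^ n) \<le> q0 ^ n"
          unfolding norm_power n\<mu> by (intro power_mono) auto
        then have "norm (\<mu>0 h j ^ n) \<le> r" using n by linarith
        then show ?thesis using True r by (simp add: norm_mult mult_right_mono)
      qed auto
    qed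
    have "ell2_le (\<lambda>j. ?d1 j + (?d2 j + ?d3 j)) (r + (r + norm (complex_of_real r) * 1))"
      by (intro ell2_le_add a1 a2 a3)
    moreover have "?d1 j + (?d2 j + ?d3 j) = \<mu>0 h j ^ n * fourier (v h 0) j" for j
      using \<delta> v0[OF h] by (auto simp: X_def)
    moreover have "r + (r + norm (complex_of_real r) * 1) = 3 * r" using r by simp
    ultimately show ?thesis by (simp only:)
  qed
  \<comment> \<open>A point of the cube with half-width \<open>c\<close> has squared norm at most
    \<open>2 c^2 = d / 2\<close>, which stays below \<open>d\<close>.\<close>
  define c where "c = sqrt (d / 4)"
  have c: "c > 0" "c\<^sup>2 = d / 4" using d by (auto simp: c_def)
  have inbox: "(norm \<xi>)\<^sup>2 < d" if "\<xi> \<in> box (\<chi> i. - c) (\<chi> i. c)" for \<xi> :: "real ^ 2"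
  proof -
    have "(\<xi> $ i)\<^sup>2 \<le> c\<^sup>2" for i
      using that by (intro abs_le_square_iff[THEN iffD1]) (auto simp: mem_box_cart abs_if less_imp_le intro: less_imp_le dest!: spec[of _ i])
    moreover have "(norm \<xi>)\<^sup>2 = (\<xi> $ 1)\<^sup>2 + (\<xi> $ 2)\<^sup>2"
      unfolding power2_norm_eq_inner by (simp add: inner_vec_def sum_2 power2_eq_square)
    ultimately have "(norm \<xi>)\<^sup>2 \<le> d / 2"
      using add_mono[of "(\<xi> $ 1)\<^sup>2" "c\<^sup>2" "(\<xi> $ 2)\<^sup>2" "c\<^sup>2"] c(2) by simp
    then show ?thesis using d(1) by linarith
  qed
  have ev: "eventually (\<lambda>h. freq_norm {R..} h (u h) < r \<and> freq_norm {0..\<delta>} h (u h) < r \<and>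
      2 * (real n * (\<alpha> * (\<epsilon> h)\<^sup>2 * S)) < r) (at_right 0)"
  proof -
    have "((\<lambda>h. 2 * (real n * (\<alpha> * (\<epsilon> h)\<^sup>2 * S))) \<longlongrightarrow> 2 * (real n * (\<alpha> * 0\<^sup>2 * S))) (at_right 0)"
      by (intro tendsto_intros eps_lim)
    then have "eventually (\<lambda>h. 2 * (real n * (\<alpha> * (\<epsilon> h)\<^sup>2 * S)) < r) (at_right 0)"
      by (rule order_tendstoD) (use r in simp)
    then show ?thesis
      using Limsup_lessD[OF R(1)] Limsup_lessD[OF \<delta>(1)] by eventually_elim simp
  qed
  show thesis
  proof (rule that[OF c(1)])
    fix N
    let ?\<beta> = "box_bump (\<chi> i. - c) (\<chi> i. c) N"
    obtain \<rho> where \<rho>: "\<rho> > 0" "\<And>\<xi>. \<xi> \<in> box (\<chi> i. - c) (\<chi> i. c :: real ^ 2) \<Longrightarrow> norm \<xi> \<le> \<rho>"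
      by (rule box_norm_bound[of "\<chi> i. - c" "\<chi> i. c"]) blast
    have supp: "?\<beta> \<xi> = 0" if "norm \<xi> > \<rho>" for \<xi>
      using \<rho>(2)[of \<xi>] that by (intro box_bump_outside) auto
    show "AE t in lborel. norm (\<mu> t (test_symbol ?\<beta> (\<lambda>_. 1) 0)) \<le> 64 * r\<^sup>2"
    proof (rule limit_AE_bound[OF sym_Cinf_c[OF box_bump_SM supp smooth_end_1]])
      show "eventually (\<lambda>j. \<forall>t. norm (dst j t (test_symbol ?\<beta> (\<lambda>_. 1) 0)) \<le> 64 * r\<^sup>2) sequentially"
        using eventually_hs[OF ev]
      proof eventually_elim
        case (elim j)
        define h where "h = hs j"
        have h: "h > 0" using hs(1) by (simp add: h_def)
        let ?\<xi> = "\<lambda>q. (pi * h) *\<^sub>R ivec (q + (q + 0))"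
        let ?Q = "{q. norm (?\<xi> q) \<le> \<rho>}"
        have Q: "finite ?Q" by (rule symbol_sum_finite[OF h])
        \<comment> \<open>For \<open>k = 0\<close> the Weyl midpoint is the frequency
          \<open>2 pi h q\<close> of the plane wave itself, so localization in \<xi> is localization
          in \<open>X\<close>.\<close>
        have X\<xi>: "(norm (?\<xi> q))\<^sup>2 = X h q" for q
        proof -
          have "ivec (q + (q + 0)) = 2 *\<^sub>R ivec q" unfolding ivec_add by (simp add: scaleR_2)
          then have "?\<xi> q = (pi * h) *\<^sub>R (2 *\<^sub>R ivec q)" by (simp only:)
          then have "?\<xi> q = (2 * pi * h) *\<^sub>R ivec q" by (simp only: scaleR_scaleR mult_ac)
          then show ?thesis using h by (simp add: X_def)
        qed
        show ?case
        proof
          fix t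
          let ?c = "fourier (v h (t * \<tau> h))"
          have "ell2_le (\<lambda>j. \<mu>0 h j ^ n * ?c j) (3 * r + 2 * (real n * (\<alpha> * (\<epsilon> h)\<^sup>2 * S)))"
            unfolding \<mu>0_def
            by (rule low_energy_propagation[OF sol[OF h] V h _ ell2_initial[OF h]])
               (use \<alpha> init[OF h] elim in \<open>auto simp: \<mu>0_def h_def\<close>)
          then have p: "ell2_le (\<lambda>j. \<mu>0 h j ^ n * ?c j) (4 * r)"
            by (rule ell2_le_mono) (use elim in \<open>simp add: h_def\<close>)
          \<comment> \<open>Where the bump does not vanish, the filter has modulus at least 1/2,
            which costs a factor 4 after squaring.\<close>
          have pt: "norm (complex_of_real (?\<beta> (?\<xi> q) * 1) * (cnj (?c q) * ?c (q + 0))) \<le> 4 * (norm (\<mu>0 h q ^ n * ?c q))\<^sup>2" for q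
          proof (cases "?\<xi> q \<in> box (\<chi> i. - c) (\<chi> i. c)")
            case True
            have "X h q < d" using inbox[OF True] X\<xi> by simp
            moreover have "0 \<le> X h q" by (simp add: X_def)
            ultimately have g: "1/2 \<le> norm (\<mu>0 h q ^ n)" unfolding norm_power n\<mu> using d'[of "X h q"] by simp
            have "norm (complex_of_real (?\<beta> (?\<xi> q) * 1) * (cnj (?c q) * ?c (q + 0))) = ?\<beta> (?\<xi> q) * (norm (?c q))\<^sup>2"
              using box_bump_range(1) by (simp add: norm_mult power2_eq_square)
            also have "\<dots> \<le> 1 * (norm (?c q))\<^sup>2" by (intro mult_right_mono box_bump_range) auto
            also have "\<dots> \<le> 4 * (norm (\<mu>0 h q ^ n))\<^sup>2 * (norm (?c q))\<^sup>2"
              using power_mono[OF g, of 2] by (intro mult_right_mono) (auto simp: power_divide)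
            also have "\<dots> = 4 * (norm (\<mu>0 h q ^ n * ?c q))\<^sup>2" by (simp add: norm_mult power_mult_distrib)
            finally show ?thesis .
          next
            case False
            then show ?thesis by (simp add: box_bump_outside)
          qed
          have "norm (two_micro_dist h (\<epsilon> h) e (v h (t * \<tau> h)) (test_symbol ?\<beta> (\<lambda>_. 1) 0))
             \<le> (\<Sum>q\<in>?Q. 4 * (norm (\<mu>0 h q ^ n * ?c q))\<^sup>2)"
            by (subst sym_dist[where R=\<rho>, OF h], erule supp) (rule sum_norm_le, rule pt)
          also have "\<dots> = 4 * (\<Sum>q\<in>?Q. (norm (\<mu>0 h q ^ n * ?c q))\<^sup>2)" by (simp add: sum_distrib_left)
          also have "\<dots> \<le> 4 * (4 * r)\<^sup>2"
            using p Q r by (intro mult_left_mono) (auto simp: ell2_le_iff_sum)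
          finally show "norm (dst j t (test_symbol ?\<beta> (\<lambda>_. 1) 0)) \<le> 64 * r\<^sup>2"
            by (simp add: h_def power_mult_distrib)
        qed
      qed
      show "0 \<le> 64 * r\<^sup>2" by simp
    qed
  qed
qed

text \<open>The slice \<xi> = 0 lies in every box around 0, and the mass of a suitable box is at
  most \<open>64 r^2\<close>. Taking \<open>r = 1 / Suc i\<close> leaves countably many exceptional
  sets of times.\<close>

lemma zero_energy_null:
  "AE t in lborel. measure (m t) {z. fst (snd z) = 0} = 0"
proof -
  have "AE t in lborel. measure (m t) {z. fst (snd z) = 0} \<le> 64 * (1 / real (Suc i))\<^sup>2" for i
  proof -
    obtain c where c: "c > 0"
      "\<And>N. AE t in lborel. norm (\<mu> t (test_symbol (box_bump (\<chi> i. - c) (\<chi> i. c) N) (\<lambda>_. 1) 0)) \<le> 64 * (1 / real (Suc i))\<^sup>2"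
      by (rule low_energy_bound[of "1 / real (Suc i)"]) auto
    let ?B = "box (\<chi> i. - c) (\<chi> i. c :: real ^ 2)"
    obtain \<rho> where \<rho>: "\<rho> > 0" "\<And>\<xi>. \<xi> \<in> ?B \<Longrightarrow> norm \<xi> \<le> \<rho>"
      by (rule box_norm_bound[of "\<chi> i. - c" "\<chi> i. c"]) blast
    have supp: "box_bump (\<chi> i. - c) (\<chi> i. c) N \<xi> = 0" if "norm \<xi> > \<rho>" for \<xi> N
      using \<rho>(2)[of \<xi>] that by (intro box_bump_outside) auto
    have "AE t in lborel. \<forall>N. norm (\<mu> t (test_symbol (box_bump (\<chi> i. - c) (\<chi> i. c) N) (\<lambda>_. 1) 0)) \<le> 64 * (1 / real (Suc i))\<^sup>2"
      by (subst AE_all_countable) (use c(2) in blast)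
    with meas show ?thesis
    proof eventually_elim
      case (elim t)
      have fm: "finite_phase_measure (m t)" using elim(1) by (simp add: is_the_measure_def)
      interpret finite_measure "m t" using fm by (simp add: finite_phase_measure_def)
      note [measurable_cong] = phase_borel[OF fm]
      have "(\<lambda>N. phase_integral (m t) (box_bump (\<chi> i. - c) (\<chi> i. c) N) (\<lambda>_. 1) 0) \<longlonglongrightarrow> phase_integral (m t) (indicator ?B) (\<lambda>_. 1) 0"
        by (rule phase_integral_limit[OF fm, where B=1])
           (auto intro: box_bump_limit borel_measurable_continuous_onI continuous_box_bump simp: box_bump_range abs_le_iff order_trans[OF _ box_bump_range(1)])
      moreover have "norm (phase_integral (m t) (box_bump (\<chi> i. - c) (\<chi> i. c) N) (\<lambda>_. 1) 0) \<le> 64 * (1 / real (Suc i))\<^sup>2" for N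
      proof -
        have "\<mu> t (test_symbol (box_bump (\<chi> i. - c) (\<chi> i. c) N) (\<lambda>_. 1) 0) = phase_integral (m t) (box_bump (\<chi> i. - c) (\<chi> i. c) N) (\<lambda>_. 1) 0"
          by (rule test_symbol_measure[where R=\<rho>, OF box_bump_SM _ smooth_end_1 elim(1)], erule supp)
        then show ?thesis using elim(2) by (metis (no_types))
      qed
      ultimately have "norm (phase_integral (m t) (indicator ?B) (\<lambda>_. 1) 0) \<le> 64 * (1 / real (Suc i))\<^sup>2"
        by (intro tendsto_upperbound[OF tendsto_norm]) auto
      moreover have "phase_integral (m t) (indicator ?B) (\<lambda>_. 1) 0 = of_real (measure (m t) {z. fst (snd z) \<in> ?B})"
      proof -
        have sp: "space (m t) = UNIV" using fm by (metis finite_phase_measure_def sets_eq_imp_space_eq space_borel)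
        have mB: "{z. fst (snd z) \<in> ?B} \<in> sets (m t)"
        proof -
          have "{z \<in> space (m t). fst (snd z) \<in> ?B} \<in> sets (m t)" by measurable
          then show ?thesis by (simp add: sp)
        qed
        have "phase_integral (m t) (indicator ?B) (\<lambda>_. 1) 0 = (LINT z|m t. complex_of_real (indicator {z. fst (snd z) \<in> ?B} z))"
          unfolding phase_integral_def by (intro Bochner_Integration.integral_cong) (auto simp: indicator_def)
        also have "\<dots> = of_real (measure (m t) {z. fst (snd z) \<in> ?B})"
          using mB by (simp add: sp)
        finally show ?thesis .
      qed
      moreover have "measure (m t) {z. fst (snd z) = 0} \<le> measure (m t) {z. fst (snd z) \<in> ?B}"
      proof (rule finite_measure_mono)
        show "{z. fst (snd z) = 0} \<subseteq> {z. fst (snd z) \<in> ?B}" using c(1) by (auto simp: mem_box_cart)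
        have sp: "space (m t) = UNIV" using fm by (metis finite_phase_measure_def sets_eq_imp_space_eq space_borel)
        have "{z \<in> space (m t). fst (snd z) \<in> ?B} \<in> sets (m t)" by measurable
        then show "{z. fst (snd z) \<in> ?B} \<in> sets (m t)" by (simp add: sp)
      qed
      ultimately show ?case by simp
    qed
  qed
  then have "AE t in lborel. \<forall>i. measure (m t) {z. fst (snd z) = 0} \<le> 64 * (1 / real (Suc i))\<^sup>2"
    by (subst AE_all_countable) blast
  then show ?thesis
  proof eventually_elim
    case (elim t)
    have "(\<lambda>i. 64 * (1 / real (Suc i))\<^sup>2) \<longlonglongrightarrow> 0" by real_asymp
    then have "measure (m t) {z. fst (snd z) = 0} \<le> 0"
      by (rule LIMSEQ_le_const) (use elim in auto)
    then show ?case by (simp add: antisym)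
  qed
qed

end

subsection \<open>Weighted measures vanishing on rational boxes\<close>

definition rat_vec :: "rat \<times> rat \<Rightarrow> real ^ 2" where
  "rat_vec p = (\<chi> i. if i = 1 then of_rat (fst p) else of_rat (snd p))"

lemma rat_vec_nth: "rat_vec p $ 1 = of_rat (fst p)" "rat_vec p $ 2 = of_rat (snd p)"
  by (simp_all add: rat_vec_def)

lemma mem_box_2: "\<xi> \<in> box a b \<longleftrightarrow> a $ 1 < \<xi> $ 1 \<and> \<xi> $ 1 < b $ 1 \<and> a $ 2 < \<xi> $ 2 \<and> \<xi> $ 2 < b $ 2"
  for \<xi> :: "real ^ 2"
  by (auto simp: mem_box_cart forall_2)

text \<open>Each face is moved strictly inwards by less than \<open>1 / Suc n\<close>, so the
  rational boxes lie inside the open box and eventually contain each of its points.\<close>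

lemma rat_box_limit:
  obtains p q :: "nat \<Rightarrow> rat \<times> rat"
  where "\<And>\<xi>. (\<lambda>n. indicator (box (rat_vec (p n)) (rat_vec (q n))) \<xi> :: real) \<longlonglongrightarrow> indicator (box a b) \<xi>"
proof -
  have "\<exists>r. x < of_rat r \<and> of_rat r < x + 1 / real (Suc n)" for x :: real and n
    by (rule of_rat_dense) simp
  then obtain up where up: "\<And>x n. x < of_rat (up x n)" "\<And>x n. of_rat (up x n) < x + 1 / real (Suc n)" by metis
  have "\<exists>r. x - 1 / real (Suc n) < of_rat r \<and> of_rat r < x" for x :: real and n
    by (rule of_rat_dense) simp
  then obtain dn where dn: "\<And>x n. x - 1 / real (Suc n) < of_rat (dn x n)" "\<And>x n. of_rat (dn x n) < (x :: real)" by metis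
  define p where "p n = (up (a $ 1) n, up (a $ 2) n)" for n
  define q where "q n = (dn (b $ 1) n, dn (b $ 2) n)" for n
  have "(\<lambda>n. indicator (box (rat_vec (p n)) (rat_vec (q n))) \<xi> :: real) \<longlonglongrightarrow> indicator (box a b) \<xi>" for \<xi>
  proof (cases "\<xi> \<in> box a b")
    case True
    define d where "d = Min {\<xi> $ 1 - a $ 1, b $ 1 - \<xi> $ 1, \<xi> $ 2 - a $ 2, b $ 2 - \<xi> $ 2}"
    have d: "d > 0" using True by (simp add: d_def mem_box_2)
    have dle: "d \<le> \<xi> $ 1 - a $ 1" "d \<le> b $ 1 - \<xi> $ 1" "d \<le> \<xi> $ 2 - a $ 2" "d \<le> b $ 2 - \<xi> $ 2"
      by (simp_all add: d_def)
    have "(\<lambda>n. 1 / real (Suc n)) \<longlonglongrightarrow> 0" by real_asymp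
    then have "eventually (\<lambda>n. 1 / real (Suc n) < d) sequentially"
      using d by (rule order_tendstoD)
    then have "eventually (\<lambda>n. indicator (box (rat_vec (p n)) (rat_vec (q n))) \<xi> = (1::real)) sequentially"
    proof eventually_elim
      case (elim n)
      have "\<xi> \<in> box (rat_vec (p n)) (rat_vec (q n))"
        unfolding mem_box_2 rat_vec_nth p_def q_def fst_conv snd_conv
        using elim dle up(2)[of "a $ 1" n] up(2)[of "a $ 2" n] dn(1)[of "b $ 1" n] dn(1)[of "b $ 2" n] by auto
      then show ?case by simp
    qed
    then show ?thesis using True by (simp add: tendsto_eventually)
  next
    case False
    have "\<xi> \<notin> box (rat_vec (p n)) (rat_vec (q n))" for n
      using False unfolding mem_box_2 rat_vec_nth p_def q_def fst_conv snd_conv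
      using up(1) dn(2) by (meson less_trans)
    then show ?thesis using False by simp
  qed
  then show thesis by (rule that)
qed

text \<open>Rational boxes determine all boxes by dominated convergence, boxes determine Borel sets
  by the pi-lambda argument, and simple functions reach every bounded Borel \<beta>. Starting from a
  countable family is what allows one null set of times to serve all \<beta>.\<close>

lemma rat_box_uniqueness:
  fixes w :: "'a \<Rightarrow> complex" and X :: "'a \<Rightarrow> real ^ 2"
  assumes M: "finite_measure M" and X [measurable]: "X \<in> borel_measurable M"
    and w [measurable]: "w \<in> borel_measurable M" and wB: "\<And>z. norm (w z) \<le> B"
    and zero: "\<And>p q. (LINT z|M. indicator (box (rat_vec p) (rat_vec q)) (X z) *\<^sub>R w z) = 0"
    and \<beta> [measurable]: "\<beta> \<in> borel_measurable borel" and \<beta>C: "\<And>\<xi>. norm (\<beta> \<xi> :: complex) \<le> C"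
  shows "(LINT z|M. \<beta> (X z) * w z) = 0"
proof -
  interpret finite_measure M by fact
  have wi: "integrable M w" using wB by (intro integrable_const_bound[where B=B]) auto
  have lim: "(\<lambda>n. LINT z|M. f n (X z) *\<^sub>R w z) \<longlonglongrightarrow> (LINT z|M. g (X z) *\<^sub>R w z)"
    if [measurable]: "\<And>n. f n \<in> borel_measurable borel" "g \<in> borel_measurable borel"
      and l: "\<And>\<xi>. (\<lambda>n. f n \<xi>) \<longlonglongrightarrow> g \<xi>" and b: "\<And>n \<xi>. \<bar>f n \<xi>\<bar> \<le> (1::real)"
    for f :: "nat \<Rightarrow> real ^ 2 \<Rightarrow> real" and g
  proof (rule integral_dominated_convergence[where w="\<lambda>_. 1 * B"])
    show "AE z in M. (\<lambda>n. f n (X z) *\<^sub>R w z) \<longlonglongrightarrow> g (X z) *\<^sub>R w z"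
      by (intro AE_I2 tendsto_intros l)
    show "AE z in M. norm (f n (X z) *\<^sub>R w z) \<le> 1 * B" for n
      using b wB unfolding norm_scaleR by (intro AE_I2 mult_mono) auto
    show "integrable M (\<lambda>_. 1 * B)" by simp
  qed measurable
  have box: "(LINT z|M. indicator (box a b) (X z) *\<^sub>R w z) = 0" for a b
  proof -
    obtain p q :: "nat \<Rightarrow> rat \<times> rat" where pq:
      "\<And>\<xi>. (\<lambda>n. indicator (box (rat_vec (p n)) (rat_vec (q n))) \<xi> :: real) \<longlonglongrightarrow> indicator (box a b) \<xi>"
      by (rule rat_box_limit[of a b]) blast
    have "(\<lambda>n. LINT z|M. indicator (box (rat_vec (p n)) (rat_vec (q n))) (X z) *\<^sub>R w z) \<longlonglongrightarrow> (LINT z|M. indicator (box a b) (X z) *\<^sub>R w z)"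
      by (rule lim[OF _ _ pq]) auto
    then show ?thesis unfolding zero by (simp add: LIMSEQ_const_iff)
  qed
  have total: "(LINT z|M. w z) = 0"
  proof -
    have "(\<lambda>n. LINT z|M. indicator (box (\<chi> i. - real n) (\<chi> i. real n)) (X z) *\<^sub>R w z) \<longlonglongrightarrow> (LINT z|M. (1::real) *\<^sub>R w z)"
    proof (rule lim)
      fix \<xi> :: "real ^ 2"
      obtain n0 :: nat where n0: "norm \<xi> < real n0" using reals_Archimedean2 by blast
      have "eventually (\<lambda>n. indicator (box (\<chi> i. - real n) (\<chi> i. real n)) \<xi> = (1::real)) sequentially"
        using eventually_ge_at_top[of n0]
      proof eventually_elim
        case (elim n)
        then have "\<bar>\<xi> $ i\<bar> < real n" for i
          using n0 component_le_norm_cart[of \<xi> i] by linarith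
        then have "\<xi> \<in> box (\<chi> i. - real n) (\<chi> i. real n)" by (auto simp: mem_box_cart abs_less_iff minus_less_iff)
        then show ?case by simp
      qed
      then show "(\<lambda>n. indicator (box (\<chi> i. - real n) (\<chi> i. real n)) \<xi>) \<longlonglongrightarrow> (1::real)" by (rule tendsto_eventually)
    qed auto
    then show ?thesis unfolding box by (simp add: LIMSEQ_const_iff)
  qed
  have ind: "(LINT z|M. indicator A (X z) *\<^sub>R w z) = 0" if A: "A \<in> sets borel" for A
  proof -
    let ?G = "range (\<lambda>(a, b). box a b :: (real ^ 2) set)"
    have G: "sigma_sets UNIV ?G = sets borel"
      by (simp add: borel_eq_box sets_measure_of)
    have eq: "(LINT z:X -` A \<inter> space M|M. w z) = (LINT z|M. indicator A (X z) *\<^sub>R w z)" for A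
      unfolding set_lebesgue_integral_def by (intro Bochner_Integration.integral_cong) (auto simp: indicator_def)
    have "(LINT z:X -` A \<inter> space M|M. w z) = 0"
    proof (rule integral_zero_sigma_sets[OF wi _ _ _ total])
      show "X -` A \<inter> space M \<in> sets M" if "A \<in> sigma_sets UNIV ?G" for A
        using that unfolding G by (intro measurable_sets[OF X])
      show "Int_stable ?G" by (auto simp: Int_stable_def box_Int_box)
      show "(LINT z:X -` A \<inter> space M|M. w z) = 0" if "A \<in> ?G" for A
        using that unfolding eq by (auto simp: box)
      show "A \<in> sigma_sets UNIV ?G" unfolding G by (rule A)
    qed
    then show ?thesis unfolding eq .
  qed
  obtain F where F: "\<And>i. simple_function borel (F i)" "\<And>\<xi>. (\<lambda>i. F i \<xi>) \<longlonglongrightarrow> \<beta> \<xi>" "\<And>i \<xi>. norm (F i \<xi>) \<le> 2 * norm (\<beta> \<xi>)"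
    using borel_measurable_implies_sequence_metric[OF \<beta>, of 0] by (auto simp: dist_norm)
  have Fm [measurable]: "F i \<in> borel_measurable borel" for i using F(1) by (rule borel_measurable_simple_function)
  have "(LINT z|M. F i (X z) * w z) = 0" for i
  proof -
    have fin: "finite (range (F i))" using F(1)[of i] by (simp add: simple_function_def)
    have "F i (X z) * w z = (\<Sum>y\<in>range (F i). y * (indicator (F i -` {y}) (X z) *\<^sub>R w z))" for z
    proof -
      have "(\<Sum>y\<in>range (F i). y * (indicator (F i -` {y}) (X z) *\<^sub>R w z)) = (\<Sum>y\<in>range (F i). if y = F i (X z) then y * w z else 0)"
        by (intro sum.cong) (auto simp: indicator_def)
      then show ?thesis using fin by simp
    qed
    then have "(LINT z|M. F i (X z) * w z) = (LINT z|M. (\<Sum>y\<in>range (F i). y * (indicator (F i -` {y}) (X z) *\<^sub>R w z)))" by simp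
    also have "\<dots> = (\<Sum>y\<in>range (F i). y * (LINT z|M. indicator (F i -` {y}) (X z) *\<^sub>R w z))"
    proof (subst Bochner_Integration.integral_sum)
      fix y
      have s: "F i -` {y} \<in> sets borel" using measurable_sets[OF Fm[of i], of "{y}"] by simp
      have "integrable M (\<lambda>z. indicator (X -` (F i -` {y}) \<inter> space M) z *\<^sub>R w z)"
        by (intro integrable_mult_indicator wi measurable_sets[OF X s])
      then have "integrable M (\<lambda>z. indicator (F i -` {y}) (X z) *\<^sub>R w z)"
        by (rule Bochner_Integration.integrable_cong[OF refl, THEN iffD1, rotated]) (auto simp: indicator_def)
      then show "integrable M (\<lambda>z. y * (indicator (F i -` {y}) (X z) *\<^sub>R w z))" by (rule integrable_mult_right)
    qed (simp only: integral_mult_right_zero)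
    also have "\<dots> = 0"
      using measurable_sets[OF Fm[of i], of "{_}"] by (simp add: ind)
    finally show ?thesis .
  qed
  moreover have "(\<lambda>i. LINT z|M. F i (X z) * w z) \<longlonglongrightarrow> (LINT z|M. \<beta> (X z) * w z)"
  proof (rule integral_dominated_convergence[where w="\<lambda>_. (2 * C) * B"])
    show "AE z in M. (\<lambda>i. F i (X z) * w z) \<longlonglongrightarrow> \<beta> (X z) * w z" by (intro AE_I2 tendsto_intros F(2))
    show "AE z in M. norm (F i (X z) * w z) \<le> 2 * C * B" for i
    proof (intro AE_I2)
      fix z
      have "norm (F i (X z)) \<le> 2 * C" using F(3)[of i "X z"] \<beta>C[of "X z"] by linarith
      then show "norm (F i (X z) * w z) \<le> 2 * C * B"
        unfolding norm_mult using order_trans[OF norm_ge_zero \<beta>C] by (intro mult_mono wB) auto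
    qed
    show "integrable M (\<lambda>_. 2 * C * B)" by simp
  qed measurable
  ultimately show ?thesis by (simp add: LIMSEQ_const_iff)
qed

abbreviation end_weight :: "real \<Rightarrow> int ^ 2 \<Rightarrow> (real ^ 2) \<times> (real ^ 2) \<times> ereal \<Rightarrow> complex" where
  "end_weight \<sigma> k z \<equiv> of_real (indicator {endpt \<sigma>} (snd (snd z))) * wave (- k) (fst z)"

lemma norm_end_weight: "norm (end_weight \<sigma> k z) \<le> 1"
  by (auto simp: norm_mult indicator_def)

lemma resonant_vanishing:
  assumes M: "finite_phase_measure M"
    and zero: "\<And>p q N. phase_integral M (box_bump (rat_vec p) (rat_vec q) N) (indicator {endpt \<sigma>}) k = 0"
    and \<beta>: "\<beta> \<in> borel_measurable borel" "\<And>\<xi>. norm (\<beta> \<xi> :: complex) \<le> C"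
  shows "(LINT z|M. \<beta> (fst (snd z)) * end_weight \<sigma> k z) = 0"
proof -
  note [measurable_cong] = phase_borel[OF M]
  have fm: "finite_measure M" using M by (simp add: finite_phase_measure_def)
  show ?thesis
  proof (rule rat_box_uniqueness[OF fm _ _ norm_end_weight _ \<beta>])
    show "(LINT z|M. indicator (box (rat_vec p) (rat_vec q)) (fst (snd z)) *\<^sub>R end_weight \<sigma> k z) = 0" for p q
    proof -
      have "(\<lambda>N. phase_integral M (box_bump (rat_vec p) (rat_vec q) N) (indicator {endpt \<sigma>}) k) \<longlonglongrightarrow>
        phase_integral M (indicator (box (rat_vec p) (rat_vec q))) (indicator {endpt \<sigma>}) k"
        by (rule phase_integral_limit[OF M, where B=1])
           (auto intro: box_bump_limit borel_measurable_continuous_onI continuous_box_bump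
             simp: abs_of_nonneg box_bump_range)
      then have "phase_integral M (indicator (box (rat_vec p) (rat_vec q))) (indicator {endpt \<sigma>}) k = 0"
        unfolding zero by (simp add: LIMSEQ_const_iff)
      then show ?thesis
        unfolding phase_integral_def by (simp add: scaleR_conv_of_real mult.assoc)
    qed
  qed measurable
qed

text \<open>The weight \<open>\<xi> \<bullet> k\<close> is unbounded, so it is truncated to a cube
  \<open>?J\<close> with integer corners that contains the support of \<beta>; on that support the
  truncation changes nothing.\<close>

lemma transport_vanishing:
  assumes M: "finite_phase_measure M"
    and zero: "\<And>p q N. phase_integral M (\<lambda>\<xi>. (\<xi> \<bullet> ivec k) * box_bump (rat_vec p) (rat_vec q) N \<xi>) (indicator {endpt \<sigma>}) k = 0"
    and \<beta>: "\<beta> \<in> borel_measurable borel" "\<And>\<xi>. norm (\<beta> \<xi> :: complex) \<le> C" "\<And>\<xi>. norm \<xi> > R \<Longrightarrow> \<beta> \<xi> = 0"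
  shows "(LINT z|M. \<beta> (fst (snd z)) * (of_real (fst (snd z) \<bullet> ivec k) * end_weight \<sigma> k z)) = 0"
proof -
  note [measurable_cong] = phase_borel[OF M]
  have fm: "finite_measure M" using M by (simp add: finite_phase_measure_def)
  obtain n :: nat where n: "R < real n" using reals_Archimedean2 by blast
  define l r where "l = (- of_nat n :: rat, - of_nat n :: rat)" and "r = (of_nat n :: rat, of_nat n :: rat)"
  let ?J = "box (rat_vec l) (rat_vec r)"
  obtain \<rho> where \<rho>: "\<rho> > 0" "\<And>\<xi>. \<xi> \<in> ?J \<Longrightarrow> norm \<xi> \<le> \<rho>"
    by (rule box_norm_bound[of "rat_vec l" "rat_vec r"]) blast
  define w where "w z = of_real ((fst (snd z) \<bullet> ivec k) * indicator ?J (fst (snd z))) * end_weight \<sigma> k z"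
    for z :: "(real ^ 2) \<times> (real ^ 2) \<times> ereal"
  have "(LINT z|M. \<beta> (fst (snd z)) * w z) = 0"
  proof (rule rat_box_uniqueness[OF fm, where B="\<rho> * norm (ivec k) * 1"])
    show "norm (w z) \<le> \<rho> * norm (ivec k) * 1" for z
    proof -
      have "\<bar>(fst (snd z) \<bullet> ivec k) * indicator ?J (fst (snd z))\<bar> \<le> \<rho> * norm (ivec k)"
      proof (cases "fst (snd z) \<in> ?J")
        case True
        have "\<bar>fst (snd z) \<bullet> ivec k\<bar> \<le> norm (fst (snd z)) * norm (ivec k)" by (rule Cauchy_Schwarz_ineq2)
        also have "\<dots> \<le> \<rho> * norm (ivec k)" using \<rho>(2)[OF True] by (intro mult_right_mono) auto
        finally show ?thesis using True by simp
      qed (use \<rho>(1) in simp)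
      then show ?thesis
        unfolding w_def norm_mult[of "of_real _"] using norm_end_weight[where \<sigma>=\<sigma> and k=k and z=z] \<rho>(1)
        by (intro mult_mono) (auto simp del: of_real_mult simp: norm_mult)
    qed
    fix p q :: "rat \<times> rat"
    \<comment> \<open>The intersection of a rational box with \<open>?J\<close> is again a rational
      box, to which the hypothesis applies.\<close>
    define p' where "p' = (max (fst p) (- of_nat n :: rat), max (snd p) (- of_nat n))"
    define q' where "q' = (min (fst q) (of_nat n :: rat), min (snd q) (of_nat n))"
    have mx: "max (of_rat x) (of_rat y) = (of_rat (max x y) :: real)" "min (of_rat x) (of_rat y) = (of_rat (min x y) :: real)" for x y
      by (auto simp: max_def min_def of_rat_less_eq)
    have J: "\<xi> \<in> box (rat_vec p) (rat_vec q) \<and> \<xi> \<in> ?J \<longleftrightarrow> \<xi> \<in> box (rat_vec p') (rat_vec q')" for \<xi>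
      unfolding mem_box_2 rat_vec_nth p'_def q'_def l_def r_def fst_conv snd_conv mx[symmetric] by auto
    obtain \<rho>' where \<rho>': "\<rho>' > 0" "\<And>\<xi>. \<xi> \<in> box (rat_vec p') (rat_vec q') \<Longrightarrow> norm \<xi> \<le> \<rho>'"
      by (rule box_norm_bound[of "rat_vec p'" "rat_vec q'"]) blast
    have "(\<lambda>N. phase_integral M (\<lambda>\<xi>. (\<xi> \<bullet> ivec k) * box_bump (rat_vec p') (rat_vec q') N \<xi>) (indicator {endpt \<sigma>}) k) \<longlonglongrightarrow>
        phase_integral M (\<lambda>\<xi>. (\<xi> \<bullet> ivec k) * indicator (box (rat_vec p') (rat_vec q')) \<xi>) (indicator {endpt \<sigma>}) k"
      by (rule phase_integral_limit[OF M, where B="\<rho>' * norm (ivec k)"])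
         (auto intro!: inner_bump_bound[OF \<rho>'(2,1)] tendsto_mult box_bump_limit borel_measurable_continuous_onI
            continuous_intros continuous_box_bump borel_measurable_times simp del: inner_real_def)
    then have "phase_integral M (\<lambda>\<xi>. (\<xi> \<bullet> ivec k) * indicator (box (rat_vec p') (rat_vec q')) \<xi>) (indicator {endpt \<sigma>}) k = 0"
      unfolding zero by (simp add: LIMSEQ_const_iff)
    moreover have "indicator (box (rat_vec p) (rat_vec q)) (fst (snd z)) *\<^sub>R w z
      = of_real ((fst (snd z) \<bullet> ivec k) * indicator (box (rat_vec p') (rat_vec q')) (fst (snd z)))
         * of_real (indicator {endpt \<sigma>} (snd (snd z))) * wave (- k) (fst z)" for z
      using J[of "fst (snd z)"] by (auto simp: w_def indicator_def)
    ultimately show "(LINT z|M. indicator (box (rat_vec p) (rat_vec q)) (fst (snd z)) *\<^sub>R w z) = 0"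
      by (simp only: phase_integral_def)
  qed (use \<beta> in \<open>auto simp: w_def\<close>)
  moreover have "\<beta> (fst (snd z)) * w z = \<beta> (fst (snd z)) * (of_real (fst (snd z) \<bullet> ivec k) * end_weight \<sigma> k z)" for z
  proof (cases "norm (fst (snd z)) > R")
    case False
    have "\<bar>fst (snd z) $ i\<bar> < real n" for i
      using component_le_norm_cart[of "fst (snd z)" i] False n by linarith
    from this[of 1] this[of 2] have "fst (snd z) \<in> ?J"
      unfolding mem_box_2 rat_vec_nth l_def r_def fst_conv snd_conv by (auto simp: of_rat_minus abs_less_iff)
    then show ?thesis by (simp add: w_def)
  qed (use \<beta>(3) in simp)
  ultimately show ?thesis by simp
qed

text \<open>\<beta> is divided by \<open>\<xi> \<bullet> k\<close> where the latter exceeds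
  \<open>1 / Suc j\<close> in modulus, and \<open>j\<close> tends to infinity. What is missed in the
  limit lies in \<open>perp e\<close> with \<open>\<xi> \<bullet> k = 0\<close>, hence at \<xi> = 0,
  a null set.\<close>

lemma nonresonant_vanishing:
  assumes M: "finite_phase_measure M"
    and zero: "\<And>p q N. phase_integral M (\<lambda>\<xi>. (\<xi> \<bullet> ivec k) * box_bump (rat_vec p) (rat_vec q) N \<xi>) (indicator {endpt \<sigma>}) k = 0"
    and null: "measure M {z. fst (snd z) = 0} = 0"
    and indep: "\<And>\<xi>. \<xi> \<in> perp e \<Longrightarrow> \<xi> \<bullet> ivec k = 0 \<Longrightarrow> \<xi> = 0"
    and \<beta>: "\<beta> \<in> borel_measurable borel" "\<And>\<xi>. norm (\<beta> \<xi> :: complex) \<le> C" "\<And>\<xi>. norm \<xi> > R \<Longrightarrow> \<beta> \<xi> = 0"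
      "\<And>\<xi>. \<xi> \<notin> perp e \<Longrightarrow> \<beta> \<xi> = 0"
  shows "(LINT z|M. \<beta> (fst (snd z)) * end_weight \<sigma> k z) = 0"
proof -
  note [measurable_cong] = phase_borel[OF M]
  note [measurable] = \<beta>(1)
  interpret finite_measure M using M by (simp add: finite_phase_measure_def)
  have C: "0 \<le> C" using order_trans[OF norm_ge_zero \<beta>(2)] .
  define g where "g j \<xi> = \<beta> \<xi> * (if \<bar>\<xi> \<bullet> ivec k\<bar> > 1 / real (Suc j) then 1 / of_real (\<xi> \<bullet> ivec k) else 0)" for j \<xi>
  have gm [measurable]: "g j \<in> borel_measurable borel" for j unfolding g_def by measurable
  have z: "(LINT z|M. g j (fst (snd z)) * (of_real (fst (snd z) \<bullet> ivec k) * end_weight \<sigma> k z)) = 0" for j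
  proof (rule transport_vanishing[OF M zero gm])
    show "norm (g j \<xi>) \<le> C * real (Suc j)" for \<xi>
    proof (cases "\<bar>\<xi> \<bullet> ivec k\<bar> > 1 / real (Suc j)")
      case True
      then have "1 < \<bar>\<xi> \<bullet> ivec k\<bar> * real (Suc j)" by (simp add: divide_less_eq)
      then have "1 / \<bar>\<xi> \<bullet> ivec k\<bar> \<le> real (Suc j)" by (simp add: divide_le_eq mult.commute)
      then have "norm (\<beta> \<xi>) * (1 / \<bar>\<xi> \<bullet> ivec k\<bar>) \<le> C * real (Suc j)"
        using C by (intro mult_mono \<beta>(2)) auto
      then show ?thesis using True by (simp add: g_def norm_mult norm_divide)
    qed (use C in \<open>simp add: g_def\<close>)
    show "g j \<xi> = 0" if "norm \<xi> > R" for \<xi> using \<beta>(3)[OF that] by (simp add: g_def)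
  qed
  have gp: "norm (g j \<xi> * of_real (\<xi> \<bullet> ivec k)) \<le> C" for j \<xi>
  proof (cases "\<bar>\<xi> \<bullet> ivec k\<bar> > 1 / real (Suc j)")
    case True
    then have "\<xi> \<bullet> ivec k \<noteq> 0" by (auto simp: zero_less_divide_iff dest: less_trans[of 0])
    then have "g j \<xi> * of_real (\<xi> \<bullet> ivec k) = \<beta> \<xi>" using True by (simp add: g_def)
    then show ?thesis using \<beta>(2) by simp
  qed (use C in \<open>simp add: g_def\<close>)
  have "(\<lambda>j. LINT z|M. g j (fst (snd z)) * (of_real (fst (snd z) \<bullet> ivec k) * end_weight \<sigma> k z))
     \<longlonglongrightarrow> (LINT z|M. \<beta> (fst (snd z)) * end_weight \<sigma> k z)"
  proof (rule integral_dominated_convergence[where w="\<lambda>_. C * 1"])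
    have sp: "space M = UNIV" using M by (metis finite_phase_measure_def sets_eq_imp_space_eq space_borel)
    have "{z \<in> space M. fst (snd z) = 0} \<in> sets M" by measurable
    then have "{z. fst (snd z) = 0} \<in> null_sets M"
      using null by (simp add: sp null_sets_def emeasure_eq_measure)
    from AE_not_in[OF this] have "AE z in M. fst (snd z) \<noteq> 0" by simp
    then show "AE z in M. (\<lambda>j. g j (fst (snd z)) * (of_real (fst (snd z) \<bullet> ivec k) * end_weight \<sigma> k z))
      \<longlonglongrightarrow> \<beta> (fst (snd z)) * end_weight \<sigma> k z"
    proof eventually_elim
      case (elim z)
      let ?\<xi> = "fst (snd z)"
      show ?case
      proof (cases "?\<xi> \<in> perp e")
        case True
        then have nz: "\<bar>?\<xi> \<bullet> ivec k\<bar> > 0" using indep elim by auto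
        have "(\<lambda>j. 1 / real (Suc j)) \<longlonglongrightarrow> 0" by real_asymp
        then have "eventually (\<lambda>j. 1 / real (Suc j) < \<bar>?\<xi> \<bullet> ivec k\<bar>) sequentially"
          using nz by (rule order_tendstoD)
        then have "eventually (\<lambda>j. g j ?\<xi> * (of_real (?\<xi> \<bullet> ivec k) * end_weight \<sigma> k z) = \<beta> ?\<xi> * end_weight \<sigma> k z) sequentially"
          by eventually_elim (use nz in \<open>simp add: g_def\<close>)
        then show ?thesis by (rule tendsto_eventually)
      next
        case False
        then show ?thesis using \<beta>(4) by (simp add: g_def)
      qed
    qed
    show "AE z in M. norm (g j (fst (snd z)) * (of_real (fst (snd z) \<bullet> ivec k) * end_weight \<sigma> k z)) \<le> C * 1" for j
      unfolding mult.assoc[symmetric, of "g j _"] norm_mult[of "_ * of_real _"]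
      using C by (intro AE_I2 mult_mono gp norm_end_weight) auto
    show "integrable M (\<lambda>_. C * 1)" by simp
  qed measurable
  then show ?thesis unfolding z by (simp add: LIMSEQ_const_iff)
qed

subsection \<open>Restriction to the part at infinity\<close>

lemma integral_measure_restr:
  fixes f :: "'a \<Rightarrow> complex"
  assumes "f \<in> borel_measurable M" "A \<in> sets M"
  shows "(LINT z|measure_restr M A. f z) = (LINT z|M. indicator A z *\<^sub>R f z)"
proof -
  have "measure_restr M A = density M (\<lambda>z. ennreal (indicator A z))"
    by (simp add: measure_restr_def ennreal_indicator)
  then show ?thesis using assms by (simp add: integral_density)
qed

lemma sets_measure_restr: "sets (measure_restr M A) = sets M"
  by (simp add: measure_restr_def)

text \<open>On each end the third variable is constant, so a symbol becomes a function of
  \<open>x\<close> and \<xi> times the indicator of that end, the shape in which the vanishing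
  statements are given.\<close>

lemma ends_integral:
  assumes M: "finite_phase_measure M"
    and f: "\<And>\<eta>. \<eta> \<in> {\<infinity>, - \<infinity>} \<Longrightarrow> (\<lambda>z :: (real ^ 2) \<times> (real ^ 2) \<times> ereal. f (fst z) (fst (snd z)) \<eta> :: complex) \<in> borel_measurable borel"
      "(\<lambda>z. f (fst z) (fst (snd z)) (snd (snd z))) \<in> borel_measurable borel"
    and B: "\<And>x \<xi> \<eta>. \<eta> \<in> {\<infinity>, - \<infinity>} \<Longrightarrow> norm (f x \<xi> \<eta>) \<le> B"
  shows "pairing (part_at_infinity M) f =
    (LINT z|M. of_real (indicator {endpt 1} (snd (snd z))) * f (fst z) (fst (snd z)) (endpt 1))
    + (LINT z|M. of_real (indicator {endpt (- 1)} (snd (snd z))) * f (fst z) (fst (snd z)) (endpt (- 1)))"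
proof -
  note [measurable_cong] = phase_borel[OF M]
  interpret finite_measure M using M by (simp add: finite_phase_measure_def)
  have sM: "sets M = sets borel" using M by (simp add: finite_phase_measure_def)
  have fm [measurable]: "(\<lambda>z. f (fst z) (fst (snd z)) (snd (snd z))) \<in> borel_measurable M"
    using f(2) by (simp add: measurable_cong_sets[OF sM refl])
  have I: "UNIV \<times> UNIV \<times> {\<infinity>, - \<infinity>} \<in> sets M"
  proof -
    have "{z \<in> space M. snd (snd z) = \<infinity> \<or> snd (snd z) = - \<infinity>} \<in> sets M" by measurable
    moreover have "{z \<in> space M. snd (snd z) = \<infinity> \<or> snd (snd z) = - \<infinity>} = UNIV \<times> UNIV \<times> {\<infinity>, - \<infinity>}"
      using sets_eq_imp_space_eq[OF sM] by auto
    ultimately show ?thesis by simp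
  qed
  have i: "integrable M (\<lambda>z. of_real (indicator {endpt \<sigma>} (snd (snd z))) * f (fst z) (fst (snd z)) (endpt \<sigma>))" for \<sigma>
  proof (rule integrable_const_bound[where B=B])
    show "AE z in M. norm (of_real (indicator {endpt \<sigma>} (snd (snd z))) * f (fst z) (fst (snd z)) (endpt \<sigma>)) \<le> B"
    proof (intro AE_I2)
      fix z :: "(real ^ 2) \<times> (real ^ 2) \<times> ereal"
      have "norm (f (fst z) (fst (snd z)) (endpt \<sigma>)) \<le> B" by (rule B) (simp add: endpt_def)
      note b = this
      show "norm (of_real (indicator {endpt \<sigma>} (snd (snd z))) * f (fst z) (fst (snd z)) (endpt \<sigma>)) \<le> B"
        using b order_trans[OF norm_ge_zero b] by (auto simp: norm_mult indicator_def)
    qed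
    have [measurable]: "(\<lambda>z. f (fst z) (fst (snd z)) (endpt \<sigma>)) \<in> borel_measurable M"
    proof -
      have "endpt \<sigma> \<in> {\<infinity>, - \<infinity>}" by (simp add: endpt_def)
      from f(1)[OF this] show ?thesis by (simp add: measurable_cong_sets[OF sM refl])
    qed
    show "(\<lambda>z. of_real (indicator {endpt \<sigma>} (snd (snd z))) * f (fst z) (fst (snd z)) (endpt \<sigma>)) \<in> borel_measurable M"
      by measurable
  qed
  have "pairing (part_at_infinity M) f = (LINT z|M. indicator (UNIV \<times> UNIV \<times> {\<infinity>, - \<infinity>}) z *\<^sub>R f (fst z) (fst (snd z)) (snd (snd z)))"
    unfolding pairing_def part_at_infinity_def case_prod_unfold by (rule integral_measure_restr[OF fm I])
  also have "\<dots> = (LINT z|M. of_real (indicator {endpt 1} (snd (snd z))) * f (fst z) (fst (snd z)) (endpt 1)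
     + of_real (indicator {endpt (- 1)} (snd (snd z))) * f (fst z) (fst (snd z)) (endpt (- 1)))"
    by (intro Bochner_Integration.integral_cong) (auto simp: indicator_def endpt_def)
  also have "\<dots> = (LINT z|M. of_real (indicator {endpt 1} (snd (snd z))) * f (fst z) (fst (snd z)) (endpt 1))
    + (LINT z|M. of_real (indicator {endpt (- 1)} (snd (snd z))) * f (fst z) (fst (snd z)) (endpt (- 1)))"
    by (rule Bochner_Integration.integral_add[OF i i])
  finally show ?thesis .
qed

text \<open>A smooth symbol is described in three charts: continuity at an end is read off from the
  extension at \<open>s = 0\<close>, and joint measurability is assembled from the two ends and the
  finite part.\<close>

lemma x_independent_symbol:
  assumes a: "(\<lambda>x. a) \<in> Cinf_c"
  shows "continuous_on UNIV (\<lambda>\<xi>. a \<xi> \<infinity>)" "continuous_on UNIV (\<lambda>\<xi>. a \<xi> (- \<infinity>))"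
    and "(\<lambda>(\<xi>, \<eta>). a \<xi> \<eta>) \<in> borel_measurable borel"
proof -
  have s: "smooth_symbol (\<lambda>x. a)" using a by (simp add: Cinf_c_def)
  obtain b :: "(real ^ 2) \<times> (real ^ 2) \<times> real \<Rightarrow> complex" where b: "smooth b" "\<And>x \<xi>. b (x, \<xi>, 0) = a \<xi> \<infinity>"
    using s unfolding smooth_symbol_def by blast
  have "continuous_on UNIV (\<lambda>\<xi>. b (0, \<xi>, 0))"
    by (rule continuous_on_compose2[OF smooth_continuous[OF b(1)]]) (auto intro!: continuous_intros)
  then show c1: "continuous_on UNIV (\<lambda>\<xi>. a \<xi> \<infinity>)" unfolding b(2) .
  obtain b' :: "(real ^ 2) \<times> (real ^ 2) \<times> real \<Rightarrow> complex" where b': "smooth b'" "\<And>x \<xi>. b' (x, \<xi>, 0) = a \<xi> (- \<infinity>)"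
    using s unfolding smooth_symbol_def by blast
  have "continuous_on UNIV (\<lambda>\<xi>. b' (0, \<xi>, 0))"
    by (rule continuous_on_compose2[OF smooth_continuous[OF b'(1)]]) (auto intro!: continuous_intros)
  then show c2: "continuous_on UNIV (\<lambda>\<xi>. a \<xi> (- \<infinity>))" unfolding b'(2) .
  have "smooth (\<lambda>(x :: real ^ 2, \<xi>, \<eta>). a \<xi> (ereal \<eta>))" using s by (simp add: smooth_symbol_def)
  from smooth_continuous[OF this]
  have "continuous_on UNIV (\<lambda>p :: (real ^ 2) \<times> real. (\<lambda>(x :: real ^ 2, \<xi>, \<eta>). a \<xi> (ereal \<eta>)) (0, fst p, snd p))"
    by (rule continuous_on_compose2) (auto intro!: continuous_intros)
  then have c: "continuous_on UNIV (\<lambda>p. a (fst p) (ereal (snd p)))" by (simp add: case_prod_unfold)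
  have m1: "(\<lambda>\<xi>. a \<xi> \<infinity>) \<in> borel_measurable borel" "(\<lambda>\<xi>. a \<xi> (- \<infinity>)) \<in> borel_measurable borel"
    by (intro borel_measurable_continuous_onI c1 c2)+
  have m2: "(\<lambda>p. a (fst p) (ereal (snd p))) \<in> borel_measurable (borel \<Otimes>\<^sub>M borel)"
    using c by (simp add: borel_prod borel_measurable_continuous_onI)
  \<comment> \<open>At the ends \<open>real_of_ereal\<close> returns the default 0; the case
    distinction overrides it there.\<close>
  have "(\<lambda>p. if snd p = \<infinity> then a (fst p) \<infinity> else if snd p = - \<infinity> then a (fst p) (- \<infinity>) else a (fst p) (ereal (real_of_ereal (snd p))))
     \<in> borel_measurable (borel \<Otimes>\<^sub>M borel)"
  proof (intro measurable_If)
    have "(\<lambda>p. (fst p, real_of_ereal (snd p))) \<in> (borel \<Otimes>\<^sub>M borel) \<rightarrow>\<^sub>M (borel \<Otimes>\<^sub>M borel)" by measurable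
    from measurable_compose[OF this m2]
    show "(\<lambda>p. a (fst p) (ereal (real_of_ereal (snd p)))) \<in> borel_measurable (borel \<Otimes>\<^sub>M borel)" by simp
    show "(\<lambda>p. a (fst p) \<infinity>) \<in> borel_measurable (borel \<Otimes>\<^sub>M borel)"
      by (rule measurable_compose[OF measurable_fst m1(1)])
    show "(\<lambda>p. a (fst p) (- \<infinity>)) \<in> borel_measurable (borel \<Otimes>\<^sub>M borel)"
      by (rule measurable_compose[OF measurable_fst m1(2)])
  qed measurable
  also have "(\<lambda>p. if snd p = \<infinity> then a (fst p) \<infinity> else if snd p = - \<infinity> then a (fst p) (- \<infinity>) else a (fst p) (ereal (real_of_ereal (snd p))))
     = (\<lambda>(\<xi>, \<eta>). a \<xi> \<eta>)"
    by (auto simp: fun_eq_iff ereal_real)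
  finally show "(\<lambda>(\<xi>, \<eta>). a \<xi> \<eta>) \<in> borel_measurable borel" by (simp add: borel_prod)
qed

lemma compactly_supported_bounded:
  fixes f :: "real ^ 2 \<Rightarrow> complex"
  assumes "continuous_on UNIV f" "\<And>\<xi>. norm \<xi> > R \<Longrightarrow> f \<xi> = 0"
  obtains C where "\<And>\<xi>. norm (f \<xi>) \<le> C"
proof -
  have "compact (f ` cball 0 R)" by (intro compact_continuous_image continuous_on_subset[OF assms(1)]) auto
  then obtain C where C: "C > 0" "\<And>y. y \<in> f ` cball 0 R \<Longrightarrow> norm y \<le> C"
    by (meson bounded_pos compact_imp_bounded)
  have "norm (f \<xi>) \<le> C" for \<xi>
    using C assms(2)[of \<xi>] by (cases "norm \<xi> > R") (auto simp: not_less)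
  then show thesis by (rule that)
qed

section \<open>Constancy in \<open>x\<close> from the vanishing of the nonzero modes\<close>

lemma C0_c_bounded:
  assumes a: "a \<in> C0_c"
  obtains B where "B > 0" "\<And>x \<xi> \<eta>. norm (a x \<xi> \<eta>) \<le> B"
proof -
  have c: "continuous_on UNIV (\<lambda>(x, \<xi>, \<eta>). a x \<xi> \<eta>)" and per: "x_periodic a"
    using a by (auto simp: C0_c_def)
  obtain R where R: "\<And>x \<xi> \<eta>. norm \<xi> > R \<Longrightarrow> a x \<xi> \<eta> = 0"
    using a by (auto simp: C0_c_def compact_support_def)
  let ?K = "cbox 0 1 \<times> cball 0 R \<times> (UNIV :: ereal set)"
  have "compact ((\<lambda>(x, \<xi>, \<eta>). a x \<xi> \<eta>) ` ?K)"
    by (intro compact_continuous_image continuous_on_subset[OF c] compact_Times compact_UNIV) auto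
  then obtain B where B: "B > 0" "\<And>y. y \<in> (\<lambda>(x, \<xi>, \<eta>). a x \<xi> \<eta>) ` ?K \<Longrightarrow> norm y \<le> B"
    by (meson bounded_pos compact_imp_bounded)
  have "norm (a x \<xi> \<eta>) \<le> B" for x \<xi> \<eta>
  proof (cases "norm \<xi> > R")
    case False
    have "periodic (\<lambda>x. a x \<xi> \<eta>)" using per by (simp add: x_periodic_def)
    then obtain y where y: "y \<in> cell" "a y \<xi> \<eta> = a x \<xi> \<eta>" by (rule periodic_reduce)
    then have "a y \<xi> \<eta> \<in> (\<lambda>(x, \<xi>, \<eta>). a x \<xi> \<eta>) ` ?K"
      using cell_subset False by (intro image_eqI[of _ _ "(y, \<xi>, \<eta>)"]) auto
    then show ?thesis using B(2) y(2) by simp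
  qed (use R B(1) in simp)
  then show thesis using B(1) that by blast
qed

text \<open>The trigonometric approximants of \<open>a\<close> in the variable \<open>x\<close>
  converge boundedly to \<open>a\<close>. Only their mode 0 survives the integration, and
  \<open>\<gamma> n 0 = 1\<close> makes that mode the average of \<open>a\<close> over
  \<open>x\<close> for every \<open>n\<close>.\<close>

lemma vanishing_imp_constant_in_x:
  assumes M: "finite_phase_measure M"
    and van: "\<And>\<sigma> k \<beta> C R. \<sigma> = 1 \<or> \<sigma> = -1 \<Longrightarrow> k \<noteq> 0 \<Longrightarrow> \<beta> \<in> borel_measurable borel \<Longrightarrow>
       (\<And>\<xi>. norm (\<beta> \<xi> :: complex) \<le> C) \<Longrightarrow> (\<And>\<xi>. norm \<xi> > R \<Longrightarrow> \<beta> \<xi> = 0) \<Longrightarrow> (\<And>\<xi>. \<xi> \<notin> perp e \<Longrightarrow> \<beta> \<xi> = 0) \<Longrightarrow>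
       (LINT z|M. \<beta> (fst (snd z)) * end_weight \<sigma> k z) = 0"
  shows "constant_in_x (measure_restr (part_at_infinity M) (UNIV \<times> perp e \<times> UNIV))"
  unfolding constant_in_x_def
proof
  fix a assume a: "a \<in> C0_c"
  interpret finite_measure M using M by (simp add: finite_phase_measure_def)
  have sM: "sets M = sets borel" using M by (simp add: finite_phase_measure_def)
  have ca: "continuous_on UNIV (\<lambda>z. a (fst z) (fst (snd z)) (snd (snd z)))" and per: "x_periodic a"
    using a by (auto simp: C0_c_def case_prod_unfold)
  obtain R where R: "\<And>x \<xi> \<eta>. norm \<xi> > R \<Longrightarrow> a x \<xi> \<eta> = 0"
    using a by (auto simp: C0_c_def compact_support_def)
  obtain B where B: "B > 0" "\<And>x \<xi> \<eta>. norm (a x \<xi> \<eta>) \<le> B" using C0_c_bounded[OF a] by blast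
  have perx: "periodic (\<lambda>x. a x \<xi> \<eta>)" for \<xi> \<eta> using per by (simp add: x_periodic_def)
  have cx: "continuous_on UNIV (\<lambda>x. a x \<xi> \<eta>)" for \<xi> \<eta>
  proof -
    have "continuous_on UNIV (\<lambda>x :: real ^ 2. (x, \<xi>, \<eta>))" by (intro continuous_intros)
    from continuous_on_compose2[OF ca this] show ?thesis by simp
  qed
  define c where "c p \<xi> \<eta> = fourier (\<lambda>y. a y \<xi> \<eta>) p" for p \<xi> \<eta>
  have cB: "norm (c p \<xi> \<eta>) \<le> B" for p \<xi> \<eta>
    unfolding c_def by (rule fourier_bounded_le[OF borel_measurable_continuous_onI[OF cx] B(2)])
  have cR: "c p \<xi> \<eta> = 0" if "norm \<xi> > R" for p \<xi> \<eta>
    using R[OF that] by (simp add: c_def fourier_torus)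
  have cm: "(\<lambda>w. c p (fst w) (snd w)) \<in> borel_measurable (borel \<Otimes>\<^sub>M borel)" for p
  proof -
    have 1: "(\<lambda>z. a (fst z) (fst (snd z)) (snd (snd z))) \<in> borel_measurable (borel \<Otimes>\<^sub>M (borel \<Otimes>\<^sub>M borel))"
      using ca by (simp add: borel_prod borel_measurable_continuous_onI)
    have "(\<lambda>(w, y). (y, w)) \<in> (borel \<Otimes>\<^sub>M borel) \<Otimes>\<^sub>M lborel \<rightarrow>\<^sub>M borel \<Otimes>\<^sub>M (borel \<Otimes>\<^sub>M borel)" by measurable
    from measurable_compose[OF this 1]
    have [measurable]: "(\<lambda>(w, y). a y (fst w) (snd w)) \<in> borel_measurable ((borel \<Otimes>\<^sub>M borel) \<Otimes>\<^sub>M lborel)"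
      by (simp add: case_prod_unfold)
    have "(\<lambda>w. LINT y|lborel. indicator cell y *\<^sub>R (a y (fst w) (snd w) * wave (- p) y)) \<in> borel_measurable (borel \<Otimes>\<^sub>M borel)"
      by measurable
    then show ?thesis by (simp add: c_def fourier_def set_lebesgue_integral_def)
  qed
  have perp_m [measurable]: "perp e \<in> sets borel"
    unfolding perp_def by measurable
  let ?P = "indicator (perp e) :: real ^ 2 \<Rightarrow> real"
  \<comment> \<open>Restricting the measure to \<open>perp e\<close> is traded for the factor
    \<open>?P\<close> on the symbol, so that \<open>ends_integral\<close> applies to the part at
    infinity.\<close>
  define I where "I f = pairing (part_at_infinity M) (\<lambda>x \<xi> \<eta>. ?P \<xi> *\<^sub>R f x \<xi> \<eta>)" for f :: symbol
  have restr: "pairing (measure_restr (part_at_infinity M) (UNIV \<times> perp e \<times> UNIV)) f = I f"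
    if f: "(\<lambda>z. f (fst z) (fst (snd z)) (snd (snd z))) \<in> borel_measurable borel" for f
  proof -
    have sets_eq: "sets (part_at_infinity M) = sets borel"
      by (simp add: part_at_infinity_def sets_measure_restr sM)
    have "{z :: (real ^ 2) \<times> (real ^ 2) \<times> ereal. fst (snd z) \<in> perp e} \<in> sets (borel \<Otimes>\<^sub>M (borel \<Otimes>\<^sub>M borel))"
    proof -
      have "{z \<in> space (borel \<Otimes>\<^sub>M (borel \<Otimes>\<^sub>M borel)) :: ((real ^ 2) \<times> (real ^ 2) \<times> ereal) set. fst (snd z) \<in> perp e} \<in> sets (borel \<Otimes>\<^sub>M (borel \<Otimes>\<^sub>M borel))"
        by measurable
      then show ?thesis by (simp add: space_pair_measure)
    qed
    moreover have "{z :: (real ^ 2) \<times> (real ^ 2) \<times> ereal. fst (snd z) \<in> perp e} = UNIV \<times> perp e \<times> UNIV" by auto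
    ultimately have "UNIV \<times> perp e \<times> UNIV \<in> sets (part_at_infinity M)"
      unfolding sets_eq using phase_borel[OF M] sM by simp
    then show ?thesis
      unfolding pairing_def case_prod_unfold I_def
      using f by (subst integral_measure_restr)
        (auto simp: measurable_cong_sets[OF sets_eq refl] indicator_def intro!: Bochner_Integration.integral_cong)
  qed
  let ?T = "\<lambda>\<sigma> f. LINT z|M. of_real (indicator {endpt \<sigma>} (snd (snd z))) * (?P (fst (snd z)) *\<^sub>R f (fst z) (fst (snd z)) (endpt \<sigma>))"
  have meas_term: "(\<lambda>z :: (real ^ 2) \<times> (real ^ 2) \<times> ereal. c p (fst (snd z)) \<eta> * wave p (fst z)) \<in> borel_measurable borel"
    "(\<lambda>z :: (real ^ 2) \<times> (real ^ 2) \<times> ereal. c p (fst (snd z)) (snd (snd z)) * wave p (fst z)) \<in> borel_measurable borel"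
    "(\<lambda>\<xi>. c p \<xi> \<eta>) \<in> borel_measurable borel" for p \<eta>
  proof -
    have "(\<lambda>\<xi>. (\<xi>, \<eta>)) \<in> borel \<rightarrow>\<^sub>M borel \<Otimes>\<^sub>M borel" by measurable
    from measurable_compose[OF this cm] show 3: "(\<lambda>\<xi>. c p \<xi> \<eta>) \<in> borel_measurable borel" by simp
    note [measurable] = 3
    have "(\<lambda>z :: (real ^ 2) \<times> (real ^ 2) \<times> ereal. c p (fst (snd z)) \<eta> * wave p (fst z)) \<in> borel_measurable (borel \<Otimes>\<^sub>M (borel \<Otimes>\<^sub>M borel))"
      by measurable
    then show "(\<lambda>z :: (real ^ 2) \<times> (real ^ 2) \<times> ereal. c p (fst (snd z)) \<eta> * wave p (fst z)) \<in> borel_measurable borel"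
      by (simp add: borel_prod)
    have [measurable]: "(\<lambda>z. c p (fst (snd z)) (snd (snd z))) \<in> borel_measurable (borel \<Otimes>\<^sub>M (borel \<Otimes>\<^sub>M borel))"
      by (rule measurable_compose[OF measurable_snd cm])
    have "(\<lambda>z :: (real ^ 2) \<times> (real ^ 2) \<times> ereal. c p (fst (snd z)) (snd (snd z)) * wave p (fst z)) \<in> borel_measurable (borel \<Otimes>\<^sub>M (borel \<Otimes>\<^sub>M borel))"
      by measurable
    then show "(\<lambda>z :: (real ^ 2) \<times> (real ^ 2) \<times> ereal. c p (fst (snd z)) (snd (snd z)) * wave p (fst z)) \<in> borel_measurable borel"
      by (simp add: borel_prod)
  qed
  have perp_z: "(\<lambda>z :: (real ^ 2) \<times> (real ^ 2) \<times> ereal. ?P (fst (snd z))) \<in> borel_measurable borel"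
  proof -
    have "(\<lambda>z :: (real ^ 2) \<times> (real ^ 2) \<times> ereal. ?P (fst (snd z))) \<in> borel_measurable (borel \<Otimes>\<^sub>M (borel \<Otimes>\<^sub>M borel))"
      by measurable
    then show ?thesis by (simp add: borel_prod)
  qed
  have I_ends: "I f = ?T 1 f + ?T (- 1) f"
    if "\<And>\<eta>. (\<lambda>z :: (real ^ 2) \<times> (real ^ 2) \<times> ereal. f (fst z) (fst (snd z)) \<eta>) \<in> borel_measurable borel"
      "(\<lambda>z. f (fst z) (fst (snd z)) (snd (snd z))) \<in> borel_measurable borel" "\<And>x \<xi> \<eta>. norm (f x \<xi> \<eta>) \<le> C"
    for f C
    unfolding I_def
  proof (rule ends_integral[OF M, where B=C])
    show "norm (?P \<xi> *\<^sub>R f x \<xi> \<eta>) \<le> C" for x \<xi> \<eta>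
      using that(3)[of x \<xi> \<eta>] order_trans[OF norm_ge_zero that(3)] by (auto simp: indicator_def)
  qed (intro borel_measurable_scaleR perp_z that)+
  obtain A \<gamma> where A: "\<And>n::nat. finite (A n)" "\<And>n. 0 \<in> A n" and \<gamma>: "\<And>n. \<gamma> n 0 = 1"
    and bd: "\<And>n x f B. periodic f \<Longrightarrow> continuous_on UNIV f \<Longrightarrow> (\<And>x. norm (f x) \<le> B) \<Longrightarrow>
        norm (trig (A n) (\<lambda>p. \<gamma> n p * fourier f p) x) \<le> B"
    and lim: "\<And>x f. periodic f \<Longrightarrow> continuous_on UNIV f \<Longrightarrow>
        (\<lambda>n. trig (A n) (\<lambda>p. \<gamma> n p * fourier f p) x) \<longlonglongrightarrow> f x"
    by (rule fejer_approximation) blast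
  define an where "an n x \<xi> \<eta> = trig (A n) (\<lambda>p. \<gamma> n p * c p \<xi> \<eta>) x" for n x \<xi> \<eta>
  have anB: "norm (an n x \<xi> \<eta>) \<le> B" for n x \<xi> \<eta>
    unfolding an_def c_def by (rule bd[OF perx cx B(2)])
  have anl: "(\<lambda>n. an n x \<xi> \<eta>) \<longlonglongrightarrow> a x \<xi> \<eta>" for x \<xi> \<eta>
    unfolding an_def c_def by (rule lim[OF perx cx])
  have an_sum: "an n x \<xi> \<eta> = (\<Sum>p\<in>A n. \<gamma> n p * (c p \<xi> \<eta> * wave p x))" for n x \<xi> \<eta>
    by (simp add: an_def trig_def mult.assoc)
  have T_mode: "?T \<sigma> (\<lambda>x \<xi> \<eta>. c p \<xi> \<eta> * wave p x) = 0" if "p \<noteq> 0" "\<sigma> = 1 \<or> \<sigma> = -1" for p \<sigma>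
  proof -
    \<comment> \<open>\<open>end_weight\<close> contains \<open>wave (- k)\<close>, so the mode
      \<open>p\<close> is the case \<open>k = - p\<close>; the function of \<xi> is
      \<open>?P\<close> times the \<open>p\<close>-th coefficient of \<open>a\<close> at the
      end.\<close>
    have "(LINT z|M. (\<lambda>\<xi>. of_real (?P \<xi>) * c p \<xi> (endpt \<sigma>)) (fst (snd z)) * end_weight \<sigma> (- p) z) = 0"
    proof (rule van[OF that(2), where C=B and R=R])
      show "- p \<noteq> 0" using that(1) by simp
      have [measurable]: "(\<lambda>\<xi>. c p \<xi> (endpt \<sigma>)) \<in> borel_measurable borel" by (rule meas_term(3))
      show "(\<lambda>\<xi>. of_real (?P \<xi>) * c p \<xi> (endpt \<sigma>)) \<in> borel_measurable borel" by measurable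
      show "norm (of_real (?P \<xi>) * c p \<xi> (endpt \<sigma>)) \<le> B" for \<xi>
        using cB[of p \<xi> "endpt \<sigma>"] B(1) by (auto simp: norm_mult indicator_def)
      show "of_real (?P \<xi>) * c p \<xi> (endpt \<sigma>) = 0" if "norm \<xi> > R" for \<xi> using cR[OF that] by simp
      show "of_real (?P \<xi>) * c p \<xi> (endpt \<sigma>) = 0" if "\<xi> \<notin> perp e" for \<xi> using that by simp
    qed
    then show ?thesis by (simp add: scaleR_conv_of_real mult_ac)
  qed
  have Tint: "integrable M (\<lambda>z. of_real (indicator {endpt \<sigma>} (snd (snd z))) * (?P (fst (snd z)) *\<^sub>R (c p (fst (snd z)) (endpt \<sigma>) * wave p (fst z))))" for \<sigma> p
  proof (rule integrable_const_bound[where B=B])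
    show "AE z in M. norm (of_real (indicator {endpt \<sigma>} (snd (snd z))) * (?P (fst (snd z)) *\<^sub>R (c p (fst (snd z)) (endpt \<sigma>) * wave p (fst z)))) \<le> B"
      using cB B(1) by (intro AE_I2) (auto simp: norm_mult indicator_def)
    note [measurable_cong] = phase_borel[OF M]
    have [measurable]: "(\<lambda>\<xi>. c p \<xi> (endpt \<sigma>)) \<in> borel_measurable borel" by (rule meas_term(3))
    show "(\<lambda>z. of_real (indicator {endpt \<sigma>} (snd (snd z))) * (?P (fst (snd z)) *\<^sub>R (c p (fst (snd z)) (endpt \<sigma>) * wave p (fst z)))) \<in> borel_measurable M"
      by measurable
  qed
  have T_an: "?T \<sigma> (an n) = ?T \<sigma> (\<lambda>x \<xi> \<eta>. c 0 \<xi> \<eta> * wave 0 x)" if \<sigma>: "\<sigma> = 1 \<or> \<sigma> = -1" for \<sigma> n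
  proof -
    let ?t = "\<lambda>p z. of_real (indicator {endpt \<sigma>} (snd (snd z))) * (?P (fst (snd z)) *\<^sub>R (c p (fst (snd z)) (endpt \<sigma>) * wave p (fst z)))"
    have "?T \<sigma> (an n) = (LINT z|M. (\<Sum>p\<in>A n. \<gamma> n p * ?t p z))"
      unfolding an_sum by (simp add: scaleR_sum_right sum_distrib_left mult_ac)
    also have "\<dots> = (\<Sum>p\<in>A n. \<gamma> n p * (LINT z|M. ?t p z))"
      by (subst Bochner_Integration.integral_sum) (simp_all only: integral_mult_right_zero integrable_mult_right Tint)
    also have "\<dots> = (\<Sum>p\<in>A n. if p = 0 then \<gamma> n 0 * (LINT z|M. ?t 0 z) else 0)"
      using T_mode[OF _ \<sigma>] by (intro sum.cong) auto
    also have "\<dots> = (LINT z|M. ?t 0 z)" using A \<gamma> by simp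
    finally show ?thesis .
  qed
  have Tlim: "(\<lambda>n. ?T \<sigma> (an n)) \<longlonglongrightarrow> ?T \<sigma> a" for \<sigma>
  proof (rule integral_dominated_convergence[where w="\<lambda>_. B"])
    note [measurable_cong] = phase_borel[OF M]
    show "integrable M (\<lambda>_. B)" by simp
    show "AE z in M. (\<lambda>n. of_real (indicator {endpt \<sigma>} (snd (snd z))) * (?P (fst (snd z)) *\<^sub>R an n (fst z) (fst (snd z)) (endpt \<sigma>)))
       \<longlonglongrightarrow> of_real (indicator {endpt \<sigma>} (snd (snd z))) * (?P (fst (snd z)) *\<^sub>R a (fst z) (fst (snd z)) (endpt \<sigma>))"
      by (intro AE_I2 tendsto_intros anl)
    show "AE z in M. norm (of_real (indicator {endpt \<sigma>} (snd (snd z))) * (?P (fst (snd z)) *\<^sub>R an n (fst z) (fst (snd z)) (endpt \<sigma>))) \<le> B" for n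
      using anB B(1) by (intro AE_I2) (auto simp: norm_mult indicator_def)
    have [measurable]: "(\<lambda>\<xi>. c p \<xi> (endpt \<sigma>)) \<in> borel_measurable borel" for p by (rule meas_term(3))
    show "(\<lambda>z. of_real (indicator {endpt \<sigma>} (snd (snd z))) * (?P (fst (snd z)) *\<^sub>R an n (fst z) (fst (snd z)) (endpt \<sigma>))) \<in> borel_measurable M" for n
      unfolding an_sum by measurable
    have "continuous_on UNIV (\<lambda>w :: (real ^ 2) \<times> (real ^ 2). a (fst w) (snd w) (endpt \<sigma>))"
    proof -
      have "continuous_on UNIV (\<lambda>w :: (real ^ 2) \<times> (real ^ 2). (fst w, snd w, endpt \<sigma>))" by (intro continuous_intros)
      from continuous_on_compose2[OF ca this] show ?thesis by simp
    qed
    then have 1: "(\<lambda>w :: (real ^ 2) \<times> (real ^ 2). a (fst w) (snd w) (endpt \<sigma>)) \<in> borel_measurable (borel \<Otimes>\<^sub>M borel)"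
      by (simp add: borel_prod borel_measurable_continuous_onI)
    have "(\<lambda>z. (fst z, fst (snd z))) \<in> M \<rightarrow>\<^sub>M (borel \<Otimes>\<^sub>M borel)" by measurable
    from measurable_compose[OF this 1] have [measurable]: "(\<lambda>z. a (fst z) (fst (snd z)) (endpt \<sigma>)) \<in> borel_measurable M" by simp
    show "(\<lambda>z. of_real (indicator {endpt \<sigma>} (snd (snd z))) * (?P (fst (snd z)) *\<^sub>R a (fst z) (fst (snd z)) (endpt \<sigma>))) \<in> borel_measurable M"
      by measurable
  qed
  have T_eq: "?T \<sigma> a = ?T \<sigma> (\<lambda>x \<xi> \<eta>. c 0 \<xi> \<eta> * wave 0 x)" if "\<sigma> = 1 \<or> \<sigma> = -1" for \<sigma>
    using Tlim[of \<sigma>] unfolding T_an[OF that] by (simp add: LIMSEQ_const_iff)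
  have am: "(\<lambda>z. a (fst z) (fst (snd z)) (snd (snd z))) \<in> borel_measurable borel"
    using ca by (rule borel_measurable_continuous_onI)
  have am': "(\<lambda>z :: (real ^ 2) \<times> (real ^ 2) \<times> ereal. a (fst z) (fst (snd z)) \<eta>) \<in> borel_measurable borel" for \<eta>
  proof -
    have "continuous_on UNIV (\<lambda>z :: (real ^ 2) \<times> (real ^ 2) \<times> ereal. (fst z, fst (snd z), \<eta>))" by (intro continuous_intros)
    from continuous_on_compose2[OF ca this] show ?thesis by (intro borel_measurable_continuous_onI) simp
  qed
  have "I a = ?T 1 a + ?T (- 1) a" by (rule I_ends[OF am' am B(2)])
  also have "\<dots> = ?T 1 (\<lambda>x \<xi> \<eta>. c 0 \<xi> \<eta> * wave 0 x) + ?T (- 1) (\<lambda>x \<xi> \<eta>. c 0 \<xi> \<eta> * wave 0 x)"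
    by (simp only: T_eq simp_thms)
  also have "\<dots> = I (\<lambda>x \<xi> \<eta>. c 0 \<xi> \<eta> * wave 0 x)"
    by (rule I_ends[symmetric, OF meas_term(1,2), where C=B]) (use cB in \<open>simp add: norm_mult\<close>)
  finally have "pairing (measure_restr (part_at_infinity M) (UNIV \<times> perp e \<times> UNIV)) a
    = pairing (measure_restr (part_at_infinity M) (UNIV \<times> perp e \<times> UNIV)) (\<lambda>x \<xi> \<eta>. c 0 \<xi> \<eta> * wave 0 x)"
    unfolding restr[OF am] restr[OF meas_term(2)] .
  also have "(\<lambda>x \<xi> \<eta>. c 0 \<xi> \<eta> * wave 0 x) = (\<lambda>x \<xi> \<eta>. LINT y:cell|lborel. a y \<xi> \<eta>)"
    by (simp add: c_def fourier_def)
  finally show "pairing (measure_restr (part_at_infinity M) (UNIV \<times> perp e \<times> UNIV)) a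
    = pairing (measure_restr (part_at_infinity M) (UNIV \<times> perp e \<times> UNIV)) (\<lambda>x \<xi> \<eta>. LINT y:cell|lborel. a y \<xi> \<eta>)" .
qed

section \<open>The lattice and its orthogonal\<close>

lemma generator_nonzero:
  assumes "primitive_rank1 \<Lambda>" "generator \<Lambda> e"
  shows "e \<noteq> 0"
proof
  assume "e = 0"
  then have "ivec ` \<Lambda> = {0}" using assms(2) by (auto simp: generator_def image_iff)
  then show False using assms(1) by (simp add: primitive_rank1_def)
qed

text \<open>A nonzero vector of the plane orthogonal to both \<open>e\<close> and \<open>k\<close>
  makes their determinant vanish, so \<open>k\<close> is a real multiple of \<open>e\<close>;
  primitivity then puts \<open>k\<close> into the lattice.\<close>

lemma generator_independent:
  assumes L: "primitive_rank1 \<Lambda>" "generator \<Lambda> e" and k: "k \<notin> \<Lambda>"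
    and \<xi>: "\<xi> \<in> perp e" "\<xi> \<bullet> ivec k = 0"
  shows "\<xi> = 0"
proof (rule ccontr)
  assume "\<xi> \<noteq> 0"
  define a where "a = ivec e"
  have a: "a \<noteq> 0" using generator_nonzero[OF L] by (auto simp: a_def vec_eq_iff)
  define x y where "x = \<xi> $ 1" and "y = \<xi> $ 2"
  have e1: "x * a $ 1 + y * a $ 2 = 0" using \<xi>(1) by (simp add: perp_def a_def inner_vec_def sum_2 x_def y_def)
  have k1: "x * ivec k $ 1 + y * ivec k $ 2 = 0" using \<xi>(2) by (simp add: inner_vec_def sum_2 x_def y_def)
  have xy: "x \<noteq> 0 \<or> y \<noteq> 0" using \<open>\<xi> \<noteq> 0\<close> by (auto simp: x_def y_def vec_eq_iff forall_2)
  have "x * (a $ 1 * ivec k $ 2 - a $ 2 * ivec k $ 1) = (x * a $ 1 + y * a $ 2) * ivec k $ 2 - (x * ivec k $ 1 + y * ivec k $ 2) * a $ 2"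
    by (simp add: algebra_simps)
  then have dx: "x * (a $ 1 * ivec k $ 2 - a $ 2 * ivec k $ 1) = 0" unfolding e1 k1 by simp
  have "y * (a $ 1 * ivec k $ 2 - a $ 2 * ivec k $ 1) = (x * ivec k $ 1 + y * ivec k $ 2) * a $ 1 - (x * a $ 1 + y * a $ 2) * ivec k $ 1"
    by (simp add: algebra_simps)
  then have dy: "y * (a $ 1 * ivec k $ 2 - a $ 2 * ivec k $ 1) = 0" unfolding e1 k1 by simp
  from dx dy xy have det: "a $ 1 * ivec k $ 2 = a $ 2 * ivec k $ 1" by auto
  have "ivec k = (if a $ 1 \<noteq> 0 then ivec k $ 1 / a $ 1 else ivec k $ 2 / a $ 2) *\<^sub>R a"
  proof (cases "a $ 1 = 0")
    case True
    then have "a $ 2 \<noteq> 0" using a by (auto simp: vec_eq_iff forall_2)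
    then show ?thesis using True det by (auto simp: vec_eq_iff forall_2)
  next
    case False
    then show ?thesis using det by (auto simp: vec_eq_iff forall_2 field_simps)
  qed
  moreover have "a \<in> ivec ` \<Lambda>"
    using L(2) unfolding generator_def a_def by (intro imageI) (metis rangeI vector_smult_lid)
  ultimately have "ivec k \<in> span (ivec ` \<Lambda>)" by (metis span_base span_scale)
  then show False using k L(1) by (auto simp: primitive_rank1_def)
qed

theorem theorem2p6:
  fixes V :: "real ^ 2 \<Rightarrow> real" and \<epsilon> \<tau> :: "real \<Rightarrow> real"
    and \<Lambda> :: "(int ^ 2) set" and e :: "int ^ 2"
    and \<mu> :: "real \<Rightarrow> symbol \<Rightarrow> complex" and m :: "real \<Rightarrow> phase_measure"
  assumes V: "smooth V" "periodic V"
    and eps_nonneg: "\<And>h. h > 0 \<Longrightarrow> \<epsilon> h \<ge> 0"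
    and eps_lim: "(\<epsilon> \<longlongrightarrow> 0) (at_right 0)"
    and h_over_eps: "((\<lambda>h. h / \<epsilon> h) \<longlongrightarrow> 0) (at_right 0)"
    and tau_lim: "filterlim \<tau> at_top (at_right 0)"
    and tau_eps: "\<And>h. h > 0 \<Longrightarrow> \<tau> h * \<epsilon> h \<ge> 1"
    and lattice: "primitive_rank1 \<Lambda>" "generator \<Lambda> e"
    and mu: "\<mu> \<in> two_micro_limits V \<epsilon> \<tau> e"
    and mu_measure: "AE t in lborel. is_the_measure (\<mu> t) (m t)"
  shows "(\<forall>k \<in> \<Lambda> - {0}. \<forall>a :: real ^ 2 \<Rightarrow> ereal \<Rightarrow> complex. (\<lambda>x. a) \<in> Cinf_c \<longrightarrow>
            (AE t in lborel. pairing (part_at_infinity (m t)) (\<lambda>x \<xi> \<eta>. a \<xi> \<eta> * wave (- k) x) = 0)) \<and>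
         (AE t in lborel. constant_in_x (measure_restr (part_at_infinity (m t)) (UNIV \<times> perp e \<times> UNIV)))"
proof -
  obtain S where S: "tame_potential V S" by (rule smooth_imp_tame[OF V])
  obtain u v hs where data: "\<forall>h>0. u h \<in> L2_torus \<and> L2_nrm (u h) = 1 \<and> schroedinger_solution h (\<epsilon> h) V (u h) (v h)"
    and loc: "frequency_localized u" and hs: "\<forall>n::nat. hs n > 0" "hs \<longlonglongrightarrow> 0"
    and lim: "\<forall>\<theta> :: real \<Rightarrow> complex. \<forall>a\<in>Cinf_c. integrable lborel \<theta> \<longrightarrow>
        integrable lborel (\<lambda>t. \<theta> t * \<mu> t a) \<and>
        (\<lambda>n. LINT t|lborel. \<theta> t * two_micro_dist (hs n) (\<epsilon> (hs n)) e (v (hs n) (t * \<tau> (hs n))) a)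
          \<longlonglongrightarrow> (LINT t|lborel. \<theta> t * \<mu> t a)"
    using mu unfolding two_micro_limits_def mem_Collect_eq by (elim exE conjE)
  \<comment> \<open>\<open>\<epsilon> h = 0\<close> would contradict
    \<open>\<tau> h * \<epsilon> h \<ge> 1\<close>.\<close>
  have eps_pos: "\<epsilon> h > 0" if "h > 0" for h
    using eps_nonneg[OF that] tau_eps[OF that] by (cases "\<epsilon> h = 0") auto
  interpret two_micro_limit_measure V \<epsilon> \<tau> e \<mu> m u v hs S
  proof unfold_locales
    show "coefficient_solution h (\<epsilon> h) V (v h)" if "h > 0" for h
      using data that schroedinger_coefficients(1)[OF _ S] by blast
    show "fourier (v h 0) = fourier (u h)" if "h > 0" for h
      using data that schroedinger_coefficients(2)[OF _ S] by blast
    show "integrable lborel (\<lambda>t. \<theta> t * \<mu> t a)" if "a \<in> Cinf_c" "integrable lborel \<theta>" for \<theta> a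
      using lim that by blast
    show "(\<lambda>n. LINT t|lborel. \<theta> t * two_micro_dist (hs n) (\<epsilon> (hs n)) e (v (hs n) (t * \<tau> (hs n))) a)
          \<longlonglongrightarrow> (LINT t|lborel. \<theta> t * \<mu> t a)" if "a \<in> Cinf_c" "integrable lborel \<theta>" for \<theta> a
      using lim that by blast
  qed (use S eps_pos eps_lim tau_lim tau_eps generator_nonzero[OF lattice] data loc hs mu_measure in auto)
  have pm: "(1::real) = 1 \<or> (1::real) = - 1" "(- 1::real) = 1 \<or> (- 1::real) = - 1" by auto
  have R: "AE t in lborel. \<forall>p q N. phase_integral (m t) (box_bump (rat_vec p) (rat_vec q) N) (indicator {endpt \<sigma>}) k = 0"
    if k: "k \<in> \<Lambda> - {0}" and \<sigma>: "\<sigma> = 1 \<or> \<sigma> = -1" for k \<sigma>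
  proof -
    obtain n where n: "k = n *s e" using lattice(2) k by (auto simp: generator_def)
    then have "n \<noteq> 0" using k by (auto simp: vec_eq_iff)
    then show ?thesis unfolding AE_all_countable using resonant_end[OF n _ \<sigma>] by blast
  qed
  have T: "AE t in lborel. \<forall>p q N. phase_integral (m t) (\<lambda>\<xi>. (\<xi> \<bullet> ivec k) * box_bump (rat_vec p) (rat_vec q) N \<xi>) (indicator {endpt \<sigma>}) k = 0"
    if \<sigma>: "\<sigma> = 1 \<or> \<sigma> = -1" for k \<sigma>
    unfolding AE_all_countable using transport_end[OF \<sigma>] by blast
  have fin: "finite_phase_measure (m t)" if "is_the_measure (\<mu> t) (m t)" for t
    using that by (simp add: is_the_measure_def)
  have part1: "AE t in lborel. pairing (part_at_infinity (m t)) (\<lambda>x \<xi> \<eta>. a \<xi> \<eta> * wave (- k) x) = 0"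
    if k: "k \<in> \<Lambda> - {0}" and a: "(\<lambda>x. a) \<in> Cinf_c" for k a
    using R[OF k pm(1)] R[OF k pm(2)] meas
  proof eventually_elim
    case (elim t)
    note M = fin[OF elim(3)]
    note ca = x_independent_symbol[OF a]
    obtain \<rho> where \<rho>: "\<And>\<xi> \<eta>. norm \<xi> > \<rho> \<Longrightarrow> a \<xi> \<eta> = 0"
      using a by (auto simp: Cinf_c_def compact_support_def)
    obtain C1 where C1: "\<And>\<xi>. norm (a \<xi> \<infinity>) \<le> C1" using compactly_supported_bounded[OF ca(1), where R=\<rho>] \<rho> by blast
    obtain C2 where C2: "\<And>\<xi>. norm (a \<xi> (- \<infinity>)) \<le> C2" using compactly_supported_bounded[OF ca(2), where R=\<rho>] \<rho> by blast
    have m1: "(\<lambda>\<xi>. a \<xi> \<infinity>) \<in> borel_measurable borel" "(\<lambda>\<xi>. a \<xi> (- \<infinity>)) \<in> borel_measurable borel"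
      by (intro borel_measurable_continuous_onI ca)+
    have v1: "(LINT z|m t. a (fst (snd z)) \<infinity> * end_weight 1 k z) = 0"
      using elim(1) by (intro resonant_vanishing[OF M _ m1(1) C1]) blast
    have v2: "(LINT z|m t. a (fst (snd z)) (- \<infinity>) * end_weight (- 1) k z) = 0"
      using elim(2) by (intro resonant_vanishing[OF M _ m1(2) C2]) blast
    have "pairing (part_at_infinity (m t)) (\<lambda>x \<xi> \<eta>. a \<xi> \<eta> * wave (- k) x) =
       (LINT z|m t. of_real (indicator {endpt 1} (snd (snd z))) * (a (fst (snd z)) (endpt 1) * wave (- k) (fst z)))
       + (LINT z|m t. of_real (indicator {endpt (- 1)} (snd (snd z))) * (a (fst (snd z)) (endpt (- 1)) * wave (- k) (fst z)))"
    proof (rule ends_integral[OF M, where B="max C1 C2"])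
      fix \<eta> :: ereal assume \<eta>: "\<eta> \<in> {\<infinity>, - \<infinity>}"
      then have [measurable]: "(\<lambda>\<xi>. a \<xi> \<eta>) \<in> borel_measurable borel" using m1 by auto
      have "(\<lambda>z :: (real ^ 2) \<times> (real ^ 2) \<times> ereal. a (fst (snd z)) \<eta> * wave (- k) (fst z)) \<in> borel_measurable (borel \<Otimes>\<^sub>M (borel \<Otimes>\<^sub>M borel))"
        by measurable
      then show "(\<lambda>z :: (real ^ 2) \<times> (real ^ 2) \<times> ereal. a (fst (snd z)) \<eta> * wave (- k) (fst z)) \<in> borel_measurable borel"
        by (simp add: borel_prod)
      show "norm (a \<xi> \<eta> * wave (- k) x) \<le> max C1 C2" for x \<xi>
        using \<eta> C1[of \<xi>] C2[of \<xi>] by (auto simp: norm_mult)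
    next
      have "(\<lambda>w. a (fst w) (snd w)) \<in> borel_measurable (borel \<Otimes>\<^sub>M borel)"
        using ca(3) by (simp add: borel_prod case_prod_unfold)
      then have [measurable]: "(\<lambda>z. a (fst (snd z)) (snd (snd z))) \<in> borel_measurable (borel \<Otimes>\<^sub>M (borel \<Otimes>\<^sub>M borel))"
        by (rule measurable_compose[OF measurable_snd])
      have "(\<lambda>z :: (real ^ 2) \<times> (real ^ 2) \<times> ereal. a (fst (snd z)) (snd (snd z)) * wave (- k) (fst z)) \<in> borel_measurable (borel \<Otimes>\<^sub>M (borel \<Otimes>\<^sub>M borel))"
        by measurable
      then show "(\<lambda>z :: (real ^ 2) \<times> (real ^ 2) \<times> ereal. a (fst (snd z)) (snd (snd z)) * wave (- k) (fst z)) \<in> borel_measurable borel"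
        by (simp add: borel_prod)
    qed
    also have "\<dots> = 0"
      using v1 v2 by (simp add: endpt_def mult_ac)
    finally show ?case .
  qed
  \<comment> \<open>One null set of times for all \<open>k\<close>, all rational boxes, all
    \<open>N\<close> and both ends, since all of these range over countable sets. Constancy in
    \<open>x\<close> tests uncountably many symbols at the same time \<open>t\<close>, so the null
    set must not depend on the symbol.\<close>
  have "AE t in lborel. \<forall>k. (k \<in> \<Lambda> - {0} \<longrightarrow>
       (\<forall>p q N. phase_integral (m t) (box_bump (rat_vec p) (rat_vec q) N) (indicator {endpt 1}) k = 0) \<and>
       (\<forall>p q N. phase_integral (m t) (box_bump (rat_vec p) (rat_vec q) N) (indicator {endpt (- 1)}) k = 0)) \<and>
       (\<forall>p q N. phase_integral (m t) (\<lambda>\<xi>. (\<xi> \<bullet> ivec k) * box_bump (rat_vec p) (rat_vec q) N \<xi>) (indicator {endpt 1}) k = 0) \<and>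
       (\<forall>p q N. phase_integral (m t) (\<lambda>\<xi>. (\<xi> \<bullet> ivec k) * box_bump (rat_vec p) (rat_vec q) N \<xi>) (indicator {endpt (- 1)}) k = 0)"
    by (rule AE_all_countable[THEN iffD2], rule allI)
       (intro AE_conjI AE_impI T[OF pm(1)] T[OF pm(2)] R[OF _ pm(1)] R[OF _ pm(2)])
  with meas zero_energy_null
  have "AE t in lborel. constant_in_x (measure_restr (part_at_infinity (m t)) (UNIV \<times> perp e \<times> UNIV))"
  proof eventually_elim
    case (elim t)
    note M = fin[OF elim(1)]
    show ?case
    proof (rule vanishing_imp_constant_in_x[OF M])
      fix \<sigma> C R :: real and k :: "int ^ 2" and \<beta> :: "real ^ 2 \<Rightarrow> complex"
      assume \<sigma>: "\<sigma> = 1 \<or> \<sigma> = - 1" and k: "k \<noteq> 0" and \<beta>: "\<beta> \<in> borel_measurable borel" "\<And>\<xi>. norm (\<beta> \<xi>) \<le> C"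
        "\<And>\<xi>. norm \<xi> > R \<Longrightarrow> \<beta> \<xi> = 0" "\<And>\<xi>. \<xi> \<notin> perp e \<Longrightarrow> \<beta> \<xi> = 0"
      have res: "k \<in> \<Lambda> - {0} \<longrightarrow> (\<forall>p q N. phase_integral (m t) (box_bump (rat_vec p) (rat_vec q) N) (indicator {endpt \<sigma>}) k = 0)"
        using \<sigma> by (elim disjE; use elim(3) in blast)
      have tra: "\<forall>p q N. phase_integral (m t) (\<lambda>\<xi>. (\<xi> \<bullet> ivec k) * box_bump (rat_vec p) (rat_vec q) N \<xi>) (indicator {endpt \<sigma>}) k = 0"
        using \<sigma> by (elim disjE; use elim(3) in blast)
      show "(LINT z|m t. \<beta> (fst (snd z)) * end_weight \<sigma> k z) = 0"
      proof (cases "k \<in> \<Lambda>")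
        case True
        show ?thesis
          by (rule resonant_vanishing[OF M _ \<beta>(1,2)]) (use res k True in blast)
      next
        case False
        show ?thesis
        proof (rule nonresonant_vanishing[OF M _ elim(2) _ \<beta>])
          show "phase_integral (m t) (\<lambda>\<xi>. (\<xi> \<bullet> ivec k) * box_bump (rat_vec p) (rat_vec q) N \<xi>) (indicator {endpt \<sigma>}) k = 0" for p q N
            using tra by blast
          show "\<xi> = 0" if "\<xi> \<in> perp e" "\<xi> \<bullet> ivec k = 0" for \<xi>
            by (rule generator_independent[OF lattice False that])
        qed
      qed
    qed
  qed
  with part1 show ?thesis by blast
qed

end
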